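(* Let $\mathsf{Q}$ be a finite quiver with no edge-loops, with vertex set $I$, and let $\mathbf{d}=(d_i)_{i\in I}$ be a collection of positive integers. Take $j \in I$, $\boldsymbol{\lambda}=(\lambda_i)_{i\in I} \in \bigoplus_{i \in I} \mathbb{C}[\epsilon_i]/(\epsilon_i^{d_i})$ and $\mathbf{v} \in \mathbb{Z}_{\geq 0}^I$ such that $\lambda_j$ is a unit of $\mathbb{C}[\epsilon_j]/(\epsilon_j^{d_j})$. Then there exists an isomorphism of $\mathbb{C}$-schemes \[ \mathcal{F}_j \colon \mathcal{S}_{\mathsf{Q},\mathbf{d}}(\boldsymbol{\lambda},\mathbf{v}) \xrightarrow{\sim} \mathcal{S}_{\mathsf{Q},\mathbf{d}}(r_j(\boldsymbol{\lambda}),s_j(\mathbf{v})). \]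
   Context: Quivers with multiplicities. A quiver $\mathsf{Q}=(I,\Omega,s,t)$ is finite, with vertex set $I$, arrow set $\Omega$, source/target maps $s,t$. Let $\overline{\Omega}$ be the set of reversed arrows $\overline{h}$ ($h\in\Omega$), $H=\Omega\sqcup\overline{\Omega}$, with involution $h\mapsto\overline{h}$, and $\operatorname{sgn}(h)=1$ for $h\in\Omega$, $\operatorname{sgn}(h)=-1$ for $h\in\overline{\Omega}$. Given multiplicities $\mathbf{d}=(d_i)_{i\in I}$ put $d_{ij}=\gcd(d_i,d_j)$, $f_{ij}=d_j/d_{ij}$, and for $h\in H$ put $d_h=d_{s(h)t(h)}$, $f_h=f_{s(h)t(h)}=d_{t(h)}/d_h$. For a positive integer $d$ put $R_d=\mathbb{C}[\epsilon]/(\epsilon^d)$, with variable written $\epsilon_d$; write $\epsilon_i=\epsilon_{d_i}\in R_{d_i}$. If $c\mid d$, $R_d$ is an $R_c$-algebra via $\epsilon_c\mapsto\epsilon_d^{d/c}$, so $R_d$-modules are $R_c$-modules. Put $R_{\mathbf{d}}=\bigoplus_{i\in I}R_{d_i}$. $\otimes$ means $\otimes_{\mathbb{C}}$. Quiver schemes. For a finite dimensional $I$-graded $\mathbb{C}$-vector space $\mathbf{V}=\bigoplus_{i\in I}V_i$ put $\mathbf{M}_{\mathsf{Q},\mathbf{d}}(\mathbf{V})=\bigoplus_{h\in H}\operatorname{Hom}_{R_{d_h}}(V_{s(h)}\otimes R_{d_{s(h)}},V_{t(h)}\otimes R_{d_{t(h)}})$, acted on by $G_{\mathbf{d}}(\mathbf{V})=\prod_{i\in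 I}\operatorname{Aut}_{R_{d_i}}(V_i\otimes R_{d_i})$ via $(g_i)\cdot(B_h)=(g_{t(h)}B_hg_{s(h)}^{-1})$. Let $N_i$ be multiplication by $\epsilon_i$ on $V_i\otimes R_{d_i}$ and define $\mu_{\mathbf{V}}=(\mu_{\mathbf{V},i})_{i\in I}\colon\mathbf{M}_{\mathsf{Q},\mathbf{d}}(\mathbf{V})\to\bigoplus_i\operatorname{End}_{R_{d_i}}(V_i\otimes R_{d_i})$ by \[\mu_{\mathbf{V},i}(\mathbf{B})=\sum_{h\in H,\,t(h)=i}\ \sum_{k=0}^{f_h-1}\operatorname{sgn}(h)N_i^kB_hB_{\overline{h}}N_i^{f_h-k-1}.\] For $\boldsymbol{\lambda}=(\lambda_i)\in R_{\mathbf{d}}$ let $\boldsymbol{\lambda}\,\mathrm{Id}_{\mathbf{V}}=(\lambda_i\,\mathrm{Id}_{V_i})_{i}$ and define, with $\mathbf{v}=(\dim V_i)_{i\in I}$, the quiver scheme $\mathcal{S}_{\mathsf{Q},\mathbf{d}}(\boldsymbol{\lambda},\mathbf{v})=\operatorname{Spec}\bigl(\mathbb{C}[\mu_{\mathbf{V}}^{-1}(-\boldsymbol{\lambda}\,\mathrm{Id}_{\mathbf{V}})]^{G_{\mathbf{d}}(\mathbf{V})}\bigr)$, where $\mathbb{C}[\mu_{\mathbf{V}}^{-1}(\cdot)]$ is the coordinate ring of the scheme-theoretic fibre; up to canonical isomorphism it depends only on $\mathbf{v}$. By convention $\mathcal{S}_{\mathsf{Q},\mathbf{d}}(\boldsymbol{\lambda},\mathbf{v})=\emptyset$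 for $\mathbf{v}\in\mathbb{Z}^I\setminus\mathbb{Z}_{\ge0}^I$. Reflections. Let $a_{ij}=\#\{h\in H\mid s(h)=i,\ t(h)=j\}$, $\mathbf{A}'=(a_{ij}/d_{ij})$, $\mathbf{D}=\operatorname{diag}(d_i)$, and $\mathbf{C}=(c_{ij})=2\,\mathrm{Id}-\mathbf{A}'\mathbf{D}$ (a symmetrizable generalized Cartan matrix). Let $\alpha_j$ denote the $j$-th standard basis vector of $\mathbb{Z}^I$. Then $s_j(\mathbf{v})=\mathbf{v}-\bigl(\sum_{k\in I}c_{jk}v_k\bigr)\alpha_j$. Writing $\lambda_j=\sum_{k=0}^{d_j-1}\lambda_{j,k}\epsilon_j^k$, the linear map $r_j\colon R_{\mathbf{d}}\to R_{\mathbf{d}}$ is given by $r_j(\boldsymbol{\lambda})_j=-\lambda_j$ and, for $k\ne j$, \[r_j(\boldsymbol{\lambda})_k=\lambda_k-\sum_{m=0}^{d_{jk}-1}c_{jk}\,\lambda_{j,\,(d_j-\frac{d_j}{d_{jk}}m-1)}\ \epsilon_k^{\,d_k-\frac{d_k}{d_{jk}}m-1}.\] *)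

theory Defs
  imports
    "Graph_Theory.Digraph"
    "Jordan_Normal_Form.Matrix"
    "HOL-Algebra.QuotRing"
    "HOL-Algebra.Product_Groups"
    "HOL-Computational_Algebra.Polynomial"
    "HOL-Analysis.Function_Topology"
begin

section \<open>Affine schemes over the complex numbers\<close>

text \<open>
  Topological spaces with a sheaf of \<open>\<complex>\<close>-algebras. The field \<open>const_sec\<close> gives the structure
  maps \<open>\<complex> \<rightarrow> \<O>(U)\<close>, which for a scheme is the same datum as a morphism to \<open>Spec \<complex>\<close>.
\<close>

record ('p, 's) ringed_space_C =
  space_of :: "'p topology"
  sections :: "'p set \<Rightarrow> 's ring"
  restr :: "'p set \<Rightarrow> 'p set \<Rightarrow> 's \<Rightarrow> 's"
  const_sec :: "'p set \<Rightarrow> complex \<Rightarrow> 's"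

text \<open>
  Isomorphisms of schemes over \<open>\<complex>\<close>: a homeomorphism \<open>\<phi>\<close> together with an isomorphism \<open>\<psi>\<close> of sheaves
  of \<open>\<complex>\<close>-algebras from \<open>\<O>\<^sub>Y\<close> to \<open>\<phi>\<^sub>*\<O>\<^sub>X\<close>. The induced maps on stalks are then isomorphisms, so
  they are automatically local.
\<close>

definition scheme_iso ::
  "('p, 's) ringed_space_C \<Rightarrow> ('q, 't) ringed_space_C \<Rightarrow> ('p \<Rightarrow> 'q) \<Rightarrow> ('q set \<Rightarrow> 't \<Rightarrow> 's) \<Rightarrow> bool"
  where
  "scheme_iso X Y \<phi> \<psi> \<longleftrightarrow>
     (let pre = (\<lambda>U. {x \<in> topspace (space_of X). \<phi> x \<in> U}) in
      homeomorphic_map (space_of X) (space_of Y) \<phi> \<and>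
      (\<forall>U. openin (space_of Y) U \<longrightarrow>
         \<psi> U \<in> ring_iso (sections Y U) (sections X (pre U)) \<and>
         (\<forall>z. \<psi> U (const_sec Y U z) = const_sec X (pre U) z)) \<and>
      (\<forall>U V. openin (space_of Y) U \<longrightarrow> openin (space_of Y) V \<longrightarrow> V \<subseteq> U \<longrightarrow>
         (\<forall>s \<in> carrier (sections Y U).
            \<psi> V (restr Y U V s) = restr X (pre U) (pre V) (\<psi> U s))))"

definition prime_spectrum :: "('a, 'b) ring_scheme \<Rightarrow> 'a set set" where
  "prime_spectrum A = {p. primeideal p A}"

definition zariski :: "('a, 'b) ring_scheme \<Rightarrow> 'a set topology" where
  "zariski A = topology_generated_by {{p \<in> prime_spectrum A. f \<notin> p} | f. f \<in> carrier A}"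

text \<open>The fraction \<open>a / f\<close> in the localization at a prime \<open>p\<close>, as an equivalence class of pairs.\<close>

definition fraction_at :: "('a, 'b) ring_scheme \<Rightarrow> 'a set \<Rightarrow> 'a \<Rightarrow> 'a \<Rightarrow> ('a \<times> 'a) set" where
  "fraction_at A p a f =
     {(b, g). b \<in> carrier A \<and> g \<in> carrier A - p \<and>
        (\<exists>h \<in> carrier A - p. h \<otimes>\<^bsub>A\<^esub> (g \<otimes>\<^bsub>A\<^esub> a) = h \<otimes>\<^bsub>A\<^esub> (f \<otimes>\<^bsub>A\<^esub> b))}"

text \<open>In the sum and the product below all members of the unions coincide.\<close>

definition local_ring_at :: "('a, 'b) ring_scheme \<Rightarrow> 'a set \<Rightarrow> ('a \<times> 'a) set ring" where
  "local_ring_at A p =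
     \<lparr>carrier = {fraction_at A p a f | a f. a \<in> carrier A \<and> f \<in> carrier A - p},
      mult = (\<lambda>x y. \<Union>(a, f) \<in> x. \<Union>(b, g) \<in> y. fraction_at A p (a \<otimes>\<^bsub>A\<^esub> b) (f \<otimes>\<^bsub>A\<^esub> g)),
      one = fraction_at A p \<one>\<^bsub>A\<^esub> \<one>\<^bsub>A\<^esub>,
      zero = fraction_at A p \<zero>\<^bsub>A\<^esub> \<one>\<^bsub>A\<^esub>,
      add = (\<lambda>x y. \<Union>(a, f) \<in> x. \<Union>(b, g) \<in> y.
               fraction_at A p ((a \<otimes>\<^bsub>A\<^esub> g) \<oplus>\<^bsub>A\<^esub> (b \<otimes>\<^bsub>A\<^esub> f)) (f \<otimes>\<^bsub>A\<^esub> g))\<rparr>"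

definition structure_sheaf ::
  "('a, 'b) ring_scheme \<Rightarrow> 'a set set \<Rightarrow> ('a set \<Rightarrow> ('a \<times> 'a) set) ring" where
  "structure_sheaf A U =
     \<lparr>carrier = {s \<in> \<Pi>\<^sub>E p \<in> U. carrier (local_ring_at A p).
        \<forall>p \<in> U. \<exists>W a f. openin (zariski A) W \<and> p \<in> W \<and> W \<subseteq> U \<and> a \<in> carrier A \<and> f \<in> carrier A \<and>
          (\<forall>q \<in> W. f \<notin> q \<and> s q = fraction_at A q a f)},
      mult = (\<lambda>s t. \<lambda>p \<in> U. s p \<otimes>\<^bsub>local_ring_at A p\<^esub> t p),
      one = (\<lambda>p \<in> U. \<one>\<^bsub>local_ring_at A p\<^esub>),
      zero = (\<lambda>p \<in> U. \<zero>\<^bsub>local_ring_at A p\<^esub>),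
      add = (\<lambda>s t. \<lambda>p \<in> U. s p \<oplus>\<^bsub>local_ring_at A p\<^esub> t p)\<rparr>"

text \<open>The spectrum of a \<open>\<complex>\<close>-algebra, given as a commutative ring with its structure map \<open>\<eta>\<close>.\<close>

definition Spec ::
  "('a, 'b) ring_scheme \<Rightarrow> (complex \<Rightarrow> 'a) \<Rightarrow> ('a set, 'a set \<Rightarrow> ('a \<times> 'a) set) ringed_space_C" where
  "Spec A \<eta> =
     \<lparr>space_of = zariski A,
      sections = structure_sheaf A,
      restr = (\<lambda>U V s. restrict s V),
      const_sec = (\<lambda>U z. \<lambda>p \<in> U. fraction_at A p (\<eta> z) \<one>\<^bsub>A\<^esub>)\<rparr>"

text \<open>No points, and zero rings of sections. (The ring sum and product are constant because there
  is only one section.)\<close>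

definition empty_scheme :: "('p, 'p \<Rightarrow> 's) ringed_space_C" where
  "empty_scheme =
     \<lparr>space_of = discrete_topology {},
      sections = (\<lambda>U. \<lparr>carrier = {\<lambda>p. undefined}, mult = (\<lambda>s t p. undefined),
        one = (\<lambda>p. undefined), zero = (\<lambda>p. undefined), add = (\<lambda>s t p. undefined)\<rparr>),
      restr = (\<lambda>U V s. s),
      const_sec = (\<lambda>U z p. undefined)\<rparr>"


section \<open>Truncated polynomial rings and their free modules\<close>

text \<open>\<open>\<complex>[\<epsilon>]/(\<epsilon>\<^sup>d)\<close> for \<open>d > 0\<close>, each class being represented by its element of degree less than \<open>d\<close>.\<close>

definition trunc_ring :: "nat \<Rightarrow> complex poly ring" where
  "trunc_ring d =
     \<lparr>carrier = {p. degree p < d}, mult = (\<lambda>p q. (p * q) mod monom 1 d),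
      one = 1, zero = 0, add = (+)\<rparr>"

text \<open>
  \<open>\<complex>\<^sup>n \<otimes> \<complex>[\<epsilon>]/(\<epsilon>\<^sup>d)\<close> is written in the basis in which \<open>e\<^sub>a \<otimes> \<epsilon>\<^sup>k\<close> (\<open>a < n\<close>, \<open>k < d\<close>) has index
  \<open>a * d + k\<close>; \<open>\<complex>\<close>-linear maps between such spaces are matrices. \<open>eps_mat n d\<close> is multiplication by
  \<open>\<epsilon>\<close>, and \<open>scal_mat n d c p\<close> is the action of an element \<open>p\<close> of \<open>trunc_ring c\<close>, where \<open>c dvd d\<close> and
  the variable of \<open>trunc_ring c\<close> acts as \<open>\<epsilon> ^ (d div c)\<close>.
\<close>

definition eps_mat :: "nat \<Rightarrow> nat \<Rightarrow> complex mat" where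
  "eps_mat n d =
     mat (n * d) (n * d) (\<lambda>(r, s). if r = Suc s \<and> r mod d \<noteq> 0 then 1 else 0)"

definition scal_mat :: "nat \<Rightarrow> nat \<Rightarrow> nat \<Rightarrow> complex poly \<Rightarrow> complex mat" where
  "scal_mat n d c p =
     mat (n * d) (n * d) (\<lambda>(r, s). \<Sum>k<c. coeff p k * (eps_mat n d ^\<^sub>m (k * (d div c))) $$ (r, s))"

text \<open>The maps from \<open>\<complex>\<^sup>n \<otimes> \<complex>[\<epsilon>]/(\<epsilon>\<^sup>d)\<close> to \<open>\<complex>\<^sup>n' \<otimes> \<complex>[\<epsilon>]/(\<epsilon>\<^sup>d')\<close> linear over \<open>trunc_ring c\<close>.\<close>

definition Hom_trunc :: "nat \<Rightarrow> nat \<Rightarrow> nat \<Rightarrow> nat \<Rightarrow> nat \<Rightarrow> complex mat set" where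
  "Hom_trunc c n d n' d' =
     {B \<in> carrier_mat (n' * d') (n * d).
        \<forall>p \<in> carrier (trunc_ring c). B * scal_mat n d c p = scal_mat n' d' c p * B}"

definition End_trunc :: "nat \<Rightarrow> nat \<Rightarrow> complex mat ring" where
  "End_trunc n d = ring_mat TYPE(complex) (n * d) () \<lparr>carrier := Hom_trunc d n d n d\<rparr>"


section \<open>Polynomial functions\<close>

text \<open>
  The algebra of functions on \<open>X\<close> generated by the constants and the functions in \<open>C\<close>. For a complex
  vector space \<open>X\<close> and functions \<open>C\<close> spanning its dual, this is the coordinate ring of \<open>X\<close>.
\<close>

inductive_set poly_funs :: "'x set \<Rightarrow> ('x \<Rightarrow> complex) set \<Rightarrow> ('x \<Rightarrow> complex) set"
  for X :: "'x set" and C :: "('x \<Rightarrow> complex) set" where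
  const: "(\<lambda>x \<in> X. z) \<in> poly_funs X C"
| gen: "f \<in> C \<Longrightarrow> restrict f X \<in> poly_funs X C"
| add: "f \<in> poly_funs X C \<Longrightarrow> g \<in> poly_funs X C \<Longrightarrow> (\<lambda>x \<in> X. f x + g x) \<in> poly_funs X C"
| mult: "f \<in> poly_funs X C \<Longrightarrow> g \<in> poly_funs X C \<Longrightarrow> (\<lambda>x \<in> X. f x * g x) \<in> poly_funs X C"

definition poly_fun_ring :: "'x set \<Rightarrow> ('x \<Rightarrow> complex) set \<Rightarrow> ('x \<Rightarrow> complex) ring" where
  "poly_fun_ring X C =
     \<lparr>carrier = poly_funs X C, mult = (\<lambda>f g. \<lambda>x \<in> X. f x * g x),
      one = (\<lambda>x \<in> X. 1), zero = (\<lambda>x \<in> X. 0), add = (\<lambda>f g. \<lambda>x \<in> X. f x + g x)\<rparr>"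


section \<open>Quivers with multiplicities\<close>

text \<open>
  A quiver \<open>Q\<close> is a digraph with parallel arcs allowed. In the doubled quiver \<open>Inl h\<close> is the arrow \<open>h\<close>
  of \<open>Q\<close> and \<open>Inr h\<close> is its reverse. The dimension vector \<open>v\<close> stands for the graded vector space with
  components the complex column vectors of length \<open>v i\<close>.
\<close>

definition dbl :: "('v, 'e) pre_digraph \<Rightarrow> ('e + 'e) set" where
  "dbl Q = arcs Q <+> arcs Q"

fun src :: "('v, 'e) pre_digraph \<Rightarrow> 'e + 'e \<Rightarrow> 'v" where
  "src Q (Inl h) = tail Q h"
| "src Q (Inr h) = head Q h"

fun tgt :: "('v, 'e) pre_digraph \<Rightarrow> 'e + 'e \<Rightarrow> 'v" where
  "tgt Q (Inl h) = head Q h"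
| "tgt Q (Inr h) = tail Q h"

fun rev_arrow :: "'e + 'e \<Rightarrow> 'e + 'e" where
  "rev_arrow (Inl h) = Inr h"
| "rev_arrow (Inr h) = Inl h"

fun sgn_arrow :: "'e + 'e \<Rightarrow> complex" where
  "sgn_arrow (Inl h) = 1"
| "sgn_arrow (Inr h) = - 1"

definition mult_h :: "('v, 'e) pre_digraph \<Rightarrow> ('v \<Rightarrow> nat) \<Rightarrow> 'e + 'e \<Rightarrow> nat" where
  "mult_h Q d h = gcd (d (src Q h)) (d (tgt Q h))"

definition f_h :: "('v, 'e) pre_digraph \<Rightarrow> ('v \<Rightarrow> nat) \<Rightarrow> 'e + 'e \<Rightarrow> nat" where
  "f_h Q d h = d (tgt Q h) div mult_h Q d h"

definition rep_space ::
  "('v, 'e) pre_digraph \<Rightarrow> ('v \<Rightarrow> nat) \<Rightarrow> ('v \<Rightarrow> nat) \<Rightarrow> ('e + 'e \<Rightarrow> complex mat) set" where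
  "rep_space Q d v =
     (\<Pi>\<^sub>E h \<in> dbl Q. Hom_trunc (mult_h Q d h) (v (src Q h)) (d (src Q h)) (v (tgt Q h)) (d (tgt Q h)))"

definition gauge_group ::
  "('v, 'e) pre_digraph \<Rightarrow> ('v \<Rightarrow> nat) \<Rightarrow> ('v \<Rightarrow> nat) \<Rightarrow> ('v \<Rightarrow> complex mat) monoid" where
  "gauge_group Q d v = product_group (verts Q) (\<lambda>i. units_of (End_trunc (v i) (d i)))"

definition gauge_act ::
  "('v, 'e) pre_digraph \<Rightarrow> ('v \<Rightarrow> nat) \<Rightarrow> ('v \<Rightarrow> nat) \<Rightarrow> ('v \<Rightarrow> complex mat) \<Rightarrow>
   ('e + 'e \<Rightarrow> complex mat) \<Rightarrow> ('e + 'e \<Rightarrow> complex mat)" where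
  "gauge_act Q d v g B =
     (\<lambda>h \<in> dbl Q. g (tgt Q h) * B h * (inv\<^bsub>gauge_group Q d v\<^esub> g) (src Q h))"

definition moment_map ::
  "('v, 'e) pre_digraph \<Rightarrow> ('v \<Rightarrow> nat) \<Rightarrow> ('v \<Rightarrow> nat) \<Rightarrow> 'v \<Rightarrow> ('e + 'e \<Rightarrow> complex mat) \<Rightarrow> complex mat"
  where
  "moment_map Q d v i B =
     mat (v i * d i) (v i * d i) (\<lambda>(r, s).
       \<Sum>h \<in> {h \<in> dbl Q. tgt Q h = i}. \<Sum>k<f_h Q d h.
         sgn_arrow h *
         (eps_mat (v i) (d i) ^\<^sub>m k * B h * B (rev_arrow h) *
          eps_mat (v i) (d i) ^\<^sub>m (f_h Q d h - k - 1)) $$ (r, s))"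

definition rep_coords ::
  "('v, 'e) pre_digraph \<Rightarrow> ('v \<Rightarrow> nat) \<Rightarrow> ('v \<Rightarrow> nat) \<Rightarrow> (('e + 'e \<Rightarrow> complex mat) \<Rightarrow> complex) set" where
  "rep_coords Q d v =
     {\<lambda>B. B h $$ (r, s) | h r s.
        h \<in> dbl Q \<and> r < v (tgt Q h) * d (tgt Q h) \<and> s < v (src Q h) * d (src Q h)}"

definition rep_ring ::
  "('v, 'e) pre_digraph \<Rightarrow> ('v \<Rightarrow> nat) \<Rightarrow> ('v \<Rightarrow> nat) \<Rightarrow> (('e + 'e \<Rightarrow> complex mat) \<Rightarrow> complex) ring" where
  "rep_ring Q d v = poly_fun_ring (rep_space Q d v) (rep_coords Q d v)"

text \<open>The ideal of the scheme-theoretic fibre of the moment map over \<open>- lam Id\<close>.\<close>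

definition fibre_ideal ::
  "('v, 'e) pre_digraph \<Rightarrow> ('v \<Rightarrow> nat) \<Rightarrow> ('v \<Rightarrow> complex poly) \<Rightarrow> ('v \<Rightarrow> nat) \<Rightarrow>
   (('e + 'e \<Rightarrow> complex mat) \<Rightarrow> complex) set" where
  "fibre_ideal Q d lam v =
     Idl\<^bsub>rep_ring Q d v\<^esub>
       {\<lambda>B \<in> rep_space Q d v. (moment_map Q d v i B + scal_mat (v i) (d i) (d i) (lam i)) $$ (r, s) | i r s.
          i \<in> verts Q \<and> r < v i * d i \<and> s < v i * d i}"

definition fibre_ring ::
  "('v, 'e) pre_digraph \<Rightarrow> ('v \<Rightarrow> nat) \<Rightarrow> ('v \<Rightarrow> complex poly) \<Rightarrow> ('v \<Rightarrow> nat) \<Rightarrow>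
   (('e + 'e \<Rightarrow> complex mat) \<Rightarrow> complex) set ring" where
  "fibre_ring Q d lam v = rep_ring Q d v Quot fibre_ideal Q d lam v"

definition gauge_act_fun ::
  "('v, 'e) pre_digraph \<Rightarrow> ('v \<Rightarrow> nat) \<Rightarrow> ('v \<Rightarrow> nat) \<Rightarrow> ('v \<Rightarrow> complex mat) \<Rightarrow>
   (('e + 'e \<Rightarrow> complex mat) \<Rightarrow> complex) \<Rightarrow> (('e + 'e \<Rightarrow> complex mat) \<Rightarrow> complex)" where
  "gauge_act_fun Q d v g f =
     (\<lambda>B \<in> rep_space Q d v. f (gauge_act Q d v (inv\<^bsub>gauge_group Q d v\<^esub> g) B))"

text \<open>
  The fibre ideal is stable under the group, so a group element maps a coset of it onto a coset.
\<close>

definition invariant_ring ::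
  "('v, 'e) pre_digraph \<Rightarrow> ('v \<Rightarrow> nat) \<Rightarrow> ('v \<Rightarrow> complex poly) \<Rightarrow> ('v \<Rightarrow> nat) \<Rightarrow>
   (('e + 'e \<Rightarrow> complex mat) \<Rightarrow> complex) set ring" where
  "invariant_ring Q d lam v =
     fibre_ring Q d lam v
       \<lparr>carrier := {X \<in> carrier (fibre_ring Q d lam v).
          \<forall>g \<in> carrier (gauge_group Q d v). gauge_act_fun Q d v g ` X = X}\<rparr>"

text \<open>Dimension vectors have integer entries; the scheme is empty if one of them is negative.\<close>

definition quiver_scheme ::
  "('v, 'e) pre_digraph \<Rightarrow> ('v \<Rightarrow> nat) \<Rightarrow> ('v \<Rightarrow> complex poly) \<Rightarrow> ('v \<Rightarrow> int) \<Rightarrow>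
   ((('e + 'e \<Rightarrow> complex mat) \<Rightarrow> complex) set set,
    (('e + 'e \<Rightarrow> complex mat) \<Rightarrow> complex) set set \<Rightarrow>
      ((('e + 'e \<Rightarrow> complex mat) \<Rightarrow> complex) set \<times> (('e + 'e \<Rightarrow> complex mat) \<Rightarrow> complex) set) set)
   ringed_space_C" where
  "quiver_scheme Q d lam v =
     (if \<forall>i \<in> verts Q. 0 \<le> v i
      then let w = (\<lambda>i. nat (v i)) in
           Spec (invariant_ring Q d lam w)
             (\<lambda>z. fibre_ideal Q d lam w +>\<^bsub>rep_ring Q d w\<^esub> (\<lambda>B \<in> rep_space Q d w. z))
      else empty_scheme)"


section \<open>Reflections\<close>

definition adj :: "('v, 'e) pre_digraph \<Rightarrow> 'v \<Rightarrow> 'v \<Rightarrow> nat" where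
  "adj Q i j = card {h \<in> dbl Q. src Q h = i \<and> tgt Q h = j}"

text \<open>The entries \<open>2 \<delta>\<^sub>i\<^sub>j - (a\<^sub>i\<^sub>j / d\<^sub>i\<^sub>j) d\<^sub>j\<close>; the division is exact.\<close>

definition cartan :: "('v, 'e) pre_digraph \<Rightarrow> ('v \<Rightarrow> nat) \<Rightarrow> 'v \<Rightarrow> 'v \<Rightarrow> int" where
  "cartan Q d i j =
     (if i = j then 2 else 0) - int (adj Q i j * (d j div gcd (d i) (d j)))"

definition reflect_dim ::
  "('v, 'e) pre_digraph \<Rightarrow> ('v \<Rightarrow> nat) \<Rightarrow> 'v \<Rightarrow> ('v \<Rightarrow> int) \<Rightarrow> ('v \<Rightarrow> int)" where
  "reflect_dim Q d j v = v(j := v j - (\<Sum>k \<in> verts Q. cartan Q d j k * v k))"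

definition reflect_param ::
  "('v, 'e) pre_digraph \<Rightarrow> ('v \<Rightarrow> nat) \<Rightarrow> 'v \<Rightarrow> ('v \<Rightarrow> complex poly) \<Rightarrow> ('v \<Rightarrow> complex poly)" where
  "reflect_param Q d j lam =
     (\<lambda>k. if k = j then - lam j
      else let g = gcd (d j) (d k) in
           lam k - (\<Sum>m<g. monom (of_int (cartan Q d j k) * coeff (lam j) (d j - (d j div g) * m - 1))
                                (d k - (d k div g) * m - 1)))"

end

theory Submission
  imports Defs "Jordan_Normal_Form.Determinant"
begin

section \<open>Algebras of functions and their ideals\<close>

locale fun_algebra =
  fixes X :: "'x set" and S :: "('x \<Rightarrow> complex) set"
  assumes const: "(\<lambda>_. z) \<in> S"
    and add: "f \<in> S \<Longrightarrow> g \<in> S \<Longrightarrow> (\<lambda>x. f x + g x) \<in> S"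
    and mult: "f \<in> S \<Longrightarrow> g \<in> S \<Longrightarrow> (\<lambda>x. f x * g x) \<in> S"
    and cong: "f \<in> S \<Longrightarrow> (\<And>x. x \<in> X \<Longrightarrow> g x = f x) \<Longrightarrow> g \<in> S"
begin

lemma scale: "f \<in> S \<Longrightarrow> (\<lambda>x. z * f x) \<in> S"
  using mult[OF const] .

lemma uminus: "f \<in> S \<Longrightarrow> (\<lambda>x. - f x) \<in> S"
  using scale[of f "-1"] by simp

lemma diff: "f \<in> S \<Longrightarrow> g \<in> S \<Longrightarrow> (\<lambda>x. f x - g x) \<in> S"
  using add[OF _ uminus, of f g] by simp

lemma sum: "(\<And>i. i \<in> K \<Longrightarrow> f i \<in> S) \<Longrightarrow> (\<lambda>x. \<Sum>i\<in>K. f i x) \<in> S"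
  by (induction K rule: infinite_finite_induct) (auto intro: const add)

lemma prod: "(\<And>i. i \<in> K \<Longrightarrow> f i \<in> S) \<Longrightarrow> (\<lambda>x. \<Prod>i\<in>K. f i x) \<in> S"
  by (induction K rule: infinite_finite_induct) (auto intro: const mult)

lemma power: "f \<in> S \<Longrightarrow> (\<lambda>x. f x ^ n) \<in> S"
  by (induction n) (auto intro: const mult)

end

locale fun_ideal = fun_algebra X S for X :: "'x set" and S +
  fixes I :: "('x \<Rightarrow> complex) set"
  assumes I_zero: "(\<lambda>_. 0) \<in> I"
    and I_add: "f \<in> I \<Longrightarrow> g \<in> I \<Longrightarrow> (\<lambda>x. f x + g x) \<in> I"
    and I_mult: "f \<in> S \<Longrightarrow> g \<in> I \<Longrightarrow> (\<lambda>x. f x * g x) \<in> I"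
    and I_cong: "f \<in> I \<Longrightarrow> (\<And>x. x \<in> X \<Longrightarrow> g x = f x) \<Longrightarrow> g \<in> I"
begin

lemma I_mult2: "f \<in> I \<Longrightarrow> g \<in> S \<Longrightarrow> (\<lambda>x. f x * g x) \<in> I"
  using I_mult[of g f] by (simp add: mult.commute)

lemma I_scale: "f \<in> I \<Longrightarrow> (\<lambda>x. z * f x) \<in> I"
  using I_mult[OF const] .

lemma I_uminus: "f \<in> I \<Longrightarrow> (\<lambda>x. - f x) \<in> I"
  using I_scale[of f "-1"] by simp

lemma I_diff: "f \<in> I \<Longrightarrow> g \<in> I \<Longrightarrow> (\<lambda>x. f x - g x) \<in> I"
  using I_add[OF _ I_uminus, of f g] by simp

lemma I_sum: "(\<And>i. i \<in> K \<Longrightarrow> f i \<in> I) \<Longrightarrow> (\<lambda>x. \<Sum>i\<in>K. f i x) \<in> I"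
  by (induction K rule: infinite_finite_induct) (auto intro: I_zero I_add)

lemma I_trans:
  assumes "(\<lambda>x. f x - g x) \<in> I" "(\<lambda>x. g x - h x) \<in> I"
  shows "(\<lambda>x. f x - h x) \<in> I"
  using I_add[OF assms] by simp

lemma I_sym: "(\<lambda>x. f x - g x) \<in> I \<Longrightarrow> (\<lambda>x. g x - f x) \<in> I"
  using I_uminus[of "\<lambda>x. f x - g x"] by simp

lemma mult_cong:
  assumes "f \<in> S" "g' \<in> S" "(\<lambda>x. f x - f' x) \<in> I" "(\<lambda>x. g x - g' x) \<in> I"
  shows "(\<lambda>x. f x * g x - f' x * g' x) \<in> I"
  using I_add[OF I_mult[OF assms(1,4)] I_mult[OF assms(2,3)]] by (simp add: algebra_simps)

lemma prod_cong:
  assumes "\<And>i. i \<in> K \<Longrightarrow> f i \<in> S" "\<And>i. i \<in> K \<Longrightarrow> g i \<in> S" "\<And>i. i \<in> K \<Longrightarrow> (\<lambda>x. f i x - g i x) \<in> I"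
  shows "(\<lambda>x. (\<Prod>i\<in>K. f i x) - (\<Prod>i\<in>K. g i x)) \<in> I"
  using assms
proof (induction K rule: infinite_finite_induct)
  case (insert i K)
  then show ?case by (auto intro!: mult_cong prod)
qed (auto intro: I_zero)

end

text \<open>Both kinds of closure pass to the functions that become elements after multiplication by a power
  of \<open>D\<close>. The power is positive, so the values at zeros of \<open>D\<close> are irrelevant, and the convention
  \<open>1 / 0 = 0\<close> lets total functions stand for fractions with denominator \<open>D ^ N\<close>.\<close>

definition localise :: "('x \<Rightarrow> complex) \<Rightarrow> ('x \<Rightarrow> complex) set \<Rightarrow> ('x \<Rightarrow> complex) set" where
  "localise D S = {h. \<exists>N. (\<lambda>x. D x ^ Suc N * h x) \<in> S}"

lemma (in fun_ideal) localise_raise: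
  assumes D: "D \<in> S" and h: "(\<lambda>x. D x ^ Suc N * h x) \<in> I" and "N \<le> M"
  shows "(\<lambda>x. D x ^ Suc M * h x) \<in> I"
proof -
  have "(\<lambda>x. D x ^ (M - N) * (D x ^ Suc N * h x)) \<in> I"
    by (rule I_mult[OF power[OF D] h])
  moreover have "D x ^ (M - N) * (D x ^ Suc N * h x) = D x ^ Suc M * h x" for x
    using \<open>N \<le> M\<close> by (simp add: mult.assoc[symmetric] power_add[symmetric] del: power_Suc)
  ultimately show ?thesis by (simp del: power_Suc)
qed

lemma (in fun_algebra) ideal_self: "fun_ideal X S S"
  by unfold_locales (auto intro: const add mult cong)

lemma (in fun_ideal) localise_add:
  assumes D: "D \<in> S" and "f \<in> localise D I" "g \<in> localise D I"
  shows "(\<lambda>x. f x + g x) \<in> localise D I"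
proof -
  obtain N M where N: "(\<lambda>x. D x ^ Suc N * f x) \<in> I" and M: "(\<lambda>x. D x ^ Suc M * g x) \<in> I"
    using assms by (auto simp: localise_def)
  have "(\<lambda>x. D x ^ Suc (max N M) * f x + D x ^ Suc (max N M) * g x) \<in> I"
    by (intro I_add localise_raise[OF D N] localise_raise[OF D M]) auto
  then show ?thesis
    by (auto simp: localise_def distrib_left intro!: exI[of _ "max N M"])
qed

lemma (in fun_ideal) localise_mult:
  assumes D: "D \<in> S" and "f \<in> localise D S" "g \<in> localise D I"
  shows "(\<lambda>x. f x * g x) \<in> localise D I"
proof -
  obtain N M where N: "(\<lambda>x. D x ^ Suc N * f x) \<in> S" and M: "(\<lambda>x. D x ^ Suc M * g x) \<in> I"
    using assms by (auto simp: localise_def)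
  have "(\<lambda>x. (D x ^ Suc N * f x) * (D x ^ Suc M * g x)) \<in> I"
    by (rule I_mult[OF N M])
  moreover have "(D x ^ Suc N * f x) * (D x ^ Suc M * g x) = D x ^ Suc (Suc (N + M)) * (f x * g x)" for x
    by (simp add: power_add)
  ultimately have "(\<lambda>x. D x ^ Suc (Suc (N + M)) * (f x * g x)) \<in> I" by (simp only:)
  then show ?thesis
    unfolding localise_def by blast
qed

lemma (in fun_ideal) localise_cong:
  assumes "f \<in> localise D I" "\<And>x. x \<in> X \<Longrightarrow> D x \<noteq> 0 \<Longrightarrow> g x = f x"
  shows "g \<in> localise D I"
proof -
  obtain N where N: "(\<lambda>x. D x ^ Suc N * f x) \<in> I"
    using assms by (auto simp: localise_def)
  have "(\<lambda>x. D x ^ Suc N * g x) \<in> I"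
    by (rule I_cong[OF N]) (use assms(2) in \<open>auto\<close>)
  then show ?thesis by (auto simp: localise_def)
qed

lemma (in fun_ideal) localise_sub: "D \<in> S \<Longrightarrow> f \<in> I \<Longrightarrow> f \<in> localise D I"
  unfolding localise_def by (auto intro!: exI[of _ 0] I_mult)

lemma (in fun_algebra) localise_algebra:
  assumes D: "D \<in> S"
  shows "fun_algebra {x \<in> X. D x \<noteq> 0} (localise D S)"
proof -
  interpret ii: fun_ideal X S S by (rule ideal_self)
  show ?thesis
    by unfold_locales
      (auto intro: ii.localise_sub[OF D const] ii.localise_add[OF D] ii.localise_mult[OF D] ii.localise_cong)
qed

lemma (in fun_ideal) localise_ideal:
  assumes D: "D \<in> S"
  shows "fun_ideal {x \<in> X. D x \<noteq> 0} (localise D S) (localise D I)"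
proof -
  interpret loc: fun_algebra "{x \<in> X. D x \<noteq> 0}" "localise D S" by (rule localise_algebra[OF D])
  show ?thesis
    by unfold_locales
      (auto intro: localise_sub[OF D I_zero] localise_add[OF D] localise_mult[OF D] localise_cong)
qed

lemma (in fun_algebra) inverse_in_localise:
  assumes "D \<in> S"
  shows "(\<lambda>x. 1 / D x) \<in> localise D S"
proof -
  have "(\<lambda>x. D x ^ Suc 1 * (1 / D x)) \<in> S"
    by (rule cong[OF assms]) simp
  then show ?thesis unfolding localise_def by blast
qed

text \<open>A substitution into the generators is a substitution into every polynomial function.\<close>

definition polyf :: "'x set \<Rightarrow> ('x \<Rightarrow> complex) set \<Rightarrow> ('x \<Rightarrow> complex) set" where
  "polyf X C = {f. restrict f X \<in> poly_funs X C}"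

lemma poly_funs_restrict: "f \<in> poly_funs X C \<Longrightarrow> restrict f X = f"
  by (induction rule: poly_funs.induct) (auto simp: fun_eq_iff)

lemma polyf_algebra: "fun_algebra X (polyf X C)"
proof
  show "(\<lambda>_. z) \<in> polyf X C" for z
    unfolding polyf_def using poly_funs.const[of z X C] by simp
  show "(\<lambda>x. f x + g x) \<in> polyf X C" if "f \<in> polyf X C" "g \<in> polyf X C" for f g
    using poly_funs.add[of "restrict f X" X C "restrict g X"] that
    unfolding polyf_def by (auto simp: restrict_def cong: if_cong)
  show "(\<lambda>x. f x * g x) \<in> polyf X C" if "f \<in> polyf X C" "g \<in> polyf X C" for f g
    using poly_funs.mult[of "restrict f X" X C "restrict g X"] that
    unfolding polyf_def by (auto simp: restrict_def cong: if_cong)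
  show "g \<in> polyf X C" if "f \<in> polyf X C" "\<And>x. x \<in> X \<Longrightarrow> g x = f x" for f g
  proof -
    have "restrict g X = restrict f X" using that by auto
    then show ?thesis using that unfolding polyf_def by auto
  qed
qed

lemma polyf_gen: "c \<in> C \<Longrightarrow> c \<in> polyf X C"
  unfolding polyf_def by (auto intro: poly_funs.gen)

lemma (in fun_algebra) poly_subst:
  assumes f: "f \<in> polyf E C" and \<sigma>: "\<And>x. x \<in> X \<Longrightarrow> \<sigma> x \<in> E"
    and C: "\<And>c. c \<in> C \<Longrightarrow> (\<lambda>x. c (\<sigma> x)) \<in> S"
  shows "(\<lambda>x. f (\<sigma> x)) \<in> S"
proof -
  have "(\<lambda>x. g (\<sigma> x)) \<in> S" if "g \<in> poly_funs E C" for g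
    using that
  proof induction
    case (const z)
    then show ?case by (rule cong[OF fun_algebra.const[OF fun_algebra_axioms, of z]]) (auto simp: \<sigma>)
  next
    case (gen f)
    then show ?case by (intro cong[OF C[OF gen]]) (auto simp: \<sigma>)
  next
    case (add f g)
    show ?case by (rule cong[OF fun_algebra.add[OF fun_algebra_axioms add.IH]]) (auto simp: \<sigma>)
  next
    case (mult f g)
    show ?case by (rule cong[OF fun_algebra.mult[OF fun_algebra_axioms mult.IH]]) (auto simp: \<sigma>)
  qed
  from this[of "restrict f E"] f have "(\<lambda>x. restrict f E (\<sigma> x)) \<in> S" by (auto simp: polyf_def)
  then show ?thesis by (rule cong) (auto simp: \<sigma>)
qed

text \<open>Polynomial functions preserve congruence.\<close>

lemma (in fun_ideal) poly_cong:
  assumes f: "f \<in> polyf E C" and \<sigma>: "\<And>x. x \<in> X \<Longrightarrow> \<sigma> x \<in> E" and \<tau>: "\<And>x. x \<in> X \<Longrightarrow> \<tau> x \<in> E"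
    and C: "\<And>c. c \<in> C \<Longrightarrow> (\<lambda>x. c (\<sigma> x)) \<in> S" "\<And>c. c \<in> C \<Longrightarrow> (\<lambda>x. c (\<tau> x)) \<in> S"
    and I: "\<And>c. c \<in> C \<Longrightarrow> (\<lambda>x. c (\<sigma> x) - c (\<tau> x)) \<in> I"
  shows "(\<lambda>x. f (\<sigma> x) - f (\<tau> x)) \<in> I"
proof -
  have poly: "f \<in> polyf E C" if "f \<in> poly_funs E C" for f
    using that poly_funs_restrict[OF that] by (simp add: polyf_def)
  have "(\<lambda>x. g (\<sigma> x) - g (\<tau> x)) \<in> I" if "g \<in> poly_funs E C" for g
    using that
  proof induction
    case (const z)
    show ?case by (rule I_cong[OF I_zero]) (auto simp: \<sigma> \<tau>)
  next
    case (gen f)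
    then show ?case by (intro I_cong[OF I[OF gen]]) (auto simp: \<sigma> \<tau>)
  next
    case (add f g)
    show ?case by (rule I_cong[OF I_add[OF add.IH]]) (auto simp: \<sigma> \<tau>)
  next
    case (mult f g)
    have "(\<lambda>x. f (\<sigma> x)) \<in> S" "(\<lambda>x. g (\<tau> x)) \<in> S"
      using poly_subst[OF poly[OF mult.hyps(1)], of \<sigma>] poly_subst[OF poly[OF mult.hyps(2)], of \<tau>]
      by (auto simp: \<sigma> \<tau> C)
    then show ?case by (intro I_cong[OF mult_cong[OF _ _ mult.IH]]) (auto simp: \<sigma> \<tau>)
  qed
  from this[of "restrict f E"] f have "(\<lambda>x. restrict f E (\<sigma> x) - restrict f E (\<tau> x)) \<in> I"
    by (auto simp: polyf_def)
  then show ?thesis by (rule I_cong) (auto simp: \<sigma> \<tau>)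
qed

inductive_set gen_ideal :: "'x set \<Rightarrow> ('x \<Rightarrow> complex) set \<Rightarrow> ('x \<Rightarrow> complex) set \<Rightarrow> ('x \<Rightarrow> complex) set"
  for X :: "'x set" and S G :: "('x \<Rightarrow> complex) set" where
  zero: "(\<And>x. x \<in> X \<Longrightarrow> f x = 0) \<Longrightarrow> f \<in> gen_ideal X S G"
| step: "i \<in> gen_ideal X S G \<Longrightarrow> a \<in> S \<Longrightarrow> s \<in> G \<Longrightarrow> (\<lambda>x. i x + a x * s x) \<in> gen_ideal X S G"

lemma (in fun_algebra) gen_ideal: "fun_ideal X S (gen_ideal X S G)"
proof
  show "(\<lambda>_. 0) \<in> gen_ideal X S G" by (rule gen_ideal.zero) auto
  show cong': "g \<in> gen_ideal X S G" if "f \<in> gen_ideal X S G" "\<And>x. x \<in> X \<Longrightarrow> g x = f x" for f g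
    using that
  proof (induction arbitrary: g)
    case (zero f)
    then show ?case by (intro gen_ideal.zero) auto
  next
    case (step i a s)
    have "(\<lambda>x. (g x - a x * s x) + a x * s x) \<in> gen_ideal X S G"
      by (rule gen_ideal.step) (use step in auto)
    then show ?case by simp
  qed
  show "(\<lambda>x. f x + g x) \<in> gen_ideal X S G" if "f \<in> gen_ideal X S G" "g \<in> gen_ideal X S G" for f g
    using that(2,1)
  proof induction
    case (zero g)
    show ?case by (rule cong'[OF zero(2)]) (auto simp: zero(1))
  next
    case (step i a s)
    show ?case
      by (rule cong'[OF gen_ideal.step[OF step.IH[OF step.prems] step.hyps(2,3)]]) simp
  qed
  show "(\<lambda>x. f x * g x) \<in> gen_ideal X S G" if "f \<in> S" "g \<in> gen_ideal X S G" for f g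
    using that(2)
  proof induction
    case (zero g)
    show ?case by (rule gen_ideal.zero) (auto simp: zero)
  next
    case (step i a s)
    show ?case
      by (rule cong'[OF gen_ideal.step[OF step.IH mult[OF that(1) step.hyps(2)] step.hyps(3)]])
        (simp add: algebra_simps)
  qed
qed

lemma (in fun_algebra) gen_ideal_gen: "s \<in> G \<Longrightarrow> s \<in> gen_ideal X S G"
  using gen_ideal.step[OF gen_ideal.zero[of X "\<lambda>_. 0"] const[of 1], of s G] by simp

lemma (in fun_ideal) gen_ideal_subst:
  assumes "f \<in> gen_ideal E T G" and \<sigma>: "\<And>x. x \<in> X \<Longrightarrow> \<sigma> x \<in> E"
    and T: "\<And>a. a \<in> T \<Longrightarrow> (\<lambda>x. a (\<sigma> x)) \<in> S" and G: "\<And>s. s \<in> G \<Longrightarrow> (\<lambda>x. s (\<sigma> x)) \<in> I"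
  shows "(\<lambda>x. f (\<sigma> x)) \<in> I"
  using assms(1)
proof induction
  case (zero f)
  show ?case by (rule I_cong[OF I_zero]) (auto simp: zero \<sigma>)
next
  case (step i a s)
  show ?case by (intro I_add step.IH I_mult T G step.hyps)
qed

text \<open>An ideal that contains powers of the summands contains a power of the sum (binomial theorem).\<close>

lemma (in fun_ideal) power_add_in_ideal:
  assumes f: "f \<in> S" "(\<lambda>x. f x ^ m) \<in> I" and g: "g \<in> S" "(\<lambda>x. g x ^ n) \<in> I"
  shows "(\<lambda>x. (f x + g x) ^ (m + n)) \<in> I"
proof -
  have "(\<lambda>x. of_nat ((m + n) choose k) * f x ^ k * g x ^ (m + n - k)) \<in> I" if "k \<le> m + n" for k
  proof (cases "m \<le> k")
    case True
    have "(\<lambda>x. (of_nat ((m + n) choose k) * f x ^ (k - m) * g x ^ (m + n - k)) * f x ^ m) \<in> I"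
      by (intro I_mult mult power f g const)
    moreover have "f x ^ k = f x ^ (k - m) * f x ^ m" for x
      using True by (simp add: power_add[symmetric])
    ultimately show ?thesis by (simp add: ac_simps)
  next
    case False
    have "(\<lambda>x. (of_nat ((m + n) choose k) * f x ^ k * g x ^ (m - k)) * g x ^ n) \<in> I"
      by (intro I_mult mult power f g const)
    moreover have "g x ^ (m + n - k) = g x ^ (m - k) * g x ^ n" for x
      using False by (simp add: power_add[symmetric])
    ultimately show ?thesis by (simp add: ac_simps)
  qed
  then show ?thesis
    unfolding binomial_ring by (intro I_sum) auto
qed

lemma (in fun_ideal) power_sum_in_ideal:
  assumes "finite K" "\<And>i. i \<in> K \<Longrightarrow> f i \<in> S" "\<And>i. i \<in> K \<Longrightarrow> \<exists>m. (\<lambda>x. f i x ^ m) \<in> I"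
  shows "\<exists>m. (\<lambda>x. (\<Sum>i\<in>K. f i x) ^ m) \<in> I"
  using assms
proof (induction K)
  case empty
  show ?case by (intro exI[of _ 1]) (auto intro: I_zero)
next
  case (insert i K)
  obtain m n where "(\<lambda>x. f i x ^ m) \<in> I" "(\<lambda>x. (\<Sum>i\<in>K. f i x) ^ n) \<in> I"
    using insert by (metis insertCI)
  then have "(\<lambda>x. (f i x + (\<Sum>i\<in>K. f i x)) ^ (m + n)) \<in> I"
    using insert.prems by (intro power_add_in_ideal sum) auto
  then show ?case using insert by auto
qed

text \<open>Functions of a pair that are finite sums of products of functions of its components.\<close>

definition tensor_sum :: "(('g \<Rightarrow> complex) \<times> ('x \<Rightarrow> complex)) list \<Rightarrow> 'g \<times> 'x \<Rightarrow> complex" where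
  "tensor_sum ps = (\<lambda>(g, x). \<Sum>(q, f)\<leftarrow>ps. q g * f x)"

definition tensors :: "'g set \<Rightarrow> ('g \<Rightarrow> complex) set \<Rightarrow> 'x set \<Rightarrow> ('x \<Rightarrow> complex) set \<Rightarrow> ('g \<times> 'x \<Rightarrow> complex) set"
  where "tensors \<Gamma> Q X S =
    {F. \<exists>ps. set ps \<subseteq> Q \<times> S \<and> (\<forall>g\<in>\<Gamma>. \<forall>x\<in>X. F (g, x) = tensor_sum ps (g, x))}"

lemma tensor_sum_Nil [simp]: "tensor_sum [] = (\<lambda>_. 0)"
  by (auto simp: tensor_sum_def)

lemma tensor_sum_Cons [simp]:
  "tensor_sum (qf # ps) (g, x) = fst qf g * snd qf x + tensor_sum ps (g, x)"
  by (simp add: tensor_sum_def case_prod_beta)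

lemma tensor_sum_append [simp]:
  "tensor_sum (ps @ rs) (g, x) = tensor_sum ps (g, x) + tensor_sum rs (g, x)"
  by (induction ps) auto

lemma tensor_sum_times:
  "tensor_sum (map (\<lambda>(q, f). (\<lambda>g. r g * q g, \<lambda>x. h x * f x)) ps) (g, x) =
     r g * h x * tensor_sum ps (g, x)"
  by (induction ps) (auto simp: algebra_simps)

lemma tensors_algebra:
  assumes Q: "fun_algebra \<Gamma> Q" and S: "fun_algebra X S"
  shows "fun_algebra (\<Gamma> \<times> X) (tensors \<Gamma> Q X S)"
proof -
  interpret Q: fun_algebra \<Gamma> Q by (rule Q)
  interpret S: fun_algebra X S by (rule S)
  show ?thesis
  proof
    show "(\<lambda>_. z) \<in> tensors \<Gamma> Q X S" for z
      unfolding tensors_def by (auto intro!: exI[of _ "[(\<lambda>_. z, \<lambda>_. 1)]"] Q.const S.const)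
    show "(\<lambda>x. f x + g x) \<in> tensors \<Gamma> Q X S" if "f \<in> tensors \<Gamma> Q X S" "g \<in> tensors \<Gamma> Q X S" for f g
    proof -
      obtain ps rs where "set ps \<subseteq> Q \<times> S" "\<forall>g\<in>\<Gamma>. \<forall>x\<in>X. f (g, x) = tensor_sum ps (g, x)"
        "set rs \<subseteq> Q \<times> S" "\<forall>h\<in>\<Gamma>. \<forall>x\<in>X. g (h, x) = tensor_sum rs (h, x)"
        using \<open>f \<in> _\<close> \<open>g \<in> _\<close> unfolding tensors_def by blast
      then show ?thesis unfolding tensors_def by (auto intro!: exI[of _ "ps @ rs"])
    qed
    show "(\<lambda>x. f x * g x) \<in> tensors \<Gamma> Q X S" if "f \<in> tensors \<Gamma> Q X S" "g \<in> tensors \<Gamma> Q X S" for f g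
    proof -
      obtain ps rs where ps: "set ps \<subseteq> Q \<times> S" and f: "\<forall>g\<in>\<Gamma>. \<forall>x\<in>X. f (g, x) = tensor_sum ps (g, x)"
        and rs: "set rs \<subseteq> Q \<times> S" and g: "\<forall>h\<in>\<Gamma>. \<forall>x\<in>X. g (h, x) = tensor_sum rs (h, x)"
        using \<open>f \<in> _\<close> \<open>g \<in> _\<close> unfolding tensors_def by blast
      define prods where "prods = concat (map (\<lambda>(r, h). map (\<lambda>(q, f). (\<lambda>g. r g * q g, \<lambda>x. h x * f x)) rs) ps)"
      have "set prods \<subseteq> Q \<times> S"
        using ps rs unfolding prods_def by (auto intro!: Q.mult S.mult)
      moreover have "tensor_sum prods (g, x) = tensor_sum ps (g, x) * tensor_sum rs (g, x)" for g x
        unfolding prods_def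
        by (induction ps) (auto simp: tensor_sum_times algebra_simps)
      ultimately show ?thesis
        using f g unfolding tensors_def by (auto intro!: exI[of _ prods])
    qed
    show "g \<in> tensors \<Gamma> Q X S" if "f \<in> tensors \<Gamma> Q X S" "\<And>x. x \<in> \<Gamma> \<times> X \<Longrightarrow> g x = f x" for f g
      using that unfolding tensors_def by auto
  qed
qed

lemma (in fun_algebra) tensors_right: "fun_algebra \<Gamma> Q \<Longrightarrow> f \<in> S \<Longrightarrow> (\<lambda>p. f (snd p)) \<in> tensors \<Gamma> Q X S"
  unfolding tensors_def
  by (auto intro!: exI[of _ "[(\<lambda>_. 1, f)]"] fun_algebra.const)

lemma (in fun_algebra) tensors_left: "q \<in> Q \<Longrightarrow> (\<lambda>p. q (fst p)) \<in> tensors \<Gamma> Q X S"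
  unfolding tensors_def
  by (auto intro!: exI[of _ "[(q, \<lambda>_. 1)]"] const)

text \<open>If a sum of tensors lies in \<open>I\<close> for each value of the first argument, then it can be rewritten
  with all second factors in \<open>I\<close>: a value \<open>g0\<close> at which the first coefficient does not vanish
  expresses its partner modulo the others. This replaces the Zariski density of the points of a group.\<close>

lemma (in fun_ideal) tensor_in_ideal:
  assumes Q: "fun_algebra \<Gamma> Q"
    and "set ps \<subseteq> Q \<times> S" "\<And>g. g \<in> \<Gamma> \<Longrightarrow> (\<lambda>x. tensor_sum ps (g, x)) \<in> I"
  shows "\<exists>rs. set rs \<subseteq> Q \<times> I \<and> (\<forall>g\<in>\<Gamma>. \<forall>x\<in>X. tensor_sum ps (g, x) = tensor_sum rs (g, x))"
  using assms(2,3)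
proof (induction "length ps" arbitrary: ps)
  case 0
  then show ?case by (intro exI[of _ "[]"]) auto
next
  case (Suc n ps)
  interpret Q: fun_algebra \<Gamma> Q by (rule Q)
  obtain q0 f0 ps' where ps: "ps = (q0, f0) # ps'" using Suc(2) by (cases ps) auto
  have q0: "q0 \<in> Q" and f0: "f0 \<in> S" and ps': "set ps' \<subseteq> Q \<times> S" using Suc.prems ps by auto
  show ?case
  proof (cases "\<exists>g0\<in>\<Gamma>. q0 g0 \<noteq> 0")
    case False
    have "\<exists>rs. set rs \<subseteq> Q \<times> I \<and> (\<forall>g\<in>\<Gamma>. \<forall>x\<in>X. tensor_sum ps' (g, x) = tensor_sum rs (g, x))"
      by (rule Suc.hyps(1)) (use Suc.hyps(2) Suc.prems ps False ps' in auto)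
    then show ?thesis using ps False by auto
  next
    case True
    then obtain g0 where g0: "g0 \<in> \<Gamma>" "q0 g0 \<noteq> 0" by blast
    define k where "k = (\<lambda>g. q0 g / q0 g0)"
    have k: "k \<in> Q" unfolding k_def using Q.scale[OF q0, of "1 / q0 g0"] by simp
    define F where "F = (\<lambda>x. tensor_sum ps (g0, x))"
    have F: "F \<in> I" unfolding F_def by (rule Suc.prems(2)[OF g0(1)])
    define ps'' where "ps'' = map (\<lambda>(q, f). (\<lambda>g. q g - q g0 * k g, f)) ps'"
    have ps'': "set ps'' \<subseteq> Q \<times> S" "length ps'' = n"
      using ps' Suc.hyps(2) ps unfolding ps''_def by (auto intro!: Q.diff Q.scale k)
    have ts: "tensor_sum ps'' (g, x) = tensor_sum ps' (g, x) - k g * tensor_sum ps' (g0, x)" for g x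
      unfolding ps''_def by (induction ps') (auto simp: algebra_simps)
    have split: "tensor_sum ps (g, x) = k g * F x + tensor_sum ps'' (g, x)" for g x
      unfolding ts F_def ps using g0 by (simp add: k_def field_simps)
    have "(\<lambda>x. tensor_sum ps'' (g, x)) \<in> I" if "g \<in> \<Gamma>" for g
      using I_diff[OF Suc.prems(2)[OF that] I_scale[OF F, of "k g"]] by (simp add: split)
    then obtain rs where "set rs \<subseteq> Q \<times> I" "\<forall>g\<in>\<Gamma>. \<forall>x\<in>X. tensor_sum ps'' (g, x) = tensor_sum rs (g, x)"
      using Suc.hyps(1)[of ps''] ps'' by auto
    then show ?thesis
      using k F split by (intro exI[of _ "(k, F) # rs"]) auto
  qed
qed

lemma (in fun_ideal) tensors_subst:
  assumes Q: "fun_algebra \<Gamma> Q" and F: "F \<in> tensors \<Gamma> Q X S"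
    and I: "\<And>g. g \<in> \<Gamma> \<Longrightarrow> (\<lambda>x. F (g, x)) \<in> I"
    and D: "D \<in> S" and \<gamma>: "\<And>x. x \<in> X \<Longrightarrow> D x \<noteq> 0 \<Longrightarrow> \<gamma> x \<in> \<Gamma>"
    and q: "\<And>q. q \<in> Q \<Longrightarrow> (\<lambda>x. q (\<gamma> x)) \<in> localise D S"
  shows "(\<lambda>x. F (\<gamma> x, x)) \<in> localise D I"
proof -
  interpret loc: fun_ideal "{x \<in> X. D x \<noteq> 0}" "localise D S" "localise D I" by (rule localise_ideal[OF D])
  obtain ps where ps: "set ps \<subseteq> Q \<times> S" and Fps: "\<forall>g\<in>\<Gamma>. \<forall>x\<in>X. F (g, x) = tensor_sum ps (g, x)"
    using F unfolding tensors_def by blast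
  have "(\<lambda>x. tensor_sum ps (g, x)) \<in> I" if "g \<in> \<Gamma>" for g
    by (rule I_cong[OF I[OF that]]) (use Fps that in auto)
  then obtain rs where rs: "set rs \<subseteq> Q \<times> I" and eq: "\<forall>g\<in>\<Gamma>. \<forall>x\<in>X. tensor_sum ps (g, x) = tensor_sum rs (g, x)"
    using tensor_in_ideal[OF Q ps] by blast
  have "(\<lambda>x. tensor_sum rs (\<gamma> x, x)) \<in> localise D I"
    using rs
  proof (induction rs)
    case Nil
    show ?case by (simp add: loc.I_zero)
  next
    case (Cons qf rs)
    then show ?case by (auto intro!: loc.I_add loc.I_mult q intro: localise_sub[OF D])
  qed
  then show ?thesis
    by (rule loc.I_cong) (use Fps eq \<gamma> in auto)
qed

section \<open>Matrices of functions\<close>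

lemma times_mat_entry:
  assumes "(A :: complex mat) \<in> carrier_mat r k" "B \<in> carrier_mat k c" "i < r" "j < c"
  shows "(A * B) $$ (i, j) = (\<Sum>l<k. A $$ (i, l) * B $$ (l, j))"
  using assms by (auto simp: scalar_prod_def lessThan_atLeast0 intro!: sum.cong)

definition mat_in :: "('x \<Rightarrow> complex) set \<Rightarrow> nat \<Rightarrow> nat \<Rightarrow> ('x \<Rightarrow> complex mat) \<Rightarrow> bool" where
  "mat_in S r c M \<longleftrightarrow> (\<forall>i<r. \<forall>j<c. (\<lambda>x. M x $$ (i, j)) \<in> S)"

lemma mat_inD: "mat_in S r c M \<Longrightarrow> i < r \<Longrightarrow> j < c \<Longrightarrow> (\<lambda>x. M x $$ (i, j)) \<in> S"
  by (auto simp: mat_in_def)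

context fun_algebra
begin

lemma mat_in_const: "mat_in S r c (\<lambda>_. M)"
  by (auto simp: mat_in_def const)

lemma mat_in_mult:
  assumes "mat_in S r k M" "mat_in S k c N"
    and "\<And>x. x \<in> X \<Longrightarrow> M x \<in> carrier_mat r k" "\<And>x. x \<in> X \<Longrightarrow> N x \<in> carrier_mat k c"
  shows "mat_in S r c (\<lambda>x. M x * N x)"
  unfolding mat_in_def
proof (intro allI impI)
  fix i j assume ij: "i < r" "j < c"
  have "(\<lambda>x. \<Sum>l<k. M x $$ (i, l) * N x $$ (l, j)) \<in> S"
    using ij by (intro sum mult mat_inD[OF assms(1)] mat_inD[OF assms(2)]) auto
  then show "(\<lambda>x. (M x * N x) $$ (i, j)) \<in> S"
    by (rule cong) (use ij assms(3,4) times_mat_entry in blast)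
qed

lemma mat_in_add:
  assumes "mat_in S r c M" "mat_in S r c N"
    and "\<And>x. x \<in> X \<Longrightarrow> M x \<in> carrier_mat r c" "\<And>x. x \<in> X \<Longrightarrow> N x \<in> carrier_mat r c"
  shows "mat_in S r c (\<lambda>x. M x + N x)"
  unfolding mat_in_def
proof (intro allI impI)
  fix i j assume ij: "i < r" "j < c"
  show "(\<lambda>x. (M x + N x) $$ (i, j)) \<in> S"
    by (rule cong[OF add[OF mat_inD[OF assms(1) ij] mat_inD[OF assms(2) ij]]]) (use ij assms(3,4) in fastforce)
qed

lemma mat_in_minus:
  assumes "mat_in S r c M" "mat_in S r c N"
    and "\<And>x. x \<in> X \<Longrightarrow> M x \<in> carrier_mat r c" "\<And>x. x \<in> X \<Longrightarrow> N x \<in> carrier_mat r c"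
  shows "mat_in S r c (\<lambda>x. M x - N x)"
  unfolding mat_in_def
proof (intro allI impI)
  fix i j assume ij: "i < r" "j < c"
  show "(\<lambda>x. (M x - N x) $$ (i, j)) \<in> S"
    by (rule cong[OF diff[OF mat_inD[OF assms(1) ij] mat_inD[OF assms(2) ij]]]) (use ij assms(3,4) in fastforce)
qed

lemma det_in:
  assumes "mat_in S n n M" "\<And>x. x \<in> X \<Longrightarrow> M x \<in> carrier_mat n n"
  shows "(\<lambda>x. det (M x)) \<in> S"
proof -
  have "(\<lambda>x. \<Sum>p\<in>{p. p permutes {0..<n}}. signof p * (\<Prod>i\<in>{0..<n}. M x $$ (i, p i))) \<in> S"
    by (intro sum mult const prod mat_inD[OF assms(1)]) (auto simp: permutes_in_image)
  then show ?thesis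
    by (rule cong) (use assms(2) det_def' in blast)
qed

end

lemma (in fun_ideal) det_cong:
  assumes "mat_in S n n M" "mat_in S n n N" "mat_in I n n (\<lambda>x. M x - N x)"
    and "\<And>x. x \<in> X \<Longrightarrow> M x \<in> carrier_mat n n" "\<And>x. x \<in> X \<Longrightarrow> N x \<in> carrier_mat n n"
  shows "(\<lambda>x. det (M x) - det (N x)) \<in> I"
proof -
  have ent: "(\<lambda>x. M x $$ (i, j) - N x $$ (i, j)) \<in> I" if "i < n" "j < n" for i j
    by (rule I_cong[OF mat_inD[OF assms(3) that]]) (use that assms(4,5) in fastforce)
  have "(\<lambda>x. \<Sum>p\<in>{p. p permutes {0..<n}}. signof p *
      ((\<Prod>i\<in>{0..<n}. M x $$ (i, p i)) - (\<Prod>i\<in>{0..<n}. N x $$ (i, p i)))) \<in> I"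
    by (intro I_sum I_scale prod_cong ent mat_inD[OF assms(1)] mat_inD[OF assms(2)])
      (auto simp: permutes_in_image)
  then show ?thesis
  proof (rule I_cong)
    fix x assume "x \<in> X"
    then show "det (M x) - det (N x) = (\<Sum>p\<in>{p. p permutes {0..<n}}. signof p *
      ((\<Prod>i\<in>{0..<n}. M x $$ (i, p i)) - (\<Prod>i\<in>{0..<n}. N x $$ (i, p i))))"
      using det_def'[OF assms(4)] det_def'[OF assms(5)]
      by (simp add: sum_subtractf[symmetric] right_diff_distrib)
  qed
qed

lemma (in fun_ideal) mat_in_ideal_left:
  assumes "mat_in S r k M" "mat_in I k c N"
    and "\<And>x. x \<in> X \<Longrightarrow> M x \<in> carrier_mat r k" "\<And>x. x \<in> X \<Longrightarrow> N x \<in> carrier_mat k c"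
  shows "mat_in I r c (\<lambda>x. M x * N x)"
  unfolding mat_in_def
proof (intro allI impI)
  fix i j assume ij: "i < r" "j < c"
  have "(\<lambda>x. \<Sum>l<k. M x $$ (i, l) * N x $$ (l, j)) \<in> I"
    using ij by (intro I_sum I_mult mat_inD[OF assms(1)] mat_inD[OF assms(2)]) auto
  then show "(\<lambda>x. (M x * N x) $$ (i, j)) \<in> I"
    by (rule I_cong) (use ij assms(3,4) times_mat_entry in blast)
qed

lemma (in fun_ideal) mat_in_ideal_right:
  assumes "mat_in I r k M" "mat_in S k c N"
    and "\<And>x. x \<in> X \<Longrightarrow> M x \<in> carrier_mat r k" "\<And>x. x \<in> X \<Longrightarrow> N x \<in> carrier_mat k c"
  shows "mat_in I r c (\<lambda>x. M x * N x)"
  unfolding mat_in_def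
proof (intro allI impI)
  fix i j assume ij: "i < r" "j < c"
  have "(\<lambda>x. \<Sum>l<k. M x $$ (i, l) * N x $$ (l, j)) \<in> I"
    using ij by (intro I_sum I_mult2 mat_inD[OF assms(1)] mat_inD[OF assms(2)]) auto
  then show "(\<lambda>x. (M x * N x) $$ (i, j)) \<in> I"
    by (rule I_cong) (use ij assms(3,4) times_mat_entry in blast)
qed

text \<open>The inverse by the adjugate formula; for a singular matrix the value is zero.\<close>

definition minv :: "complex mat \<Rightarrow> complex mat" where
  "minv M = (1 / det M) \<cdot>\<^sub>m adj_mat M"

lemma minv_carrier [simp]: "M \<in> carrier_mat n n \<Longrightarrow> minv M \<in> carrier_mat n n"
  unfolding minv_def using adj_mat(1)[of M n] by auto

lemma minv:
  assumes "M \<in> carrier_mat n n" "det M \<noteq> 0"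
  shows "M * minv M = 1\<^sub>m n" "minv M * M = 1\<^sub>m n"
proof -
  have "(1 / det M) \<cdot>\<^sub>m (det M \<cdot>\<^sub>m 1\<^sub>m n) = 1\<^sub>m n"
    using assms(2) by (intro eq_matI) auto
  then show "M * minv M = 1\<^sub>m n" "minv M * M = 1\<^sub>m n"
    unfolding minv_def using adj_mat[OF assms(1)] assms(1)
    by (auto simp: mult_smult_distrib[of _ n n _ n] mult_smult_assoc_mat[of _ n n _ n])
qed

lemma (in fun_algebra) minv_in:
  assumes M: "mat_in S n n M" "\<And>x. x \<in> X \<Longrightarrow> M x \<in> carrier_mat n n"
    and det: "(\<lambda>x. 1 / det (M x)) \<in> S"
  shows "mat_in S n n (\<lambda>x. minv (M x))"
  unfolding mat_in_def
proof (intro allI impI)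
  fix i j assume ij: "i < n" "j < n"
  have "mat_in S (n - 1) (n - 1) (\<lambda>x. mat_delete (M x) j i)"
    unfolding mat_in_def
  proof (intro allI impI)
    fix i' j' assume ij': "i' < n - 1" "j' < n - 1"
    have "(\<lambda>x. M x $$ (if i' < j then i' else Suc i', if j' < i then j' else Suc j')) \<in> S"
      by (rule mat_inD[OF M(1)]) (use ij' in auto)
    then show "(\<lambda>x. mat_delete (M x) j i $$ (i', j')) \<in> S"
    proof (rule cong)
      fix x assume "x \<in> X"
      then have "M x \<in> carrier_mat n n" by (rule M(2))
      then show "mat_delete (M x) j i $$ (i', j') =
          M x $$ (if i' < j then i' else Suc i', if j' < i then j' else Suc j')"
        using ij' by (auto simp: mat_delete_def)
    qed
  qed
  then have "(\<lambda>x. det (mat_delete (M x) j i)) \<in> S"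
    by (rule det_in) (use M(2) mat_delete_carrier in blast)
  then have "(\<lambda>x. (1 / det (M x)) * ((-1) ^ (j + i) * det (mat_delete (M x) j i))) \<in> S"
    by (intro mult det const)
  then show "(\<lambda>x. minv (M x) $$ (i, j)) \<in> S"
  proof (rule cong)
    fix x assume "x \<in> X"
    then have "M x \<in> carrier_mat n n" by (rule M(2))
    then show "minv (M x) $$ (i, j) = (1 / det (M x)) * ((-1) ^ (j + i) * det (mat_delete (M x) j i))"
      using ij by (simp add: minv_def adj_mat_def cofactor_def)
  qed
qed

section \<open>Matrices commuting with the nilpotent operators\<close>

lemma idx_less: "a < n \<Longrightarrow> k < d \<Longrightarrow> a * d + k < n * (d::nat)"
proof -
  assume "a < n" "k < d"
  then have "a * d + k < Suc a * d" by simp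
  also have "\<dots> \<le> n * d" using \<open>a < n\<close> by (intro mult_le_mono1) simp
  finally show ?thesis .
qed

lemma idx_div_mod [simp]: "k < d \<Longrightarrow> (a * d + k) div d = a" "k < d \<Longrightarrow> (a * d + k) mod d = (k::nat)"
  by auto

lemma idx_eq: "k < d \<Longrightarrow> l < d \<Longrightarrow> a * d + k = b * d + l \<longleftrightarrow> a = b \<and> k = (l::nat)"
  by (metis idx_div_mod)

lemma eps_carrier [simp]: "eps_mat n d \<in> carrier_mat (n * d) (n * d)"
  by (simp add: eps_mat_def)

lemma eps_dim [simp]: "dim_row (eps_mat n d) = n * d" "dim_col (eps_mat n d) = n * d"
  by (simp_all add: eps_mat_def)

lemma Suc_same_block:
  assumes "Suc s mod d \<noteq> 0"
  shows "Suc s div d = s div d" "Suc s mod d = Suc (s mod d)"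
proof -
  show "Suc s mod d = Suc (s mod d)" using assms by (auto simp: mod_Suc split: if_splits)
  show "Suc s div d = s div d" using assms by (auto simp: div_Suc split: if_splits)
qed

lemma Suc_less_block:
  assumes "s < n * d" "Suc s mod d \<noteq> 0"
  shows "Suc s < n * (d::nat)"
  using assms by (metis Suc_lessI mod_mult_self2_is_0)

lemma eps_right_entry:
  assumes M: "M \<in> carrier_mat r (n * d)" and ij: "i < r" "j < n * d"
  shows "(M * eps_mat n d) $$ (i, j) = (if Suc j mod d \<noteq> 0 then M $$ (i, Suc j) else 0)"
proof -
  have "(M * eps_mat n d) $$ (i, j) = (\<Sum>l<n*d. M $$ (i, l) * eps_mat n d $$ (l, j))"
    by (rule times_mat_entry[OF M eps_carrier ij])
  also have "\<dots> = (\<Sum>l<n*d. if l = Suc j then (if Suc j mod d \<noteq> 0 then M $$ (i, Suc j) else 0) else 0)"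
    using ij by (intro sum.cong) (auto simp: eps_mat_def)
  also have "\<dots> = (if Suc j mod d \<noteq> 0 then M $$ (i, Suc j) else 0)"
    using Suc_less_block[OF ij(2)] by (auto simp: sum.delta)
  finally show ?thesis .
qed

lemma eps_left_entry:
  assumes M: "M \<in> carrier_mat (n * d) c" and ij: "i < n * d" "j < c"
  shows "(eps_mat n d * M) $$ (i, j) = (if i mod d \<noteq> 0 then M $$ (i - 1, j) else 0)"
proof -
  have "(eps_mat n d * M) $$ (i, j) = (\<Sum>l<n*d. eps_mat n d $$ (i, l) * M $$ (l, j))"
    by (rule times_mat_entry[OF eps_carrier M ij])
  also have "\<dots> = (\<Sum>l<n*d. if l = i - 1 then (if i mod d \<noteq> 0 then M $$ (i - 1, j) else 0) else 0)"
    using ij by (intro sum.cong) (cases i; auto simp: eps_mat_def)+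
  also have "\<dots> = (if i mod d \<noteq> 0 then M $$ (i - 1, j) else 0)"
    using ij by (auto simp: sum.delta)
  finally show ?thesis .
qed

lemma eps_pow_entry:
  assumes "i < n * d" "j < n * d"
  shows "(eps_mat n d ^\<^sub>m l) $$ (i, j) = (if i = j + l \<and> i div d = j div d then 1 else 0)"
  using assms
proof (induction l arbitrary: i j)
  case 0
  then show ?case by (auto simp: eps_mat_def)
next
  case (Suc l)
  have d: "d > 0" using Suc.prems by (auto intro: Nat.gr0I)
  have "(eps_mat n d ^\<^sub>m Suc l) $$ (i, j) =
      (if Suc j mod d \<noteq> 0 then (eps_mat n d ^\<^sub>m l) $$ (i, Suc j) else 0)"
    unfolding pow_mat.simps by (rule eps_right_entry) (use Suc.prems in auto)
  also have "\<dots> = (if i = j + Suc l \<and> i div d = j div d then 1 else 0)"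
  proof (cases "Suc j mod d = 0")
    case True
    have "i div d \<noteq> j div d" if "i = j + Suc l"
    proof -
      have "Suc j div d = Suc (j div d)" using True by (simp add: div_Suc)
      then have "Suc (j div d) \<le> i div d" using that by (metis add_Suc_right add_Suc div_le_mono le_add1)
      then show ?thesis by simp
    qed
    then show ?thesis using True by auto
  next
    case False
    have sj: "Suc j < n * d" using Suc_less_block Suc.prems False by blast
    show ?thesis
      using Suc.IH[OF Suc.prems(1) sj] Suc_same_block(1)[OF False] False by auto
  qed
  finally show ?case .
qed

lemma eps_pow_carrier [simp]: "eps_mat n d ^\<^sub>m l \<in> carrier_mat (n * d) (n * d)"
  by simp

lemma same_block_shift: "0 < (d::nat) \<Longrightarrow> (j + l) div d = j div d \<longleftrightarrow> j mod d + l < d"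
proof -
  assume d: "0 < d"
  have "(j + l) div d = j div d + (j mod d + l) div d"
    by (metis add.assoc div_mult_mod_eq div_mult_self3 d less_not_refl)
  then show ?thesis using d by (auto simp: div_eq_0_iff)
qed

lemma shift_in_block: "j < n * d \<Longrightarrow> j mod d + l < d \<Longrightarrow> j + l < n * (d::nat)"
proof -
  assume j: "j < n * d" and l: "j mod d + l < d"
  have "(j div d) * d + (j mod d + l) < n * d"
    by (rule idx_less[OF _ l]) (use j in \<open>simp add: less_mult_imp_div_less\<close>)
  then show ?thesis by (simp add: add.assoc[symmetric])
qed

lemma eps_pow_right_entry:
  assumes M: "M \<in> carrier_mat r (n * d)" and ij: "i < r" "j < n * d"
  shows "(M * eps_mat n d ^\<^sub>m l) $$ (i, j) = (if j mod d + l < d then M $$ (i, j + l) else 0)"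
proof -
  have d: "d > 0" using ij by (auto intro: Nat.gr0I)
  have "(M * eps_mat n d ^\<^sub>m l) $$ (i, j) = (\<Sum>k<n*d. M $$ (i, k) * (eps_mat n d ^\<^sub>m l) $$ (k, j))"
    by (rule times_mat_entry[OF M eps_pow_carrier ij])
  also have "\<dots> = (\<Sum>k<n*d. if k = j + l then (if j mod d + l < d then M $$ (i, j + l) else 0) else 0)"
    using ij by (intro sum.cong) (auto simp: eps_pow_entry same_block_shift[OF d])
  also have "\<dots> = (if j mod d + l < d then M $$ (i, j + l) else 0)"
    using shift_in_block[OF ij(2)] by (auto simp: sum.delta)
  finally show ?thesis .
qed

lemma eps_pow_left_entry:
  assumes M: "M \<in> carrier_mat (n * d) c" and ij: "i < n * d" "j < c"
  shows "(eps_mat n d ^\<^sub>m l * M) $$ (i, j) = (if l \<le> i mod d then M $$ (i - l, j) else 0)"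
proof -
  have d: "d > 0" using ij by (auto intro: Nat.gr0I)
  have blk: "i = k + l \<and> i div d = k div d \<longleftrightarrow> k = i - l \<and> l \<le> i mod d" for k
  proof
    assume "i = k + l \<and> i div d = k div d"
    then have "k mod d + l < d" "i = k + l" using same_block_shift[OF d] by auto
    moreover from this have "i mod d = k mod d + l" by (metis mod_add_left_eq mod_less)
    ultimately show "k = i - l \<and> l \<le> i mod d" by simp
  next
    assume a: "k = i - l \<and> l \<le> i mod d"
    have li: "l \<le> i" using a by (metis le_trans mod_less_eq_dividend)
    have "i = (i div d) * d + (i mod d - l) + l" using a by (metis add.assoc div_mult_mod_eq le_add_diff_inverse2)
    then have "k = (i div d) * d + (i mod d - l)" using a by (metis diff_add_inverse2)
    moreover have "i mod d - l < d" using d by (simp add: less_imp_diff_less)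
    ultimately have "k div d = i div d" by (metis idx_div_mod(1))
    then show "i = k + l \<and> i div d = k div d" using a li by (metis le_add_diff_inverse2)
  qed
  have "(eps_mat n d ^\<^sub>m l * M) $$ (i, j) = (\<Sum>k<n*d. (eps_mat n d ^\<^sub>m l) $$ (i, k) * M $$ (k, j))"
    by (rule times_mat_entry[OF eps_pow_carrier M ij])
  also have "\<dots> = (\<Sum>k<n*d. if k = i - l then (if l \<le> i mod d then M $$ (i - l, j) else 0) else 0)"
    using ij by (intro sum.cong) (auto simp: eps_pow_entry blk)
  also have "\<dots> = (if l \<le> i mod d then M $$ (i - l, j) else 0)"
    using ij by (auto simp: sum.delta)
  finally show ?thesis .
qed

definition lin :: "nat \<Rightarrow> nat \<Rightarrow> nat \<Rightarrow> complex mat \<Rightarrow> bool" where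
  "lin d r c M \<longleftrightarrow> M \<in> carrier_mat (r * d) (c * d) \<and> M * eps_mat c d = eps_mat r d * M"

lemma lin_carrier: "lin d r c M \<Longrightarrow> M \<in> carrier_mat (r * d) (c * d)"
  by (simp add: lin_def)

lemma lin_iff_entries:
  assumes M: "M \<in> carrier_mat (r * d) (c * d)"
  shows "lin d r c M \<longleftrightarrow> (\<forall>i < r * d. \<forall>j < c * d.
    (if Suc j mod d \<noteq> 0 then M $$ (i, Suc j) else 0) = (if i mod d \<noteq> 0 then M $$ (i - 1, j) else 0))"
proof
  assume L: "lin d r c M"
  show "\<forall>i < r * d. \<forall>j < c * d.
    (if Suc j mod d \<noteq> 0 then M $$ (i, Suc j) else 0) = (if i mod d \<noteq> 0 then M $$ (i - 1, j) else 0)"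
  proof (intro allI impI)
    fix i j assume ij: "i < r * d" "j < c * d"
    show "(if Suc j mod d \<noteq> 0 then M $$ (i, Suc j) else 0) = (if i mod d \<noteq> 0 then M $$ (i - 1, j) else 0)"
      unfolding eps_right_entry[OF M ij, symmetric] eps_left_entry[OF M ij, symmetric]
      using L unfolding lin_def by argo
  qed
next
  assume R: "\<forall>i < r * d. \<forall>j < c * d.
    (if Suc j mod d \<noteq> 0 then M $$ (i, Suc j) else 0) = (if i mod d \<noteq> 0 then M $$ (i - 1, j) else 0)"
  have "M * eps_mat c d = eps_mat r d * M"
  proof (rule eq_matI, goal_cases)
    case (1 i j)
    then have ij: "i < r * d" "j < c * d" using M by auto
    show ?case unfolding eps_right_entry[OF M ij] eps_left_entry[OF M ij] using R ij by blast
  qed (use M in auto)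
  then show "lin d r c M" using M by (simp add: lin_def)
qed

lemma lin_one: "lin d n n (1\<^sub>m (n * d))"
  by (simp add: lin_def)

lemma lin_eps: "lin d n n (eps_mat n d)"
  by (simp add: lin_def)

lemma lin_mult:
  assumes "lin d r k M" "lin d k c N"
  shows "lin d r c (M * N)"
proof -
  have M: "M \<in> carrier_mat (r * d) (k * d)" and N: "N \<in> carrier_mat (k * d) (c * d)"
    using assms by (auto simp: lin_def)
  have "M * N * eps_mat c d = M * (N * eps_mat c d)" by (rule assoc_mult_mat[OF M N eps_carrier])
  also have "\<dots> = M * (eps_mat k d * N)" using assms(2) by (simp add: lin_def)
  also have "\<dots> = (M * eps_mat k d) * N"
    by (rule assoc_mult_mat[OF M eps_carrier N, symmetric])
  also have "\<dots> = eps_mat r d * M * N" using assms(1) by (simp add: lin_def)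
  also have "\<dots> = eps_mat r d * (M * N)" by (rule assoc_mult_mat[OF eps_carrier M N])
  finally show ?thesis using M N by (simp add: lin_def)
qed

lemma lin_add:
  assumes "lin d r c M" "lin d r c N"
  shows "lin d r c (M + N)"
proof -
  have M: "M \<in> carrier_mat (r * d) (c * d)" and N: "N \<in> carrier_mat (r * d) (c * d)"
    using assms by (auto simp: lin_def)
  show ?thesis using assms M N
    by (auto simp: lin_def add_mult_distrib_mat[OF M N eps_carrier] mult_add_distrib_mat[OF eps_carrier M N])
qed

lemma lin_minus:
  assumes "lin d r c M" "lin d r c N"
  shows "lin d r c (M - N)"
proof -
  have M: "M \<in> carrier_mat (r * d) (c * d)" and N: "N \<in> carrier_mat (r * d) (c * d)"
    using assms by (auto simp: lin_def)
  show ?thesis using assms M N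
    by (auto simp: lin_def minus_mult_distrib_mat[OF M N eps_carrier] mult_minus_distrib_mat[OF eps_carrier M N])
qed

lemma lin_inverse:
  assumes "lin d n n M" "N \<in> carrier_mat (n * d) (n * d)" "M * N = 1\<^sub>m (n * d)" "N * M = 1\<^sub>m (n * d)"
  shows "lin d n n N"
proof -
  let ?c = "carrier_mat (n * d) (n * d)"
  have M: "M \<in> ?c" and N: "N \<in> ?c" and e: "eps_mat n d \<in> ?c"
    using assms by (auto simp: lin_def)
  have "N * eps_mat n d = N * eps_mat n d * (M * N)"
    unfolding assms(3) by (rule right_mult_one_mat[OF mult_carrier_mat[OF N e], symmetric])
  also have "\<dots> = N * eps_mat n d * M * N"
    by (rule assoc_mult_mat[OF mult_carrier_mat[OF N e] M N, symmetric])
  also have "N * eps_mat n d * M = N * (eps_mat n d * M)" by (rule assoc_mult_mat[OF N e M])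
  also have "eps_mat n d * M = M * eps_mat n d" using assms(1) by (simp add: lin_def)
  also have "N * (M * eps_mat n d) = N * M * eps_mat n d" by (rule assoc_mult_mat[OF N M e, symmetric])
  also have "\<dots> = eps_mat n d" unfolding assms(4) by (rule left_mult_one_mat[OF e])
  finally show ?thesis using N by (simp add: lin_def)
qed

lemma lin_minv: "lin d n n M \<Longrightarrow> det M \<noteq> 0 \<Longrightarrow> lin d n n (minv M)"
  by (rule lin_inverse[OF _ minv_carrier[OF lin_carrier] minv[OF lin_carrier]]) assumption+

lemma lin_eps_pow:
  assumes "lin d r c M"
  shows "M * eps_mat c d ^\<^sub>m l = eps_mat r d ^\<^sub>m l * M"
proof (induction l)
  case 0
  show ?case using left_mult_one_mat[OF lin_carrier[OF assms]] right_mult_one_mat[OF lin_carrier[OF assms]]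
    by simp
next
  case (Suc l)
  have M: "M \<in> carrier_mat (r * d) (c * d)" by (rule lin_carrier[OF assms])
  have "M * eps_mat c d ^\<^sub>m Suc l = (M * eps_mat c d ^\<^sub>m l) * eps_mat c d"
    unfolding pow_mat.simps by (rule assoc_mult_mat[symmetric, OF M eps_pow_carrier eps_carrier])
  also have "\<dots> = eps_mat r d ^\<^sub>m l * (M * eps_mat c d)"
    unfolding Suc by (rule assoc_mult_mat[OF eps_pow_carrier M eps_carrier])
  also have "\<dots> = eps_mat r d ^\<^sub>m l * (eps_mat r d * M)" using assms by (simp add: lin_def)
  also have "\<dots> = eps_mat r d ^\<^sub>m Suc l * M"
    unfolding pow_mat.simps by (rule assoc_mult_mat[symmetric, OF eps_pow_carrier eps_carrier M])
  finally show ?case .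
qed

lemma lin_shift_entry:
  assumes M: "lin d r c M" and i: "i < r * d" and j: "j < c * d"
  shows "(if j mod d + l < d then M $$ (i, j + l) else 0) = (if l \<le> i mod d then M $$ (i - l, j) else 0)"
  using eps_pow_right_entry[OF lin_carrier[OF M] i j, of l] eps_pow_left_entry[OF lin_carrier[OF M] i j, of l]
    lin_eps_pow[OF M, of l] by simp

text \<open>Reduction modulo \<open>\<epsilon>\<close>.\<close>

definition ct :: "nat \<Rightarrow> nat \<Rightarrow> nat \<Rightarrow> complex mat \<Rightarrow> complex mat" where
  "ct d r c M = mat r c (\<lambda>(a, b). M $$ (a * d, b * d))"

lemma ct_carrier [simp]: "ct d r c M \<in> carrier_mat r c"
  by (simp add: ct_def)

lemma lin_upper_zero:
  assumes M: "lin d r c M" and "a < r" "b < c" "0 < k" "k < d"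
  shows "M $$ (a * d, b * d + k) = 0"
  using lin_shift_entry[OF M, of "a * d" "b * d" k] idx_less[of a r 0 d] idx_less[of b c 0 d] assms
  by simp

lemma sum_idx: "(\<Sum>l<n * d. f l) = (\<Sum>a<n. \<Sum>k<d. f (a * d + k :: nat))"
proof -
  have "b mod d < d" if "b < n * d" for b using that by (cases d) auto
  note this[simp]
  have "(\<Sum>a<n. \<Sum>k<d. f (a * d + k)) = (\<Sum>p\<in>{..<n} \<times> {..<d}. f (fst p * d + snd p))"
    by (simp add: sum.cartesian_product case_prod_beta)
  also have "\<dots> = (\<Sum>l<n * d. f l)"
    by (rule sum.reindex_bij_witness[where i = "\<lambda>l. (l div d, l mod d)" and j = "\<lambda>p. fst p * d + snd p"])
      (auto simp: less_mult_imp_div_less idx_less intro: Nat.gr0I)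
  finally show ?thesis by simp
qed

lemma ct_mult:
  assumes M: "lin d r k M" and N: "N \<in> carrier_mat (k * d) (c * d)" and d: "0 < d"
  shows "ct d r c (M * N) = ct d r k M * ct d k c N"
proof (rule eq_matI)
  fix a b assume "a < dim_row (ct d r k M * ct d k c N)" "b < dim_col (ct d r k M * ct d k c N)"
  then have ab: "a < r" "b < c" by (auto simp: ct_def)
  have lt: "a * d < r * d" "b * d < c * d" using ab d by auto
  have "ct d r c (M * N) $$ (a, b) = (\<Sum>l<k * d. M $$ (a * d, l) * N $$ (l, b * d))"
    using ab times_mat_entry[OF lin_carrier[OF M] N lt] by (simp add: ct_def)
  also have "\<dots> = (\<Sum>e<k. \<Sum>t<d. M $$ (a * d, e * d + t) * N $$ (e * d + t, b * d))"
    by (rule sum_idx)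
  also have "\<dots> = (\<Sum>e<k. \<Sum>t<d. if t = 0 then M $$ (a * d, e * d) * N $$ (e * d, b * d) else 0)"
    by (intro sum.cong refl) (use lin_upper_zero[OF M ab(1)] in auto)
  also have "\<dots> = (\<Sum>e<k. M $$ (a * d, e * d) * N $$ (e * d, b * d))"
    using d by (simp add: sum.delta)
  also have "\<dots> = (ct d r k M * ct d k c N) $$ (a, b)"
    using ab by (subst times_mat_entry[OF ct_carrier ct_carrier ab]) (simp add: ct_def)
  finally show "ct d r c (M * N) $$ (a, b) = (ct d r k M * ct d k c N) $$ (a, b)" .
qed (auto simp: ct_def)

text \<open>In the basis ordered by powers of \<open>\<epsilon>\<close>, a linear endomorphism is block lower triangular with
  its reduction in every diagonal block.\<close>

lemma det_block_toeplitz: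
  fixes F :: "nat \<Rightarrow> nat \<Rightarrow> nat \<Rightarrow> complex" and n :: nat
  defines "T \<equiv> \<lambda>d. mat (d * n) (d * n) (\<lambda>(x, y).
    if y div n \<le> x div n then F (x div n - y div n) (x mod n) (y mod n) else 0)"
  shows "det (T d) = det (mat n n (\<lambda>(a, b). F 0 a b)) ^ d"
proof (induction d)
  case 0
  have "T 0 = 1\<^sub>m 0" by (rule eq_matI) (auto simp: T_def)
  then show ?case by simp
next
  case (Suc d)
  define A1 where "A1 = mat n n (\<lambda>(a, b). F 0 a b)"
  define A3 where "A3 = mat (d * n) n (\<lambda>(x, b). F (Suc (x div n)) (x mod n) b)"
  have step: "(x - n) div n = x div n - 1 \<and> (x - n) mod n = x mod n \<and> 1 \<le> x div n"
    if "\<not> x < n" "0 < n" for x :: nat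
    using that by (metis One_nat_def Suc_le_eq diff_Suc_1 div_greater_zero_iff le_mod_geq le_div_geq not_less)
  have "T (Suc d) = four_block_mat A1 (0\<^sub>m n (d * n)) A3 (T d)"
  proof (rule eq_matI)
    fix x y assume "x < dim_row (four_block_mat A1 (0\<^sub>m n (d * n)) A3 (T d))"
      "y < dim_col (four_block_mat A1 (0\<^sub>m n (d * n)) A3 (T d))"
    then have xy: "x < n + d * n" "y < n + d * n" by (auto simp: A1_def T_def)
    then have n: "0 < n" by (cases n) auto
    show "T (Suc d) $$ (x, y) = four_block_mat A1 (0\<^sub>m n (d * n)) A3 (T d) $$ (x, y)"
    proof (cases "x < n"; cases "y < n")
      assume "x < n" "y < n"
      then show ?thesis using xy by (simp add: A1_def T_def)
    next
      assume x: "x < n" and y: "\<not> y < n"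
      then show ?thesis using xy step[OF y n] by (simp add: A1_def T_def)
    next
      assume x: "\<not> x < n" and y: "y < n"
      then have "Suc ((x - n) div n) = x div n" using step[OF x n] by simp
      then show ?thesis using xy x y step[OF x n] by (simp add: A1_def A3_def T_def)
    next
      assume x: "\<not> x < n" and y: "\<not> y < n"
      have "x div n - 1 - (y div n - 1) = x div n - y div n" using step[OF y n] by simp
      moreover have "y div n - 1 \<le> x div n - 1 \<longleftrightarrow> y div n \<le> x div n"
        using step[OF y n] step[OF x n] by auto
      ultimately show ?thesis using xy x y step[OF x n] step[OF y n]
        by (simp add: A1_def T_def)
    qed
  qed (auto simp: A1_def T_def)
  then have "det (T (Suc d)) = det (four_block_mat A1 (0\<^sub>m n (d * n)) A3 (T d))" by (rule arg_cong)
  also have "\<dots> = det A1 * det (T d)"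
    by (rule det_four_block_mat_upper_right_zero[where m = "d * n"]) (auto simp: A1_def A3_def T_def)
  finally have "det (T (Suc d)) = det A1 * det (T d)" .
  then show ?case using Suc by (simp add: A1_def)
qed

lemma det_permute_both:
  assumes A: "(A :: complex mat) \<in> carrier_mat n n" and p: "p permutes {0..<n}"
  shows "det (mat n n (\<lambda>(i, j). A $$ (p i, p j))) = det A"
proof -
  have pl: "p i < n" if "i < n" for i using permutes_in_image[OF p, of i] that by simp
  define B where "B = mat n n (\<lambda>(i, j). A $$ (p i, j))"
  have B: "B \<in> carrier_mat n n" by (simp add: B_def)
  have "det (mat n n (\<lambda>(i, j). A $$ (p i, p j))) =
      det (transpose_mat (mat n n (\<lambda>(i, j). A $$ (p i, p j))))"
    by (rule det_transpose[where n = n, symmetric]) simp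
  also have "transpose_mat (mat n n (\<lambda>(i, j). A $$ (p i, p j))) =
      mat n n (\<lambda>(i, j). transpose_mat B $$ (p i, j))"
    by (rule eq_matI) (auto simp: B_def pl)
  also have "det \<dots> = signof p * det (transpose_mat B)"
    by (rule det_permute_rows[OF _ p]) (simp add: B)
  also have "det (transpose_mat B) = signof p * det A"
    unfolding det_transpose[OF B] unfolding B_def by (rule det_permute_rows[OF A p])
  finally show ?thesis by (simp add: sign_def)
qed

lemma det_lin:
  assumes M: "lin d n n M" and d: "0 < d"
  shows "det M = det (ct d n n M) ^ d"
proof (cases "n = 0")
  case True
  then have "M = 1\<^sub>m 0" "ct d n n M = 1\<^sub>m 0" using lin_carrier[OF M] by (auto simp: ct_def)
  then show ?thesis by simp
next
  case False
  then have n: "0 < n" by simp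
  define p where "p x = (if x < d * n then (x mod n) * d + x div n else x)" for x
  define F where "F t a b = M $$ (a * d + t, b * d)" for t a b
  have plt: "(x mod n) * d + x div n < n * d" if "x < d * n" for x
    by (rule idx_less) (use that n in \<open>auto simp: less_mult_imp_div_less\<close>)
  have "bij_betw p {0..<d * n} {0..<d * n}"
  proof (rule bij_betw_byWitness[where f' = "\<lambda>y. (y mod d) * n + y div d"])
    show "\<forall>x\<in>{0..<d * n}. (p x mod d) * n + p x div d = x"
    proof
      fix x assume "x \<in> {0..<d * n}"
      then have "x < d * n" "x div n < d" by (auto simp: less_mult_imp_div_less)
      then show "(p x mod d) * n + p x div d = x" by (simp add: p_def)
    qed
    show "\<forall>y\<in>{0..<d * n}. p ((y mod d) * n + y div d) = y"
    proof
      fix y assume "y \<in> {0..<d * n}"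
      then have y: "y div d < n" "y mod d < d" using d by (auto simp: less_mult_imp_div_less mult.commute)
      then have "(y mod d) * n + y div d < d * n" using idx_less by blast
      then show "p ((y mod d) * n + y div d) = y" using y by (simp add: p_def)
    qed
    show "p ` {0..<d * n} \<subseteq> {0..<d * n}" using plt by (auto simp: p_def mult.commute)
    show "(\<lambda>y. (y mod d) * n + y div d) ` {0..<d * n} \<subseteq> {0..<d * n}"
    proof
      fix z assume "z \<in> (\<lambda>y. (y mod d) * n + y div d) ` {0..<d * n}"
      then obtain y where y: "y < d * n" "z = (y mod d) * n + y div d" by auto
      then have "y div d < n" "y mod d < d" using d by (auto simp: less_mult_imp_div_less mult.commute)
      then show "z \<in> {0..<d * n}" using idx_less y by auto
    qed
  qed
  then have p: "p permutes {0..<d * n}"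
    by (rule bij_imp_permutes) (auto simp: p_def)
  have car: "M \<in> carrier_mat (d * n) (d * n)" using lin_carrier[OF M] by (simp add: mult.commute)
  have "mat (d * n) (d * n) (\<lambda>(x, y). M $$ (p x, p y)) = mat (d * n) (d * n) (\<lambda>(x, y).
    if y div n \<le> x div n then F (x div n - y div n) (x mod n) (y mod n) else 0)"
  proof (rule eq_matI, goal_cases)
    case (1 x y)
    then have xy: "x < d * n" "y < d * n" by auto
    then have b: "x div n < d" "y div n < d" "x mod n < n" "y mod n < n"
      using n by (auto simp: less_mult_imp_div_less)
    have "(if (y mod n * d) mod d + y div n < d then M $$ (p x, y mod n * d + y div n) else 0)
        = (if y div n \<le> p x mod d then M $$ (p x - y div n, y mod n * d) else 0)"
      by (rule lin_shift_entry[OF M]) (use b plt[OF xy(1)] xy idx_less[of "y mod n" n 0 d] d in \<open>auto simp: p_def\<close>)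
    then show ?case using xy b by (simp add: p_def F_def)
  qed auto
  then have "det M = det (mat n n (\<lambda>(a, b). F 0 a b)) ^ d"
    using det_permute_both[OF car p] det_block_toeplitz[of d n F] by simp
  also have "mat n n (\<lambda>(a, b). F 0 a b) = ct d n n M"
    by (simp add: ct_def F_def)
  finally show ?thesis .
qed

subsection \<open>Scalars\<close>

lemma scal_entry:
  assumes "i < n * d" "j < n * d"
  shows "scal_mat n d d p $$ (i, j) = (if j \<le> i \<and> i div d = j div d then coeff p (i - j) else 0)"
proof -
  have d: "d > 0" using assms by (auto intro: Nat.gr0I)
  have lt: "i - j < d" if "j \<le> i" "i div d = j div d"
  proof -
    have "i = i div d * d + i mod d" "j = j div d * d + j mod d" by simp_all
    then have "i - j = i mod d - j mod d" using that by (metis add_diff_cancel_left)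
    then show ?thesis using d by (simp add: less_imp_diff_less)
  qed
  have "scal_mat n d d p $$ (i, j) = (\<Sum>k<d. coeff p k * (eps_mat n d ^\<^sub>m k) $$ (i, j))"
    using assms d by (simp add: scal_mat_def)
  also have "\<dots> = (\<Sum>k<d. if k = i - j then (if j \<le> i \<and> i div d = j div d then coeff p (i - j) else 0) else 0)"
    using assms by (intro sum.cong) (auto simp: eps_pow_entry)
  also have "\<dots> = (if j \<le> i \<and> i div d = j div d then coeff p (i - j) else 0)"
    using lt by (auto simp: sum.delta)
  finally show ?thesis .
qed

lemma scal_carrier [simp]: "scal_mat n d c p \<in> carrier_mat (n * d) (n * d)"
  by (simp add: scal_mat_def)

lemma scal_diff: "scal_mat n d d (p - q) = scal_mat n d d p - scal_mat n d d q"
  by (rule eq_matI) (auto simp: scal_mat_def sum_subtractf algebra_simps)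

lemma scal_zero [simp]: "scal_mat n d d 0 = 0\<^sub>m (n * d) (n * d)"
  by (rule eq_matI) (auto simp: scal_mat_def)

lemma lin_scal:
  assumes M: "lin d r c M"
  shows "M * scal_mat c d d p = scal_mat r d d p * M"
proof (rule eq_matI, goal_cases)
  case (1 i j)
  then have ij: "i < r * d" "j < c * d" using lin_carrier[OF M] carrier_matD[OF scal_carrier] by auto
  then have d: "0 < d" by (auto intro: Nat.gr0I)
  have "(M * scal_mat c d d p) $$ (i, j) = (\<Sum>l<c * d. M $$ (i, l) * scal_mat c d d p $$ (l, j))"
    by (rule times_mat_entry[OF lin_carrier[OF M] scal_carrier ij])
  also have "\<dots> = (\<Sum>l<c * d. \<Sum>k<d. coeff p k * (M $$ (i, l) * (eps_mat c d ^\<^sub>m k) $$ (l, j)))"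
    using ij d by (intro sum.cong refl) (simp add: scal_mat_def sum_distrib_left ac_simps)
  also have "\<dots> = (\<Sum>k<d. coeff p k * (\<Sum>l<c * d. M $$ (i, l) * (eps_mat c d ^\<^sub>m k) $$ (l, j)))"
    by (subst sum.swap) (simp add: sum_distrib_left)
  also have "\<dots> = (\<Sum>k<d. coeff p k * (M * eps_mat c d ^\<^sub>m k) $$ (i, j))"
    by (intro sum.cong refl) (simp only: times_mat_entry[OF lin_carrier[OF M] eps_pow_carrier ij])
  also have "\<dots> = (\<Sum>k<d. coeff p k * (eps_mat r d ^\<^sub>m k * M) $$ (i, j))"
    by (simp only: lin_eps_pow[OF M])
  also have "\<dots> = (\<Sum>k<d. coeff p k * (\<Sum>l<r * d. (eps_mat r d ^\<^sub>m k) $$ (i, l) * M $$ (l, j)))"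
    by (intro sum.cong refl) (simp only: times_mat_entry[OF eps_pow_carrier lin_carrier[OF M] ij])
  also have "\<dots> = (\<Sum>l<r * d. \<Sum>k<d. coeff p k * ((eps_mat r d ^\<^sub>m k) $$ (i, l) * M $$ (l, j)))"
    by (subst sum.swap) (simp add: sum_distrib_left)
  also have "\<dots> = (\<Sum>l<r * d. scal_mat r d d p $$ (i, l) * M $$ (l, j))"
    using ij d by (intro sum.cong refl) (simp add: scal_mat_def sum_distrib_right sum_distrib_left ac_simps)
  also have "\<dots> = (scal_mat r d d p * M) $$ (i, j)"
    by (rule times_mat_entry[OF scal_carrier lin_carrier[OF M] ij, symmetric])
  finally show ?case .
qed (use lin_carrier[OF M] carrier_matD[OF scal_carrier] in auto)

lemma scal_lin: "lin d n n (scal_mat n d d p)"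
  using lin_scal[OF lin_eps, of n d p] by (simp add: lin_def)

lemma ct_scal: "0 < d \<Longrightarrow> ct d n n (scal_mat n d d p) = coeff p 0 \<cdot>\<^sub>m 1\<^sub>m n"
proof (rule eq_matI, goal_cases)
  case (1 a b)
  then have "a < n" "b < n" "a * d < n * d" "b * d < n * d" by auto
  then show ?case using 1 by (auto simp: ct_def scal_entry)
qed (auto simp: ct_def)

subsection \<open>Coordinate inclusions and projections\<close>

definition sel :: "nat \<Rightarrow> nat \<Rightarrow> nat \<Rightarrow> (nat \<Rightarrow> nat) \<Rightarrow> complex mat" where
  "sel d n w \<phi> = mat (n * d) (w * d) (\<lambda>(r, s). if s = \<phi> (r div d) * d + r mod d then 1 else 0)"

definition emb :: "nat \<Rightarrow> nat \<Rightarrow> nat \<Rightarrow> (nat \<Rightarrow> nat) \<Rightarrow> complex mat" where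
  "emb d w n \<phi> = mat (w * d) (n * d) (\<lambda>(r, s). if r = \<phi> (s div d) * d + s mod d then 1 else 0)"

lemma sel_carrier [simp]: "sel d n w \<phi> \<in> carrier_mat (n * d) (w * d)"
  by (simp add: sel_def)

lemma emb_carrier [simp]: "emb d w n \<phi> \<in> carrier_mat (w * d) (n * d)"
  by (simp add: emb_def)

lemma sel_pos:
  fixes \<phi> :: "nat \<Rightarrow> nat"
  assumes "\<phi> \<in> {0..<n} \<rightarrow> {0..<w}" "r < n * d"
  shows "\<phi> (r div d) * d + r mod d < w * d"
proof (rule idx_less)
  have "0 < d" using assms(2) by (auto intro: Nat.gr0I)
  then show "r mod d < d" by simp
  show "\<phi> (r div d) < w" using assms by (auto simp: less_mult_imp_div_less)
qed

lemma sel_mult_entry: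
  assumes \<phi>: "\<phi> \<in> {0..<n} \<rightarrow> {0..<w}" and M: "M \<in> carrier_mat (w * d) c" and rs: "r < n * d" "s < c"
  shows "(sel d n w \<phi> * M) $$ (r, s) = M $$ (\<phi> (r div d) * d + r mod d, s)"
proof -
  have "(sel d n w \<phi> * M) $$ (r, s) = (\<Sum>l<w * d. sel d n w \<phi> $$ (r, l) * M $$ (l, s))"
    by (rule times_mat_entry[OF sel_carrier M rs])
  also have "\<dots> = (\<Sum>l<w * d. if l = \<phi> (r div d) * d + r mod d then M $$ (\<phi> (r div d) * d + r mod d, s) else 0)"
    using rs by (intro sum.cong) (auto simp: sel_def)
  also have "\<dots> = M $$ (\<phi> (r div d) * d + r mod d, s)"
    using sel_pos[OF \<phi> rs(1)] by (simp add: sum.delta)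
  finally show ?thesis .
qed

lemma mult_emb_entry:
  assumes \<phi>: "\<phi> \<in> {0..<n} \<rightarrow> {0..<w}" and M: "M \<in> carrier_mat c (w * d)" and rs: "r < c" "s < n * d"
  shows "(M * emb d w n \<phi>) $$ (r, s) = M $$ (r, \<phi> (s div d) * d + s mod d)"
proof -
  have "(M * emb d w n \<phi>) $$ (r, s) = (\<Sum>l<w * d. M $$ (r, l) * emb d w n \<phi> $$ (l, s))"
    by (rule times_mat_entry[OF M emb_carrier rs])
  also have "\<dots> = (\<Sum>l<w * d. if l = \<phi> (s div d) * d + s mod d then M $$ (r, \<phi> (s div d) * d + s mod d) else 0)"
    using rs by (intro sum.cong) (auto simp: emb_def)
  also have "\<dots> = M $$ (r, \<phi> (s div d) * d + s mod d)"
    using sel_pos[OF \<phi> rs(2)] by (simp add: sum.delta)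
  finally show ?thesis .
qed

lemma sel_lin:
  assumes \<phi>: "\<phi> \<in> {0..<n} \<rightarrow> {0..<w}"
  shows "lin d n w (sel d n w \<phi>)"
  unfolding lin_iff_entries[OF sel_carrier]
proof (intro allI impI)
  fix i j assume ij: "i < n * d" "j < w * d"
  then have d: "0 < d" by (auto intro: Nat.gr0I)
  have pred: "(i - 1) div d = i div d" "(i - 1) mod d = i mod d - 1" if "i mod d \<noteq> 0"
    using Suc_same_block[of "i - 1" d] that by (cases i; simp)+
  have eq: "Suc j = \<phi> (i div d) * d + i mod d \<longleftrightarrow> j = \<phi> (i div d) * d + (i mod d - 1)" if "i mod d \<noteq> 0"
    using that by (cases "i mod d") auto
  have a: "Suc j mod d = i mod d" if "Suc j = \<phi> (i div d) * d + i mod d"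
    unfolding that using d by simp
  have b: "i mod d \<noteq> 0 \<Longrightarrow> j = \<phi> (i div d) * d + (i mod d - 1) \<Longrightarrow> Suc j mod d = i mod d"
    using eq a by blast
  show "(if Suc j mod d \<noteq> 0 then sel d n w \<phi> $$ (i, Suc j) else 0) =
      (if i mod d \<noteq> 0 then sel d n w \<phi> $$ (i - 1, j) else 0)"
  proof (cases "i mod d = 0")
    case True
    then show ?thesis using a ij Suc_less_block[OF ij(2)] by (auto simp: sel_def)
  next
    case False
    have "i - 1 < n * d" using ij by simp
    then show ?thesis using False a b ij Suc_less_block[OF ij(2)] pred[OF False] eq[OF False]
      by (auto simp: sel_def)
  qed
qed

lemma emb_lin:
  assumes \<phi>: "\<phi> \<in> {0..<n} \<rightarrow> {0..<w}"
  shows "lin d w n (emb d w n \<phi>)"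
  unfolding lin_iff_entries[OF emb_carrier]
proof (intro allI impI)
  fix i j assume ij: "i < w * d" "j < n * d"
  then have d: "0 < d" by (auto intro: Nat.gr0I)
  have a: "i mod d \<noteq> 0 \<and> i - 1 = \<phi> (j div d) * d + j mod d"
    if "Suc j mod d \<noteq> 0" "i = \<phi> (Suc j div d) * d + Suc j mod d"
  proof -
    have "i = \<phi> (j div d) * d + Suc (j mod d)" "Suc (j mod d) < d"
      using that Suc_same_block[OF that(1)] d mod_less_divisor[OF d, of "Suc j"] by simp_all
    then show ?thesis using idx_div_mod(2)[of "Suc (j mod d)" d "\<phi> (j div d)"] by simp
  qed
  have b: "Suc j mod d \<noteq> 0 \<and> i = \<phi> (Suc j div d) * d + Suc j mod d"
    if "i mod d \<noteq> 0" "i - 1 = \<phi> (j div d) * d + j mod d"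
  proof -
    have i: "i = \<phi> (j div d) * d + Suc (j mod d)" using that by (cases i) auto
    have "Suc j mod d \<noteq> 0"
    proof
      assume "Suc j mod d = 0"
      then have "Suc (j mod d) = d" by (auto simp: mod_Suc split: if_splits)
      then show False using that(1) i by simp
    qed
    then show ?thesis using Suc_same_block[of j d] i by simp
  qed
  show "(if Suc j mod d \<noteq> 0 then emb d w n \<phi> $$ (i, Suc j) else 0) =
      (if i mod d \<noteq> 0 then emb d w n \<phi> $$ (i - 1, j) else 0)"
  proof -
    have l: "(if Suc j mod d \<noteq> 0 then emb d w n \<phi> $$ (i, Suc j) else 0) =
        (if Suc j mod d \<noteq> 0 \<and> i = \<phi> (Suc j div d) * d + Suc j mod d then 1 else 0)"
      using ij Suc_less_block[OF ij(2)] by (simp add: emb_def)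
    have r: "(if i mod d \<noteq> 0 then emb d w n \<phi> $$ (i - 1, j) else 0) =
        (if i mod d \<noteq> 0 \<and> i - 1 = \<phi> (j div d) * d + j mod d then 1 else 0)"
      using ij by (simp add: emb_def)
    have eq: "Suc j mod d \<noteq> 0 \<and> i = \<phi> (Suc j div d) * d + Suc j mod d \<longleftrightarrow>
        i mod d \<noteq> 0 \<and> i - 1 = \<phi> (j div d) * d + j mod d"
      using a b by blast
    show ?thesis unfolding l r eq by (rule refl)
  qed
qed

lemma ct_sel_mult:
  assumes "\<phi> \<in> {0..<n} \<rightarrow> {0..<w}" "M \<in> carrier_mat (w * d) (n * d)" "0 < d"
  shows "ct d n n (sel d n w \<phi> * M) = mat n n (\<lambda>(i, j). ct d w n M $$ (\<phi> i, j))"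
proof (rule eq_matI, goal_cases)
  case (1 i j)
  then have "i < n" "j < n" "i * d < n * d" "j * d < n * d" "\<phi> i < w" using assms by auto
  then show ?case using sel_mult_entry[OF assms(1,2), of "i * d" "j * d"] assms(3) by (simp add: ct_def)
qed (auto simp: ct_def)

lemma ct_mult_emb:
  assumes "\<phi> \<in> {0..<n} \<rightarrow> {0..<w}" "M \<in> carrier_mat (n * d) (w * d)" "0 < d"
  shows "ct d n n (M * emb d w n \<phi>) = mat n n (\<lambda>(i, j). ct d n w M $$ (i, \<phi> j))"
proof (rule eq_matI, goal_cases)
  case (1 i j)
  then have "i < n" "j < n" "i * d < n * d" "j * d < n * d" "\<phi> j < w" using assms by auto
  then show ?case using mult_emb_entry[OF assms(1,2), of "i * d" "j * d"] assms(3) by (simp add: ct_def)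
qed (auto simp: ct_def)

lemma sel_emb:
  assumes \<phi>: "\<phi> \<in> {0..<n} \<rightarrow> {0..<w}" and inj: "inj_on \<phi> {0..<n}"
  shows "sel d n w \<phi> * emb d w n \<phi> = 1\<^sub>m (n * d)"
proof (rule eq_matI, goal_cases)
  case (1 r s)
  then have rs: "r < n * d" "s < n * d" by auto
  then have d: "0 < d" by (auto intro: Nat.gr0I)
  have "\<phi> (r div d) * d + r mod d = \<phi> (s div d) * d + s mod d \<longleftrightarrow> r = s"
  proof -
    have "\<phi> (r div d) * d + r mod d = \<phi> (s div d) * d + s mod d \<longleftrightarrow> \<phi> (r div d) = \<phi> (s div d) \<and> r mod d = s mod d"
      using d by (intro idx_eq) auto
    also have "\<dots> \<longleftrightarrow> r div d = s div d \<and> r mod d = s mod d"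
      using inj_on_eq_iff[OF inj, of "r div d" "s div d"] rs by (simp add: less_mult_imp_div_less)
    also have "\<dots> \<longleftrightarrow> r = s" by (metis div_mult_mod_eq)
    finally show ?thesis .
  qed
  then show ?case
    using sel_mult_entry[OF \<phi> emb_carrier rs] sel_pos[OF \<phi> rs(1)] rs by (simp add: emb_def)
qed (auto simp: sel_def emb_def)

lemma sel_emb_disjoint:
  assumes \<psi>: "\<psi> \<in> {0..<m} \<rightarrow> {0..<w}" and \<phi>: "\<phi> \<in> {0..<n} \<rightarrow> {0..<w}"
    and disj: "\<And>a b. a < m \<Longrightarrow> b < n \<Longrightarrow> \<psi> a \<noteq> \<phi> b"
  shows "sel d m w \<psi> * emb d w n \<phi> = 0\<^sub>m (m * d) (n * d)"
proof (rule eq_matI, goal_cases)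
  case (1 r s)
  then have rs: "r < m * d" "s < n * d" by auto
  then have d: "0 < d" by (auto intro: Nat.gr0I)
  have "\<psi> (r div d) * d + r mod d \<noteq> \<phi> (s div d) * d + s mod d"
    using disj[of "r div d" "s div d"] rs d by (subst idx_eq) (auto simp: less_mult_imp_div_less)
  then show ?case
    using sel_mult_entry[OF \<psi> emb_carrier rs] sel_pos[OF \<psi> rs(1)] rs by (simp add: emb_def)
qed (auto simp: sel_def emb_def)

lemma emb_sel_entry:
  assumes \<phi>: "\<phi> \<in> {0..<n} \<rightarrow> {0..<w}" and inj: "inj_on \<phi> {0..<n}" and ij: "i < w * d" "j < w * d"
  shows "(emb d w n \<phi> * sel d n w \<phi>) $$ (i, j) = (if i = j \<and> i div d \<in> \<phi> ` {0..<n} then 1 else 0)"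
proof -
  have d: "0 < d" using ij by (auto intro: Nat.gr0I)
  have "(emb d w n \<phi> * sel d n w \<phi>) $$ (i, j) = (\<Sum>l<n * d. emb d w n \<phi> $$ (i, l) * sel d n w \<phi> $$ (l, j))"
    by (rule times_mat_entry[OF emb_carrier sel_carrier ij])
  also have "\<dots> = (\<Sum>a<n. \<Sum>k<d. emb d w n \<phi> $$ (i, a * d + k) * sel d n w \<phi> $$ (a * d + k, j))"
    by (rule sum_idx)
  also have "\<dots> = (\<Sum>a<n. \<Sum>k<d. if k = i mod d then (if i = j \<and> \<phi> a = i div d then 1 else 0) else 0)"
  proof (intro sum.cong refl, goal_cases)
    case (1 a k)
    then have ak: "a * d + k < n * d" "k < d" using idx_less by auto
    have ieq: "x = \<phi> a * d + k \<longleftrightarrow> x div d = \<phi> a \<and> x mod d = k" for x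
      using ak(2) by (metis idx_div_mod div_mult_mod_eq)
    have e: "emb d w n \<phi> $$ (i, a * d + k) = (if i div d = \<phi> a \<and> i mod d = k then 1 else 0)"
      using ak ij unfolding emb_def by (simp add: ieq[symmetric])
    have s: "sel d n w \<phi> $$ (a * d + k, j) = (if j div d = \<phi> a \<and> j mod d = k then 1 else 0)"
      using ak ij unfolding sel_def by (simp add: ieq[symmetric])
    have ij_eq: "i = j \<longleftrightarrow> i div d = j div d \<and> i mod d = j mod d" by (metis div_mult_mod_eq)
    show ?case unfolding e s ij_eq by simp
  qed
  also have "\<dots> = (\<Sum>a<n. if i = j \<and> \<phi> a = i div d then 1 else 0)"
    using d by (simp add: sum.delta)
  also have "\<dots> = (if i = j \<and> i div d \<in> \<phi> ` {0..<n} then 1 else 0)"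
  proof (cases "i = j \<and> i div d \<in> \<phi> ` {0..<n}")
    case True
    then obtain a0 where a0: "a0 < n" "\<phi> a0 = i div d" by auto
    have "(\<Sum>a<n. if i = j \<and> \<phi> a = i div d then 1 else 0) = (\<Sum>a<n. if a = a0 then 1 else 0)"
      using True a0 inj by (intro sum.cong refl) (auto simp: inj_on_def)
    also have "\<dots> = 1" using a0 by simp
    finally show ?thesis unfolding if_P[OF True] .
  next
    case False
    then have "\<not> (i = j \<and> \<phi> a = i div d)" if "a < n" for a using that by force
    then show ?thesis unfolding if_not_P[OF False] by (intro sum.neutral) simp
  qed
  finally show ?thesis .
qed

lemma emb_sel_complement:
  assumes \<phi>: "\<phi> \<in> {0..<n} \<rightarrow> {0..<w}" "inj_on \<phi> {0..<n}" and \<psi>: "\<psi> \<in> {0..<m} \<rightarrow> {0..<w}" "inj_on \<psi> {0..<m}"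
    and img: "\<psi> ` {0..<m} = {0..<w} - \<phi> ` {0..<n}"
  shows "emb d w m \<psi> * sel d m w \<psi> = 1\<^sub>m (w * d) - emb d w n \<phi> * sel d n w \<phi>"
proof (rule eq_matI, goal_cases)
  case (1 i j)
  then have ij: "i < w * d" "j < w * d" by (auto simp: sel_def emb_def)
  then have "i div d < w" by (simp add: less_mult_imp_div_less)
  then show ?case
    using emb_sel_entry[OF \<phi> ij] emb_sel_entry[OF \<psi> ij] ij unfolding img
    by (auto simp: emb_def sel_def simp del: index_mult_mat(1))
qed (auto simp: sel_def emb_def)

section \<open>The Cauchy-Binet formula\<close>

text \<open>The sum runs over all maps rather than over subsets, at the cost of a factorial; the terms of
  maps that are not injective vanish.\<close>

lemma det_mat: "det (mat n n (\<lambda>(i, j). f i j)) =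
    (\<Sum>p\<in>{p. p permutes {0..<n}}. signof p * (\<Prod>i\<in>{0..<n}. f i (p i) :: complex))"
proof -
  have "p i < n" if "p permutes {0..<n}" "i < n" for p i
    using permutes_in_image[OF that(1), of i] that(2) by simp
  then show ?thesis by (simp add: det_def'[of _ n])
qed

lemma cauchy_binet:
  fixes A B :: "complex mat"
  assumes A: "A \<in> carrier_mat n w" and B: "B \<in> carrier_mat w n"
  shows "(\<Sum>\<phi>\<in>{0..<n} \<rightarrow>\<^sub>E {0..<w}. det (mat n n (\<lambda>(i, j). A $$ (i, \<phi> j))) * det (mat n n (\<lambda>(i, j). B $$ (\<phi> i, j))))
    = fact n * det (A * B)"
proof -
  let ?N = "{0..<n}" and ?Phi = "{0..<n} \<rightarrow>\<^sub>E {0..<w}" and ?P = "{p. p permutes {0..<n}}"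
  define DB where "DB \<phi> = det (mat n n (\<lambda>(i, j). B $$ (\<phi> i, j)))" for \<phi>
  have DB: "DB \<phi> = (\<Sum>p\<in>?P. signof p * (\<Prod>i\<in>?N. B $$ (\<phi> i, p i)))" for \<phi>
    unfolding DB_def by (rule det_mat)
  have expand: "det (A * B) = (\<Sum>\<phi>\<in>?Phi. (\<Prod>i\<in>?N. A $$ (i, \<phi> i)) * DB \<phi>)"
  proof -
    have AB: "A * B = mat n n (\<lambda>(i, j). \<Sum>k\<in>{0..<w}. A $$ (i, k) * B $$ (k, j))"
      using A B by (intro eq_matI) (auto simp: scalar_prod_def)
    have "det (A * B) = (\<Sum>p\<in>?P. signof p * (\<Prod>i\<in>?N. \<Sum>k\<in>{0..<w}. A $$ (i, k) * B $$ (k, p i)))"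
      unfolding AB by (rule det_mat)
    also have "\<dots> = (\<Sum>p\<in>?P. signof p * (\<Sum>\<phi>\<in>?Phi. \<Prod>i\<in>?N. A $$ (i, \<phi> i) * B $$ (\<phi> i, p i)))"
      by (subst prod_sum_PiE) auto
    also have "\<dots> = (\<Sum>\<phi>\<in>?Phi. \<Sum>p\<in>?P. (\<Prod>i\<in>?N. A $$ (i, \<phi> i)) * (signof p * (\<Prod>i\<in>?N. B $$ (\<phi> i, p i))))"
      by (subst sum.swap) (simp add: sum_distrib_left prod.distrib ac_simps)
    finally show ?thesis by (simp add: DB sum_distrib_left)
  qed
  have perm: "det (A * B) = (\<Sum>\<phi>\<in>?Phi. signof \<sigma> * (\<Prod>i\<in>?N. A $$ (i, \<phi> (\<sigma> i))) * DB \<phi>)"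
    if \<sigma>: "\<sigma> permutes ?N" for \<sigma>
  proof -
    have comp: "\<phi> \<circ> \<tau> \<in> ?Phi" if "\<phi> \<in> ?Phi" "\<tau> permutes ?N" for \<phi> \<tau>
    proof
      show "(\<phi> \<circ> \<tau>) i \<in> {0..<w}" if "i \<in> ?N" for i
        unfolding o_apply by (rule PiE_mem[OF \<open>\<phi> \<in> ?Phi\<close>]) (use permutes_in_image[OF \<open>\<tau> permutes ?N\<close>] that in blast)
      show "(\<phi> \<circ> \<tau>) i = undefined" if "i \<notin> ?N" for i
        unfolding o_apply permutes_not_in[OF \<open>\<tau> permutes ?N\<close> that] by (rule PiE_arb[OF \<open>\<phi> \<in> ?Phi\<close> that])
    qed
    have \<sigma>l: "\<sigma> i < n" if "i < n" for i using permutes_in_image[OF \<sigma>, of i] that by simp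
    have DBc: "DB (\<phi> \<circ> \<sigma>) = signof \<sigma> * DB \<phi>" if "\<phi> \<in> ?Phi" for \<phi>
    proof -
      have "mat n n (\<lambda>(i, j). B $$ ((\<phi> \<circ> \<sigma>) i, j)) =
          mat n n (\<lambda>(i, j). mat n n (\<lambda>(i, j). B $$ (\<phi> i, j)) $$ (\<sigma> i, j))"
        using \<sigma>l by (intro eq_matI) auto
      then show ?thesis unfolding DB_def
        by (simp add: det_permute_rows[OF _ \<sigma>])
    qed
    have "det (A * B) = (\<Sum>\<phi>\<in>?Phi. (\<Prod>i\<in>?N. A $$ (i, (\<phi> \<circ> \<sigma>) i)) * DB (\<phi> \<circ> \<sigma>))"
      unfolding expand
    proof (rule sum.reindex_bij_witness[where i = "\<lambda>\<phi>. \<phi> \<circ> \<sigma>" and j = "\<lambda>\<phi>. \<phi> \<circ> inv_into UNIV \<sigma>"])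
      fix \<phi> assume \<phi>: "\<phi> \<in> ?Phi"
      show c1: "\<phi> \<circ> inv_into UNIV \<sigma> \<circ> \<sigma> = \<phi>" and "\<phi> \<circ> \<sigma> \<circ> inv_into UNIV \<sigma> = \<phi>"
        using permutes_inv_o[OF \<sigma>] by (simp_all add: o_assoc[symmetric])
      show "\<phi> \<circ> inv_into UNIV \<sigma> \<in> ?Phi" "\<phi> \<circ> \<sigma> \<in> ?Phi"
        using comp[OF \<phi>] \<sigma> permutes_inv[OF \<sigma>] by blast+
      show "(\<Prod>i\<in>?N. A $$ (i, (\<phi> \<circ> inv_into UNIV \<sigma> \<circ> \<sigma>) i)) * DB (\<phi> \<circ> inv_into UNIV \<sigma> \<circ> \<sigma>) =
          (\<Prod>i\<in>?N. A $$ (i, \<phi> i)) * DB \<phi>"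
        unfolding c1 by (rule refl)
    qed
    also have "\<dots> = (\<Sum>\<phi>\<in>?Phi. signof \<sigma> * (\<Prod>i\<in>?N. A $$ (i, \<phi> (\<sigma> i))) * DB \<phi>)"
      by (intro sum.cong refl) (simp add: DBc)
    finally show ?thesis .
  qed
  have DA: "det (mat n n (\<lambda>(i, j). A $$ (i, \<phi> j))) = (\<Sum>\<sigma>\<in>?P. signof \<sigma> * (\<Prod>i\<in>?N. A $$ (i, \<phi> (\<sigma> i))))" for \<phi>
    by (rule det_mat)
  have "fact n * det (A * B) = (\<Sum>\<sigma>\<in>?P. det (A * B))"
    by (simp add: card_permutations[of ?N n])
  also have "\<dots> = (\<Sum>\<sigma>\<in>?P. \<Sum>\<phi>\<in>?Phi. signof \<sigma> * (\<Prod>i\<in>?N. A $$ (i, \<phi> (\<sigma> i))) * DB \<phi>)"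
    using perm by (intro sum.cong) auto
  also have "\<dots> = (\<Sum>\<phi>\<in>?Phi. det (mat n n (\<lambda>(i, j). A $$ (i, \<phi> j))) * DB \<phi>)"
    by (subst sum.swap) (simp add: DA sum_distrib_right)
  finally show ?thesis by (simp add: DB_def)
qed

lemma det_repeated_row:
  assumes \<phi>: "\<not> inj_on \<phi> {0..<n}"
  shows "det (mat n n (\<lambda>(i, j). F (\<phi> i) j :: complex)) = 0"
proof -
  obtain i k where ik: "i < n" "k < n" "i \<noteq> k" "\<phi> i = \<phi> k" using \<phi> by (auto simp: inj_on_def)
  show ?thesis
    by (rule det_identical_rows[of _ n i k]) (use ik in \<open>auto intro!: eq_vecI\<close>)
qed

section \<open>Invariants of a pair of maps with scalar composition\<close>

lemma zero_minus_mat: "A \<in> carrier_mat r c \<Longrightarrow> 0\<^sub>m r c - A = - (A :: complex mat)"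
  by (rule eq_matI) auto

lemma minus_zero_mat: "A \<in> carrier_mat r c \<Longrightarrow> A - 0\<^sub>m r c = (A :: complex mat)"
  by (rule eq_matI) auto

lemma mat_diff_self: "A \<in> carrier_mat r c \<Longrightarrow> A - A = (0\<^sub>m r c :: complex mat)"
  by (rule eq_matI) auto

lemma (in fun_ideal) power_cong:
  assumes "f \<in> S" "g \<in> S" "(\<lambda>x. f x - g x) \<in> I"
  shows "(\<lambda>x. f x ^ m - g x ^ m) \<in> I"
proof (induction m)
  case 0
  then show ?case by (simp add: I_zero)
next
  case (Suc m)
  then show ?case using mult_cong[OF assms(1) power[OF assms(2)] assms(3) Suc] by simp
qed

text \<open>If \<open>T\<close> inverts \<open>a c\<close>, then \<open>1 - c T a\<close> is the projector onto the kernel of \<open>a\<close> along the image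
  of \<open>c\<close>. Its restriction \<open>q\<close> to a coordinate complement of \<open>c\<close> parametrises that kernel.\<close>

lemma kernel_parametrisation:
  fixes a :: "complex mat"
  assumes a: "a \<in> carrier_mat p W" and c: "c \<in> carrier_mat W p" and T: "T \<in> carrier_mat p p"
    and c2: "c2 \<in> carrier_mat W m" and e: "e \<in> carrier_mat m W" and e2: "e2 \<in> carrier_mat p W"
    and inv: "(a * c) * T = 1\<^sub>m p" "T * (a * c) = 1\<^sub>m p"
    and ec2: "e * c2 = 1\<^sub>m m" and ec: "e * c = 0\<^sub>m m p" and c2e: "c2 * e = 1\<^sub>m W - c * e2"
  defines "q \<equiv> (1\<^sub>m W - c * T * a) * c2"
  shows "a * q = 0\<^sub>m p m" "e * q = 1\<^sub>m m" "q * e = 1\<^sub>m W - c * T * a"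
proof -
  define R where "R = 1\<^sub>m W - c * T * a"
  have cT: "c * T \<in> carrier_mat W p" and cTa: "c * T * a \<in> carrier_mat W W" and R: "R \<in> carrier_mat W W"
    using a c T by (auto simp: R_def)
  have 1: "(1\<^sub>m W :: complex mat) \<in> carrier_mat W W" by simp
  have "a * (c * T * a) = (a * c * T) * a"
    using assoc_mult_mat[OF a cT a] assoc_mult_mat[OF a c T] by simp
  then have "a * (c * T * a) = a" using inv a by simp
  then have aR: "a * R = 0\<^sub>m p W"
    unfolding R_def using mult_minus_distrib_mat[OF a 1 cTa] a mat_diff_self[OF a] by simp
  have "c * T * a * c = c * (T * (a * c))"
    using assoc_mult_mat[OF cT a c] assoc_mult_mat[OF c T mult_carrier_mat[OF a c]] by simp
  then have "c * T * a * c = c" using inv c by simp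
  then have Rc: "R * c = 0\<^sub>m W p"
    unfolding R_def using minus_mult_distrib_mat[OF 1 cTa c] c mat_diff_self[OF c] by simp
  have "e * (c * T * a) = (e * c) * T * a"
    using assoc_mult_mat[OF e cT a] assoc_mult_mat[OF e c T] by simp
  then have "e * (c * T * a) = 0\<^sub>m m W" using ec a T by simp
  then have eR: "e * R = e"
    unfolding R_def using mult_minus_distrib_mat[OF e 1 cTa] e minus_zero_mat[OF e] by simp
  show "a * q = 0\<^sub>m p m"
    unfolding q_def R_def[symmetric] using assoc_mult_mat[OF a R c2] aR c2 by simp
  show "e * q = 1\<^sub>m m"
    unfolding q_def R_def[symmetric] using assoc_mult_mat[OF e R c2] eR ec2 by simp
  have "q * e = R * (1\<^sub>m W - c * e2)"
    unfolding q_def R_def[symmetric] using assoc_mult_mat[OF R c2 e] c2e by simp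
  also have "\<dots> = R - R * (c * e2)"
    using mult_minus_distrib_mat[OF R 1 mult_carrier_mat[OF c e2]] R by simp
  also have "R * (c * e2) = 0\<^sub>m W W"
    using assoc_mult_mat[OF R c e2] Rc e2 by simp
  finally show "q * e = 1\<^sub>m W - c * T * a" using minus_zero_mat[OF R] R_def by simp
qed

locale pair_maps =
  fixes d w :: nat and Y :: "'y set" and CY :: "('y \<Rightarrow> complex) set"
    and M :: "(complex mat \<times> 'y \<Rightarrow> complex) set"
  assumes d: "0 < d"
begin

definition W :: "(complex mat \<times> 'y) set" where
  "W = {(X, y). lin d w w X \<and> y \<in> Y}"

definition CW :: "(complex mat \<times> 'y \<Rightarrow> complex) set" where
  "CW = {\<lambda>x. fst x $$ (r, s) | r s. r < w * d \<and> s < w * d} \<union> {\<lambda>x. c (snd x) | c. c \<in> CY}"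

definition AW where "AW = polyf W CW"

definition E :: "nat \<Rightarrow> (complex mat \<times> complex mat \<times> 'y) set" where
  "E n = {(a, b, y). lin d n w a \<and> lin d w n b \<and> y \<in> Y}"

definition CE :: "nat \<Rightarrow> (complex mat \<times> complex mat \<times> 'y \<Rightarrow> complex) set" where
  "CE n = {\<lambda>x. fst x $$ (r, s) | r s. r < n * d \<and> s < w * d} \<union>
    {\<lambda>x. fst (snd x) $$ (r, s) | r s. r < w * d \<and> s < n * d} \<union> {\<lambda>x. c (snd (snd x)) | c. c \<in> CY}"

definition A where "A n = polyf (E n) (CE n)"

definition \<pi> :: "complex poly \<Rightarrow> complex mat \<times> complex mat \<times> 'y \<Rightarrow> complex mat \<times> 'y" where
  "\<pi> z x = (fst (snd x) * fst x + scal_mat w d d z, snd (snd x))"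

definition I where
  "I n l z = gen_ideal (E n) (A n)
    ({\<lambda>x. (fst x * fst (snd x) + scal_mat n d d l) $$ (r, s) | r s. r < n * d \<and> s < n * d} \<union>
     {\<lambda>x. m (\<pi> z x) | m. m \<in> M})"

sublocale AW: fun_algebra W AW
  unfolding AW_def by (rule polyf_algebra)

lemma A_algebra: "fun_algebra (E n) (A n)"
  unfolding A_def by (rule polyf_algebra)

lemma I_ideal: "fun_ideal (E n) (A n) (I n l z)"
  unfolding I_def by (rule fun_algebra.gen_ideal[OF A_algebra])

lemma coord_W: "mat_in AW (w * d) (w * d) fst" "c \<in> CY \<Longrightarrow> (\<lambda>x. c (snd x)) \<in> AW"
  unfolding mat_in_def AW_def CW_def by (auto intro!: polyf_gen)

lemma coord_E:
  "mat_in (A n) (n * d) (w * d) fst"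
  "mat_in (A n) (w * d) (n * d) (\<lambda>x. fst (snd x))"
  "c \<in> CY \<Longrightarrow> (\<lambda>x. c (snd (snd x))) \<in> A n"
  unfolding mat_in_def A_def CE_def by (auto intro!: polyf_gen)

lemma subst_E:
  assumes "fun_algebra X S" "f \<in> A n"
    and "mat_in S (n * d) (w * d) \<alpha>" "mat_in S (w * d) (n * d) \<beta>" "\<And>c. c \<in> CY \<Longrightarrow> (\<lambda>x. c (\<eta> x)) \<in> S"
    and "\<And>x. x \<in> X \<Longrightarrow> (\<alpha> x, \<beta> x, \<eta> x) \<in> E n"
  shows "(\<lambda>x. f (\<alpha> x, \<beta> x, \<eta> x)) \<in> S"
  by (rule fun_algebra.poly_subst[OF assms(1) assms(2)[unfolded A_def]])
    (use assms(3-) in \<open>auto simp: CE_def mat_in_def\<close>)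

lemma subst_W:
  assumes "fun_algebra X S" "f \<in> AW"
    and "mat_in S (w * d) (w * d) \<xi>" "\<And>c. c \<in> CY \<Longrightarrow> (\<lambda>x. c (\<eta> x)) \<in> S"
    and "\<And>x. x \<in> X \<Longrightarrow> (\<xi> x, \<eta> x) \<in> W"
  shows "(\<lambda>x. f (\<xi> x, \<eta> x)) \<in> S"
  by (rule fun_algebra.poly_subst[OF assms(1) assms(2)[unfolded AW_def]])
    (use assms(3-) in \<open>auto simp: CW_def mat_in_def\<close>)

lemma EE: "x \<in> E n \<Longrightarrow> lin d n w (fst x)" "x \<in> E n \<Longrightarrow> lin d w n (fst (snd x))" "x \<in> E n \<Longrightarrow> snd (snd x) \<in> Y"
  by (auto simp: E_def)

lemma Ecar: "x \<in> E n \<Longrightarrow> fst x \<in> carrier_mat (n * d) (w * d)"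
  "x \<in> E n \<Longrightarrow> fst (snd x) \<in> carrier_mat (w * d) (n * d)"
  by (auto intro: lin_carrier EE)

lemma Ecar_mult:
  assumes "x \<in> E n"
  shows "fst (snd x) * fst x \<in> carrier_mat (w * d) (w * d)"
    "fst x * fst (snd x) \<in> carrier_mat (n * d) (n * d)"
    "sel d n w \<phi> * fst (snd x) \<in> carrier_mat (n * d) (n * d)"
    "fst x * emb d w n \<phi> \<in> carrier_mat (n * d) (n * d)"
  by (rule mult_carrier_mat Ecar assms sel_carrier emb_carrier)+

lemma EI: "lin d n w a \<Longrightarrow> lin d w n b \<Longrightarrow> y \<in> Y \<Longrightarrow> (a, b, y) \<in> E n"
  by (simp add: E_def)

lemma WI: "lin d w w X \<Longrightarrow> y \<in> Y \<Longrightarrow> (X, y) \<in> W"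
  by (simp add: W_def)

lemma \<pi>_W: "x \<in> E n \<Longrightarrow> \<pi> z x \<in> W"
  unfolding \<pi>_def by (intro WI lin_add lin_mult[of d w n _ w] scal_lin EE)

lemma \<pi>_mat: "mat_in (A n) (w * d) (w * d) (\<lambda>x. fst (snd x) * fst x + scal_mat w d d z)"
proof -
  interpret A: fun_algebra "E n" "A n" by (rule A_algebra)
  show ?thesis
    by (intro A.mat_in_add A.mat_in_mult[of "w * d" "n * d"] coord_E A.mat_in_const)
      (simp_all add: Ecar Ecar_mult)
qed

lemma \<pi>_pullback:
  assumes "p \<in> AW"
  shows "(\<lambda>x. p (\<pi> z x)) \<in> A n"
  unfolding \<pi>_def
  by (rule subst_W[OF A_algebra assms \<pi>_mat coord_E(3)]) (use \<pi>_W in \<open>auto simp: \<pi>_def\<close>)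

text \<open>The maximal minors of \<open>a\<close> and \<open>b\<close> modulo \<open>\<epsilon>\<close> generate the unit ideal on the fibre. Only products
  of complementary minors occur, and these are functions of \<open>b a\<close>.\<close>

definition minors :: "nat \<Rightarrow> (nat \<Rightarrow> nat) \<Rightarrow> complex mat \<times> complex mat \<times> 'y \<Rightarrow> complex" where
  "minors n \<phi> x = det (ct d n n (sel d n w \<phi> * fst (snd x))) * det (ct d n n (fst x * emb d w n \<phi>))"

definition charts :: "nat \<Rightarrow> (nat \<Rightarrow> nat) set" where
  "charts n = {0..<n} \<rightarrow>\<^sub>E {0..<w}"

lemma charts_fun: "\<phi> \<in> charts n \<Longrightarrow> \<phi> \<in> {0..<n} \<rightarrow> {0..<w}"
  by (auto simp: charts_def)

lemma finite_charts: "finite (charts n)"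
  unfolding charts_def by (intro finite_PiE) auto

lemma ct_in:
  assumes "mat_in S (r * d) (c * d) N"
  shows "mat_in S r c (\<lambda>x. ct d r c (N x))"
  unfolding mat_in_def
proof (intro allI impI)
  fix i j assume "i < r" "j < c"
  then have "(\<lambda>x. N x $$ (i * d, j * d)) \<in> S" using d by (intro mat_inD[OF assms]) auto
  then show "(\<lambda>x. ct d r c (N x) $$ (i, j)) \<in> S" using \<open>i < r\<close> \<open>j < c\<close> by (simp add: ct_def)
qed

lemma minor_parts:
  "(\<lambda>x. det (ct d n n (sel d n w \<phi> * fst (snd x)))) \<in> A n"
  "(\<lambda>x. det (ct d n n (fst x * emb d w n \<phi>))) \<in> A n"
proof -
  interpret A: fun_algebra "E n" "A n" by (rule A_algebra)
  show "(\<lambda>x. det (ct d n n (sel d n w \<phi> * fst (snd x)))) \<in> A n"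
    by (intro A.det_in[of n] ct_in A.mat_in_mult[of "n * d" "w * d"] coord_E A.mat_in_const)
      (simp_all add: Ecar Ecar_mult)
  show "(\<lambda>x. det (ct d n n (fst x * emb d w n \<phi>))) \<in> A n"
    by (intro A.det_in[of n] ct_in A.mat_in_mult[of "n * d" "w * d"] coord_E A.mat_in_const)
      (simp_all add: Ecar Ecar_mult)
qed

lemma minors_in: "minors n \<phi> \<in> A n"
  using fun_algebra.mult[OF A_algebra minor_parts[of n \<phi>]] by (simp add: minors_def[abs_def])

lemma minors_not_inj:
  assumes "\<phi> \<in> charts n" "\<not> inj_on \<phi> {0..<n}" "x \<in> E n"
  shows "minors n \<phi> x = 0"
  unfolding minors_def
  using ct_sel_mult[OF charts_fun[OF assms(1)] Ecar(2)[OF assms(3)] d]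
    det_repeated_row[OF assms(2), of "\<lambda>r j. ct d w n (fst (snd x)) $$ (r, j)"] by simp

lemma minors_sum:
  assumes x: "x \<in> E n"
  shows "(\<Sum>\<phi>\<in>charts n. minors n \<phi> x) = fact n * det (ct d n n (fst x * fst (snd x)))"
proof -
  have "(\<Sum>\<phi>\<in>charts n. minors n \<phi> x) =
    (\<Sum>\<phi>\<in>charts n. det (mat n n (\<lambda>(i, j). ct d n w (fst x) $$ (i, \<phi> j))) *
       det (mat n n (\<lambda>(i, j). ct d w n (fst (snd x)) $$ (\<phi> i, j))))"
    by (intro sum.cong refl)
      (simp add: minors_def ct_sel_mult[OF charts_fun Ecar(2)[OF x] d] ct_mult_emb[OF charts_fun Ecar(1)[OF x] d])
  also have "\<dots> = fact n * det (ct d n w (fst x) * ct d w n (fst (snd x)))"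
    unfolding charts_def by (rule cauchy_binet) auto
  also have "ct d n w (fst x) * ct d w n (fst (snd x)) = ct d n n (fst x * fst (snd x))"
    by (rule ct_mult[OF EE(1)[OF x] Ecar(2)[OF x] d, symmetric])
  finally show ?thesis .
qed

lemma minors_sum_cong:
  "(\<lambda>x. (\<Sum>\<phi>\<in>charts n. minors n \<phi> x) - fact n * (- coeff l 0) ^ n) \<in> I n l z"
proof -
  interpret I: fun_ideal "E n" "A n" "I n l z" by (rule I_ideal)
  define L where "L = (- coeff l 0) \<cdot>\<^sub>m (1\<^sub>m n :: complex mat)"
  have "(\<lambda>x. det (ct d n n (fst x * fst (snd x))) - det L) \<in> I n l z"
  proof (rule I.det_cong)
    show "mat_in (A n) n n (\<lambda>x. ct d n n (fst x * fst (snd x)))"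
      by (intro ct_in I.mat_in_mult[of "n * d" "w * d"] coord_E) (simp_all add: Ecar)
    show "mat_in (I n l z) n n (\<lambda>x. ct d n n (fst x * fst (snd x)) - L)"
      unfolding mat_in_def
    proof (intro allI impI)
      fix i j assume ij: "i < n" "j < n"
      then have lt: "i * d < n * d" "j * d < n * d" using d by auto
      then have "(\<lambda>x. (fst x * fst (snd x) + scal_mat n d d l) $$ (i * d, j * d)) \<in> I n l z"
        unfolding I_def by (intro fun_algebra.gen_ideal_gen[OF A_algebra]) blast
      then show "(\<lambda>x. (ct d n n (fst x * fst (snd x)) - L) $$ (i, j)) \<in> I n l z"
      proof (rule I.I_cong)
        fix x assume "x \<in> E n"
        have "scal_mat n d d l $$ (i * d, j * d) = ct d n n (scal_mat n d d l) $$ (i, j)"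
          using ij by (simp add: ct_def)
        then have "scal_mat n d d l $$ (i * d, j * d) = - L $$ (i, j)"
          using ij ct_scal[OF d, of n l] by (simp add: L_def)
        then show "(ct d n n (fst x * fst (snd x)) - L) $$ (i, j) =
            (fst x * fst (snd x) + scal_mat n d d l) $$ (i * d, j * d)"
          using ij lt Ecar[OF \<open>x \<in> E n\<close>] by (simp add: ct_def L_def scal_mat_def)
      qed
    qed
  qed (auto intro: I.mat_in_const simp: L_def)
  then have "(\<lambda>x. fact n * (det (ct d n n (fst x * fst (snd x))) - det L)) \<in> I n l z"
    by (rule I.I_scale)
  moreover have "det L = (- coeff l 0) ^ n" by (simp add: L_def)
  ultimately show ?thesis
    by (rule_tac I.I_cong) (auto simp: minors_sum algebra_simps)
qed

lemma unit_from_minors: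
  assumes l: "coeff l 0 \<noteq> 0" and h: "h \<in> A n"
    and m: "(\<lambda>x. (\<Sum>\<phi>\<in>charts n. minors n \<phi> x) ^ m * h x - g x) \<in> I n l z"
  shows "\<exists>k. k \<noteq> 0 \<and> (\<lambda>x. k * h x - g x) \<in> I n l z"
proof -
  interpret I: fun_ideal "E n" "A n" "I n l z" by (rule I_ideal)
  define k where "k = (fact n * (- coeff l 0) ^ n) ^ m"
  have "(\<lambda>x. (\<Sum>\<phi>\<in>charts n. minors n \<phi> x) ^ m - k) \<in> I n l z"
    unfolding k_def by (rule I.power_cong) (auto intro: I.sum minors_in I.const minors_sum_cong)
  then have "(\<lambda>x. ((\<Sum>\<phi>\<in>charts n. minors n \<phi> x) ^ m - k) * h x) \<in> I n l z"
    by (rule I.I_mult2[OF _ h])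
  from I.I_diff[OF m this] have "(\<lambda>x. k * h x - g x) \<in> I n l z"
    by (simp add: algebra_simps)
  moreover have "k \<noteq> 0" using l by (simp add: k_def)
  ultimately show ?thesis by blast
qed

text \<open>There is no pair with invertible scalar composition through a space of smaller rank.\<close>

lemma one_in_ideal:
  assumes "coeff l 0 \<noteq> 0" "w < n"
  shows "(\<lambda>_. 1) \<in> I n l z"
proof -
  interpret I: fun_ideal "E n" "A n" "I n l z" by (rule I_ideal)
  have "minors n \<phi> x = 0" if "\<phi> \<in> charts n" "x \<in> E n" for \<phi> x
  proof (rule minors_not_inj[OF that(1) _ that(2)])
    show "\<not> inj_on \<phi> {0..<n}"
      using card_inj_on_le[of \<phi> "{0..<n}" "{0..<w}"] charts_fun[OF that(1)] assms(2) by auto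
  qed
  then have "(\<lambda>x. (\<Sum>\<phi>\<in>charts n. minors n \<phi> x) ^ 1 * 1 - 0) \<in> I n l z"
    by (intro I.I_cong[OF I.I_zero]) simp
  then obtain k where k: "k \<noteq> 0" "(\<lambda>x. k * 1 - 0) \<in> I n l z"
    using unit_from_minors[OF assms(1) I.const[of 1], where m = 1 and g = "\<lambda>_. 0" and z = z] by auto
  show ?thesis using I.I_scale[OF k(2), of "1 / k"] k(1) by simp
qed

lemma minors_nonzero:
  assumes x: "x \<in> E n" and \<phi>: "\<phi> \<in> charts n" and nz: "minors n \<phi> x \<noteq> 0"
  shows "lin d n n (sel d n w \<phi> * fst (snd x))" "lin d n n (fst x * emb d w n \<phi>)"
    "det (sel d n w \<phi> * fst (snd x)) = det (ct d n n (sel d n w \<phi> * fst (snd x))) ^ d"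
    "det (fst x * emb d w n \<phi>) = det (ct d n n (fst x * emb d w n \<phi>)) ^ d"
    "det (sel d n w \<phi> * fst (snd x)) \<noteq> 0" "det (fst x * emb d w n \<phi>) \<noteq> 0"
proof -
  show l: "lin d n n (sel d n w \<phi> * fst (snd x))" "lin d n n (fst x * emb d w n \<phi>)"
    by (intro lin_mult[of d n w] sel_lin emb_lin charts_fun[OF \<phi>] EE x)+
  show e: "det (sel d n w \<phi> * fst (snd x)) = det (ct d n n (sel d n w \<phi> * fst (snd x))) ^ d"
    "det (fst x * emb d w n \<phi>) = det (ct d n n (fst x * emb d w n \<phi>)) ^ d"
    by (rule det_lin[OF l(1) d], rule det_lin[OF l(2) d])
  show "det (sel d n w \<phi> * fst (snd x)) \<noteq> 0" "det (fst x * emb d w n \<phi>) \<noteq> 0"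
    using nz unfolding e by (auto simp: minors_def)
qed

lemma minor_inverses:
  assumes \<phi>: "\<phi> \<in> charts n"
  shows "mat_in (localise (minors n \<phi>) (A n)) (n * d) (n * d) (\<lambda>x. minv (sel d n w \<phi> * fst (snd x)))"
    "mat_in (localise (minors n \<phi>) (A n)) (n * d) (n * d) (\<lambda>x. minv (fst x * emb d w n \<phi>))"
proof -
  let ?D = "minors n \<phi>"
  interpret A: fun_algebra "E n" "A n" by (rule A_algebra)
  interpret AA: fun_ideal "E n" "A n" "A n" by (rule A.ideal_self)
  interpret L: fun_algebra "{x \<in> E n. ?D x \<noteq> 0}" "localise ?D (A n)" by (rule A.localise_algebra[OF minors_in])
  have sub: "f \<in> localise ?D (A n)" if "f \<in> A n" for f
    by (rule AA.localise_sub[OF minors_in that])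
  have sub': "mat_in (localise ?D (A n)) r c N" if "mat_in (A n) r c N" for r c N
    using that sub unfolding mat_in_def by blast
  have inv: "(\<lambda>x. (h x * (1 / ?D x)) ^ d) \<in> localise ?D (A n)" if "h \<in> A n" for h
    by (intro L.power L.mult sub that A.inverse_in_localise minors_in)
  show "mat_in (localise ?D (A n)) (n * d) (n * d) (\<lambda>x. minv (sel d n w \<phi> * fst (snd x)))"
  proof (rule L.minv_in)
    show "mat_in (localise ?D (A n)) (n * d) (n * d) (\<lambda>x. sel d n w \<phi> * fst (snd x))"
      by (rule sub', intro A.mat_in_mult[of "n * d" "w * d"] coord_E A.mat_in_const) (simp_all add: Ecar)
    show "(\<lambda>x. 1 / det (sel d n w \<phi> * fst (snd x))) \<in> localise ?D (A n)"
    proof (rule L.cong[OF inv[OF minor_parts(2)[of n \<phi>]]])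
      fix x assume x: "x \<in> {x \<in> E n. ?D x \<noteq> 0}"
      then show "1 / det (sel d n w \<phi> * fst (snd x)) = (det (ct d n n (fst x * emb d w n \<phi>)) * (1 / ?D x)) ^ d"
        using minors_nonzero(3)[OF _ \<phi>, of x] by (simp add: minors_def power_divide power_mult_distrib)
    qed
  qed (simp add: Ecar_mult)
  show "mat_in (localise ?D (A n)) (n * d) (n * d) (\<lambda>x. minv (fst x * emb d w n \<phi>))"
  proof (rule L.minv_in)
    show "mat_in (localise ?D (A n)) (n * d) (n * d) (\<lambda>x. fst x * emb d w n \<phi>)"
      by (rule sub', intro A.mat_in_mult[of "n * d" "w * d"] coord_E A.mat_in_const) (simp_all add: Ecar)
    show "(\<lambda>x. 1 / det (fst x * emb d w n \<phi>)) \<in> localise ?D (A n)"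
    proof (rule L.cong[OF inv[OF minor_parts(1)[of n \<phi>]]])
      fix x assume x: "x \<in> {x \<in> E n. ?D x \<noteq> 0}"
      then show "1 / det (fst x * emb d w n \<phi>) = (det (ct d n n (sel d n w \<phi> * fst (snd x))) * (1 / ?D x)) ^ d"
        using minors_nonzero(4)[OF _ \<phi>, of x] by (simp add: minors_def power_divide power_mult_distrib)
    qed
  qed (simp add: Ecar_mult)
qed

end

lemma minus_add_entry:
  fixes A B C :: "complex mat"
  assumes "A \<in> carrier_mat r c" "B \<in> carrier_mat r c" "C \<in> carrier_mat r c" "i < r" "j < c"
  shows "(A - B + C) $$ (i, j) - (A + C) $$ (i, j) = - B $$ (i, j)"
  using assms by simp

context pair_maps
begin

text \<open>Elimination of one pair in favour of the complementary one, on the chart of a nonvanishing minor.\<close>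

lemma substitution_chart:
  assumes nm: "n + m = w" and M: "M \<subseteq> AW" and p: "p \<in> AW" and pI: "(\<lambda>x. p (\<pi> z x)) \<in> I n l z"
    and \<phi>: "\<phi> \<in> charts m" and inj: "inj_on \<phi> {0..<m}"
  shows "(\<lambda>x. p (\<pi> (z - l) x)) \<in> localise (minors m \<phi>) (I m (- l) (z - l))"
proof -
  let ?D = "minors m \<phi>" and ?J = "I m (- l) (z - l)"
  interpret J: fun_ideal "E m" "A m" ?J by (rule I_ideal)
  interpret JA: fun_ideal "E m" "A m" "A m" by (rule J.ideal_self)
  interpret L: fun_algebra "{x \<in> E m. ?D x \<noteq> 0}" "localise ?D (A m)" by (rule J.localise_algebra[OF minors_in])
  interpret LJ: fun_ideal "{x \<in> E m. ?D x \<noteq> 0}" "localise ?D (A m)" "localise ?D ?J"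
    by (rule J.localise_ideal[OF minors_in])
  have sub: "f \<in> localise ?D (A m)" if "f \<in> A m" for f by (rule JA.localise_sub[OF minors_in that])
  have sub': "mat_in (localise ?D (A m)) r c N" if "mat_in (A m) r c N" for r c N
    using that sub unfolding mat_in_def by blast
  have \<phi>f: "\<phi> \<in> {0..<m} \<rightarrow> {0..<w}" by (rule charts_fun[OF \<phi>])
  obtain \<psi> where "bij_betw \<psi> {0..<n} ({0..<w} - \<phi> ` {0..<m})"
  proof -
    have "card ({0..<w} - \<phi> ` {0..<m}) = n"
      using \<phi>f nm by (subst card_Diff_subset) (auto simp: card_image[OF inj])
    then show thesis using that ex_bij_betw_nat_finite[of "{0..<w} - \<phi> ` {0..<m}"] by auto
  qed
  then have \<psi>: "\<psi> \<in> {0..<n} \<rightarrow> {0..<w}" "inj_on \<psi> {0..<n}" "\<psi> ` {0..<n} = {0..<w} - \<phi> ` {0..<m}"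
    by (auto simp: bij_betw_def)
  define e where "e = sel d n w \<psi>"
  define e2 where "e2 = sel d m w \<phi>"
  define c where "c = emb d w m \<phi>"
  define c2 where "c2 = emb d w n \<psi>"
  define S where "S = scal_mat w d d l"
  define T where "T x = minv (fst x * c)" for x :: "complex mat \<times> complex mat \<times> 'y"
  define q where "q x = (1\<^sub>m (w * d) - c * T x * fst x) * c2" for x :: "complex mat \<times> complex mat \<times> 'y"
  define X where "X x = fst (snd x) * fst x - S" for x :: "complex mat \<times> complex mat \<times> 'y"
  define \<alpha> where "\<alpha> x = e * X x" for x
  have lins: "lin d n w e" "lin d m w e2" "lin d w m c" "lin d w n c2" "lin d w w S"
    unfolding e_def e2_def c_def c2_def S_def using sel_lin emb_lin \<phi>f \<psi>(1) scal_lin by blast+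
  note cars = lins[THEN lin_carrier]
  have T_lin: "lin d m m (T x)" if "x \<in> {x \<in> E m. ?D x \<noteq> 0}" for x
  proof -
    have x: "x \<in> E m" "?D x \<noteq> 0" using that by simp_all
    show ?thesis unfolding T_def c_def
      by (rule lin_minv[OF minors_nonzero(2)[OF x(1) \<phi> x(2)] minors_nonzero(6)[OF x(1) \<phi> x(2)]])
  qed
  have T_car: "T x \<in> carrier_mat (m * d) (m * d)" if "x \<in> E m" for x
    unfolding T_def c_def by (intro minv_carrier Ecar_mult that)
  have X_lin: "lin d w w (X x)" if "x \<in> E m" for x
    unfolding X_def by (intro lin_minus lin_mult[of d w m _ w] EE that lins)
  have P_lin: "lin d w w (1\<^sub>m (w * d) - c * T x * fst x)" if "x \<in> {x \<in> E m. ?D x \<noteq> 0}" for x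
    using that by (intro lin_minus lin_one lin_mult[OF lin_mult[OF lins(3) T_lin]] EE(1)) auto
  have q_lin: "lin d w n (q x)" if "x \<in> {x \<in> E m. ?D x \<noteq> 0}" for x
    unfolding q_def by (rule lin_mult[OF P_lin[OF that] lins(4)])
  have a_lin: "lin d n w (\<alpha> x)" if "x \<in> E m" for x
    unfolding \<alpha>_def by (rule lin_mult[OF lins(1) X_lin[OF that]])
  define \<sigma> where "\<sigma> x = (\<alpha> x, q x, snd (snd x))" for x
  have \<sigma>E: "\<sigma> x \<in> E n" if "x \<in> {x \<in> E m. ?D x \<noteq> 0}" for x
    unfolding \<sigma>_def using that by (intro EI a_lin q_lin EE(3)) auto
  have id: "\<alpha> x * q x + scal_mat n d d l = 0\<^sub>m (n * d) (n * d)"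
    "q x * \<alpha> x = X x - c * T x * (fst x * X x)" if x: "x \<in> {x \<in> E m. ?D x \<noteq> 0}" for x
  proof -
    have xE: "x \<in> E m" using x by simp
    note a = Ecar(1)[OF xE] and b = Ecar(2)[OF xE] and Tc = T_car[OF xE]
      and Xc = lin_carrier[OF X_lin[OF xE]] and qc = lin_carrier[OF q_lin[OF x]]
    have "det (fst x * c) \<noteq> 0" unfolding c_def using minors_nonzero(6)[OF xE \<phi>] x by simp
    then have TT: "fst x * c * T x = 1\<^sub>m (m * d)" "T x * (fst x * c) = 1\<^sub>m (m * d)"
      unfolding T_def using minv[of "fst x * c" "m * d"] Ecar_mult(4)[OF xE] c_def by auto
    have ec2: "e * c2 = 1\<^sub>m (n * d)" unfolding e_def c2_def by (rule sel_emb[OF \<psi>(1,2)])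
    have ec: "e * c = 0\<^sub>m (n * d) (m * d)"
      unfolding e_def c_def using \<psi>(3) by (intro sel_emb_disjoint \<psi> \<phi>f) force
    have c2e: "c2 * e = 1\<^sub>m (w * d) - c * e2"
      unfolding c2_def e_def c_def e2_def by (rule emb_sel_complement[OF \<phi>f inj \<psi>])
    note kp = kernel_parametrisation[OF a cars(3) Tc cars(4) cars(1) cars(2) TT ec2 ec c2e, folded q_def]
    have ba: "fst (snd x) * fst x \<in> carrier_mat (w * d) (w * d)" by (rule Ecar_mult[OF xE])
    have "X x * q x = fst (snd x) * (fst x * q x) - S * q x"
      unfolding X_def minus_mult_distrib_mat[OF ba cars(5) qc] assoc_mult_mat[OF b a qc] by (rule refl)
    also have "\<dots> = - (S * q x)"
      unfolding kp(1) using b cars(5) qc by (simp add: zero_minus_mat[of _ "w * d" "n * d"])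
    finally have Xq: "X x * q x = - (S * q x)" .
    have "\<alpha> x * q x = e * (X x * q x)"
      unfolding \<alpha>_def by (rule assoc_mult_mat[OF cars(1) Xc qc])
    also have "\<dots> = - (e * (S * q x))"
      unfolding Xq using cars(1) cars(5) by (intro uminus_mult_right_mat) auto
    also have "e * (S * q x) = (e * S) * q x"
      by (rule assoc_mult_mat[OF cars(1) cars(5) qc, symmetric])
    also have "e * S = scal_mat n d d l * e" unfolding S_def by (rule lin_scal[OF lins(1)])
    also have "scal_mat n d d l * e * q x = scal_mat n d d l"
      unfolding assoc_mult_mat[OF scal_carrier cars(1) qc] kp(2) by (rule right_mult_one_mat[OF scal_carrier])
    finally show "\<alpha> x * q x + scal_mat n d d l = 0\<^sub>m (n * d) (n * d)"
      using uminus_l_inv_mat[of "scal_mat n d d l" "n * d" "n * d"] by simp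
    have cTa: "c * T x * fst x \<in> carrier_mat (w * d) (w * d)" using cars(3) Tc a by simp
    have "q x * \<alpha> x = q x * e * X x"
      unfolding \<alpha>_def by (rule assoc_mult_mat[OF qc cars(1) Xc, symmetric])
    also have "\<dots> = X x - c * T x * fst x * X x"
      unfolding kp(3) using minus_mult_distrib_mat[OF one_carrier_mat cTa Xc] Xc by simp
    also have "c * T x * fst x * X x = c * T x * (fst x * X x)"
      by (rule assoc_mult_mat[OF mult_carrier_mat[OF cars(3) Tc] a Xc])
    finally show "q x * \<alpha> x = X x - c * T x * (fst x * X x)" .
  qed
  have X_in: "mat_in (A m) (w * d) (w * d) X"
    unfolding X_def[abs_def]
    by (intro J.mat_in_minus J.mat_in_mult[of "w * d" "m * d"] coord_E J.mat_in_const)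
      (simp_all add: Ecar Ecar_mult cars)
  have T_in: "mat_in (localise ?D (A m)) (m * d) (m * d) T"
    unfolding T_def[abs_def] c_def by (rule minor_inverses[OF \<phi>])
  have cT_in: "mat_in (localise ?D (A m)) (w * d) (m * d) (\<lambda>x. c * T x)"
    by (intro L.mat_in_mult[of "w * d" "m * d"] L.mat_in_const T_in) (simp_all add: cars T_car)
  have cT_car: "c * T x \<in> carrier_mat (w * d) (m * d)" if "x \<in> E m" for x
    using cars(3) T_car[OF that] by simp
  have q_in: "mat_in (localise ?D (A m)) (w * d) (n * d) q"
  proof -
    have "mat_in (localise ?D (A m)) (w * d) (w * d) (\<lambda>x. c * T x * fst x)"
      by (rule L.mat_in_mult[OF cT_in sub'[OF coord_E(1)]]) (simp_all add: cT_car Ecar)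
    then have "mat_in (localise ?D (A m)) (w * d) (w * d) (\<lambda>x. 1\<^sub>m (w * d) - c * T x * fst x)"
      by (rule L.mat_in_minus[OF L.mat_in_const]) (simp_all add: mult_carrier_mat[OF cT_car Ecar(1)])
    then show ?thesis
      unfolding q_def[abs_def]
      by (rule L.mat_in_mult[OF _ L.mat_in_const])
        (simp_all add: minus_carrier_mat mult_carrier_mat[OF cT_car Ecar(1)] cars)
  qed
  have a_in: "mat_in (localise ?D (A m)) (n * d) (w * d) \<alpha>"
    unfolding \<alpha>_def[abs_def]
    by (intro sub' J.mat_in_mult[of "n * d" "w * d"] J.mat_in_const X_in)
      (simp_all add: cars lin_carrier[OF X_lin])
  have y_in: "(\<lambda>x. cc (snd (snd x))) \<in> localise ?D (A m)" if "cc \<in> CY" for cc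
    by (rule sub[OF coord_E(3)[OF that]])
  have \<pi>_eq: "\<pi> (z - l) x = (X x + scal_mat w d d z, snd (snd x))" if "x \<in> E m" for x
    unfolding \<pi>_def X_def S_def scal_diff using Ecar_mult(1)[OF that]
    by (auto simp: scal_mat_def intro!: eq_matI)
  have \<pi>\<sigma>: "\<pi> z (\<sigma> x) = (q x * \<alpha> x + scal_mat w d d z, snd (snd x))" for x
    by (simp add: \<pi>_def \<sigma>_def)
  have aX: "mat_in ?J (m * d) (w * d) (\<lambda>x. fst x * X x)"
  proof -
    have g: "mat_in ?J (m * d) (m * d) (\<lambda>x. fst x * fst (snd x) + scal_mat m d d (- l))"
      unfolding mat_in_def I_def by (auto intro!: fun_algebra.gen_ideal_gen[OF A_algebra])
    have "mat_in ?J (m * d) (w * d) (\<lambda>x. (fst x * fst (snd x) + scal_mat m d d (- l)) * fst x)"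
      by (rule J.mat_in_ideal_right[OF g coord_E(1)]) (simp_all add: Ecar Ecar_mult)
    note h = mat_inD[OF this]
    show ?thesis
      unfolding mat_in_def
    proof (intro allI impI)
      fix i j assume ij: "i < m * d" "j < w * d"
      show "(\<lambda>x. (fst x * X x) $$ (i, j)) \<in> ?J"
      proof (rule J.I_cong[OF h[OF ij]])
        fix x assume x: "x \<in> E m"
        note a = Ecar(1)[OF x] and b = Ecar(2)[OF x]
        have "fst x * X x = fst x * (fst (snd x) * fst x) - fst x * S"
          unfolding X_def by (rule mult_minus_distrib_mat[OF a Ecar_mult(1)[OF x] cars(5)])
        also have "fst x * S = scal_mat m d d l * fst x"
          unfolding S_def by (rule lin_scal[OF EE(1)[OF x]])
        also have "fst x * (fst (snd x) * fst x) = fst x * fst (snd x) * fst x"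
          by (rule assoc_mult_mat[OF a b a, symmetric])
        also have "fst x * fst (snd x) * fst x - scal_mat m d d l * fst x =
            (fst x * fst (snd x) - scal_mat m d d l) * fst x"
          by (rule minus_mult_distrib_mat[OF Ecar_mult(2)[OF x] scal_carrier a, symmetric])
        also have "fst x * fst (snd x) - scal_mat m d d l = fst x * fst (snd x) + scal_mat m d d (- l)"
          using Ecar_mult(2)[OF x] scal_diff[of m d 0 l] by (auto simp: scal_mat_def intro!: eq_matI)
        finally show "(fst x * X x) $$ (i, j) =
            ((fst x * fst (snd x) + scal_mat m d d (- l)) * fst x) $$ (i, j)" by simp
      qed
    qed
  qed
  have err: "mat_in (localise ?D ?J) (w * d) (w * d) (\<lambda>x. c * T x * (fst x * X x))"
  proof (rule LJ.mat_in_ideal_left[OF cT_in])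
    show "mat_in (localise ?D ?J) (m * d) (w * d) (\<lambda>x. fst x * X x)"
      using aX J.localise_sub[OF minors_in] unfolding mat_in_def by blast
  qed (use cT_car mult_carrier_mat[OF Ecar(1) lin_carrier[OF X_lin]] in auto)
  have qa_in: "mat_in (localise ?D (A m)) (w * d) (w * d) (\<lambda>x. q x * \<alpha> x + scal_mat w d d z)"
    using q_lin a_lin
    by (intro L.mat_in_add L.mat_in_mult[of "w * d" "n * d"] q_in a_in L.mat_in_const)
      (simp_all add: lin_carrier lin_carrier[OF lin_mult[OF q_lin a_lin]])
  have Xz_in: "mat_in (localise ?D (A m)) (w * d) (w * d) (\<lambda>x. X x + scal_mat w d d z)"
    by (intro sub' J.mat_in_add X_in J.mat_in_const) (simp_all add: lin_carrier[OF X_lin])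
  have W1: "(q x * \<alpha> x + scal_mat w d d z, snd (snd x)) \<in> W" if "x \<in> {x \<in> E m. ?D x \<noteq> 0}" for x
    using \<pi>_W[OF \<sigma>E[OF that], of z] unfolding \<pi>\<sigma> .
  have W2: "(X x + scal_mat w d d z, snd (snd x)) \<in> W" if "x \<in> E m" for x
    using \<pi>_W[OF that, of "z - l"] unfolding \<pi>_eq[OF that] .
  have cong: "(\<lambda>x. h (\<pi> z (\<sigma> x)) - h (\<pi> (z - l) x)) \<in> localise ?D ?J" if "h \<in> AW" for h
  proof -
    have "(\<lambda>x. h (q x * \<alpha> x + scal_mat w d d z, snd (snd x)) - h (X x + scal_mat w d d z, snd (snd x)))
        \<in> localise ?D ?J"
    proof (rule LJ.poly_cong[OF that[unfolded AW_def]])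
      fix cc assume cc: "cc \<in> CW"
      show "(\<lambda>x. cc (q x * \<alpha> x + scal_mat w d d z, snd (snd x))) \<in> localise ?D (A m)"
        "(\<lambda>x. cc (X x + scal_mat w d d z, snd (snd x))) \<in> localise ?D (A m)"
        using cc qa_in Xz_in y_in unfolding CW_def mat_in_def by auto
      show "(\<lambda>x. cc (q x * \<alpha> x + scal_mat w d d z, snd (snd x)) - cc (X x + scal_mat w d d z, snd (snd x)))
          \<in> localise ?D ?J"
      proof -
        have "(\<lambda>x. (q x * \<alpha> x + scal_mat w d d z) $$ (r, s) - (X x + scal_mat w d d z) $$ (r, s))
            \<in> localise ?D ?J" if rs: "r < w * d" "s < w * d" for r s
        proof (rule LJ.I_cong[OF LJ.I_uminus[OF mat_inD[OF err rs]]])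
          fix x assume x: "x \<in> {x \<in> E m. ?D x \<noteq> 0}"
          then have "X x \<in> carrier_mat (w * d) (w * d)" "c * T x * (fst x * X x) \<in> carrier_mat (w * d) (w * d)"
            using mult_carrier_mat[OF cT_car mult_carrier_mat[OF Ecar(1) lin_carrier[OF X_lin]]] X_lin lin_carrier
            by auto
          then show "(q x * \<alpha> x + scal_mat w d d z) $$ (r, s) - (X x + scal_mat w d d z) $$ (r, s) =
              - (c * T x * (fst x * X x)) $$ (r, s)"
            unfolding id(2)[OF x] by (rule minus_add_entry[OF _ _ scal_carrier rs])
        qed
        then show ?thesis using cc LJ.I_zero unfolding CW_def by auto
      qed
    qed (use W1 W2 in auto)
    then show ?thesis
      by (rule LJ.I_cong) (simp add: \<pi>\<sigma> \<pi>_eq)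
  qed
  have "(\<lambda>x. p (\<pi> z (\<sigma> x))) \<in> localise ?D ?J"
  proof (rule LJ.gen_ideal_subst[OF pI[unfolded I_def]])
    show "\<sigma> x \<in> E n" if "x \<in> {x \<in> E m. ?D x \<noteq> 0}" for x by (rule \<sigma>E[OF that])
    show "(\<lambda>x. f (\<sigma> x)) \<in> localise ?D (A m)" if "f \<in> A n" for f
      unfolding \<sigma>_def
      by (rule subst_E[OF L.fun_algebra_axioms that a_in q_in y_in]) (use \<sigma>E in \<open>auto simp: \<sigma>_def\<close>)
  next
    fix g assume "g \<in> {\<lambda>x. (fst x * fst (snd x) + scal_mat n d d l) $$ (r, s) | r s. r < n * d \<and> s < n * d} \<union>
     {\<lambda>x. m (\<pi> z x) | m. m \<in> M}"
    then consider (1) r s where "r < n * d" "s < n * d" "g = (\<lambda>x. (fst x * fst (snd x) + scal_mat n d d l) $$ (r, s))"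
      | (2) mm where "mm \<in> M" "g = (\<lambda>x. mm (\<pi> z x))" by blast
    then show "(\<lambda>x. g (\<sigma> x)) \<in> localise ?D ?J"
    proof cases
      case 1
      show ?thesis
        by (rule LJ.I_cong[OF LJ.I_zero]) (simp add: 1 \<sigma>_def id)
    next
      case 2
      have "(\<lambda>x. mm (\<pi> (z - l) x)) \<in> ?J"
        unfolding I_def using 2(1) by (intro fun_algebra.gen_ideal_gen[OF A_algebra]) blast
      from LJ.I_add[OF cong[of mm] J.localise_sub[OF minors_in this]] 2 M show ?thesis by auto
    qed
  qed
  from LJ.I_diff[OF this cong[OF p]] show ?thesis by simp
qed

text \<open>Hence the relations among the entries of \<open>b a\<close> and \<open>y\<close> agree on both sides.\<close>

theorem relations_transfer:
  assumes nm: "n + m = w" and M: "M \<subseteq> AW" and l: "coeff l 0 \<noteq> 0"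
    and p: "p \<in> AW" and pI: "(\<lambda>x. p (\<pi> z x)) \<in> I n l z"
  shows "(\<lambda>x. p (\<pi> (z - l) x)) \<in> I m (- l) (z - l)"
proof -
  let ?J = "I m (- l) (z - l)"
  interpret J: fun_ideal "E m" "A m" ?J by (rule I_ideal)
  have pA: "(\<lambda>x. p (\<pi> (z - l) x)) \<in> A m" by (rule \<pi>_pullback[OF p])
  define K where "K = {u \<in> A m. (\<lambda>x. u x * p (\<pi> (z - l) x)) \<in> ?J}"
  interpret K: fun_ideal "E m" "A m" K
  proof
    show "(\<lambda>_. 0) \<in> K" by (simp add: K_def J.const J.I_zero)
    show "(\<lambda>x. f x + g x) \<in> K" if "f \<in> K" "g \<in> K" for f g
      using that J.I_add by (auto simp: K_def J.add distrib_right)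
    show "(\<lambda>x. f x * g x) \<in> K" if "f \<in> A m" "g \<in> K" for f g
      using that J.I_mult[of f "\<lambda>x. g x * p (\<pi> (z - l) x)"] by (auto simp: K_def J.mult mult.assoc)
    show "g \<in> K" if "f \<in> K" "\<And>x. x \<in> E m \<Longrightarrow> g x = f x" for f g
      using that J.cong[of f g] J.I_cong[of "\<lambda>x. f x * p (\<pi> (z - l) x)" "\<lambda>x. g x * p (\<pi> (z - l) x)"]
      by (auto simp: K_def)
  qed
  have "\<exists>k. (\<lambda>x. minors m \<phi> x ^ k) \<in> K" if \<phi>: "\<phi> \<in> charts m" for \<phi>
  proof (cases "inj_on \<phi> {0..<m}")
    case True
    from substitution_chart[OF nm M p pI \<phi> True] obtain N where
      "(\<lambda>x. minors m \<phi> x ^ Suc N * p (\<pi> (z - l) x)) \<in> ?J" by (auto simp: localise_def)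
    then show ?thesis
      by (intro exI[of _ "Suc N"]) (auto simp: K_def simp del: power_Suc intro: J.power minors_in)
  next
    case False
    then show ?thesis
      by (intro exI[of _ 1] K.I_cong[OF K.I_zero]) (simp add: minors_not_inj[OF \<phi>])
  qed
  then obtain k where "(\<lambda>x. (\<Sum>\<phi>\<in>charts m. minors m \<phi> x) ^ k) \<in> K"
    using K.power_sum_in_ideal[OF finite_charts[of m], of "minors m"] minors_in by blast
  then have "(\<lambda>x. (\<Sum>\<phi>\<in>charts m. minors m \<phi> x) ^ k * p (\<pi> (z - l) x) - 0) \<in> ?J" by (simp add: K_def)
  from unit_from_minors[OF _ pA this] l obtain u where u: "u \<noteq> 0" "(\<lambda>x. u * p (\<pi> (z - l) x) - 0) \<in> ?J"
    by auto
  show ?thesis using J.I_scale[OF u(2), of "1 / u"] u(1) by simp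
qed

end

lemma add_diff_mat:
  fixes A B :: "complex mat"
  assumes "A \<in> carrier_mat r c" "B \<in> carrier_mat r c"
  shows "A + B - B = A"
proof (rule eq_matI)
  show "(A + B - B) $$ (i, j) = A $$ (i, j)" if "i < dim_row A" "j < dim_col A" for i j
    using assms that by simp
  show "dim_row (A + B - B) = dim_row A" "dim_col (A + B - B) = dim_col A" using assms by simp_all
qed

context pair_maps
begin

text \<open>On the chart of a nonvanishing minor \<open>det (e b) det (a c)\<close> the group element \<open>g = e b\<close> moves \<open>(a, b)\<close>
  to \<open>(e (b a), (b a) c (e (b a) c)\<^sup>-\<^sup>1)\<close>, which depends on \<open>b a\<close> only. So there an invariant is a rational function
  of \<open>b a\<close>.\<close>

lemma invariant_chart:
  assumes f: "f \<in> A n"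
    and inv: "\<And>g. lin d n n g \<Longrightarrow> det g \<noteq> 0 \<Longrightarrow>
      (\<lambda>x. f (g * fst x, fst (snd x) * minv g, snd (snd x)) - f x) \<in> I n l z"
    and \<phi>: "\<phi> \<in> charts n"
  shows "\<exists>u\<in>AW. (\<forall>x\<in>E n. u (\<pi> z x) = minors n \<phi> x) \<and>
    (\<exists>N p. p \<in> AW \<and> (\<lambda>x. minors n \<phi> x ^ Suc N * f x - p (\<pi> z x)) \<in> I n l z)"
proof -
  let ?D = "minors n \<phi>" and ?I = "I n l z"
  interpret I: fun_ideal "E n" "A n" ?I by (rule I_ideal)
  interpret IA: fun_ideal "E n" "A n" "A n" by (rule I.ideal_self)
  interpret L: fun_algebra "{x \<in> E n. ?D x \<noteq> 0}" "localise ?D (A n)" by (rule I.localise_algebra[OF minors_in])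
  have sub: "f \<in> localise ?D (A n)" if "f \<in> A n" for f by (rule IA.localise_sub[OF minors_in that])
  have sub': "mat_in (localise ?D (A n)) r c N" if "mat_in (A n) r c N" for r c N
    using that sub unfolding mat_in_def by blast
  have \<phi>f: "\<phi> \<in> {0..<n} \<rightarrow> {0..<w}" by (rule charts_fun[OF \<phi>])
  define e where "e = sel d n w \<phi>"
  define c where "c = emb d w n \<phi>"
  have lins: "lin d n w e" "lin d w n c" unfolding e_def c_def using sel_lin emb_lin \<phi>f by blast+
  note cars = lins[THEN lin_carrier]
  \<comment> \<open>invariance under each group element gives invariance under \<open>e b\<close>, an element that varies with the point\<close>
  define \<gamma> where "\<gamma> x = e * fst (snd x)" for x :: "complex mat \<times> complex mat \<times> 'y"
  define \<Gamma> where "\<Gamma> = {g. lin d n n g \<and> det g \<noteq> 0}"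
  define Q where "Q = {q. (\<lambda>x. q (\<gamma> x)) \<in> localise ?D (A n)}"
  have \<gamma>\<Gamma>: "\<gamma> x \<in> \<Gamma>" if "x \<in> E n" "?D x \<noteq> 0" for x
    unfolding \<gamma>_def e_def \<Gamma>_def using minors_nonzero[OF that(1) \<phi> that(2)] by blast
  interpret Q: fun_algebra \<Gamma> Q
  proof
    show "g \<in> Q" if "f \<in> Q" "\<And>x. x \<in> \<Gamma> \<Longrightarrow> g x = f x" for f g
      using L.cong[of "\<lambda>x. f (\<gamma> x)" "\<lambda>x. g (\<gamma> x)"] that \<gamma>\<Gamma> by (auto simp: Q_def)
  qed (auto simp: Q_def L.const L.add L.mult)
  have Q_mat: "mat_in Q (n * d) (n * d) (\<lambda>g. g)" "mat_in Q (n * d) (n * d) minv"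
  proof -
    have "mat_in (A n) (n * d) (n * d) \<gamma>"
      unfolding \<gamma>_def[abs_def] by (intro I.mat_in_mult[of "n * d" "w * d"] coord_E I.mat_in_const)
        (simp_all add: Ecar cars)
    then show "mat_in Q (n * d) (n * d) (\<lambda>g. g)" using sub unfolding mat_in_def Q_def by blast
    show "mat_in Q (n * d) (n * d) minv"
      using minor_inverses(1)[OF \<phi>] unfolding mat_in_def Q_def \<gamma>_def e_def by blast
  qed
  define T where "T = tensors \<Gamma> Q (E n) (A n)"
  interpret T: fun_algebra "\<Gamma> \<times> E n" T
    unfolding T_def by (rule tensors_algebra[OF Q.fun_algebra_axioms A_algebra])
  have Tl: "mat_in T r s (\<lambda>p. N (fst p))" if "mat_in Q r s N" for r s N
    unfolding T_def mat_in_def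
    by (intro allI impI I.tensors_left[where q = "\<lambda>g. N g $$ (i, j)" for i j] mat_inD[OF that])
  have Tr: "mat_in T r s (\<lambda>p. N (snd p))" if "mat_in (A n) r s N" for r s N
    unfolding T_def mat_in_def
    by (intro allI impI I.tensors_right[OF Q.fun_algebra_axioms, where f = "\<lambda>x. N x $$ (i, j)" for i j] mat_inD[OF that])
  define F where "F = (\<lambda>p. f (fst p * fst (snd p), fst (snd (snd p)) * minv (fst p), snd (snd (snd p))) - f (snd p))"
  have "F \<in> T"
    unfolding F_def
  proof (rule T.diff[OF subst_E[OF T.fun_algebra_axioms f]])
    show "mat_in T (n * d) (w * d) (\<lambda>p. fst p * fst (snd p))"
      by (rule T.mat_in_mult[OF Tl[OF Q_mat(1)] Tr[OF coord_E(1)]])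
        (auto simp: \<Gamma>_def lin_carrier E_def)
    show "mat_in T (w * d) (n * d) (\<lambda>p. fst (snd (snd p)) * minv (fst p))"
      by (rule T.mat_in_mult[OF Tr[OF coord_E(2)] Tl[OF Q_mat(2)]])
        (auto simp: \<Gamma>_def lin_carrier E_def)
    show "(\<lambda>p. cc (snd (snd (snd p)))) \<in> T" if "cc \<in> CY" for cc
      unfolding T_def by (rule I.tensors_right[OF Q.fun_algebra_axioms coord_E(3)[OF that]])
    show "(\<lambda>p. f (snd p)) \<in> T"
      unfolding T_def by (rule I.tensors_right[OF Q.fun_algebra_axioms f])
    show "(fst p * fst (snd p), fst (snd (snd p)) * minv (fst p), snd (snd (snd p))) \<in> E n" if "p \<in> \<Gamma> \<times> E n" for p
    proof (rule EI)
      have g: "lin d n n (fst p)" "det (fst p) \<noteq> 0" and x: "snd p \<in> E n" using that by (auto simp: \<Gamma>_def)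
      show "lin d n w (fst p * fst (snd p))" by (rule lin_mult[OF g(1) EE(1)[OF x]])
      show "lin d w n (fst (snd (snd p)) * minv (fst p))" by (rule lin_mult[OF EE(2)[OF x] lin_minv[OF g]])
      show "snd (snd (snd p)) \<in> Y" by (rule EE(3)[OF x])
    qed
  qed
  then have Floc: "(\<lambda>x. F (\<gamma> x, x)) \<in> localise ?D ?I"
    unfolding T_def
  proof (rule I.tensors_subst[OF Q.fun_algebra_axioms])
    show "(\<lambda>x. F (g, x)) \<in> ?I" if "g \<in> \<Gamma>" for g
      using inv[of g] that by (simp add: F_def \<Gamma>_def)
  qed (auto simp: minors_in \<gamma>\<Gamma> Q_def)
  \<comment> \<open>the moved point in terms of \<open>X = b a\<close>\<close>
  define X where "X v = fst v - scal_mat w d d z" for v :: "complex mat \<times> 'y"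
  define u where "u v = det (ct d n n (e * X v * c))" for v
  define h where "h v = f (e * X v, X v * c * minv (e * X v * c), snd v)" for v
  have X_lin: "lin d w w (X v)" if "v \<in> W" for v
    using that unfolding X_def W_def by (auto intro: lin_minus scal_lin)
  have X_in: "mat_in AW (w * d) (w * d) X"
    unfolding X_def[abs_def] by (intro AW.mat_in_minus coord_W AW.mat_in_const) (auto simp: W_def lin_carrier)
  note X_car = lin_carrier[OF X_lin]
  have eX_in: "mat_in AW (n * d) (w * d) (\<lambda>v. e * X v)"
    by (intro AW.mat_in_mult[of _ "w * d"] X_in AW.mat_in_const) (simp_all add: X_car cars)
  have Xc_in: "mat_in AW (w * d) (n * d) (\<lambda>v. X v * c)"
    by (intro AW.mat_in_mult[of _ "w * d"] X_in AW.mat_in_const) (simp_all add: X_car cars)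
  have eXc_lin: "lin d n n (e * X v * c)" if "v \<in> W" for v
    by (intro lin_mult[OF lin_mult[OF lins(1) X_lin[OF that]] lins(2)])
  have eXc_in: "mat_in AW (n * d) (n * d) (\<lambda>v. e * X v * c)"
    by (rule AW.mat_in_mult[OF eX_in AW.mat_in_const]) (simp_all add: cars mult_carrier_mat[OF _ X_car])
  have u_in: "u \<in> AW"
    unfolding u_def[abs_def] by (intro AW.det_in[of n] ct_in eXc_in) simp
  have det_u: "det (e * X v * c) = u v ^ d" if "v \<in> W" for v
    unfolding u_def by (rule det_lin[OF eXc_lin[OF that] d])
  interpret AWI: fun_ideal W AW AW by (rule AW.ideal_self)
  interpret LW: fun_algebra "{v \<in> W. u v \<noteq> 0}" "localise u AW" by (rule AW.localise_algebra[OF u_in])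
  have subW: "mat_in (localise u AW) r s N" if "mat_in AW r s N" for r s N
    using that AWI.localise_sub[OF u_in] unfolding mat_in_def by blast
  have minv_in: "mat_in (localise u AW) (n * d) (n * d) (\<lambda>v. minv (e * X v * c))"
  proof (rule LW.minv_in[OF subW[OF eXc_in]])
    show "(\<lambda>v. 1 / det (e * X v * c)) \<in> localise u AW"
      by (rule LW.cong[OF LW.power[OF AW.inverse_in_localise[OF u_in], of d]]) (simp add: det_u power_divide)
  qed (simp add: lin_carrier[OF eXc_lin])
  have "h \<in> localise u AW"
    unfolding h_def[abs_def]
  proof (rule subst_E[OF LW.fun_algebra_axioms f])
    show "mat_in (localise u AW) (n * d) (w * d) (\<lambda>v. e * X v)" by (rule subW[OF eX_in])
    show "mat_in (localise u AW) (w * d) (n * d) (\<lambda>v. X v * c * minv (e * X v * c))"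
      by (rule LW.mat_in_mult[OF subW[OF Xc_in] minv_in])
        (simp_all add: cars mult_carrier_mat[OF X_car] lin_carrier[OF eXc_lin])
    show "(\<lambda>v. cc (snd v)) \<in> localise u AW" if "cc \<in> CY" for cc
      by (rule AWI.localise_sub[OF u_in coord_W(2)[OF that]])
    show "(e * X v, X v * c * minv (e * X v * c), snd v) \<in> E n" if "v \<in> {v \<in> W. u v \<noteq> 0}" for v
    proof (rule EI)
      have v: "v \<in> W" "det (e * X v * c) \<noteq> 0" using that det_u by auto
      show "lin d n w (e * X v)" by (rule lin_mult[OF lins(1) X_lin[OF v(1)]])
      show "lin d w n (X v * c * minv (e * X v * c))"
        by (rule lin_mult[OF lin_mult[OF X_lin[OF v(1)] lins(2)] lin_minv[OF eXc_lin[OF v(1)] v(2)]])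
      show "snd v \<in> Y" using v(1) by (auto simp: W_def)
    qed
  qed
  then obtain N where N: "(\<lambda>v. u v ^ Suc N * h v) \<in> AW" by (auto simp: localise_def)
  have X\<pi>: "X (\<pi> z x) = fst (snd x) * fst x" if "x \<in> E n" for x
    unfolding X_def \<pi>_def fst_conv by (rule add_diff_mat[OF Ecar_mult(1)[OF that] scal_carrier])
  have split: "e * (fst (snd x) * fst x) * c = (e * fst (snd x)) * (fst x * c)" if "x \<in> E n" for x
  proof -
    note a = Ecar(1)[OF that] and b = Ecar(2)[OF that]
    have "e * (fst (snd x) * fst x) * c = e * fst (snd x) * fst x * c"
      using assoc_mult_mat[OF cars(1) b a] by simp
    also have "\<dots> = (e * fst (snd x)) * (fst x * c)"
      by (rule assoc_mult_mat[OF mult_carrier_mat[OF cars(1) b] a cars(2)])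
    finally show ?thesis .
  qed
  have u\<pi>: "u (\<pi> z x) = ?D x" if x: "x \<in> E n" for x
  proof -
    have "ct d n n (e * X (\<pi> z x) * c) = ct d n n (e * fst (snd x)) * ct d n n (fst x * c)"
      unfolding X\<pi>[OF x] split[OF x]
      by (rule ct_mult[OF lin_mult[OF lins(1) EE(2)[OF x]] mult_carrier_mat[OF Ecar(1)[OF x] cars(2)] d])
    then show ?thesis
      unfolding u_def minors_def e_def c_def by (simp add: det_mult[of _ n])
  qed
  have h\<pi>: "h (\<pi> z x) = f (\<gamma> x * fst x, fst (snd x) * minv (\<gamma> x), snd (snd x))" if x: "x \<in> E n" "?D x \<noteq> 0" for x
  proof -
    note a = Ecar(1)[OF x(1)] and b = Ecar(2)[OF x(1)]
    have e1: "e * (fst (snd x) * fst x) = \<gamma> x * fst x"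
      unfolding \<gamma>_def by (rule assoc_mult_mat[OF cars(1) b a, symmetric])
    define K where "K = fst x * c"
    have g: "\<gamma> x \<in> carrier_mat (n * d) (n * d)" and K: "K \<in> carrier_mat (n * d) (n * d)"
      unfolding \<gamma>_def K_def using a b cars by auto
    have gn: "det (\<gamma> x) \<noteq> 0" and Kn: "det K \<noteq> 0"
      using minors_nonzero(5,6)[OF x(1) \<phi> x(2)] by (simp_all add: \<gamma>_def K_def e_def c_def)
    have gK: "\<gamma> x * K \<in> carrier_mat (n * d) (n * d)" "det (\<gamma> x * K) \<noteq> 0"
      using g K gn Kn by (simp_all add: det_mult[OF g K])
    have mg: "minv (\<gamma> x) \<in> carrier_mat (n * d) (n * d)" and mK: "minv (\<gamma> x * K) \<in> carrier_mat (n * d) (n * d)"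
      using g gK by simp_all
    have "minv (\<gamma> x) = minv (\<gamma> x) * (\<gamma> x * K * minv (\<gamma> x * K))"
      using minv(1)[OF gK] mg by simp
    also have "\<gamma> x * K * minv (\<gamma> x * K) = \<gamma> x * (K * minv (\<gamma> x * K))" by (rule assoc_mult_mat[OF g K mK])
    also have "minv (\<gamma> x) * (\<gamma> x * (K * minv (\<gamma> x * K))) = minv (\<gamma> x) * \<gamma> x * (K * minv (\<gamma> x * K))"
      by (rule assoc_mult_mat[OF mg g mult_carrier_mat[OF K mK], symmetric])
    also have "\<dots> = K * minv (\<gamma> x * K)"
      unfolding minv(2)[OF g gn] by (rule left_mult_one_mat[OF mult_carrier_mat[OF K mK]])
    finally have inv_eq: "minv (\<gamma> x) = K * minv (\<gamma> x * K)" .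
    have "X (\<pi> z x) * c * minv (e * X (\<pi> z x) * c) = fst (snd x) * fst x * c * minv (\<gamma> x * K)"
      unfolding X\<pi>[OF x(1)] split[OF x(1)] K_def \<gamma>_def by (rule refl)
    also have "fst (snd x) * fst x * c = fst (snd x) * K"
      unfolding K_def by (rule assoc_mult_mat[OF b a cars(2)])
    also have "fst (snd x) * K * minv (\<gamma> x * K) = fst (snd x) * minv (\<gamma> x)"
      unfolding inv_eq by (rule assoc_mult_mat[OF b K mK])
    finally show ?thesis
      unfolding h_def X\<pi>[OF x(1)] e1 by (simp add: \<pi>_def)
  qed
  have "(\<lambda>x. f x - h (\<pi> z x)) \<in> localise ?D ?I"
    by (rule I.localise_cong[OF fun_ideal.I_uminus[OF I.localise_ideal[OF minors_in] Floc]])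
      (simp add: F_def h\<pi>)
  then obtain K where K: "(\<lambda>x. ?D x ^ Suc K * (f x - h (\<pi> z x))) \<in> ?I" by (auto simp: localise_def)
  define k where "k = max N K"
  define p where "p v = u v ^ Suc k * h v" for v
  have pAW: "p \<in> AW"
    unfolding p_def[abs_def] by (rule AWI.localise_raise[OF u_in N]) (simp add: k_def)
  have pI: "(\<lambda>x. ?D x ^ Suc k * f x - p (\<pi> z x)) \<in> ?I"
  proof (rule I.I_cong[OF I.localise_raise[OF minors_in K, of k]])
    show "K \<le> k" by (simp add: k_def)
    show "?D x ^ Suc k * f x - p (\<pi> z x) = ?D x ^ Suc k * (f x - h (\<pi> z x))" if "x \<in> E n" for x
      unfolding p_def u\<pi>[OF that] by (rule right_diff_distrib[symmetric])
  qed
  show ?thesis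
  proof (intro bexI[of _ u] conjI ballI exI[of _ k] exI[of _ p])
    show "u (\<pi> z x) = ?D x" if "x \<in> E n" for x by (rule u\<pi>[OF that])
  qed (rule pAW pI u_in)+
qed

text \<open>A first fundamental theorem: modulo the equations, every invariant is a polynomial in the entries of
  \<open>b a\<close> and in \<open>y\<close>.\<close>

theorem invariants_generated:
  assumes l: "coeff l 0 \<noteq> 0" and f: "f \<in> A n"
    and inv: "\<And>g. lin d n n g \<Longrightarrow> det g \<noteq> 0 \<Longrightarrow>
      (\<lambda>x. f (g * fst x, fst (snd x) * minv g, snd (snd x)) - f x) \<in> I n l z"
  shows "\<exists>p\<in>AW. (\<lambda>x. f x - p (\<pi> z x)) \<in> I n l z"
proof -
  let ?I = "I n l z"
  interpret I: fun_ideal "E n" "A n" ?I by (rule I_ideal)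
  define P where "P \<phi> u \<longleftrightarrow> u \<in> AW \<and> (\<forall>x\<in>E n. u (\<pi> z x) = minors n \<phi> x) \<and>
    (\<exists>N p. p \<in> AW \<and> (\<lambda>x. minors n \<phi> x ^ Suc N * f x - p (\<pi> z x)) \<in> ?I)" for \<phi> u
  have "\<forall>\<phi>\<in>charts n. \<exists>u. P \<phi> u"
  proof
    fix \<phi> assume "\<phi> \<in> charts n"
    from invariant_chart[OF f inv this] show "\<exists>u. P \<phi> u" unfolding P_def Bex_def .
  qed
  then obtain u where uP: "\<forall>\<phi>\<in>charts n. P \<phi> (u \<phi>)" by (rule bchoice[THEN exE])
  have u: "u \<phi> \<in> AW" "x \<in> E n \<Longrightarrow> u \<phi> (\<pi> z x) = minors n \<phi> x"
    "\<exists>N p. p \<in> AW \<and> (\<lambda>x. minors n \<phi> x ^ Suc N * f x - p (\<pi> z x)) \<in> ?I" if "\<phi> \<in> charts n" for \<phi> x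
    using uP[rule_format, OF that] unfolding P_def by simp_all
  define J where "J = {h \<in> AW. \<exists>p\<in>AW. (\<lambda>x. h (\<pi> z x) * f x - p (\<pi> z x)) \<in> ?I}"
  interpret J: fun_ideal W AW J
  proof
    show "(\<lambda>_. 0) \<in> J" unfolding J_def using AW.const[of 0] I.I_zero by (auto intro!: bexI[of _ "\<lambda>_. 0"])
    show "(\<lambda>v. g v + h v) \<in> J" if "g \<in> J" "h \<in> J" for g h
    proof -
      obtain p q where "p \<in> AW" "(\<lambda>x. g (\<pi> z x) * f x - p (\<pi> z x)) \<in> ?I"
        "q \<in> AW" "(\<lambda>x. h (\<pi> z x) * f x - q (\<pi> z x)) \<in> ?I" using \<open>g \<in> J\<close> \<open>h \<in> J\<close> by (auto simp: J_def)
      note gh = this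
      have "(\<lambda>x. (g (\<pi> z x) + h (\<pi> z x)) * f x - (p (\<pi> z x) + q (\<pi> z x))) \<in> ?I"
        by (rule I.I_cong[OF I.I_add[OF gh(2,4)]]) (simp add: algebra_simps)
      moreover have "g \<in> AW" "h \<in> AW" using that by (auto simp: J_def)
      ultimately show ?thesis
        unfolding J_def using AW.add[OF gh(1,3)] AW.add[of g h]
        by (intro CollectI conjI bexI[of _ "\<lambda>v. p v + q v"])
    qed
    show "(\<lambda>v. g v * h v) \<in> J" if "g \<in> AW" "h \<in> J" for g h
    proof -
      obtain q where "q \<in> AW" "(\<lambda>x. h (\<pi> z x) * f x - q (\<pi> z x)) \<in> ?I" using \<open>h \<in> J\<close> by (auto simp: J_def)
      note h = this
      have "(\<lambda>x. (g (\<pi> z x) * h (\<pi> z x)) * f x - (g (\<pi> z x) * q (\<pi> z x))) \<in> ?I"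
        by (rule I.I_cong[OF I.I_mult[OF \<pi>_pullback[OF that(1)] h(2)]]) (simp add: algebra_simps)
      moreover have "h \<in> AW" using that by (auto simp: J_def)
      ultimately show ?thesis
        unfolding J_def using AW.mult[OF that(1) h(1)] AW.mult[OF that(1), of h]
        by (intro CollectI conjI bexI[of _ "\<lambda>v. g v * q v"])
    qed
    show "h \<in> J" if "g \<in> J" "\<And>v. v \<in> W \<Longrightarrow> h v = g v" for g h
    proof -
      obtain p where "p \<in> AW" "(\<lambda>x. g (\<pi> z x) * f x - p (\<pi> z x)) \<in> ?I" using \<open>g \<in> J\<close> by (auto simp: J_def)
      note g = this
      have "(\<lambda>x. h (\<pi> z x) * f x - p (\<pi> z x)) \<in> ?I"
        by (rule I.I_cong[OF g(2)]) (simp add: that(2)[OF \<pi>_W])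
      moreover have "h \<in> AW" using AW.cong[of g h] that by (auto simp: J_def)
      ultimately show ?thesis
        unfolding J_def using g(1) by blast
    qed
  qed
  have "\<exists>k. (\<lambda>v. u \<phi> v ^ k) \<in> J" if \<phi>: "\<phi> \<in> charts n" for \<phi>
  proof -
    from u(3)[OF \<phi>] obtain N p where p: "p \<in> AW" "(\<lambda>x. minors n \<phi> x ^ Suc N * f x - p (\<pi> z x)) \<in> ?I" by blast
    have "(\<lambda>x. u \<phi> (\<pi> z x) ^ Suc N * f x - p (\<pi> z x)) \<in> ?I"
      by (rule I.I_cong[OF p(2)]) (simp add: u(2)[OF \<phi>])
    then have "(\<lambda>v. u \<phi> v ^ Suc N) \<in> J"
      unfolding J_def using p(1) AW.power[OF u(1)[OF \<phi>], of "Suc N"] by blast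
    then show ?thesis by blast
  qed
  then obtain k where "(\<lambda>v. (\<Sum>\<phi>\<in>charts n. u \<phi> v) ^ k) \<in> J"
    using J.power_sum_in_ideal[OF finite_charts[of n], of u] u(1) by blast
  then obtain p where p: "p \<in> AW" "(\<lambda>x. (\<Sum>\<phi>\<in>charts n. u \<phi> (\<pi> z x)) ^ k * f x - p (\<pi> z x)) \<in> ?I"
    by (auto simp: J_def)
  have "(\<lambda>x. (\<Sum>\<phi>\<in>charts n. minors n \<phi> x) ^ k * f x - p (\<pi> z x)) \<in> ?I"
    by (rule I.I_cong[OF p(2)]) (simp add: u(2))
  from unit_from_minors[OF l f this] obtain t where t: "t \<noteq> 0" "(\<lambda>x. t * f x - p (\<pi> z x)) \<in> ?I" by blast
  have "(\<lambda>x. f x - 1 / t * p (\<pi> z x)) \<in> ?I"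
    using I.I_scale[OF t(2), of "1 / t"] t(1) by (simp add: algebra_simps)
  moreover have "(\<lambda>v. 1 / t * p v) \<in> AW" by (rule AW.scale[OF p(1)])
  ultimately show ?thesis by (intro bexI[of _ "\<lambda>v. 1 / t * p v"])
qed

end

section \<open>Linear maps over a truncated polynomial subring\<close>

lemma eps_pow_top: "eps_mat n d ^\<^sub>m d = 0\<^sub>m (n * d) (n * d)"
proof (rule eq_matI)
  fix i j assume "i < dim_row (0\<^sub>m (n * d) (n * d) :: complex mat)" "j < dim_col (0\<^sub>m (n * d) (n * d) :: complex mat)"
  then have ij: "i < n * d" "j < n * d" by auto
  then have d: "0 < d" by (auto intro: Nat.gr0I)
  show "(eps_mat n d ^\<^sub>m d) $$ (i, j) = 0\<^sub>m (n * d) (n * d) $$ (i, j)"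
    using ij d by (simp add: eps_pow_entry)
qed auto

lemma eps_pow_add: "eps_mat n d ^\<^sub>m k * eps_mat n d ^\<^sub>m l = eps_mat n d ^\<^sub>m (k + l)"
proof (induction l)
  case 0
  show ?case by (simp add: right_mult_one_mat[OF eps_pow_carrier])
next
  case (Suc l)
  have "eps_mat n d ^\<^sub>m k * eps_mat n d ^\<^sub>m Suc l = eps_mat n d ^\<^sub>m k * eps_mat n d ^\<^sub>m l * eps_mat n d"
    unfolding pow_mat.simps by (rule assoc_mult_mat[symmetric, OF eps_pow_carrier eps_pow_carrier eps_carrier])
  then show ?case unfolding Suc by simp
qed

lemma eps_pow_mult_commute:
  assumes M: "M \<in> carrier_mat (n' * d') (n * d)"
    and e: "M * eps_mat n d ^\<^sub>m e = eps_mat n' d' ^\<^sub>m f * M"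
  shows "M * eps_mat n d ^\<^sub>m (k * e) = eps_mat n' d' ^\<^sub>m (k * f) * M"
proof (induction k)
  case 0
  show ?case by (simp add: left_mult_one_mat[OF M] right_mult_one_mat[OF M])
next
  case (Suc k)
  have "M * eps_mat n d ^\<^sub>m (Suc k * e) = M * (eps_mat n d ^\<^sub>m e * eps_mat n d ^\<^sub>m (k * e))"
    by (simp add: eps_pow_add)
  also have "\<dots> = M * eps_mat n d ^\<^sub>m e * eps_mat n d ^\<^sub>m (k * e)"
    by (rule assoc_mult_mat[symmetric, OF M eps_pow_carrier eps_pow_carrier])
  also have "\<dots> = eps_mat n' d' ^\<^sub>m f * (M * eps_mat n d ^\<^sub>m (k * e))"
    unfolding e by (rule assoc_mult_mat[OF eps_pow_carrier M eps_pow_carrier])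
  also have "\<dots> = eps_mat n' d' ^\<^sub>m f * eps_mat n' d' ^\<^sub>m (k * f) * M"
    unfolding Suc by (rule assoc_mult_mat[symmetric, OF eps_pow_carrier eps_pow_carrier M])
  also have "\<dots> = eps_mat n' d' ^\<^sub>m (Suc k * f) * M" by (simp add: eps_pow_add)
  finally show ?case .
qed

lemma times_scal_entry:
  assumes M: "M \<in> carrier_mat r (n * d)" and ij: "i < r" "j < n * d"
  shows "(M * scal_mat n d c p) $$ (i, j) = (\<Sum>k<c. coeff p k * (M * eps_mat n d ^\<^sub>m (k * (d div c))) $$ (i, j))"
proof -
  have "(M * scal_mat n d c p) $$ (i, j) = (\<Sum>l<n * d. M $$ (i, l) * scal_mat n d c p $$ (l, j))"
    by (rule times_mat_entry[OF M scal_carrier ij])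
  also have "\<dots> = (\<Sum>l<n * d. \<Sum>k<c. coeff p k * (M $$ (i, l) * (eps_mat n d ^\<^sub>m (k * (d div c))) $$ (l, j)))"
    using ij by (intro sum.cong refl) (simp add: scal_mat_def sum_distrib_left ac_simps)
  also have "\<dots> = (\<Sum>k<c. coeff p k * (\<Sum>l<n * d. M $$ (i, l) * (eps_mat n d ^\<^sub>m (k * (d div c))) $$ (l, j)))"
    by (subst sum.swap) (simp add: sum_distrib_left)
  also have "\<dots> = (\<Sum>k<c. coeff p k * (M * eps_mat n d ^\<^sub>m (k * (d div c))) $$ (i, j))"
    by (intro sum.cong refl) (simp only: times_mat_entry[OF M eps_pow_carrier ij])
  finally show ?thesis .
qed

lemma scal_times_entry:
  assumes M: "M \<in> carrier_mat (n * d) r" and ij: "i < n * d" "j < r"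
  shows "(scal_mat n d c p * M) $$ (i, j) = (\<Sum>k<c. coeff p k * (eps_mat n d ^\<^sub>m (k * (d div c)) * M) $$ (i, j))"
proof -
  have "(scal_mat n d c p * M) $$ (i, j) = (\<Sum>l<n * d. scal_mat n d c p $$ (i, l) * M $$ (l, j))"
    by (rule times_mat_entry[OF scal_carrier M ij])
  also have "\<dots> = (\<Sum>l<n * d. \<Sum>k<c. coeff p k * ((eps_mat n d ^\<^sub>m (k * (d div c))) $$ (i, l) * M $$ (l, j)))"
    using ij by (intro sum.cong refl) (simp add: scal_mat_def sum_distrib_left sum_distrib_right ac_simps)
  also have "\<dots> = (\<Sum>k<c. coeff p k * (\<Sum>l<n * d. (eps_mat n d ^\<^sub>m (k * (d div c))) $$ (i, l) * M $$ (l, j)))"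
    by (subst sum.swap) (simp add: sum_distrib_left)
  also have "\<dots> = (\<Sum>k<c. coeff p k * (eps_mat n d ^\<^sub>m (k * (d div c)) * M) $$ (i, j))"
    by (intro sum.cong refl) (simp only: times_mat_entry[OF eps_pow_carrier M ij])
  finally show ?thesis .
qed

lemma Hom_trunc_iff:
  assumes c: "0 < c" "c dvd d" "c dvd d'"
  shows "B \<in> Hom_trunc c n d n' d' \<longleftrightarrow> B \<in> carrier_mat (n' * d') (n * d) \<and>
    B * eps_mat n d ^\<^sub>m (d div c) = eps_mat n' d' ^\<^sub>m (d' div c) * B"
proof
  assume B: "B \<in> Hom_trunc c n d n' d'"
  then have car: "B \<in> carrier_mat (n' * d') (n * d)" by (simp add: Hom_trunc_def)
  have "B * eps_mat n d ^\<^sub>m (d div c) = eps_mat n' d' ^\<^sub>m (d' div c) * B"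
  proof (cases "c = 1")
    case True
    then show ?thesis using car by (simp add: eps_pow_top left_mult_zero_mat[of _ _ "n * d"] right_mult_zero_mat[of _ "n' * d'"])
  next
    case False
    have "monom 1 1 \<in> carrier (trunc_ring c)"
      using False c(1) by (simp add: trunc_ring_def degree_monom_eq)
    then have comm: "B * scal_mat n d c (monom 1 1) = scal_mat n' d' c (monom 1 1) * B"
      using B by (simp add: Hom_trunc_def)
    have sc: "scal_mat m e c (monom 1 1) = eps_mat m e ^\<^sub>m (e div c)" for m e
    proof (rule eq_matI)
      fix i j assume "i < dim_row (eps_mat m e ^\<^sub>m (e div c))" "j < dim_col (eps_mat m e ^\<^sub>m (e div c))"
      then have ij: "i < m * e" "j < m * e" by (auto split: if_splits)
      have "scal_mat m e c (monom 1 1) $$ (i, j) =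
          (\<Sum>k<c. coeff (monom 1 1) k * (eps_mat m e ^\<^sub>m (k * (e div c))) $$ (i, j))"
        using ij by (simp add: scal_mat_def)
      also have "\<dots> = (\<Sum>k<c. if k = 1 then (eps_mat m e ^\<^sub>m (1 * (e div c))) $$ (i, j) else 0)"
        by (intro sum.cong) auto
      finally show "scal_mat m e c (monom 1 1) $$ (i, j) = (eps_mat m e ^\<^sub>m (e div c)) $$ (i, j)"
        using False c(1) by (simp add: sum.delta)
    qed (auto simp: scal_mat_def)
    show ?thesis using comm unfolding sc .
  qed
  then show "B \<in> carrier_mat (n' * d') (n * d) \<and>
    B * eps_mat n d ^\<^sub>m (d div c) = eps_mat n' d' ^\<^sub>m (d' div c) * B" using car by simp
next
  assume "B \<in> carrier_mat (n' * d') (n * d) \<and>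
    B * eps_mat n d ^\<^sub>m (d div c) = eps_mat n' d' ^\<^sub>m (d' div c) * B"
  then have car: "B \<in> carrier_mat (n' * d') (n * d)"
    and comm: "B * eps_mat n d ^\<^sub>m (d div c) = eps_mat n' d' ^\<^sub>m (d' div c) * B" by auto
  have "B * scal_mat n d c p = scal_mat n' d' c p * B" for p
  proof (rule eq_matI)
    fix i j assume "i < dim_row (scal_mat n' d' c p * B)" "j < dim_col (scal_mat n' d' c p * B)"
    then have ij: "i < n' * d'" "j < n * d" using car carrier_matD[OF scal_carrier] by auto
    show "(B * scal_mat n d c p) $$ (i, j) = (scal_mat n' d' c p * B) $$ (i, j)"
      unfolding times_scal_entry[OF car ij] scal_times_entry[OF car ij] eps_pow_mult_commute[OF car comm]
      by (rule refl)
  qed (use car carrier_matD[OF scal_carrier] in auto)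
  then show "B \<in> Hom_trunc c n d n' d'" using car by (simp add: Hom_trunc_def)
qed

lemma Hom_trunc_lin: "0 < d \<Longrightarrow> M \<in> Hom_trunc d n d n d \<longleftrightarrow> lin d n n M"
  unfolding Hom_trunc_iff[OF _ dvd_refl dvd_refl] by (simp add: lin_def left_mult_one_mat[OF eps_carrier])

lemma End_trunc_simps [simp]:
  "mult (End_trunc n d) = (*)" "one (End_trunc n d) = 1\<^sub>m (n * d)"
  "carrier (End_trunc n d) = Hom_trunc d n d n d"
  by (simp_all add: End_trunc_def ring_mat_def)

lemma End_trunc_monoid:
  assumes d: "0 < d"
  shows "Group.monoid (End_trunc n d)"
proof (rule Group.monoid.intro)
  show "\<one>\<^bsub>End_trunc n d\<^esub> \<in> carrier (End_trunc n d)" by (simp add: Hom_trunc_lin[OF d] lin_one)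
  show "x \<otimes>\<^bsub>End_trunc n d\<^esub> y \<in> carrier (End_trunc n d)"
    if "x \<in> carrier (End_trunc n d)" "y \<in> carrier (End_trunc n d)" for x y
    using that by (simp add: Hom_trunc_lin[OF d] lin_mult)
  show "x \<otimes>\<^bsub>End_trunc n d\<^esub> y \<otimes>\<^bsub>End_trunc n d\<^esub> z = x \<otimes>\<^bsub>End_trunc n d\<^esub> (y \<otimes>\<^bsub>End_trunc n d\<^esub> z)"
    if "x \<in> carrier (End_trunc n d)" "y \<in> carrier (End_trunc n d)" "z \<in> carrier (End_trunc n d)" for x y z
    using that assoc_mult_mat[OF lin_carrier[of d n n x] lin_carrier[of d n n y] lin_carrier[of d n n z]]
    by (simp add: Hom_trunc_lin[OF d])
  show "\<one>\<^bsub>End_trunc n d\<^esub> \<otimes>\<^bsub>End_trunc n d\<^esub> x = x" "x \<otimes>\<^bsub>End_trunc n d\<^esub> \<one>\<^bsub>End_trunc n d\<^esub> = x"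
    if "x \<in> carrier (End_trunc n d)" for x
    using that left_mult_one_mat[OF lin_carrier[of d n n x]] right_mult_one_mat[OF lin_carrier[of d n n x]]
    by (simp_all add: Hom_trunc_lin[OF d])
qed

lemma End_trunc_Units:
  assumes d: "0 < d"
  shows "M \<in> Units (End_trunc n d) \<longleftrightarrow> lin d n n M \<and> (\<exists>N. lin d n n N \<and> M * N = 1\<^sub>m (n * d) \<and> N * M = 1\<^sub>m (n * d))"
  by (auto simp: Units_def Hom_trunc_lin[OF d])

section \<open>Reversal of arrows and the group action\<close>

lemma rev_simps [simp]:
  "rev_arrow (rev_arrow h) = h" "src Q (rev_arrow h) = tgt Q h" "tgt Q (rev_arrow h) = src Q h"
  "sgn_arrow (rev_arrow h) = - sgn_arrow h" "sgn_arrow h * sgn_arrow h = 1" "sgn_arrow h * (sgn_arrow h * z) = z"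
  "mult_h Q d (rev_arrow h) = mult_h Q d h"
  by (cases h; simp add: mult_h_def gcd.commute; fail)+

lemma rev_in_dbl [simp]: "rev_arrow h \<in> dbl Q \<longleftrightarrow> h \<in> dbl Q"
  by (cases h) (auto simp: dbl_def)

locale gauge_setting =
  fixes Q :: "('v, 'e) pre_digraph" and d :: "'v \<Rightarrow> nat" and v :: "'v \<Rightarrow> nat"
  assumes fin: "fin_digraph Q" and dpos: "\<And>i. i \<in> verts Q \<Longrightarrow> 0 < d i"
begin

lemma finite_dbl: "finite (dbl Q)"
  using fin_digraph.finite_arcs[OF fin] by (simp add: dbl_def)

lemma finite_verts: "finite (verts Q)"
  by (rule fin_digraph.finite_verts[OF fin])

lemma ends_in_verts: "h \<in> dbl Q \<Longrightarrow> src Q h \<in> verts Q" "h \<in> dbl Q \<Longrightarrow> tgt Q h \<in> verts Q"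
proof -
  interpret fin_digraph Q by (rule fin)
  show "h \<in> dbl Q \<Longrightarrow> src Q h \<in> verts Q" "h \<in> dbl Q \<Longrightarrow> tgt Q h \<in> verts Q"
    by (cases h; auto simp: dbl_def)+
qed

lemma mult_h_pos: "h \<in> dbl Q \<Longrightarrow> 0 < mult_h Q d h"
  using dpos[OF ends_in_verts(1)] by (simp add: mult_h_def)

lemma mult_h_dvd: "mult_h Q d h dvd d (src Q h)" "mult_h Q d h dvd d (tgt Q h)"
  by (simp_all add: mult_h_def)

definition comm_h :: "'e + 'e \<Rightarrow> complex mat \<Rightarrow> bool" where
  "comm_h h M \<longleftrightarrow> M \<in> carrier_mat (v (tgt Q h) * d (tgt Q h)) (v (src Q h) * d (src Q h)) \<and>
    M * eps_mat (v (src Q h)) (d (src Q h)) ^\<^sub>m (f_h Q d (rev_arrow h)) =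
    eps_mat (v (tgt Q h)) (d (tgt Q h)) ^\<^sub>m (f_h Q d h) * M"

lemma rep_space_iff:
  "B \<in> rep_space Q d v \<longleftrightarrow> B \<in> extensional (dbl Q) \<and> (\<forall>h\<in>dbl Q. comm_h h (B h))"
proof -
  have "B h \<in> Hom_trunc (mult_h Q d h) (v (src Q h)) (d (src Q h)) (v (tgt Q h)) (d (tgt Q h)) \<longleftrightarrow> comm_h h (B h)"
    if "h \<in> dbl Q" for h
    unfolding Hom_trunc_iff[OF mult_h_pos[OF that] mult_h_dvd] comm_h_def f_h_def by simp
  then show ?thesis unfolding rep_space_def PiE_iff by blast
qed

lemma comm_h_mult:
  assumes M: "comm_h h M" and g: "lin (d (tgt Q h)) (v (tgt Q h)) (v (tgt Q h)) g"
    and k: "lin (d (src Q h)) (v (src Q h)) (v (src Q h)) k"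
  shows "comm_h h (g * M * k)"
proof -
  let ?s = "v (src Q h) * d (src Q h)" and ?t = "v (tgt Q h) * d (tgt Q h)"
  let ?es = "eps_mat (v (src Q h)) (d (src Q h)) ^\<^sub>m (f_h Q d (rev_arrow h))"
  let ?et = "eps_mat (v (tgt Q h)) (d (tgt Q h)) ^\<^sub>m (f_h Q d h)"
  have Mc: "M \<in> carrier_mat ?t ?s" and Mh: "M * ?es = ?et * M" using M by (auto simp: comm_h_def)
  have gc: "g \<in> carrier_mat ?t ?t" and kc: "k \<in> carrier_mat ?s ?s" using g k by (auto intro: lin_carrier)
  have es: "?es \<in> carrier_mat ?s ?s" and et: "?et \<in> carrier_mat ?t ?t" by auto
  have gM: "g * M \<in> carrier_mat ?t ?s" using gc Mc by simp
  have "g * M * k * ?es = g * M * (k * ?es)" by (rule assoc_mult_mat[OF gM kc es])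
  also have "k * ?es = ?es * k" by (rule lin_eps_pow[OF k])
  also have "g * M * (?es * k) = g * M * ?es * k" by (rule assoc_mult_mat[OF gM es kc, symmetric])
  also have "g * M * ?es = g * (M * ?es)" by (rule assoc_mult_mat[OF gc Mc es])
  also have "g * (M * ?es) = g * ?et * M" unfolding Mh by (rule assoc_mult_mat[OF gc et Mc, symmetric])
  also have "g * ?et = ?et * g" by (rule lin_eps_pow[OF g])
  also have "?et * g * M = ?et * (g * M)" by (rule assoc_mult_mat[OF et gc Mc])
  also have "?et * (g * M) * k = ?et * (g * M * k)" by (rule assoc_mult_mat[OF et gM kc])
  finally show ?thesis using gM kc by (simp add: comm_h_def)
qed

abbreviation G where "G \<equiv> gauge_group Q d v"

lemma gauge_group: "group G"
  unfolding gauge_group_def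
  by (intro product_group monoid.units_group End_trunc_monoid dpos)

lemma gauge_carrier:
  "g \<in> carrier G \<longleftrightarrow> g \<in> extensional (verts Q) \<and>
    (\<forall>i\<in>verts Q. lin (d i) (v i) (v i) (g i) \<and>
      (\<exists>N. lin (d i) (v i) (v i) N \<and> g i * N = 1\<^sub>m (v i * d i) \<and> N * g i = 1\<^sub>m (v i * d i)))"
  unfolding gauge_group_def carrier_product_group PiE_iff units_of_carrier
  using End_trunc_Units[OF dpos] by blast

lemma gauge_lin: "g \<in> carrier G \<Longrightarrow> i \<in> verts Q \<Longrightarrow> lin (d i) (v i) (v i) (g i)"
  by (simp add: gauge_carrier)

lemma gauge_mult: "i \<in> verts Q \<Longrightarrow> (g \<otimes>\<^bsub>G\<^esub> h) i = g i * h i"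
  by (simp add: gauge_group_def units_of_mult)

lemma gauge_one: "i \<in> verts Q \<Longrightarrow> \<one>\<^bsub>G\<^esub> i = 1\<^sub>m (v i * d i)"
  by (simp add: gauge_group_def units_of_one)

lemma gauge_inv:
  assumes g: "g \<in> carrier G"
  shows "inv\<^bsub>G\<^esub> g \<in> carrier G" "i \<in> verts Q \<Longrightarrow> g i * (inv\<^bsub>G\<^esub> g) i = 1\<^sub>m (v i * d i)"
    "i \<in> verts Q \<Longrightarrow> (inv\<^bsub>G\<^esub> g) i * g i = 1\<^sub>m (v i * d i)"
proof -
  interpret group G by (rule gauge_group)
  show "inv\<^bsub>G\<^esub> g \<in> carrier G" using g by simp
  show "g i * (inv\<^bsub>G\<^esub> g) i = 1\<^sub>m (v i * d i)" if "i \<in> verts Q"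
    unfolding gauge_mult[OF that, symmetric] r_inv[OF g] by (rule gauge_one[OF that])
  show "(inv\<^bsub>G\<^esub> g) i * g i = 1\<^sub>m (v i * d i)" if "i \<in> verts Q"
    unfolding gauge_mult[OF that, symmetric] l_inv[OF g] by (rule gauge_one[OF that])
qed

lemma gauge_act_rep:
  assumes g: "g \<in> carrier G" and B: "B \<in> rep_space Q d v"
  shows "gauge_act Q d v g B \<in> rep_space Q d v"
  unfolding rep_space_iff
proof
  show "gauge_act Q d v g B \<in> extensional (dbl Q)" by (simp add: gauge_act_def)
  show "\<forall>h\<in>dbl Q. comm_h h (gauge_act Q d v g B h)"
  proof
    fix h assume h: "h \<in> dbl Q"
    have "comm_h h (B h)" using B h by (simp add: rep_space_iff)
    then show "comm_h h (gauge_act Q d v g B h)"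
      using h unfolding gauge_act_def
      by (simp add: comm_h_mult gauge_lin[OF g] gauge_lin[OF gauge_inv(1)[OF g]] ends_in_verts)
  qed
qed

lemma rep_carrier: "B \<in> rep_space Q d v \<Longrightarrow> h \<in> dbl Q \<Longrightarrow>
    B h \<in> carrier_mat (v (tgt Q h) * d (tgt Q h)) (v (src Q h) * d (src Q h))"
  by (simp add: rep_space_iff comm_h_def)

lemma gauge_act_inv:
  assumes g: "g \<in> carrier G" and B: "B \<in> rep_space Q d v"
  shows "gauge_act Q d v g (gauge_act Q d v (inv\<^bsub>G\<^esub> g) B) = B"
proof (rule ext)
  interpret group G by (rule gauge_group)
  fix h
  show "gauge_act Q d v g (gauge_act Q d v (inv\<^bsub>G\<^esub> g) B) h = B h"
  proof (cases "h \<in> dbl Q")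
    case False
    moreover have "B h = undefined"
      using B False unfolding rep_space_iff by (intro extensional_arb[of B "dbl Q"]) auto
    ultimately show ?thesis by (simp add: gauge_act_def)
  next
    case h: True
    let ?s = "v (src Q h) * d (src Q h)" and ?t = "v (tgt Q h) * d (tgt Q h)"
    note e = ends_in_verts[OF h]
    have gi: "inv\<^bsub>G\<^esub> (inv\<^bsub>G\<^esub> g) = g" using g by simp
    define t where "t = g (tgt Q h)"
    define s where "s = g (src Q h)"
    define t' where "t' = (inv\<^bsub>G\<^esub> g) (tgt Q h)"
    define s' where "s' = (inv\<^bsub>G\<^esub> g) (src Q h)"
    note defs = t_def s_def t'_def s'_def
    have c: "t \<in> carrier_mat ?t ?t" "s \<in> carrier_mat ?s ?s" "t' \<in> carrier_mat ?t ?t" "s' \<in> carrier_mat ?s ?s"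
      unfolding defs by (rule lin_carrier gauge_lin gauge_inv(1)[OF g] g e)+
    have o: "t * t' = 1\<^sub>m ?t" "s * s' = 1\<^sub>m ?s"
      unfolding defs by (rule gauge_inv(2)[OF g] e)+
    have Bc: "B h \<in> carrier_mat ?t ?s" by (rule rep_carrier[OF B h])
    have "gauge_act Q d v g (gauge_act Q d v (inv\<^bsub>G\<^esub> g) B) h = t * (t' * B h * s) * s'"
      using h by (simp add: gauge_act_def gi defs)
    also have "t * (t' * B h * s) = t * (t' * B h) * s"
      by (rule assoc_mult_mat[symmetric, OF c(1) mult_carrier_mat[OF c(3) Bc] c(2)])
    also have "t * (t' * B h) = t * t' * B h"
      by (rule assoc_mult_mat[symmetric, OF c(1) c(3) Bc])
    also have "t * t' * B h = B h" unfolding o by (rule left_mult_one_mat[OF Bc])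
    also have "B h * s * s' = B h * (s * s')" by (rule assoc_mult_mat[OF Bc c(2) c(4)])
    also have "\<dots> = B h" unfolding o by (rule right_mult_one_mat[OF Bc])
    finally show ?thesis .
  qed
qed

end

section \<open>The arrows at a vertex as a pair of linear maps\<close>

locale vertex_setting =
  fixes Q :: "('v, 'e) pre_digraph" and d :: "'v \<Rightarrow> nat" and j :: 'v and v0 :: "'v \<Rightarrow> nat"
  assumes fin: "fin_digraph Q" and loopfree: "loopfree_digraph Q"
    and dpos: "\<And>i. i \<in> verts Q \<Longrightarrow> 0 < d i" and j: "j \<in> verts Q"
begin

sublocale gs: gauge_setting Q d "v0(j := n)" for n
  by (rule gauge_setting.intro[OF fin dpos])

definition hin :: "('e + 'e) set" where
  "hin = {h \<in> dbl Q. tgt Q h = j}"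

abbreviation D where "D \<equiv> d j"
abbreviation ff where "ff \<equiv> f_h Q d"
abbreviation ee where "ee h \<equiv> f_h Q d (rev_arrow h)"
abbreviation cc where "cc \<equiv> mult_h Q d"
abbreviation dk where "dk h \<equiv> d (src Q h)"
abbreviation vk where "vk h \<equiv> v0 (src Q h)"
abbreviation N where "N h \<equiv> eps_mat (vk h) (dk h)"

lemma D_pos: "0 < D" by (rule dpos[OF j])

lemma finite_hin: "finite hin"
  using gs.finite_dbl unfolding hin_def by simp

lemma hinD: "h \<in> hin \<Longrightarrow> h \<in> dbl Q" "h \<in> hin \<Longrightarrow> tgt Q h = j"
  by (auto simp: hin_def)

lemma no_loops: "h \<in> dbl Q \<Longrightarrow> src Q h \<noteq> tgt Q h"
proof -
  interpret loopfree_digraph Q by (rule loopfree)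
  show "h \<in> dbl Q \<Longrightarrow> src Q h \<noteq> tgt Q h"
    using no_loops by (cases h) (auto simp: dbl_def dest: not_sym[OF no_loops])
qed

lemma hin_src: "h \<in> hin \<Longrightarrow> src Q h \<noteq> j" "h \<in> hin \<Longrightarrow> src Q h \<in> verts Q"
  using no_loops[of h] gs.ends_in_verts(1)[of h] by (auto simp: hin_def)

lemma hin_mult:
  assumes "h \<in> hin"
  shows "ff h * cc h = D" "ee h * cc h = dk h" "0 < cc h" "0 < ff h" "0 < ee h" "0 < dk h"
proof -
  show 1: "ff h * cc h = D" "ee h * cc h = dk h"
    using gs.mult_h_dvd[of h] hinD[OF assms] by (simp_all add: f_h_def)
  show "0 < cc h" by (rule gs.mult_h_pos[OF hinD(1)[OF assms]])
  show 2: "0 < dk h" by (rule dpos[OF hin_src(2)[OF assms]])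
  show "0 < ff h" "0 < ee h" using 1 2 D_pos by (auto intro: Nat.gr0I)
qed

definition J :: "(('e + 'e) \<times> nat \<times> nat) set" where
  "J = (SIGMA h:hin. {..<ff h} \<times> {..<vk h * dk h})"

definition U :: "(('e + 'e) \<times> nat \<times> nat) set" where
  "U = (SIGMA h:hin. {..<vk h} \<times> {..<ee h})"

definition w :: nat where
  "w = card U"

lemma w_eq: "w = (\<Sum>h\<in>hin. vk h * ee h)"
  unfolding w_def U_def using finite_hin by (subst card_SigmaI) auto

definition \<nu> where
  "\<nu> = (SOME g. bij_betw g U {0..<w})"

lemma \<nu>: "bij_betw \<nu> U {0..<w}"
  unfolding \<nu>_def w_def
  by (rule someI_ex[of "\<lambda>g. bij_betw g U {0..<card U}"], rule ex_bij_betw_finite_nat)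
    (simp add: U_def finite_hin)

text \<open>The induced module is \<open>\<Oplus>\<close> over arrows \<open>h\<close> into \<open>j\<close> and \<open>m < ff h\<close> of copies of the space at
  the source, on which \<open>\<epsilon>\<close> raises \<open>m\<close>, and returns to \<open>m = 0\<close> with a factor \<open>N h ^ ee h\<close> at the end. The
  \<open>\<epsilon>\<close>-chains start at \<open>m = 0\<close> and at indices below \<open>ee h\<close> in their block, and numbering them identifies the
  module with a free one of rank \<open>w\<close>.\<close>

definition lab where
  "lab h i = (h, i div dk h, (i mod dk h) mod ee h)"

definition pos where
  "pos h m i = ff h * ((i mod dk h) div ee h) + m"

definition \<iota> where
  "\<iota> h m i = \<nu> (lab h i) * D + pos h m i"

lemma JI: "h \<in> hin \<Longrightarrow> m < ff h \<Longrightarrow> i < vk h * dk h \<Longrightarrow> (h, m, i) \<in> J"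
  by (simp add: J_def)

lemma pos_less: "h \<in> hin \<Longrightarrow> m < ff h \<Longrightarrow> pos h m i < D"
proof -
  assume h: "h \<in> hin" and m: "m < ff h"
  note hm = hin_mult[OF h]
  have "(i mod dk h) div ee h < cc h"
    using hm by (intro less_mult_imp_div_less) (metis mod_less_divisor mult.commute)
  then have "(i mod dk h) div ee h * ff h + m < cc h * ff h" by (rule idx_less[OF _ m])
  then show ?thesis using hm(1) unfolding pos_def by (metis mult.commute)
qed

lemma lab_in: "h \<in> hin \<Longrightarrow> i < vk h * dk h \<Longrightarrow> lab h i \<in> U"
  using hin_mult[of h] by (auto simp: lab_def U_def less_mult_imp_div_less)

lemma \<nu>_inj: "x \<in> U \<Longrightarrow> y \<in> U \<Longrightarrow> \<nu> x = \<nu> y \<longleftrightarrow> x = y"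
  using \<nu> by (auto simp: bij_betw_def inj_on_def)

lemma \<nu>_less: "x \<in> U \<Longrightarrow> \<nu> x < w"
  using \<nu> by (auto simp: bij_betw_def)

lemma \<iota>_less: "h \<in> hin \<Longrightarrow> m < ff h \<Longrightarrow> i < vk h * dk h \<Longrightarrow> \<iota> h m i < w * D"
  unfolding \<iota>_def by (intro idx_less \<nu>_less lab_in pos_less)

lemma \<iota>_div_mod:
  assumes "h \<in> hin" "m < ff h"
  shows "\<iota> h m i div D = \<nu> (lab h i)" "\<iota> h m i mod D = pos h m i"
  unfolding \<iota>_def using pos_less[OF assms] by simp_all

lemma lab_eq:
  assumes h: "h \<in> hin" and i: "i < vk h * dk h" and h': "h' \<in> hin" and i': "i' < vk h' * dk h'"
  shows "\<nu> (lab h' i') = \<nu> (lab h i) \<longleftrightarrow>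
    h' = h \<and> i' div dk h = i div dk h \<and> i' mod dk h mod ee h = i mod dk h mod ee h"
  unfolding \<nu>_inj[OF lab_in[OF h' i'] lab_in[OF h i]] by (auto simp: lab_def)

lemma mod_shift_eq:
  assumes "0 < (f :: nat)" "m' < f"
  shows "f * q' + m' = f * q + m + l \<longleftrightarrow> m' = (m + l) mod f \<and> q' = q + (m + l) div f"
proof
  assume eq: "f * q' + m' = f * q + m + l"
  have m': "m' = (m + l) mod f"
  proof -
    have "m' = (f * q' + m') mod f" using assms by simp
    also have "\<dots> = (m + l) mod f" unfolding eq by (simp add: add.assoc)
    finally show ?thesis .
  qed
  have "q' = (f * q' + m') div f" using assms by simp
  also have "\<dots> = q + (m + l) div f" unfolding eq using assms(1) by (simp add: add.assoc)
  finally show "m' = (m + l) mod f \<and> q' = q + (m + l) div f" using m' by simp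
next
  assume "m' = (m + l) mod f \<and> q' = q + (m + l) div f"
  then have "f * q' + m' = f * q + (f * ((m + l) div f) + (m + l) mod f)" by (simp add: distrib_left)
  also have "\<dots> = f * q + m + l" by simp
  finally show "f * q' + m' = f * q + m + l" .
qed

lemma index_decompose:
  fixes e :: nat
  assumes e: "0 < e"
  shows "i' = i + e * L \<and> i' div n = i div n \<longleftrightarrow>
    i' div n = i div n \<and> i' mod n mod e = i mod n mod e \<and> i' mod n div e = i mod n div e + L"
proof (cases "i' div n = i div n")
  case True
  have "i' = i' div n * n + i' mod n" "i = i div n * n + i mod n" by simp_all
  then have "i' = i + e * L \<longleftrightarrow> i' mod n = i mod n + e * L" using True by (metis add.assoc add_left_cancel)
  also have "\<dots> \<longleftrightarrow> i' mod n mod e = i mod n mod e \<and> i' mod n div e = i mod n div e + L"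
  proof
    assume "i' mod n = i mod n + e * L"
    then show "i' mod n mod e = i mod n mod e \<and> i' mod n div e = i mod n div e + L" using e by simp
  next
    assume a: "i' mod n mod e = i mod n mod e \<and> i' mod n div e = i mod n div e + L"
    have "i' mod n = e * (i' mod n div e) + i' mod n mod e" by simp
    also have "\<dots> = e * (i mod n div e) + i mod n mod e + e * L" using a by (simp add: distrib_left)
    finally show "i' mod n = i mod n + e * L" by simp
  qed
  finally show ?thesis using True by simp
next
  case False
  then show ?thesis by simp
qed

text \<open>The powers of \<open>\<epsilon>\<close> in the block numbering.\<close>

lemma eps_pow_\<iota>:
  assumes h: "h \<in> hin" "m < ff h" "i < vk h * dk h" and h': "h' \<in> hin" "m' < ff h'" "i' < vk h' * dk h'"
  shows "(eps_mat w D ^\<^sub>m l) $$ (\<iota> h' m' i', \<iota> h m i) =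
    (if h' = h \<and> m' = (m + l) mod ff h then (N h ^\<^sub>m (ee h * ((m + l) div ff h))) $$ (i', i) else 0)"
proof -
  let ?L = "(m + l) div ff h"
  have "\<iota> h' m' i' = \<iota> h m i + l \<and> \<iota> h' m' i' div D = \<iota> h m i div D \<longleftrightarrow>
    \<nu> (lab h' i') = \<nu> (lab h i) \<and> pos h' m' i' = pos h m i + l"
    unfolding \<iota>_div_mod[OF h(1,2)] \<iota>_div_mod[OF h'(1,2)] by (auto simp: \<iota>_def)
  also have "\<dots> \<longleftrightarrow> h' = h \<and> m' = (m + l) mod ff h \<and> (i' = i + ee h * ?L \<and> i' div dk h = i div dk h)"
  proof (cases "h' = h")
    case True
    have "pos h' m' i' = pos h m i + l \<longleftrightarrow> m' = (m + l) mod ff h \<and> i' mod dk h div ee h = i mod dk h div ee h + ?L"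
      unfolding True pos_def by (rule mod_shift_eq[OF hin_mult(4)[OF h(1)]]) (use h'(2) True in simp)
    then show ?thesis
      unfolding lab_eq[OF h(1,3) h'(1,3)] index_decompose[OF hin_mult(5)[OF h(1)]] using True by auto
  next
    case False
    then show ?thesis unfolding lab_eq[OF h(1,3) h'(1,3)] by simp
  qed
  finally have iff: "\<iota> h' m' i' = \<iota> h m i + l \<and> \<iota> h' m' i' div D = \<iota> h m i div D \<longleftrightarrow>
    h' = h \<and> m' = (m + l) mod ff h \<and> (i' = i + ee h * ?L \<and> i' div dk h = i div dk h)" .
  have "(eps_mat w D ^\<^sub>m l) $$ (\<iota> h' m' i', \<iota> h m i) =
     (if h' = h \<and> m' = (m + l) mod ff h \<and> (i' = i + ee h * ?L \<and> i' div dk h = i div dk h) then 1 else 0)"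
    unfolding eps_pow_entry[OF \<iota>_less[OF h'] \<iota>_less[OF h]] iff by (rule refl)
  also have "\<dots> = (if h' = h \<and> m' = (m + l) mod ff h then (N h ^\<^sub>m (ee h * ?L)) $$ (i', i) else 0)"
  proof (cases "h' = h")
    case True
    have i': "i' < vk h * dk h" using h'(3) True by simp
    show ?thesis unfolding eps_pow_entry[OF i' h(3)] using True by simp
  qed simp
  finally show ?thesis .
qed

lemma eps_\<iota>:
  assumes h: "h \<in> hin" "m < ff h" "i < vk h * dk h" and h': "h' \<in> hin" "m' < ff h'" "i' < vk h' * dk h'"
  shows "eps_mat w D $$ (\<iota> h' m' i', \<iota> h m i) =
    (if h' = h \<and> m' = (m + 1) mod ff h then (N h ^\<^sub>m (ee h * ((m + 1) div ff h))) $$ (i', i) else 0)"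
  using eps_pow_\<iota>[OF assms, of 1] unfolding One_nat_def pow_mat.simps eps_dim left_mult_one_mat[OF eps_carrier] .

lemma \<iota>_bij: "bij_betw (\<lambda>(h, m, i). \<iota> h m i) J {..<w * D}"
proof -
  have inj: "inj_on (\<lambda>(h, m, i). \<iota> h m i) J"
  proof (rule inj_onI, clarsimp simp: J_def)
    fix h m i h' m' i'
    assume a: "h \<in> hin" "m < ff h" "i < vk h * dk h" "h' \<in> hin" "m' < ff h'" "i' < vk h' * dk h'"
      and eq: "\<iota> h m i = \<iota> h' m' i'"
    have "(eps_mat w D ^\<^sub>m 0) $$ (\<iota> h' m' i', \<iota> h m i) = 1"
      unfolding eps_pow_entry[OF \<iota>_less[OF a(4-6)] \<iota>_less[OF a(1-3)]] using eq by simp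
    then have *: "h' = h \<and> m' = m \<and> (N h ^\<^sub>m 0) $$ (i', i) = 1"
      unfolding eps_pow_\<iota>[OF a] using a(2) by (auto split: if_splits)
    then have "i' < vk h * dk h" using a(6) by simp
    then show "h = h' \<and> m = m' \<and> i = i'" using * a(3) by (auto split: if_splits)
  qed
  have sub: "(\<lambda>(h, m, i). \<iota> h m i) ` J \<subseteq> {..<w * D}"
    by (auto simp: J_def \<iota>_less)
  have "card J = (\<Sum>h\<in>hin. ff h * (vk h * dk h))"
    unfolding J_def using finite_hin by (subst card_SigmaI) auto
  also have "\<dots> = (\<Sum>h\<in>hin. vk h * ee h * D)"
  proof (rule sum.cong[OF refl])
    fix h assume "h \<in> hin"
    note hm = hin_mult(1,2)[OF this, symmetric]
    show "ff h * (vk h * dk h) = vk h * ee h * D" unfolding hm by (simp add: ac_simps)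
  qed
  also have "\<dots> = w * D" unfolding w_eq by (simp add: sum_distrib_right)
  finally have "card ((\<lambda>(h, m, i). \<iota> h m i) ` J) = card {..<w * D}"
    using card_image[OF inj] by simp
  then have "(\<lambda>(h, m, i). \<iota> h m i) ` J = {..<w * D}"
    using card_subset_eq[OF _ sub] by simp
  then show ?thesis using inj by (simp add: bij_betw_def)
qed

lemma \<iota>_cases:
  assumes "x < w * D"
  obtains h m i where "h \<in> hin" "m < ff h" "i < vk h * dk h" "x = \<iota> h m i"
proof -
  have "x \<in> (\<lambda>(h, m, i). \<iota> h m i) ` J" using \<iota>_bij assms by (simp add: bij_betw_def)
  then show thesis using that by (auto simp: J_def)
qed

lemma sum_\<iota>: "(\<Sum>x<w * D. g x) = (\<Sum>h\<in>hin. \<Sum>m<ff h. \<Sum>i<vk h * dk h. g (\<iota> h m i))"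
proof -
  have "(\<Sum>x<w * D. g x) = (\<Sum>p\<in>J. g ((\<lambda>(h, m, i). \<iota> h m i) p))"
    by (rule sum.reindex_bij_betw[OF \<iota>_bij, symmetric])
  also have "\<dots> = (\<Sum>h\<in>hin. \<Sum>q\<in>{..<ff h} \<times> {..<vk h * dk h}. g (\<iota> h (fst q) (snd q)))"
    unfolding J_def using finite_hin by (subst sum.Sigma) (auto simp: case_prod_beta)
  also have "\<dots> = (\<Sum>h\<in>hin. \<Sum>m<ff h. \<Sum>i<vk h * dk h. g (\<iota> h m i))"
    by (intro sum.cong refl) (simp add: sum.cartesian_product case_prod_beta)
  finally show ?thesis .
qed

definition \<kappa> where
  "\<kappa> = the_inv_into J (\<lambda>(h, m, i). \<iota> h m i)"

lemma \<kappa>_\<iota>: "h \<in> hin \<Longrightarrow> m < ff h \<Longrightarrow> i < vk h * dk h \<Longrightarrow> \<kappa> (\<iota> h m i) = (h, m, i)"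
  unfolding \<kappa>_def using the_inv_into_f_f[of "\<lambda>(h, m, i). \<iota> h m i" J "(h, m, i)"] \<iota>_bij JI[of h m i]
  by (simp add: bij_betw_def)

subsection \<open>Blocks\<close>

definition Col :: "complex mat \<Rightarrow> 'e + 'e \<Rightarrow> nat \<Rightarrow> complex mat" where
  "Col M h m = mat (dim_row M) (vk h * dk h) (\<lambda>(r, i). M $$ (r, \<iota> h m i))"

definition Row :: "complex mat \<Rightarrow> 'e + 'e \<Rightarrow> nat \<Rightarrow> complex mat" where
  "Row M h m = mat (vk h * dk h) (dim_col M) (\<lambda>(i, s). M $$ (\<iota> h m i, s))"

lemma Col_carrier: "M \<in> carrier_mat r (w * D) \<Longrightarrow> Col M h m \<in> carrier_mat r (vk h * dk h)"
  by (auto simp: Col_def)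

lemma Row_carrier: "M \<in> carrier_mat (w * D) c \<Longrightarrow> Row M h m \<in> carrier_mat (vk h * dk h) c"
  by (auto simp: Row_def)

lemma Col_ext:
  assumes "A \<in> carrier_mat r (w * D)" "B \<in> carrier_mat r (w * D)"
    and eq: "\<And>h m. h \<in> hin \<Longrightarrow> m < ff h \<Longrightarrow> Col A h m = Col B h m"
  shows "A = B"
proof (rule eq_matI)
  fix i x assume "i < dim_row B" "x < dim_col B"
  then have ix: "i < r" "x < w * D" using assms by auto
  obtain h m k where k: "h \<in> hin" "m < ff h" "k < vk h * dk h" "x = \<iota> h m k" by (rule \<iota>_cases[OF ix(2)])
  have "Col A h m $$ (i, k) = Col B h m $$ (i, k)" using eq[OF k(1,2)] by simp
  then show "A $$ (i, x) = B $$ (i, x)" using assms(1,2) ix k by (simp add: Col_def)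
qed (use assms in auto)

lemma Row_ext:
  assumes "A \<in> carrier_mat (w * D) c" "B \<in> carrier_mat (w * D) c"
    and eq: "\<And>h m. h \<in> hin \<Longrightarrow> m < ff h \<Longrightarrow> Row A h m = Row B h m"
  shows "A = B"
proof (rule eq_matI)
  fix x s assume "x < dim_row B" "s < dim_col B"
  then have ix: "s < c" "x < w * D" using assms by auto
  obtain h m k where k: "h \<in> hin" "m < ff h" "k < vk h * dk h" "x = \<iota> h m k" by (rule \<iota>_cases[OF ix(2)])
  have "Row A h m $$ (k, s) = Row B h m $$ (k, s)" using eq[OF k(1,2)] by simp
  then show "A $$ (x, s) = B $$ (x, s)" using assms(1,2) ix k by (simp add: Row_def)
qed (use assms in auto)

lemma Col_left_mult:
  assumes A: "A \<in> carrier_mat p r" and M: "M \<in> carrier_mat r (w * D)" and h: "h \<in> hin" "m < ff h"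
  shows "Col (A * M) h m = A * Col M h m"
proof (rule eq_matI)
  fix i k assume "i < dim_row (A * Col M h m)" "k < dim_col (A * Col M h m)"
  then have ik: "i < p" "k < vk h * dk h" using A by (auto simp: Col_def)
  show "Col (A * M) h m $$ (i, k) = (A * Col M h m) $$ (i, k)"
    unfolding times_mat_entry[OF A Col_carrier[OF M] ik]
    using ik times_mat_entry[OF A M ik(1) \<iota>_less[OF h ik(2)]] M A by (simp add: Col_def)
qed (use A in \<open>auto simp: Col_def\<close>)

lemma Row_right_mult:
  assumes A: "A \<in> carrier_mat r p" and M: "M \<in> carrier_mat (w * D) r" and h: "h \<in> hin" "m < ff h"
  shows "Row (M * A) h m = Row M h m * A"
proof (rule eq_matI)
  fix k i assume "k < dim_row (Row M h m * A)" "i < dim_col (Row M h m * A)"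
  then have ik: "i < p" "k < vk h * dk h" using A by (auto simp: Row_def)
  show "Row (M * A) h m $$ (k, i) = (Row M h m * A) $$ (k, i)"
    unfolding times_mat_entry[OF Row_carrier[OF M] A ik(2,1)]
    using ik times_mat_entry[OF M A \<iota>_less[OF h ik(2)] ik(1)] M A by (simp add: Row_def)
qed (use A in \<open>auto simp: Row_def\<close>)

lemma block_product:
  assumes A: "A \<in> carrier_mat p (w * D)" and B: "B \<in> carrier_mat (w * D) r" and rs: "i < p" "s < r"
  shows "(A * B) $$ (i, s) = (\<Sum>h\<in>hin. \<Sum>m<ff h. (Col A h m * Row B h m) $$ (i, s))"
proof -
  have "(A * B) $$ (i, s) = (\<Sum>h\<in>hin. \<Sum>m<ff h. \<Sum>k<vk h * dk h. A $$ (i, \<iota> h m k) * B $$ (\<iota> h m k, s))"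
    unfolding times_mat_entry[OF A B rs] by (rule sum_\<iota>)
  also have "\<dots> = (\<Sum>h\<in>hin. \<Sum>m<ff h. (Col A h m * Row B h m) $$ (i, s))"
    by (intro sum.cong refl) (simp only: times_mat_entry[OF Col_carrier[OF A] Row_carrier[OF B] rs],
      use A B rs in \<open>simp add: Col_def Row_def\<close>)
  finally show ?thesis .
qed

lemma eps_block_sum:
  assumes h: "h \<in> hin" "m < ff h" and h': "h' \<in> hin" "h' \<noteq> h" and i: "i < vk h * dk h"
  shows "(\<Sum>m'<ff h'. \<Sum>i'<vk h' * dk h'. g m' i' * eps_mat w D $$ (\<iota> h' m' i', \<iota> h m i)) = 0"
proof (intro sum.neutral ballI)
  fix m' i' assume "m' \<in> {..<ff h'}" "i' \<in> {..<vk h' * dk h'}"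
  then show "g m' i' * eps_mat w D $$ (\<iota> h' m' i', \<iota> h m i) = 0"
    using eps_\<iota>[OF h i h'(1), of m' i'] h'(2) by simp
qed

lemma Col_eps:
  assumes M: "M \<in> carrier_mat r (w * D)" and h: "h \<in> hin" "m < ff h"
  shows "Col (M * eps_mat w D) h m = (if Suc m < ff h then Col M h (Suc m) else Col M h 0 * N h ^\<^sub>m ee h)"
proof (rule eq_matI)
  fix x i assume "x < dim_row (if Suc m < ff h then Col M h (Suc m) else Col M h 0 * N h ^\<^sub>m ee h)"
    "i < dim_col (if Suc m < ff h then Col M h (Suc m) else Col M h 0 * N h ^\<^sub>m ee h)"
  then have xi: "x < r" "i < vk h * dk h" using M by (auto simp: Col_def split: if_splits)
  let ?n = "(m + 1) mod ff h" and ?L = "(m + 1) div ff h"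
  have ent: "eps_mat w D $$ (\<iota> h' m' i', \<iota> h m i) =
      (if h' = h \<and> m' = ?n then (N h ^\<^sub>m (ee h * ?L)) $$ (i', i) else 0)"
    if "h' \<in> hin" "m' < ff h'" "i' < vk h' * dk h'" for h' m' i'
    by (rule eps_\<iota>[OF h xi(2) that])
  have n: "?n < ff h" using hin_mult(4)[OF h(1)] by simp
  have "Col (M * eps_mat w D) h m $$ (x, i) = (\<Sum>y<w * D. M $$ (x, y) * eps_mat w D $$ (y, \<iota> h m i))"
    using xi M times_mat_entry[OF M eps_carrier xi(1) \<iota>_less[OF h xi(2)]] by (simp add: Col_def)
  also have "\<dots> = (\<Sum>h'\<in>hin. \<Sum>m'<ff h'. \<Sum>i'<vk h' * dk h'. M $$ (x, \<iota> h' m' i') * eps_mat w D $$ (\<iota> h' m' i', \<iota> h m i))"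
    by (rule sum_\<iota>)
  also have "\<dots> = (\<Sum>h'\<in>hin. if h' = h then
      (\<Sum>m'<ff h. \<Sum>i'<vk h * dk h. M $$ (x, \<iota> h m' i') * eps_mat w D $$ (\<iota> h m' i', \<iota> h m i)) else 0)"
    using eps_block_sum[OF h _ _ xi(2)] by (intro sum.cong refl) auto
  also have "\<dots> = (\<Sum>m'<ff h. \<Sum>i'<vk h * dk h. M $$ (x, \<iota> h m' i') * eps_mat w D $$ (\<iota> h m' i', \<iota> h m i))"
    using h finite_hin by (simp add: sum.delta)
  also have "\<dots> = (\<Sum>m'<ff h. if m' = ?n then
      (\<Sum>i'<vk h * dk h. M $$ (x, \<iota> h ?n i') * (N h ^\<^sub>m (ee h * ?L)) $$ (i', i)) else 0)"
    using ent h by (intro sum.cong refl) (auto intro!: sum.neutral sum.cong)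
  also have "\<dots> = (\<Sum>i'<vk h * dk h. M $$ (x, \<iota> h ?n i') * (N h ^\<^sub>m (ee h * ?L)) $$ (i', i))"
    using n by (simp add: sum.delta)
  also have "\<dots> = (Col M h ?n * N h ^\<^sub>m (ee h * ?L)) $$ (x, i)"
    unfolding times_mat_entry[OF Col_carrier[OF M] eps_pow_carrier xi] using xi M by (simp add: Col_def)
  also have "Col M h ?n * N h ^\<^sub>m (ee h * ?L) = (if Suc m < ff h then Col M h (Suc m) else Col M h 0 * N h ^\<^sub>m ee h)"
  proof (cases "Suc m < ff h")
    case True
    then show ?thesis using right_mult_one_mat[OF Col_carrier[OF M, of h "Suc m"]] by simp
  next
    case False
    then have "Suc m = ff h" using h by simp
    then show ?thesis using hin_mult(4)[OF h(1)] by simp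
  qed
  finally show "Col (M * eps_mat w D) h m $$ (x, i) =
    (if Suc m < ff h then Col M h (Suc m) else Col M h 0 * N h ^\<^sub>m ee h) $$ (x, i)" .
qed (use M in \<open>auto simp: Col_def\<close>)

lemma Row_eps:
  assumes M: "M \<in> carrier_mat (w * D) r" and h: "h \<in> hin" "m < ff h"
  shows "Row (eps_mat w D * M) h m = (if m = 0 then N h ^\<^sub>m ee h * Row M h (ff h - 1) else Row M h (m - 1))"
proof -
  let ?p = "if m = 0 then ff h - 1 else m - 1" and ?L = "if m = 0 then 1 else 0 :: nat"
  have p: "?p < ff h" using h by auto
  have nx: "m = (m' + 1) mod ff h \<longleftrightarrow> m' = ?p" if "m' < ff h" for m'
    using that h(2) by (cases "m' + 1 = ff h") auto
  have L: "(?p + 1) div ff h = ?L" using h(2) by auto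
  show ?thesis
  proof (rule eq_matI)
    fix i x assume "i < dim_row (if m = 0 then N h ^\<^sub>m ee h * Row M h (ff h - 1) else Row M h (m - 1))"
      "x < dim_col (if m = 0 then N h ^\<^sub>m ee h * Row M h (ff h - 1) else Row M h (m - 1))"
    then have xi: "i < vk h * dk h" "x < r" using M by (auto simp: Row_def split: if_splits)
    have ent: "eps_mat w D $$ (\<iota> h m i, \<iota> h' m' i') =
        (if h' = h \<and> m' = ?p then (N h ^\<^sub>m (ee h * ?L)) $$ (i, i') else 0)"
      if "h' \<in> hin" "m' < ff h'" "i' < vk h' * dk h'" for h' m' i'
    proof (cases "h' = h \<and> m' = ?p")
      case True
      then show ?thesis
        unfolding eps_\<iota>[OF that h xi(1)] using nx[of m'] that L by auto
    next
      case False
      then have "\<not> (h = h' \<and> m = (m' + 1) mod ff h')" using nx[of m'] that by auto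
      then show ?thesis
        unfolding eps_\<iota>[OF that h xi(1)] using False by auto
    qed
    have "Row (eps_mat w D * M) h m $$ (i, x) = (\<Sum>y<w * D. eps_mat w D $$ (\<iota> h m i, y) * M $$ (y, x))"
      using xi M times_mat_entry[OF eps_carrier M \<iota>_less[OF h xi(1)] xi(2)] by (simp add: Row_def)
    also have "\<dots> = (\<Sum>h'\<in>hin. \<Sum>m'<ff h'. \<Sum>i'<vk h' * dk h'. eps_mat w D $$ (\<iota> h m i, \<iota> h' m' i') * M $$ (\<iota> h' m' i', x))"
      by (rule sum_\<iota>)
    also have "\<dots> = (\<Sum>h'\<in>hin. if h' = h then
        (\<Sum>m'<ff h. \<Sum>i'<vk h * dk h. eps_mat w D $$ (\<iota> h m i, \<iota> h m' i') * M $$ (\<iota> h m' i', x)) else 0)"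
    proof (intro sum.cong refl)
      fix h' assume h': "h' \<in> hin"
      show "(\<Sum>m'<ff h'. \<Sum>i'<vk h' * dk h'. eps_mat w D $$ (\<iota> h m i, \<iota> h' m' i') * M $$ (\<iota> h' m' i', x)) =
        (if h' = h then (\<Sum>m'<ff h. \<Sum>i'<vk h * dk h. eps_mat w D $$ (\<iota> h m i, \<iota> h m' i') * M $$ (\<iota> h m' i', x)) else 0)"
      proof (cases "h' = h")
        case False
        show ?thesis unfolding if_not_P[OF False]
        proof (intro sum.neutral ballI)
          fix m' i' assume "m' \<in> {..<ff h'}" "i' \<in> {..<vk h' * dk h'}"
          then show "eps_mat w D $$ (\<iota> h m i, \<iota> h' m' i') * M $$ (\<iota> h' m' i', x) = 0"
            using ent[OF h', of m' i'] False by simp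
        qed
      qed simp
    qed
    also have "\<dots> = (\<Sum>m'<ff h. \<Sum>i'<vk h * dk h. eps_mat w D $$ (\<iota> h m i, \<iota> h m' i') * M $$ (\<iota> h m' i', x))"
      using h finite_hin by (simp add: sum.delta)
    also have "\<dots> = (\<Sum>m'<ff h. if m' = ?p then
        (\<Sum>i'<vk h * dk h. (N h ^\<^sub>m (ee h * ?L)) $$ (i, i') * M $$ (\<iota> h ?p i', x)) else 0)"
    proof (intro sum.cong refl)
      fix m' assume m': "m' \<in> {..<ff h}"
      show "(\<Sum>i'<vk h * dk h. eps_mat w D $$ (\<iota> h m i, \<iota> h m' i') * M $$ (\<iota> h m' i', x)) = (if m' = ?p then
        (\<Sum>i'<vk h * dk h. (N h ^\<^sub>m (ee h * ?L)) $$ (i, i') * M $$ (\<iota> h ?p i', x)) else 0)"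
      proof (cases "m' = ?p")
        case True
        have "eps_mat w D $$ (\<iota> h m i, \<iota> h m' i') = (N h ^\<^sub>m (ee h * ?L)) $$ (i, i')" if "i' < vk h * dk h" for i'
          using ent[OF h(1) _ that, of m'] m' True by simp
        then show ?thesis using True by (simp cong: if_cong)
      next
        case False
        have "eps_mat w D $$ (\<iota> h m i, \<iota> h m' i') = 0" if "i' < vk h * dk h" for i'
          using ent[OF h(1) _ that, of m'] m' False by simp
        then show ?thesis unfolding if_not_P[OF False] by (intro sum.neutral) simp
      qed
    qed
    also have "\<dots> = (\<Sum>i'<vk h * dk h. (N h ^\<^sub>m (ee h * ?L)) $$ (i, i') * M $$ (\<iota> h ?p i', x))"
      using p by (simp add: sum.delta)
    also have "\<dots> = (N h ^\<^sub>m (ee h * ?L) * Row M h ?p) $$ (i, x)"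
      unfolding times_mat_entry[OF eps_pow_carrier Row_carrier[OF M] xi] using xi M by (simp add: Row_def)
    also have "N h ^\<^sub>m (ee h * ?L) * Row M h ?p = (if m = 0 then N h ^\<^sub>m ee h * Row M h (ff h - 1) else Row M h (m - 1))"
      using left_mult_one_mat[OF Row_carrier[OF M, of h "m - 1"]] by simp
    finally show "Row (eps_mat w D * M) h m $$ (i, x) =
      (if m = 0 then N h ^\<^sub>m ee h * Row M h (ff h - 1) else Row M h (m - 1)) $$ (i, x)" .
  qed (use M in \<open>auto simp: Row_def\<close>)
qed

end

lemma triple_entry:
  fixes P Z R :: "complex mat"
  assumes "P \<in> carrier_mat a b" "Z \<in> carrier_mat b c" "R \<in> carrier_mat c e" "r < a" "s < e"
  shows "(P * Z * R) $$ (r, s) = (\<Sum>i<b. \<Sum>l<c. P $$ (r, i) * Z $$ (i, l) * R $$ (l, s))"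
proof -
  have "(P * Z * R) $$ (r, s) = (\<Sum>l<c. (P * Z) $$ (r, l) * R $$ (l, s))"
    by (rule times_mat_entry[OF mult_carrier_mat[OF assms(1,2)] assms(3-5)])
  also have "\<dots> = (\<Sum>l<c. \<Sum>i<b. P $$ (r, i) * Z $$ (i, l) * R $$ (l, s))"
    by (intro sum.cong refl) (use times_mat_entry[OF assms(1,2,4)] in \<open>simp add: sum_distrib_right\<close>)
  also have "\<dots> = (\<Sum>i<b. \<Sum>l<c. P $$ (r, i) * Z $$ (i, l) * R $$ (l, s))"
    by (rule sum.swap)
  finally show ?thesis .
qed

lemma triple_sum:
  fixes P R :: "complex mat"
  assumes "P \<in> carrier_mat a b" "Z \<in> carrier_mat b c" "R \<in> carrier_mat c e" "r < a" "s < e"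
    and Y: "\<And>q. q \<in> K \<Longrightarrow> Y q \<in> carrier_mat b c"
    and Z: "\<And>i l. i < b \<Longrightarrow> l < c \<Longrightarrow> Z $$ (i, l) = (\<Sum>q\<in>K. y q * Y q $$ (i, l))"
  shows "(P * Z * R) $$ (r, s) = (\<Sum>q\<in>K. y q * (P * Y q * R) $$ (r, s))"
proof -
  have "(P * Z * R) $$ (r, s) = (\<Sum>i<b. \<Sum>l<c. \<Sum>q\<in>K. y q * (P $$ (r, i) * Y q $$ (i, l) * R $$ (l, s)))"
    unfolding triple_entry[OF assms(1-5)]
    by (intro sum.cong refl) (simp add: Z sum_distrib_left sum_distrib_right ac_simps)
  also have "\<dots> = (\<Sum>i<b. \<Sum>q\<in>K. \<Sum>l<c. y q * (P $$ (r, i) * Y q $$ (i, l) * R $$ (l, s)))"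
    by (intro sum.cong refl) (rule sum.swap)
  also have "\<dots> = (\<Sum>q\<in>K. \<Sum>i<b. \<Sum>l<c. y q * (P $$ (r, i) * Y q $$ (i, l) * R $$ (l, s)))"
    by (rule sum.swap)
  also have "\<dots> = (\<Sum>q\<in>K. y q * (P * Y q * R) $$ (r, s))"
    by (intro sum.cong refl) (simp add: triple_entry[OF assms(1) Y assms(3-5)] sum_distrib_left)
  finally show ?thesis .
qed

context vertex_setting
begin

abbreviation Rep where "Rep n \<equiv> rep_space Q d (v0(j := n))"

definition hoff :: "('e + 'e) set" where
  "hoff = {h \<in> dbl Q. src Q h \<noteq> j \<and> tgt Q h \<noteq> j}"

lemma dbl_cases: "h \<in> dbl Q \<Longrightarrow> h \<in> hin \<or> rev_arrow h \<in> hin \<or> h \<in> hoff"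
  by (auto simp: hin_def hoff_def)

lemma hin_rev: "h \<in> hin \<Longrightarrow> rev_arrow h \<notin> hin"
  using hin_src(1) by (auto simp: hin_def)

lemma hoff_not: "h \<in> hoff \<Longrightarrow> h \<notin> hin" "h \<in> hoff \<Longrightarrow> rev_arrow h \<notin> hin"
  by (auto simp: hin_def hoff_def)

lemma hoff_rev: "h \<in> hoff \<Longrightarrow> rev_arrow h \<in> hoff"
  by (auto simp: hoff_def)

lemma comm_in:
  assumes "h \<in> hin"
  shows "gs.comm_h n h M \<longleftrightarrow> M \<in> carrier_mat (n * D) (vk h * dk h) \<and> M * N h ^\<^sub>m ee h = eps_mat n D ^\<^sub>m ff h * M"
    "gs.comm_h n (rev_arrow h) M \<longleftrightarrow>
      M \<in> carrier_mat (vk h * dk h) (n * D) \<and> M * eps_mat n D ^\<^sub>m ff h = N h ^\<^sub>m ee h * M"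
  using hinD[OF assms] hin_src(1)[OF assms] by (simp_all add: gs.comm_h_def)

lemma comm_off: "h \<in> hoff \<Longrightarrow> gs.comm_h n h M \<longleftrightarrow> gs.comm_h 0 h M"
  by (simp add: gs.comm_h_def hoff_def)

lemma rep_in:
  assumes "B \<in> Rep n" "h \<in> hin"
  shows "B h \<in> carrier_mat (n * D) (vk h * dk h)" "B h * N h ^\<^sub>m ee h = eps_mat n D ^\<^sub>m ff h * B h"
    "B (rev_arrow h) \<in> carrier_mat (vk h * dk h) (n * D)"
    "B (rev_arrow h) * eps_mat n D ^\<^sub>m ff h = N h ^\<^sub>m ee h * B (rev_arrow h)"
proof -
  have "gs.comm_h n h (B h)" "gs.comm_h n (rev_arrow h) (B (rev_arrow h))"
    using assms(1) hinD(1)[OF assms(2)] unfolding gs.rep_space_iff by simp_all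
  then show "B h \<in> carrier_mat (n * D) (vk h * dk h)" "B h * N h ^\<^sub>m ee h = eps_mat n D ^\<^sub>m ff h * B h"
    "B (rev_arrow h) \<in> carrier_mat (vk h * dk h) (n * D)"
    "B (rev_arrow h) * eps_mat n D ^\<^sub>m ff h = N h ^\<^sub>m ee h * B (rev_arrow h)"
    unfolding comm_in[OF assms(2)] by simp_all
qed

definition amat :: "nat \<Rightarrow> ('e + 'e \<Rightarrow> complex mat) \<Rightarrow> complex mat" where
  "amat n B = mat (n * D) (w * D) (\<lambda>(r, x). case \<kappa> x of (h, m, i) \<Rightarrow> (eps_mat n D ^\<^sub>m m * B h) $$ (r, i))"

definition bmat :: "nat \<Rightarrow> ('e + 'e \<Rightarrow> complex mat) \<Rightarrow> complex mat" where
  "bmat n B = mat (w * D) (n * D) (\<lambda>(x, s). case \<kappa> x of (h, m, i) \<Rightarrow>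
     (sgn_arrow h \<cdot>\<^sub>m (B (rev_arrow h) * eps_mat n D ^\<^sub>m (ff h - 1 - m))) $$ (i, s))"

lemma amat_carrier: "amat n B \<in> carrier_mat (n * D) (w * D)"
  by (simp add: amat_def)

lemma bmat_carrier: "bmat n B \<in> carrier_mat (w * D) (n * D)"
  by (simp add: bmat_def)

lemma Col_amat:
  assumes B: "B \<in> Rep n" and h: "h \<in> hin" "m < ff h"
  shows "Col (amat n B) h m = eps_mat n D ^\<^sub>m m * B h"
proof (rule eq_matI)
  fix r i assume "r < dim_row (eps_mat n D ^\<^sub>m m * B h)" "i < dim_col (eps_mat n D ^\<^sub>m m * B h)"
  then have ri: "r < n * D" "i < vk h * dk h" using rep_in(1)[OF B h(1)] by auto
  then show "Col (amat n B) h m $$ (r, i) = (eps_mat n D ^\<^sub>m m * B h) $$ (r, i)"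
    using \<iota>_less[OF h ri(2)] \<kappa>_\<iota>[OF h ri(2)] by (simp add: Col_def amat_def)
qed (use rep_in(1)[OF B h(1)] in \<open>auto simp: Col_def amat_def\<close>)

lemma Row_bmat:
  assumes B: "B \<in> Rep n" and h: "h \<in> hin" "m < ff h"
  shows "Row (bmat n B) h m = sgn_arrow h \<cdot>\<^sub>m (B (rev_arrow h) * eps_mat n D ^\<^sub>m (ff h - 1 - m))"
proof (rule eq_matI)
  have car: "B (rev_arrow h) * eps_mat n D ^\<^sub>m (ff h - 1 - m) \<in> carrier_mat (vk h * dk h) (n * D)"
    by (rule mult_carrier_mat[OF rep_in(3)[OF B h(1)] eps_pow_carrier])
  fix i s assume "i < dim_row (sgn_arrow h \<cdot>\<^sub>m (B (rev_arrow h) * eps_mat n D ^\<^sub>m (ff h - 1 - m)))"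
    "s < dim_col (sgn_arrow h \<cdot>\<^sub>m (B (rev_arrow h) * eps_mat n D ^\<^sub>m (ff h - 1 - m)))"
  then have ri: "i < vk h * dk h" "s < n * D" using car by auto
  then show "Row (bmat n B) h m $$ (i, s) = (sgn_arrow h \<cdot>\<^sub>m (B (rev_arrow h) * eps_mat n D ^\<^sub>m (ff h - 1 - m))) $$ (i, s)"
    using \<iota>_less[OF h ri(1)] \<kappa>_\<iota>[OF h ri(1)] by (simp add: Row_def bmat_def)
qed (use rep_in(3)[OF B h(1)] in \<open>auto simp: Row_def bmat_def\<close>)

lemma amat_lin:
  assumes B: "B \<in> Rep n"
  shows "lin D n w (amat n B)"
proof -
  have "amat n B * eps_mat w D = eps_mat n D * amat n B"
  proof (rule Col_ext)
    fix h m assume h: "h \<in> hin" "m < ff h"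
    note Bh = rep_in(1)[OF B h(1)]
    have step: "eps_mat n D * (eps_mat n D ^\<^sub>m m * B h) = eps_mat n D ^\<^sub>m Suc m * B h"
    proof -
      have "eps_mat n D * (eps_mat n D ^\<^sub>m m * B h) = eps_mat n D * eps_mat n D ^\<^sub>m m * B h"
        by (rule assoc_mult_mat[OF eps_carrier eps_pow_carrier Bh, symmetric])
      also have "eps_mat n D * eps_mat n D ^\<^sub>m m = eps_mat n D ^\<^sub>m Suc m"
        using lin_eps_pow[OF lin_eps, of n D m] by simp
      finally show ?thesis .
    qed
    have "Col (amat n B * eps_mat w D) h m = (if Suc m < ff h then Col (amat n B) h (Suc m) else Col (amat n B) h 0 * N h ^\<^sub>m ee h)"
      by (rule Col_eps[OF amat_carrier h])
    also have "\<dots> = eps_mat n D ^\<^sub>m Suc m * B h"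
    proof (cases "Suc m < ff h")
      case True
      then show ?thesis using Col_amat[OF B h(1) True] by simp
    next
      case False
      then have m: "Suc m = ff h" using h(2) by simp
      have "Col (amat n B) h 0 = B h"
        using Col_amat[OF B h(1) hin_mult(4)[OF h(1)]] left_mult_one_mat[OF Bh] by simp
      then show ?thesis using False rep_in(2)[OF B h(1)] unfolding m by simp
    qed
    also have "\<dots> = Col (eps_mat n D * amat n B) h m"
      unfolding Col_left_mult[OF eps_carrier amat_carrier h] Col_amat[OF B h] step by (rule refl)
    finally show "Col (amat n B * eps_mat w D) h m = Col (eps_mat n D * amat n B) h m" .
  qed (auto simp: amat_def)
  then show ?thesis by (simp add: lin_def amat_carrier)
qed

lemma bmat_lin:
  assumes B: "B \<in> Rep n"
  shows "lin D w n (bmat n B)"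
proof -
  have "bmat n B * eps_mat n D = eps_mat w D * bmat n B"
  proof (rule Row_ext)
    fix h m assume h: "h \<in> hin" "m < ff h"
    note Bh = rep_in(3)[OF B h(1)]
    have "Row (bmat n B * eps_mat n D) h m = sgn_arrow h \<cdot>\<^sub>m (B (rev_arrow h) * eps_mat n D ^\<^sub>m (ff h - 1 - m)) * eps_mat n D"
      unfolding Row_right_mult[OF eps_carrier bmat_carrier h] Row_bmat[OF B h] by (rule refl)
    also have "\<dots> = sgn_arrow h \<cdot>\<^sub>m (B (rev_arrow h) * eps_mat n D ^\<^sub>m (ff h - 1 - m) * eps_mat n D)"
      by (rule mult_smult_assoc_mat[OF mult_carrier_mat[OF Bh eps_pow_carrier] eps_carrier])
    also have "B (rev_arrow h) * eps_mat n D ^\<^sub>m (ff h - 1 - m) * eps_mat n D = B (rev_arrow h) * eps_mat n D ^\<^sub>m Suc (ff h - 1 - m)"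
      unfolding pow_mat.simps by (rule assoc_mult_mat[OF Bh eps_pow_carrier eps_carrier])
    finally have l: "Row (bmat n B * eps_mat n D) h m = sgn_arrow h \<cdot>\<^sub>m (B (rev_arrow h) * eps_mat n D ^\<^sub>m Suc (ff h - 1 - m))" .
    have r: "Row (eps_mat w D * bmat n B) h m = (if m = 0 then N h ^\<^sub>m ee h * Row (bmat n B) h (ff h - 1) else Row (bmat n B) h (m - 1))"
      by (rule Row_eps[OF bmat_carrier h])
    show "Row (bmat n B * eps_mat n D) h m = Row (eps_mat w D * bmat n B) h m"
    proof (cases "m = 0")
      case True
      have last: "Row (bmat n B) h (ff h - 1) = sgn_arrow h \<cdot>\<^sub>m B (rev_arrow h)"
        using Row_bmat[OF B h(1), of "ff h - 1"] hin_mult(4)[OF h(1)] right_mult_one_mat[OF Bh] by simp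
      have "N h ^\<^sub>m ee h * (sgn_arrow h \<cdot>\<^sub>m B (rev_arrow h)) = sgn_arrow h \<cdot>\<^sub>m (N h ^\<^sub>m ee h * B (rev_arrow h))"
        by (rule mult_smult_distrib[OF eps_pow_carrier Bh])
      moreover have "Suc (ff h - 1 - m) = ff h" using True hin_mult(4)[OF h(1)] by simp
      ultimately show ?thesis unfolding l r last using True rep_in(4)[OF B h(1)] by simp
    next
      case False
      then have "Suc (ff h - 1 - m) = ff h - 1 - (m - 1)" "m - 1 < ff h" using h(2) by auto
      then show ?thesis unfolding l r using False Row_bmat[OF B h(1), of "m - 1"] by simp
    qed
  qed (auto simp: bmat_def)
  then show ?thesis by (simp add: lin_def bmat_carrier)
qed

definition Y :: "('e + 'e \<Rightarrow> complex mat) set" where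
  "Y = {y \<in> extensional hoff. \<forall>h\<in>hoff. gs.comm_h 0 h (y h)}"

definition CY :: "(('e + 'e \<Rightarrow> complex mat) \<Rightarrow> complex) set" where
  "CY = {\<lambda>y. y h $$ (r, s) | h r s. h \<in> hoff \<and> r < v0 (tgt Q h) * d (tgt Q h) \<and> s < v0 (src Q h) * d (src Q h)}"

lemma Y_carrier: "y \<in> Y \<Longrightarrow> h \<in> hoff \<Longrightarrow> y h \<in> carrier_mat (v0 (tgt Q h) * d (tgt Q h)) (v0 (src Q h) * d (src Q h))"
  by (auto simp: Y_def gs.comm_h_def hoff_def)

definition \<beta> where
  "\<beta> n B = (amat n B, bmat n B, restrict B hoff)"

definition asm :: "nat \<Rightarrow> complex mat \<times> complex mat \<times> ('e + 'e \<Rightarrow> complex mat) \<Rightarrow> 'e + 'e \<Rightarrow> complex mat" where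
  "asm n x = (\<lambda>h\<in>dbl Q. if h \<in> hin then Col (fst x) h 0
     else if rev_arrow h \<in> hin then
       sgn_arrow (rev_arrow h) \<cdot>\<^sub>m Row (fst (snd x)) (rev_arrow h) (ff (rev_arrow h) - 1)
     else snd (snd x) h)"

definition Zb :: "complex mat \<Rightarrow> 'e + 'e \<Rightarrow> complex mat" where
  "Zb X h = mat (vk h * dk h) (vk h * dk h) (\<lambda>(i, l). X $$ (\<iota> h (ff h - 1) i, \<iota> h 0 l))"

definition vertex_eq :: "('v \<Rightarrow> complex poly) \<Rightarrow> 'v \<Rightarrow> nat \<Rightarrow> nat \<Rightarrow> complex mat \<times> ('e + 'e \<Rightarrow> complex mat) \<Rightarrow> complex" where
  "vertex_eq lam k r s Xy =
     (\<Sum>h\<in>{h \<in> hoff. tgt Q h = k}. \<Sum>t<ff h. sgn_arrow h *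
       (eps_mat (v0 k) (d k) ^\<^sub>m t * snd Xy h * snd Xy (rev_arrow h) * eps_mat (v0 k) (d k) ^\<^sub>m (ff h - t - 1)) $$ (r, s)) +
     (\<Sum>h\<in>{h \<in> hin. src Q h = k}. \<Sum>t<ee h.
       - (eps_mat (v0 k) (d k) ^\<^sub>m t * Zb (fst Xy) h * eps_mat (v0 k) (d k) ^\<^sub>m (ee h - t - 1)) $$ (r, s)) +
     scal_mat (v0 k) (d k) (d k) (lam k) $$ (r, s)"

definition vertex_eqs where
  "vertex_eqs lam = {vertex_eq lam k r s | k r s. k \<in> verts Q \<and> k \<noteq> j \<and> r < v0 k * d k \<and> s < v0 k * d k}"

sublocale pm: pair_maps D w Y CY "vertex_eqs lam" for lam
  by unfold_locales (rule D_pos)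

lemma \<beta>_E: "B \<in> Rep n \<Longrightarrow> \<beta> n B \<in> pm.E n"
  unfolding \<beta>_def
proof (rule pm.EI[OF amat_lin bmat_lin])
  assume B: "B \<in> Rep n"
  have "gs.comm_h 0 h (restrict B hoff h)" if "h \<in> hoff" for h
    using B that comm_off[OF that, of n "B h"] unfolding gs.rep_space_iff by (simp add: hoff_def)
  then show "restrict B hoff \<in> Y" by (simp add: Y_def)
qed

lemma lin_Cols:
  assumes a: "lin D n w a" and h: "h \<in> hin"
  shows "m < ff h \<Longrightarrow> Col a h m = eps_mat n D ^\<^sub>m m * Col a h 0"
    "Col a h 0 * N h ^\<^sub>m ee h = eps_mat n D ^\<^sub>m ff h * Col a h 0"
proof -
  note ac = lin_carrier[OF a]
  have step: "(if Suc m < ff h then Col a h (Suc m) else Col a h 0 * N h ^\<^sub>m ee h) = eps_mat n D * Col a h m"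
    if "m < ff h" for m
    using Col_eps[OF ac h that] Col_left_mult[OF eps_carrier ac h that] a unfolding lin_def by simp
  have next_pow: "eps_mat n D * (eps_mat n D ^\<^sub>m m * Col a h 0) = eps_mat n D ^\<^sub>m Suc m * Col a h 0" for m
  proof -
    have "eps_mat n D * (eps_mat n D ^\<^sub>m m * Col a h 0) = eps_mat n D * eps_mat n D ^\<^sub>m m * Col a h 0"
      by (rule assoc_mult_mat[OF eps_carrier eps_pow_carrier Col_carrier[OF ac], symmetric])
    then show ?thesis using lin_eps_pow[OF lin_eps, of n D m] by simp
  qed
  show cols: "Col a h m = eps_mat n D ^\<^sub>m m * Col a h 0" if "m < ff h" for m
    using that
  proof (induction m)
    case 0
    show ?case using left_mult_one_mat[OF Col_carrier[OF ac]] by simp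
  next
    case (Suc m)
    then show ?case using step[of m] next_pow[of m] by simp
  qed
  have l: "ff h - 1 < ff h" "\<not> Suc (ff h - 1) < ff h" "Suc (ff h - 1) = ff h" using hin_mult(4)[OF h] by auto
  show "Col a h 0 * N h ^\<^sub>m ee h = eps_mat n D ^\<^sub>m ff h * Col a h 0"
    using step[OF l(1)] cols[OF l(1)] next_pow[of "ff h - 1"] l(2) unfolding l(3) by simp
qed

lemma lin_Rows:
  assumes b: "lin D w n b" and h: "h \<in> hin"
  shows "m < ff h \<Longrightarrow> Row b h m = Row b h (ff h - 1) * eps_mat n D ^\<^sub>m (ff h - 1 - m)"
    "N h ^\<^sub>m ee h * Row b h (ff h - 1) = Row b h (ff h - 1) * eps_mat n D ^\<^sub>m ff h"
proof -
  note bc = lin_carrier[OF b]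
  let ?R = "Row b h (ff h - 1)"
  have step: "Row b h m * eps_mat n D = (if m = 0 then N h ^\<^sub>m ee h * ?R else Row b h (m - 1))" if "m < ff h" for m
    using Row_eps[OF bc h that] Row_right_mult[OF eps_carrier bc h that] b unfolding lin_def by simp
  have next_pow: "?R * eps_mat n D ^\<^sub>m t * eps_mat n D = ?R * eps_mat n D ^\<^sub>m Suc t" for t
    unfolding pow_mat.simps by (rule assoc_mult_mat[OF Row_carrier[OF bc] eps_pow_carrier eps_carrier])
  have rows: "Row b h (ff h - 1 - t) = ?R * eps_mat n D ^\<^sub>m t" if "t < ff h" for t
    using that
  proof (induction t)
    case 0
    show ?case using right_mult_one_mat[OF Row_carrier[OF bc]] by simp
  next
    case (Suc t)
    then have "ff h - 1 - t < ff h" "ff h - 1 - t \<noteq> 0" "ff h - 1 - t - 1 = ff h - 1 - Suc t" by auto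
    then show ?case using Suc step[of "ff h - 1 - t"] next_pow[of t] by simp
  qed
  show "Row b h m = ?R * eps_mat n D ^\<^sub>m (ff h - 1 - m)" if "m < ff h" for m
    using rows[of "ff h - 1 - m"] that by simp
  have "0 < ff h" "ff h - 1 - (ff h - 1) = 0" "ff h - 1 < ff h" "Suc (ff h - 1) = ff h" using hin_mult(4)[OF h] by auto
  then show "N h ^\<^sub>m ee h * ?R = ?R * eps_mat n D ^\<^sub>m ff h"
    using step[of 0] rows[of "ff h - 1"] next_pow[of "ff h - 1"] by simp
qed

lemma asm_rep:
  assumes x: "x \<in> pm.E n"
  shows "asm n x \<in> Rep n"
  unfolding gs.rep_space_iff
proof (intro conjI ballI)
  note a = pm.EE(1)[OF x] and b = pm.EE(2)[OF x] and y = pm.EE(3)[OF x]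
  show "asm n x \<in> extensional (dbl Q)" by (simp add: asm_def)
  fix h assume h: "h \<in> dbl Q"
  consider "h \<in> hin" | "rev_arrow h \<in> hin" | "h \<in> hoff" using dbl_cases[OF h] by blast
  then show "gs.comm_h n h (asm n x h)"
  proof cases
    case 1
    then have "asm n x h = Col (fst x) h 0" using h by (simp add: asm_def)
    then show ?thesis
      unfolding comm_in(1)[OF 1] using lin_Cols(2)[OF a 1] Col_carrier[OF lin_carrier[OF a]] by simp
  next
    case 2
    define g where "g = rev_arrow h"
    have g: "g \<in> hin" "h = rev_arrow g" "h \<notin> hin" using 2 hin_rev[of g] by (simp_all add: g_def)
    define R where "R = Row (fst (snd x)) g (ff g - 1)"
    have Rc: "R \<in> carrier_mat (vk g * dk g) (n * D)" unfolding R_def by (rule Row_carrier[OF lin_carrier[OF b]])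
    have R: "N g ^\<^sub>m ee g * R = R * eps_mat n D ^\<^sub>m ff g" unfolding R_def by (rule lin_Rows(2)[OF b g(1)])
    have "asm n x h = sgn_arrow g \<cdot>\<^sub>m R" using h 2 g(3) by (simp add: asm_def R_def g_def)
    moreover have "sgn_arrow g \<cdot>\<^sub>m R * eps_mat n D ^\<^sub>m ff g = N g ^\<^sub>m ee g * (sgn_arrow g \<cdot>\<^sub>m R)"
      unfolding mult_smult_assoc_mat[OF Rc eps_pow_carrier] mult_smult_distrib[OF eps_pow_carrier Rc] R by (rule refl)
    ultimately have "gs.comm_h n (rev_arrow g) (asm n x h)"
      unfolding comm_in(2)[OF g(1)] using Rc by simp
    then show ?thesis using g(2) by simp
  next
    case 3
    then have "asm n x h = snd (snd x) h" using h hoff_not[OF 3] by (simp add: asm_def)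
    moreover have "gs.comm_h 0 h (snd (snd x) h)" using y 3 unfolding Y_def by blast
    ultimately show ?thesis using comm_off[OF 3, THEN iffD2, of "snd (snd x) h" n] by argo
  qed
qed

lemma smult_smult_sgn: "sgn_arrow h \<cdot>\<^sub>m (sgn_arrow h \<cdot>\<^sub>m M) = M"
  by (rule eq_matI) auto

lemma asm_in: "h \<in> hin \<Longrightarrow> asm n x h = Col (fst x) h 0"
  "h \<in> hin \<Longrightarrow> asm n x (rev_arrow h) = sgn_arrow h \<cdot>\<^sub>m Row (fst (snd x)) h (ff h - 1)"
  using hin_rev[of h] hinD(1)[of h] by (simp_all add: asm_def)

lemma \<beta>_asm:
  assumes x: "x \<in> pm.E n"
  shows "\<beta> n (asm n x) = x"
proof -
  note a = pm.EE(1)[OF x] and b = pm.EE(2)[OF x] and y = pm.EE(3)[OF x] and B = asm_rep[OF x]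
  have "amat n (asm n x) = fst x"
  proof (rule Col_ext[OF amat_carrier lin_carrier[OF a]])
    fix h m assume h: "h \<in> hin" "m < ff h"
    show "Col (amat n (asm n x)) h m = Col (fst x) h m"
      unfolding Col_amat[OF B h] asm_in(1)[OF h(1)] by (rule lin_Cols(1)[OF a h, symmetric])
  qed
  moreover have "bmat n (asm n x) = fst (snd x)"
  proof (rule Row_ext[OF bmat_carrier lin_carrier[OF b]])
    fix h m assume h: "h \<in> hin" "m < ff h"
    show "Row (bmat n (asm n x)) h m = Row (fst (snd x)) h m"
      unfolding Row_bmat[OF B h] asm_in(2)[OF h(1)]
        mult_smult_assoc_mat[OF Row_carrier[OF lin_carrier[OF b]] eps_pow_carrier] smult_smult_sgn
      by (rule lin_Rows(1)[OF b h, symmetric])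
  qed
  moreover have "restrict (asm n x) hoff = snd (snd x)"
  proof (rule ext)
    fix h
    show "restrict (asm n x) hoff h = snd (snd x) h"
    proof (cases "h \<in> hoff")
      case True
      then show ?thesis using hoff_not[OF True] by (simp add: asm_def hoff_def)
    next
      case False
      have "snd (snd x) \<in> extensional hoff" using y by (simp add: Y_def)
      from extensional_arb[OF this False] show ?thesis using False by simp
    qed
  qed
  ultimately show ?thesis by (simp add: \<beta>_def)
qed

lemma asm_\<beta>:
  assumes B: "B \<in> Rep n"
  shows "asm n (\<beta> n B) = B"
proof (rule ext)
  fix h
  show "asm n (\<beta> n B) h = B h"
  proof (cases "h \<in> dbl Q")
    case h: True
    consider "h \<in> hin" | "rev_arrow h \<in> hin" | "h \<in> hoff" using dbl_cases[OF h] by blast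
    then show ?thesis
    proof cases
      case 1
      show ?thesis unfolding asm_in(1)[OF 1] \<beta>_def fst_conv Col_amat[OF B 1 hin_mult(4)[OF 1]]
        using left_mult_one_mat[OF rep_in(1)[OF B 1]] by simp
    next
      case 2
      have "ff (rev_arrow h) - 1 < ff (rev_arrow h)" using hin_mult(4)[OF 2] by simp
      note r = Row_bmat[OF B 2 this]
      have "asm n (\<beta> n B) (rev_arrow (rev_arrow h)) = B (rev_arrow (rev_arrow h))"
        unfolding asm_in(2)[OF 2] \<beta>_def snd_conv fst_conv r smult_smult_sgn
        using right_mult_one_mat[OF rep_in(3)[OF B 2]] by simp
      then show ?thesis by simp
    next
      case 3
      then show ?thesis using h hoff_not[OF 3] by (simp add: asm_def \<beta>_def)
    qed
  next
    case False
    have "B \<in> extensional (dbl Q)" using B unfolding gs.rep_space_iff by simp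
    from extensional_arb[OF this False] show ?thesis using False by (simp add: asm_def)
  qed
qed

end

lemma scal_monom_entry:
  assumes "i < n * d" "l < n * d" "k < d"
  shows "scal_mat n d d (monom c k) $$ (i, l) = c * (eps_mat n d ^\<^sub>m k) $$ (i, l)"
proof -
  have "0 < d" using assms by simp
  then have "scal_mat n d d (monom c k) $$ (i, l) = (\<Sum>q<d. coeff (monom c k) q * (eps_mat n d ^\<^sub>m q) $$ (i, l))"
    using assms by (simp add: scal_mat_def)
  also have "\<dots> = (\<Sum>q<d. if q = k then c * (eps_mat n d ^\<^sub>m k) $$ (i, l) else 0)"
    by (intro sum.cong) auto
  finally show ?thesis using assms(3) by (simp add: sum.delta)
qed

lemma smult_sum_right: "smult c (\<Sum>q\<in>K. p q) = (\<Sum>q\<in>K. smult c (p q))"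
  by (induction K rule: infinite_finite_induct) (auto simp: smult_add_right)

lemma scal_sum_entry:
  assumes "i < n * d" "l < n * d"
  shows "scal_mat n d d (\<Sum>q\<in>K. p q) $$ (i, l) = (\<Sum>q\<in>K. scal_mat n d d (p q) $$ (i, l))"
  using assms by (simp add: scal_mat_def coeff_sum sum_distrib_right) (rule sum.swap)

context vertex_setting
begin

lemma moment_at_j:
  assumes B: "B \<in> Rep n" and rs: "r < n * D" "s < n * D"
  shows "(amat n B * bmat n B) $$ (r, s) = moment_map Q d (v0(j := n)) j B $$ (r, s)"
proof -
  have "(amat n B * bmat n B) $$ (r, s) = (\<Sum>h\<in>hin. \<Sum>m<ff h. (Col (amat n B) h m * Row (bmat n B) h m) $$ (r, s))"
    by (rule block_product[OF amat_carrier bmat_carrier rs])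
  also have "\<dots> = (\<Sum>h\<in>hin. \<Sum>m<ff h. sgn_arrow h *
      (eps_mat n D ^\<^sub>m m * B h * B (rev_arrow h) * eps_mat n D ^\<^sub>m (ff h - m - 1)) $$ (r, s))"
  proof (intro sum.cong refl)
    fix h m assume "h \<in> hin" "m \<in> {..<ff h}"
    then have h: "h \<in> hin" "m < ff h" by auto
    note b = rep_in(1)[OF B h(1)] and b' = rep_in(3)[OF B h(1)]
    let ?P = "eps_mat n D ^\<^sub>m m * B h" and ?q = "ff h - 1 - m"
    have P: "?P \<in> carrier_mat (n * D) (vk h * dk h)" by (rule mult_carrier_mat[OF eps_pow_carrier b])
    have q: "ff h - m - 1 = ?q" by simp
    have "Col (amat n B) h m * Row (bmat n B) h m = ?P * (sgn_arrow h \<cdot>\<^sub>m (B (rev_arrow h) * eps_mat n D ^\<^sub>m ?q))"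
      unfolding Col_amat[OF B h] Row_bmat[OF B h] by (rule refl)
    also have "\<dots> = sgn_arrow h \<cdot>\<^sub>m (?P * (B (rev_arrow h) * eps_mat n D ^\<^sub>m ?q))"
      by (rule mult_smult_distrib[OF P mult_carrier_mat[OF b' eps_pow_carrier]])
    also have "?P * (B (rev_arrow h) * eps_mat n D ^\<^sub>m ?q) = ?P * B (rev_arrow h) * eps_mat n D ^\<^sub>m ?q"
      by (rule assoc_mult_mat[OF P b' eps_pow_carrier, symmetric])
    finally have eq: "Col (amat n B) h m * Row (bmat n B) h m =
      sgn_arrow h \<cdot>\<^sub>m (?P * B (rev_arrow h) * eps_mat n D ^\<^sub>m ?q)" .
    have "?P * B (rev_arrow h) * eps_mat n D ^\<^sub>m ?q \<in> carrier_mat (n * D) (n * D)"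
      by (rule mult_carrier_mat[OF mult_carrier_mat[OF P b'] eps_pow_carrier])
    then show "(Col (amat n B) h m * Row (bmat n B) h m) $$ (r, s) =
      sgn_arrow h * (?P * B (rev_arrow h) * eps_mat n D ^\<^sub>m (ff h - m - 1)) $$ (r, s)"
      unfolding eq q using rs by (simp del: index_mult_mat(1))
  qed
  finally show ?thesis
    using rs by (simp add: moment_map_def hin_def del: index_mult_mat(1))
qed

lemma Zb_carrier [simp]: "Zb X h \<in> carrier_mat (vk h * dk h) (vk h * dk h)"
  by (simp add: Zb_def)

lemma Zb_add:
  assumes "X1 \<in> carrier_mat (w * D) (w * D)" "X2 \<in> carrier_mat (w * D) (w * D)" "h \<in> hin"
  shows "Zb (X1 + X2) h = Zb X1 h + Zb X2 h"
  using assms hin_mult(4)[OF assms(3)] by (auto simp: Zb_def \<iota>_less)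

lemma Zb_product:
  assumes B: "B \<in> Rep n" and h: "h \<in> hin"
  shows "Zb (bmat n B * amat n B) h = sgn_arrow h \<cdot>\<^sub>m (B (rev_arrow h) * B h)"
proof (rule eq_matI)
  note b = rep_in(1)[OF B h(1)] and b' = rep_in(3)[OF B h(1)] and f = hin_mult(4)[OF h]
  have f1: "ff h - 1 < ff h" using f by simp
  fix i l assume "i < dim_row (sgn_arrow h \<cdot>\<^sub>m (B (rev_arrow h) * B h))" "l < dim_col (sgn_arrow h \<cdot>\<^sub>m (B (rev_arrow h) * B h))"
  then have il: "i < vk h * dk h" "l < vk h * dk h" using b b' by auto
  have R: "Row (bmat n B) h (ff h - 1) = sgn_arrow h \<cdot>\<^sub>m B (rev_arrow h)"
    using Row_bmat[OF B h f1] right_mult_one_mat[OF b'] by simp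
  have C: "Col (amat n B) h 0 = B h"
    using Col_amat[OF B h f] left_mult_one_mat[OF b] by simp
  have "Zb (bmat n B * amat n B) h $$ (i, l) = (\<Sum>x<n * D. bmat n B $$ (\<iota> h (ff h - 1) i, x) * amat n B $$ (x, \<iota> h 0 l))"
    using il times_mat_entry[OF bmat_carrier[of n B] amat_carrier[of n B] \<iota>_less[OF h f1 il(1)] \<iota>_less[OF h f il(2)]]
    by (simp add: Zb_def del: index_mult_mat(1))
  also have "\<dots> = (\<Sum>x<n * D. Row (bmat n B) h (ff h - 1) $$ (i, x) * Col (amat n B) h 0 $$ (x, l))"
    using il carrier_matD[OF amat_carrier] carrier_matD[OF bmat_carrier] by (intro sum.cong) (auto simp: Row_def Col_def)
  also have "\<dots> = (sgn_arrow h \<cdot>\<^sub>m B (rev_arrow h) * B h) $$ (i, l)"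
    unfolding R C by (rule times_mat_entry[symmetric, OF _ b il]) (use b' in simp)
  also have "sgn_arrow h \<cdot>\<^sub>m B (rev_arrow h) * B h = sgn_arrow h \<cdot>\<^sub>m (B (rev_arrow h) * B h)"
    by (rule mult_smult_assoc_mat[OF b' b])
  finally show "Zb (bmat n B * amat n B) h $$ (i, l) = (sgn_arrow h \<cdot>\<^sub>m (B (rev_arrow h) * B h)) $$ (i, l)" .
qed (use rep_in(1,3)[OF B h] in \<open>auto simp: Zb_def\<close>)

lemma Zb_scal_entry:
  assumes h: "h \<in> hin" and il: "i < vk h * dk h" "l < vk h * dk h"
  shows "Zb (scal_mat w D D z) h $$ (i, l) =
    (\<Sum>q<cc h. coeff z (ff h * q + ff h - 1) * (N h ^\<^sub>m (ee h * q)) $$ (i, l))"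
proof -
  note f = hin_mult(4)[OF h]
  have f1: "ff h - 1 < ff h" using f by simp
  have D: "D = cc h * ff h" using hin_mult(1)[OF h] by (simp add: mult.commute)
  have "Zb (scal_mat w D D z) h $$ (i, l) = (\<Sum>k<D. coeff z k * (eps_mat w D ^\<^sub>m k) $$ (\<iota> h (ff h - 1) i, \<iota> h 0 l))"
    using il \<iota>_less[OF h f1 il(1)] \<iota>_less[OF h f il(2)] D_pos by (simp add: Zb_def scal_mat_def)
  also have "\<dots> = (\<Sum>k<D. coeff z k * (if ff h - 1 = k mod ff h then (N h ^\<^sub>m (ee h * (k div ff h))) $$ (i, l) else 0))"
    by (intro sum.cong refl) (subst eps_pow_\<iota>[OF h f il(2) h f1 il(1)], simp)
  also have "\<dots> = (\<Sum>q<cc h. \<Sum>m<ff h. coeff z (q * ff h + m) *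
      (if ff h - 1 = (q * ff h + m) mod ff h then (N h ^\<^sub>m (ee h * ((q * ff h + m) div ff h))) $$ (i, l) else 0))"
    unfolding D by (rule sum_idx)
  also have "\<dots> = (\<Sum>q<cc h. \<Sum>m<ff h. if m = ff h - 1 then
      coeff z (ff h * q + ff h - 1) * (N h ^\<^sub>m (ee h * q)) $$ (i, l) else 0)"
  proof (intro sum.cong refl)
    fix q m assume "m \<in> {..<ff h}"
    then have m: "m < ff h" by simp
    have "ff h * q + ff h - 1 = q * ff h + (ff h - 1)" using f by (simp add: mult.commute)
    then show "coeff z (q * ff h + m) * (if ff h - 1 = (q * ff h + m) mod ff h
        then (N h ^\<^sub>m (ee h * ((q * ff h + m) div ff h))) $$ (i, l) else 0) =
      (if m = ff h - 1 then coeff z (ff h * q + ff h - 1) * (N h ^\<^sub>m (ee h * q)) $$ (i, l) else 0)"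
      unfolding idx_div_mod[OF m] by (simp only: eq_commute[of m]) simp
  qed
  also have "\<dots> = (\<Sum>q<cc h. coeff z (ff h * q + ff h - 1) * (N h ^\<^sub>m (ee h * q)) $$ (i, l))"
    using f by (simp add: sum.delta)
  finally show ?thesis .
qed

text \<open>Adding a scalar to \<open>X\<close> shifts the equation at \<open>k\<close> by a scalar, which is the change of parameters in the
  reflection.\<close>

definition shift :: "complex poly \<Rightarrow> 'v \<Rightarrow> complex poly" where
  "shift z k = (\<Sum>h\<in>{h \<in> hin. src Q h = k}.
     smult (of_nat (ee h)) (\<Sum>q<cc h. monom (coeff z (ff h * q + ff h - 1)) (ee h * q + ee h - 1)))"

lemma scal_smult_entry:
  "i < n * e \<Longrightarrow> l < n * e \<Longrightarrow> scal_mat n e e (smult c p) $$ (i, l) = c * scal_mat n e e p $$ (i, l)"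
  by (simp add: scal_mat_def sum_distrib_left ac_simps)

lemma scal_contribution:
  assumes h: "h \<in> hin" and rs: "r < vk h * dk h" "s < vk h * dk h"
  shows "(\<Sum>t<ee h. (N h ^\<^sub>m t * Zb (scal_mat w D D z) h * N h ^\<^sub>m (ee h - t - 1)) $$ (r, s)) =
    scal_mat (vk h) (dk h) (dk h)
      (smult (of_nat (ee h)) (\<Sum>q<cc h. monom (coeff z (ff h * q + ff h - 1)) (ee h * q + ee h - 1))) $$ (r, s)"
proof -
  let ?c = "\<lambda>q. coeff z (ff h * q + ff h - 1)"
  have pw: "N h ^\<^sub>m t * N h ^\<^sub>m (ee h * q) * N h ^\<^sub>m (ee h - t - 1) = N h ^\<^sub>m (ee h * q + ee h - 1)" if "t < ee h" for t q
  proof -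
    have "t + ee h * q + (ee h - t - 1) = ee h * q + ee h - 1" using that by simp
    then show ?thesis by (simp only: eps_pow_add)
  qed
  have lt: "ee h * q + ee h - 1 < dk h" if "q < cc h" for q
  proof -
    have "ee h * Suc q \<le> ee h * cc h" using that by (intro mult_le_mono2) simp
    then show ?thesis using hin_mult(2,5)[OF h] by simp
  qed
  have "(\<Sum>t<ee h. (N h ^\<^sub>m t * Zb (scal_mat w D D z) h * N h ^\<^sub>m (ee h - t - 1)) $$ (r, s)) =
      (\<Sum>t<ee h. \<Sum>q<cc h. ?c q * (N h ^\<^sub>m (ee h * q + ee h - 1)) $$ (r, s))"
  proof (intro sum.cong refl)
    fix t assume "t \<in> {..<ee h}"
    then have t: "t < ee h" by simp
    have "(N h ^\<^sub>m t * Zb (scal_mat w D D z) h * N h ^\<^sub>m (ee h - t - 1)) $$ (r, s) =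
      (\<Sum>q<cc h. ?c q * (N h ^\<^sub>m t * N h ^\<^sub>m (ee h * q) * N h ^\<^sub>m (ee h - t - 1)) $$ (r, s))"
      by (rule triple_sum[OF eps_pow_carrier Zb_carrier eps_pow_carrier rs eps_pow_carrier])
        (rule Zb_scal_entry[OF h])
    then show "(N h ^\<^sub>m t * Zb (scal_mat w D D z) h * N h ^\<^sub>m (ee h - t - 1)) $$ (r, s) =
      (\<Sum>q<cc h. ?c q * (N h ^\<^sub>m (ee h * q + ee h - 1)) $$ (r, s))"
      unfolding pw[OF t] .
  qed
  also have "\<dots> = of_nat (ee h) * (\<Sum>q<cc h. ?c q * (N h ^\<^sub>m (ee h * q + ee h - 1)) $$ (r, s))" by simp
  also have "(\<Sum>q<cc h. ?c q * (N h ^\<^sub>m (ee h * q + ee h - 1)) $$ (r, s)) =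
      (\<Sum>q<cc h. scal_mat (vk h) (dk h) (dk h) (monom (?c q) (ee h * q + ee h - 1)) $$ (r, s))"
    by (intro sum.cong refl) (use scal_monom_entry[OF rs] lt in simp)
  also have "\<dots> = scal_mat (vk h) (dk h) (dk h) (\<Sum>q<cc h. monom (?c q) (ee h * q + ee h - 1)) $$ (r, s)"
    by (rule scal_sum_entry[OF rs, symmetric])
  finally show ?thesis unfolding scal_smult_entry[OF rs] .
qed

lemma moment_off_j:
  assumes B: "B \<in> Rep n" and k: "k \<in> verts Q" "k \<noteq> j" and rs: "r < v0 k * d k" "s < v0 k * d k"
  shows "vertex_eq lam k r s (pm.\<pi> z (\<beta> n B)) =
    (moment_map Q d (v0(j := n)) k B + scal_mat (v0 k) (d k) (d k) (lam k - shift z k)) $$ (r, s)"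
proof -
  let ?N = "eps_mat (v0 k) (d k)"
  let ?X = "bmat n B * amat n B + scal_mat w D D z"
  define F where "F h t = sgn_arrow h * (?N ^\<^sub>m t * B h * B (rev_arrow h) * ?N ^\<^sub>m (ff h - t - 1)) $$ (r, s)" for h t
  have \<pi>: "pm.\<pi> z (\<beta> n B) = (?X, restrict B hoff)" by (simp add: pm.\<pi>_def \<beta>_def)
  have Zsplit: "(\<Sum>t<ee h. - (?N ^\<^sub>m t * Zb ?X h * ?N ^\<^sub>m (ee h - t - 1)) $$ (r, s)) =
      (\<Sum>t<ee h. F (rev_arrow h) t) - scal_mat (v0 k) (d k) (d k)
      (smult (of_nat (ee h)) (\<Sum>q<cc h. monom (coeff z (ff h * q + ff h - 1)) (ee h * q + ee h - 1))) $$ (r, s)"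
    if hk: "h \<in> hin" "src Q h = k" for h
  proof -
    note h = hk(1)
    note b = rep_in(1)[OF B h] and b' = rep_in(3)[OF B h]
    have rs': "r < vk h * dk h" "s < vk h * dk h" using rs hk by auto
    have Zc: "Zb Z h \<in> carrier_mat (v0 k * d k) (v0 k * d k)" for Z using Zb_carrier[of Z h] hk(2) by simp
    have bb: "B (rev_arrow h) * B h \<in> carrier_mat (v0 k * d k) (v0 k * d k)"
      using mult_carrier_mat[OF b' b] hk(2) by simp
    have ZX: "Zb ?X h = sgn_arrow h \<cdot>\<^sub>m (B (rev_arrow h) * B h) + Zb (scal_mat w D D z) h"
      using Zb_add[OF mult_carrier_mat[OF bmat_carrier amat_carrier] scal_carrier h] Zb_product[OF B h] by simp
    have one: "- (?N ^\<^sub>m t * Zb ?X h * ?N ^\<^sub>m (ee h - t - 1)) $$ (r, s) = F (rev_arrow h) t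
        - (?N ^\<^sub>m t * Zb (scal_mat w D D z) h * ?N ^\<^sub>m (ee h - t - 1)) $$ (r, s)" for t
    proof -
      have "(?N ^\<^sub>m t * Zb ?X h * ?N ^\<^sub>m (ee h - t - 1)) $$ (r, s) =
        (\<Sum>q\<in>UNIV. (if q then sgn_arrow h else 1) * (?N ^\<^sub>m t * (if q then B (rev_arrow h) * B h else Zb (scal_mat w D D z) h)
            * ?N ^\<^sub>m (ee h - t - 1)) $$ (r, s))"
      proof (rule triple_sum[OF eps_pow_carrier Zc eps_pow_carrier rs])
        show "(if q then B (rev_arrow h) * B h else Zb (scal_mat w D D z) h) \<in> carrier_mat (v0 k * d k) (v0 k * d k)" for q
          using bb Zc by simp
        show "Zb ?X h $$ (i, l) = (\<Sum>q\<in>UNIV. (if q then sgn_arrow h else 1) * (if q then B (rev_arrow h) * B h else Zb (scal_mat w D D z) h) $$ (i, l))"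
          if "i < v0 k * d k" "l < v0 k * d k" for i l
          unfolding ZX using that bb carrier_matD[OF b] carrier_matD[OF b'] hk(2) carrier_matD[OF Zc[of "scal_mat w D D z"]] by (simp add: UNIV_bool del: index_mult_mat(1))
      qed
      also have "\<dots> = sgn_arrow h * (?N ^\<^sub>m t * (B (rev_arrow h) * B h) * ?N ^\<^sub>m (ee h - t - 1)) $$ (r, s)
         + (?N ^\<^sub>m t * Zb (scal_mat w D D z) h * ?N ^\<^sub>m (ee h - t - 1)) $$ (r, s)"
        by (simp add: UNIV_bool del: index_mult_mat(1))
      also have "?N ^\<^sub>m t * (B (rev_arrow h) * B h) = ?N ^\<^sub>m t * B (rev_arrow h) * B h"
        using assoc_mult_mat[OF eps_pow_carrier b' b] hk(2) by simp
      finally show ?thesis unfolding F_def by simp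
    qed
    show ?thesis
      unfolding one sum_subtractf using scal_contribution[OF h rs', of z] hk(2) by simp
  qed
  have "vertex_eq lam k r s (pm.\<pi> z (\<beta> n B)) =
    (\<Sum>h\<in>{h \<in> hoff. tgt Q h = k}. \<Sum>t<ff h. F h t) +
    (\<Sum>h\<in>{h \<in> hin. src Q h = k}. (\<Sum>t<ee h. F (rev_arrow h) t) - scal_mat (v0 k) (d k) (d k)
      (smult (of_nat (ee h)) (\<Sum>q<cc h. monom (coeff z (ff h * q + ff h - 1)) (ee h * q + ee h - 1))) $$ (r, s)) +
    scal_mat (v0 k) (d k) (d k) (lam k) $$ (r, s)"
  proof -
    have 1: "(\<Sum>h\<in>{h \<in> hoff. tgt Q h = k}. \<Sum>t<ff h. sgn_arrow h * (?N ^\<^sub>m t * restrict B hoff h *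
        restrict B hoff (rev_arrow h) * ?N ^\<^sub>m (ff h - t - 1)) $$ (r, s)) = (\<Sum>h\<in>{h \<in> hoff. tgt Q h = k}. \<Sum>t<ff h. F h t)"
      by (intro sum.cong refl) (simp add: F_def hoff_rev del: index_mult_mat(1))
    have 2: "(\<Sum>h\<in>{h \<in> hin. src Q h = k}. \<Sum>t<ee h. - (?N ^\<^sub>m t * Zb ?X h * ?N ^\<^sub>m (ee h - t - 1)) $$ (r, s)) =
      (\<Sum>h\<in>{h \<in> hin. src Q h = k}. (\<Sum>t<ee h. F (rev_arrow h) t) - scal_mat (v0 k) (d k) (d k)
      (smult (of_nat (ee h)) (\<Sum>q<cc h. monom (coeff z (ff h * q + ff h - 1)) (ee h * q + ee h - 1))) $$ (r, s))"
      by (rule sum.cong[OF refl], rule Zsplit) simp_all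
    show ?thesis unfolding vertex_eq_def \<pi> fst_conv snd_conv 1 2 by (rule refl)
  qed
  also have "\<dots> = (\<Sum>h\<in>{h \<in> hoff. tgt Q h = k}. \<Sum>t<ff h. F h t) +
    (\<Sum>h\<in>{h \<in> hin. src Q h = k}. \<Sum>t<ee h. F (rev_arrow h) t) +
    scal_mat (v0 k) (d k) (d k) (lam k - shift z k) $$ (r, s)"
  proof -
    have "scal_mat (v0 k) (d k) (d k) (shift z k) $$ (r, s) = (\<Sum>h\<in>{h \<in> hin. src Q h = k}. scal_mat (v0 k) (d k) (d k)
      (smult (of_nat (ee h)) (\<Sum>q<cc h. monom (coeff z (ff h * q + ff h - 1)) (ee h * q + ee h - 1))) $$ (r, s))"
      unfolding shift_def by (rule scal_sum_entry[OF rs])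
    moreover have "scal_mat (v0 k) (d k) (d k) (lam k - shift z k) $$ (r, s) =
      scal_mat (v0 k) (d k) (d k) (lam k) $$ (r, s) - scal_mat (v0 k) (d k) (d k) (shift z k) $$ (r, s)"
      unfolding scal_diff using rs carrier_matD[OF scal_carrier] by simp
    ultimately show ?thesis unfolding sum_subtractf by simp
  qed
  also have "(\<Sum>h\<in>{h \<in> hin. src Q h = k}. \<Sum>t<ee h. F (rev_arrow h) t) =
    (\<Sum>h\<in>{h \<in> dbl Q. tgt Q h = k \<and> src Q h = j}. \<Sum>t<ff h. F h t)"
    by (rule sum.reindex_bij_witness[where i = rev_arrow and j = rev_arrow]) (auto simp: hin_def)
  also have "(\<Sum>h\<in>{h \<in> hoff. tgt Q h = k}. \<Sum>t<ff h. F h t) +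
     (\<Sum>h\<in>{h \<in> dbl Q. tgt Q h = k \<and> src Q h = j}. \<Sum>t<ff h. F h t) =
     (\<Sum>h\<in>{h \<in> hoff. tgt Q h = k} \<union> {h \<in> dbl Q. tgt Q h = k \<and> src Q h = j}. \<Sum>t<ff h. F h t)"
    by (rule sum.union_disjoint[symmetric]) (use gs.finite_dbl in \<open>auto simp: hoff_def\<close>)
  also have "{h \<in> hoff. tgt Q h = k} \<union> {h \<in> dbl Q. tgt Q h = k \<and> src Q h = j} = {h \<in> dbl Q. tgt Q h = k}"
    using k by (auto simp: hoff_def)
  also have "(\<Sum>h\<in>{h \<in> dbl Q. tgt Q h = k}. \<Sum>t<ff h. F h t) = moment_map Q d (v0(j := n)) k B $$ (r, s)"
    using rs k by (simp add: moment_map_def F_def del: index_mult_mat(1))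
  finally show ?thesis using rs k by (simp add: scal_mat_def)
qed

lemma adj_eq: "adj Q j k = card {h \<in> hin. src Q h = k}"
  unfolding adj_def
  by (rule bij_betw_same_card[where f = rev_arrow], rule bij_betw_byWitness[where f' = rev_arrow])
    (auto simp: hin_def)

lemma reflect_param_eq:
  assumes k: "k \<noteq> j"
  shows "reflect_param Q d j lam k = lam k - shift (- lam j) k"
proof -
  define g where "g = gcd D (d k)"
  define e where "e = d k div g"
  define f where "f = D div g"
  let ?S = "{h \<in> hin. src Q h = k}"
  let ?c = "\<lambda>q. coeff (lam j) (f * q + f - 1)"
  have g: "0 < g" using D_pos by (simp add: g_def)
  have De: "D = f * g" "d k = e * g" by (simp_all add: e_def f_def g_def)
  have h: "cc h = g" "ff h = f" "ee h = e" if "h \<in> ?S" for h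
    using that by (auto simp: hin_def mult_h_def f_h_def g_def e_def f_def gcd.commute)
  have "shift (- lam j) k = (\<Sum>h\<in>?S. smult (of_nat e) (\<Sum>q<g. monom (- ?c q) (e * q + e - 1)))"
    unfolding shift_def by (intro sum.cong refl) (simp add: h)
  also have "\<dots> = smult (of_nat (card ?S) * of_nat e) (\<Sum>q<g. monom (- ?c q) (e * q + e - 1))"
    by (simp add: of_nat_poly mult.commute)
  also have "\<dots> = (\<Sum>q<g. monom (of_int (cartan Q d j k) * ?c q) (e * q + e - 1))"
    unfolding smult_sum_right smult_monom
    by (intro sum.cong refl arg_cong2[where f = monom])
      (use k in \<open>simp add: cartan_def adj_eq e_def g_def\<close>)
  also have "\<dots> = (\<Sum>m<g. monom (of_int (cartan Q d j k) * ?c (g - Suc m)) (e * (g - Suc m) + e - 1))"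
    by (rule sum.nat_diff_reindex[symmetric])
  also have "\<dots> = (\<Sum>m<g. monom (of_int (cartan Q d j k) * coeff (lam j) (D - f * m - 1)) (d k - e * m - 1))"
  proof (intro sum.cong refl)
    fix m assume "m \<in> {..<g}"
    then have m: "m < g" by simp
    have "x * (g - Suc m) + x = x * g - x * m" for x :: nat
    proof -
      have "g - m = Suc (g - Suc m)" using m by simp
      then have "x * (g - m) = x * (g - Suc m) + x" by simp
      then show ?thesis by (simp add: diff_mult_distrib2)
    qed
    then show "monom (of_int (cartan Q d j k) * ?c (g - Suc m)) (e * (g - Suc m) + e - 1) =
      monom (of_int (cartan Q d j k) * coeff (lam j) (D - f * m - 1)) (d k - e * m - 1)"
      unfolding De by simp
  qed
  finally show ?thesis
    using k unfolding reflect_param_def Let_def g_def[symmetric] e_def[symmetric] f_def[symmetric] by simp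
qed

lemma shift_zero: "shift 0 k = 0"
  by (simp add: shift_def)

end

context gauge_setting
begin

definition AR :: "(('e + 'e \<Rightarrow> complex mat) \<Rightarrow> complex) set" where
  "AR = polyf (rep_space Q d v) (rep_coords Q d v)"

definition gens :: "('v \<Rightarrow> complex poly) \<Rightarrow> (('e + 'e \<Rightarrow> complex mat) \<Rightarrow> complex) set" where
  "gens lam = {\<lambda>B. (moment_map Q d v i B + scal_mat (v i) (d i) (d i) (lam i)) $$ (r, s) | i r s.
     i \<in> verts Q \<and> r < v i * d i \<and> s < v i * d i}"

definition IR where
  "IR lam = gen_ideal (rep_space Q d v) AR (gens lam)"

definition Inv where
  "Inv lam = {f \<in> AR. \<forall>g\<in>carrier G. (\<lambda>B. f (gauge_act Q d v g B) - f B) \<in> IR lam}"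

lemma AR_algebra: "fun_algebra (rep_space Q d v) AR"
  unfolding AR_def by (rule polyf_algebra)

lemma IR_ideal: "fun_ideal (rep_space Q d v) AR (IR lam)"
  unfolding IR_def by (rule fun_algebra.gen_ideal[OF AR_algebra])

lemma rep_coord: "h \<in> dbl Q \<Longrightarrow> mat_in AR (v (tgt Q h) * d (tgt Q h)) (v (src Q h) * d (src Q h)) (\<lambda>B. B h)"
  unfolding mat_in_def AR_def rep_coords_def by (auto intro!: polyf_gen)

lemma moment_carrier: "moment_map Q d v i B \<in> carrier_mat (v i * d i) (v i * d i)"
  by (simp add: moment_map_def)

lemma moment_equivariant:
  assumes g: "g \<in> carrier G" and B: "B \<in> rep_space Q d v" and i: "i \<in> verts Q"
    and rs: "r < v i * d i" "s < v i * d i"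
  shows "(moment_map Q d v i (gauge_act Q d v g B) + scal_mat (v i) (d i) (d i) (lam i)) $$ (r, s) =
    (g i * (moment_map Q d v i B + scal_mat (v i) (d i) (d i) (lam i)) * (inv\<^bsub>G\<^esub> g) i) $$ (r, s)"
proof -
  let ?n = "v i * d i" and ?N = "eps_mat (v i) (d i)" and ?g = "g i" and ?k = "(inv\<^bsub>G\<^esub> g) i"
  let ?S = "scal_mat (v i) (d i) (d i) (lam i)" and ?B' = "gauge_act Q d v g B"
  note gi = gauge_lin[OF g i] and ki = gauge_lin[OF gauge_inv(1)[OF g] i]
  note gc = lin_carrier[OF gi] and kc = lin_carrier[OF ki]
  define K where "K = (SIGMA h:{h \<in> dbl Q. tgt Q h = i}. {..<f_h Q d h})"
  define T where "T B p = ?N ^\<^sub>m snd p * B (fst p) * B (rev_arrow (fst p)) * ?N ^\<^sub>m (f_h Q d (fst p) - snd p - 1)"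
    for p :: "('e + 'e) \<times> nat" and B :: "'e + 'e \<Rightarrow> complex mat"
  have fin: "finite {h \<in> dbl Q. tgt Q h = i}" using finite_dbl by simp
  have mm: "moment_map Q d v i B $$ (r, s) = (\<Sum>p\<in>K. sgn_arrow (fst p) * T B p $$ (r, s))"
    if "r < ?n" "s < ?n" for B r s
    using that fin unfolding K_def T_def
    by (simp add: moment_map_def del: index_mult_mat(1)) (subst sum.Sigma, auto simp: case_prod_beta simp del: index_mult_mat(1))
  have Kd: "fst p \<in> dbl Q" "tgt Q (fst p) = i" if "p \<in> K" for p using that by (auto simp: K_def)
  have Bc: "B (fst p) \<in> carrier_mat ?n (v (src Q (fst p)) * d (src Q (fst p)))"
    "B (rev_arrow (fst p)) \<in> carrier_mat (v (src Q (fst p)) * d (src Q (fst p))) ?n"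
    if "p \<in> K" "B \<in> rep_space Q d v" for p B
    using rep_carrier[OF that(2), of "fst p"] rep_carrier[OF that(2), of "rev_arrow (fst p)"] Kd[OF that(1)] by simp_all
  have Tc: "T B p \<in> carrier_mat ?n ?n" if "p \<in> K" "B \<in> rep_space Q d v" for p B
    unfolding T_def by (rule mult_carrier_mat[OF mult_carrier_mat[OF mult_carrier_mat[OF eps_pow_carrier Bc(1)[OF that]] Bc(2)[OF that]] eps_pow_carrier])
  have Teq: "T ?B' p = ?g * T B p * ?k" if p: "p \<in> K" for p
  proof -
    let ?h = "fst p" and ?m = "v (src Q (fst p)) * d (src Q (fst p))"
    let ?P = "?N ^\<^sub>m snd p" and ?Q = "?N ^\<^sub>m (f_h Q d (fst p) - snd p - 1)"
    let ?s = "g (src Q ?h)" and ?s' = "(inv\<^bsub>G\<^esub> g) (src Q ?h)"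
    define b where "b = B ?h"
    define b' where "b' = B (rev_arrow ?h)"
    note sv = ends_in_verts(1)[OF Kd(1)[OF p]]
    have b: "b \<in> carrier_mat ?n ?m" and b': "b' \<in> carrier_mat ?m ?n" using Bc[OF p B] by (simp_all add: b_def b'_def)
    have s: "?s \<in> carrier_mat ?m ?m" and s': "?s' \<in> carrier_mat ?m ?m"
      by (rule lin_carrier[OF gauge_lin[OF g sv]], rule lin_carrier[OF gauge_lin[OF gauge_inv(1)[OF g] sv]])
    have ss: "?s' * ?s = 1\<^sub>m ?m" by (rule gauge_inv(3)[OF g sv])
    have P: "?P \<in> carrier_mat ?n ?n" and Q: "?Q \<in> carrier_mat ?n ?n" by simp_all
    have e1: "?B' ?h = ?g * b * ?s'" and e2: "?B' (rev_arrow ?h) = ?s * b' * ?k"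
      using Kd[OF p] by (simp_all add: gauge_act_def b_def b'_def)
    have gb: "?g * b \<in> carrier_mat ?n ?m" and bk: "b' * ?k \<in> carrier_mat ?m ?n" using gc b b' kc by simp_all
    have "?g * b * ?s' * (?s * b' * ?k) = ?g * b * (?s' * (?s * (b' * ?k)))"
      using assoc_mult_mat[OF gb s' mult_carrier_mat[OF s bk]] assoc_mult_mat[OF s b' kc] by simp
    also have "?s' * (?s * (b' * ?k)) = b' * ?k"
      using assoc_mult_mat[OF s' s bk] ss left_mult_one_mat[OF bk] by simp
    also have "?g * b * (b' * ?k) = ?g * (b * b') * ?k"
      using assoc_mult_mat[OF gb b' kc] assoc_mult_mat[OF gc b b'] by simp
    finally have prod: "?g * b * ?s' * (?s * b' * ?k) = ?g * (b * b') * ?k" .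
    have bb: "b * b' \<in> carrier_mat ?n ?n" using b b' by simp
    have gbk: "?g * (b * b') \<in> carrier_mat ?n ?n" using gc bb by simp
    have "T ?B' p = ?P * (?g * b * ?s') * (?s * b' * ?k) * ?Q" unfolding T_def e1 e2 by (rule refl)
    also have "?P * (?g * b * ?s') * (?s * b' * ?k) = ?P * (?g * (b * b') * ?k)"
      using assoc_mult_mat[OF P mult_carrier_mat[OF gb s'] mult_carrier_mat[OF mult_carrier_mat[OF s b'] kc]] prod by simp
    also have "\<dots> = ?P * (?g * (b * b')) * ?k" by (rule assoc_mult_mat[OF P gbk kc, symmetric])
    also have "?P * (?g * (b * b')) = ?P * ?g * (b * b')" by (rule assoc_mult_mat[OF P gc bb, symmetric])
    also have "?P * ?g = ?g * ?P" by (rule lin_eps_pow[OF gi, symmetric])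
    also have "?g * ?P * (b * b') = ?g * (?P * (b * b'))" by (rule assoc_mult_mat[OF gc P bb])
    also have "?P * (b * b') = ?P * b * b'" by (rule assoc_mult_mat[OF P b b', symmetric])
    finally have "T ?B' p = ?g * (?P * b * b') * ?k * ?Q" .
    also have "\<dots> = ?g * (?P * b * b') * (?k * ?Q)"
      by (rule assoc_mult_mat[OF mult_carrier_mat[OF gc mult_carrier_mat[OF mult_carrier_mat[OF P b] b']] kc Q])
    also have "?k * ?Q = ?Q * ?k" by (rule lin_eps_pow[OF ki])
    also have "?g * (?P * b * b') * (?Q * ?k) = ?g * (?P * b * b') * ?Q * ?k"
      by (rule assoc_mult_mat[OF mult_carrier_mat[OF gc mult_carrier_mat[OF mult_carrier_mat[OF P b] b']] Q kc, symmetric])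
    also have "?g * (?P * b * b') * ?Q = ?g * (?P * b * b' * ?Q)"
      by (rule assoc_mult_mat[OF gc mult_carrier_mat[OF mult_carrier_mat[OF P b] b'] Q])
    finally show ?thesis by (simp add: T_def b_def b'_def)
  qed
  have M: "moment_map Q d v i B \<in> carrier_mat ?n ?n" by (rule moment_carrier)
  have "(?g * moment_map Q d v i B * ?k) $$ (r, s) = (\<Sum>p\<in>K. sgn_arrow (fst p) * (?g * T B p * ?k) $$ (r, s))"
    by (rule triple_sum[OF gc M kc rs Tc[OF _ B] mm])
  also have "\<dots> = moment_map Q d v i ?B' $$ (r, s)"
    unfolding mm[OF rs] by (intro sum.cong refl) (simp only: Teq)
  finally have 1: "(?g * moment_map Q d v i B * ?k) $$ (r, s) = moment_map Q d v i ?B' $$ (r, s)" .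
  have 2: "?g * ?S * ?k = ?S"
  proof -
    have "?g * ?S * ?k = ?S * (?g * ?k)"
      unfolding lin_scal[OF gi] by (rule assoc_mult_mat[OF scal_carrier gc kc])
    then show ?thesis unfolding gauge_inv(2)[OF g i] using right_mult_one_mat[OF scal_carrier] by simp
  qed
  have "?g * (moment_map Q d v i B + ?S) * ?k = ?g * moment_map Q d v i B * ?k + ?g * ?S * ?k"
    using mult_add_distrib_mat[OF gc M scal_carrier]
      add_mult_distrib_mat[OF mult_carrier_mat[OF gc M] mult_carrier_mat[OF gc scal_carrier] kc] by simp
  then show ?thesis
    unfolding 2 using 1 rs moment_carrier[of i B] moment_carrier[of i ?B'] gc kc
    by (simp add: carrier_matD[OF scal_carrier] del: index_mult_mat(1))
qed

lemma act_coords: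
  assumes g: "g \<in> carrier G" and f: "f \<in> AR"
  shows "(\<lambda>B. f (gauge_act Q d v g B)) \<in> AR"
proof -
  interpret A: fun_algebra "rep_space Q d v" AR by (rule AR_algebra)
  show ?thesis
  proof (rule A.poly_subst[OF f[unfolded AR_def]])
    show "gauge_act Q d v g B \<in> rep_space Q d v" if "B \<in> rep_space Q d v" for B by (rule gauge_act_rep[OF g that])
    fix c assume "c \<in> rep_coords Q d v"
    then obtain h r s where h: "h \<in> dbl Q" and rs: "r < v (tgt Q h) * d (tgt Q h)" "s < v (src Q h) * d (src Q h)"
      and c: "c = (\<lambda>B. B h $$ (r, s))" by (auto simp: rep_coords_def)
    let ?t = "v (tgt Q h) * d (tgt Q h)" and ?s = "v (src Q h) * d (src Q h)"
    note e = ends_in_verts[OF h]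
    have gt: "g (tgt Q h) \<in> carrier_mat ?t ?t" by (rule lin_carrier[OF gauge_lin[OF g e(2)]])
    have gs: "(inv\<^bsub>G\<^esub> g) (src Q h) \<in> carrier_mat ?s ?s" by (rule lin_carrier[OF gauge_lin[OF gauge_inv(1)[OF g] e(1)]])
    have "mat_in AR ?t ?s (\<lambda>B. g (tgt Q h) * B h)"
      by (rule A.mat_in_mult[OF A.mat_in_const rep_coord[OF h]], rule gt, rule rep_carrier[OF _ h])
    then have "mat_in AR ?t ?s (\<lambda>B. g (tgt Q h) * B h * (inv\<^bsub>G\<^esub> g) (src Q h))"
      by (rule A.mat_in_mult[OF _ A.mat_in_const]) (rule mult_carrier_mat[OF gt] rep_carrier[OF _ h] gs | assumption)+
    from mat_inD[OF this rs] show "(\<lambda>B. c (gauge_act Q d v g B)) \<in> AR"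
      using h by (simp add: c gauge_act_def)
  qed
qed

text \<open>The group permutes the equations up to linear combinations.\<close>

lemma act_ideal:
  assumes g: "g \<in> carrier G" and f: "f \<in> IR lam"
  shows "(\<lambda>B. f (gauge_act Q d v g B)) \<in> IR lam"
proof -
  interpret I: fun_ideal "rep_space Q d v" AR "IR lam" by (rule IR_ideal)
  show ?thesis
  proof (rule I.gen_ideal_subst[OF f[unfolded IR_def]])
    show "gauge_act Q d v g B \<in> rep_space Q d v" if "B \<in> rep_space Q d v" for B by (rule gauge_act_rep[OF g that])
    show "(\<lambda>B. a (gauge_act Q d v g B)) \<in> AR" if "a \<in> AR" for a by (rule act_coords[OF g that])
  next
    fix c assume "c \<in> gens lam"
    then obtain i r s where i: "i \<in> verts Q" and rs: "r < v i * d i" "s < v i * d i"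
      and c: "c = (\<lambda>B. (moment_map Q d v i B + scal_mat (v i) (d i) (d i) (lam i)) $$ (r, s))"
      by (auto simp: gens_def)
    let ?M = "\<lambda>B. moment_map Q d v i B + scal_mat (v i) (d i) (d i) (lam i)"
    let ?n = "v i * d i"
    have Mc: "?M B \<in> carrier_mat ?n ?n" for B using moment_carrier[of i B] by simp
    have gc: "g i \<in> carrier_mat ?n ?n" by (rule lin_carrier[OF gauge_lin[OF g i]])
    have kc: "(inv\<^bsub>G\<^esub> g) i \<in> carrier_mat ?n ?n" by (rule lin_carrier[OF gauge_lin[OF gauge_inv(1)[OF g] i]])
    have "mat_in (IR lam) ?n ?n ?M"
      unfolding mat_in_def IR_def gens_def using i by (intro allI impI fun_algebra.gen_ideal_gen[OF AR_algebra]) blast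
    then have "mat_in (IR lam) ?n ?n (\<lambda>B. g i * ?M B)"
      by (rule I.mat_in_ideal_left[OF I.mat_in_const _ gc Mc])
    then have "mat_in (IR lam) ?n ?n (\<lambda>B. g i * ?M B * (inv\<^bsub>G\<^esub> g) i)"
      by (rule I.mat_in_ideal_right[OF _ I.mat_in_const mult_carrier_mat[OF gc Mc] kc])
    from mat_inD[OF this rs] show "(\<lambda>B. c (gauge_act Q d v g B)) \<in> IR lam"
      by (rule I.I_cong) (simp only: c moment_equivariant[OF g _ i rs])
  qed
qed

end

context vertex_setting
begin

lemma vertex_eqs_AW: "vertex_eqs lam \<subseteq> pm.AW"
proof
  fix f assume "f \<in> vertex_eqs lam"
  then obtain k r s where k: "k \<in> verts Q" "k \<noteq> j" and rs: "r < v0 k * d k" "s < v0 k * d k"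
    and f: "f = vertex_eq lam k r s" by (auto simp: vertex_eqs_def)
  let ?N = "eps_mat (v0 k) (d k)"
  have yc: "snd x h \<in> carrier_mat (v0 (tgt Q h) * d (tgt Q h)) (v0 (src Q h) * d (src Q h))"
    if "x \<in> pm.W" "h \<in> hoff" for x h
    using Y_carrier[OF _ that(2)] that(1) by (auto simp: pm.W_def)
  have y_in: "mat_in pm.AW (v0 (tgt Q h) * d (tgt Q h)) (v0 (src Q h) * d (src Q h)) (\<lambda>x. snd x h)" if "h \<in> hoff" for h
    unfolding mat_in_def
  proof (intro allI impI)
    fix r s assume rs: "r < v0 (tgt Q h) * d (tgt Q h)" "s < v0 (src Q h) * d (src Q h)"
    have "(\<lambda>y. y h $$ (r, s)) \<in> CY" using rs that unfolding CY_def by blast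
    from pm.coord_W(2)[OF this] show "(\<lambda>x. snd x h $$ (r, s)) \<in> pm.AW" .
  qed
  have 1: "(\<lambda>x. sgn_arrow h * (?N ^\<^sub>m t * snd x h * snd x (rev_arrow h) * ?N ^\<^sub>m u) $$ (r, s)) \<in> pm.AW"
    if h: "h \<in> hoff" "tgt Q h = k" for h t u
  proof -
    let ?m = "v0 (src Q h) * d (src Q h)" and ?n = "v0 k * d k"
    have c1: "snd x h \<in> carrier_mat ?n ?m" and c2: "snd x (rev_arrow h) \<in> carrier_mat ?m ?n" if "x \<in> pm.W" for x
      using yc[OF that h(1)] yc[OF that hoff_rev[OF h(1)]] h(2) by simp_all
    have m1: "mat_in pm.AW ?n ?m (\<lambda>x. snd x h)" and m2: "mat_in pm.AW ?m ?n (\<lambda>x. snd x (rev_arrow h))"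
      using y_in[OF h(1)] y_in[OF hoff_rev[OF h(1)]] h(2) by simp_all
    have "mat_in pm.AW ?n ?m (\<lambda>x. ?N ^\<^sub>m t * snd x h)"
      by (rule pm.AW.mat_in_mult[OF pm.AW.mat_in_const m1 eps_pow_carrier c1])
    then have "mat_in pm.AW ?n ?n (\<lambda>x. ?N ^\<^sub>m t * snd x h * snd x (rev_arrow h))"
      by (rule pm.AW.mat_in_mult[OF _ m2 mult_carrier_mat[OF eps_pow_carrier c1] c2])
    then have "mat_in pm.AW ?n ?n (\<lambda>x. ?N ^\<^sub>m t * snd x h * snd x (rev_arrow h) * ?N ^\<^sub>m u)"
      by (rule pm.AW.mat_in_mult[OF _ pm.AW.mat_in_const mult_carrier_mat[OF mult_carrier_mat[OF eps_pow_carrier c1] c2] eps_pow_carrier])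
    from pm.AW.scale[OF mat_inD[OF this rs]] show ?thesis .
  qed
  have 2: "(\<lambda>x. - (?N ^\<^sub>m t * Zb (fst x) h * ?N ^\<^sub>m u) $$ (r, s)) \<in> pm.AW"
    if h: "h \<in> hin" "src Q h = k" for h t u
  proof -
    let ?n = "v0 k * d k"
    have Zc: "Zb (fst x) h \<in> carrier_mat ?n ?n" for x :: "complex mat \<times> ('e + 'e \<Rightarrow> complex mat)"
      using Zb_carrier[of "fst x" h] h(2) by simp
    have f: "ff h - 1 < ff h" "0 < ff h" using hin_mult(4)[OF h(1)] by auto
    have "mat_in pm.AW ?n ?n (\<lambda>x. Zb (fst x) h)"
      unfolding mat_in_def
    proof (intro allI impI)
      fix i l assume "i < ?n" "l < ?n"
      then have il: "i < vk h * dk h" "l < vk h * dk h" using h(2) by auto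
      from mat_inD[OF pm.coord_W(1) \<iota>_less[OF h(1) f(1) il(1)] \<iota>_less[OF h(1) f(2) il(2)]]
      show "(\<lambda>x. Zb (fst x) h $$ (i, l)) \<in> pm.AW" using il by (simp add: Zb_def)
    qed
    then have "mat_in pm.AW ?n ?n (\<lambda>x. ?N ^\<^sub>m t * Zb (fst x) h)"
      by (rule pm.AW.mat_in_mult[OF pm.AW.mat_in_const _ eps_pow_carrier Zc])
    then have "mat_in pm.AW ?n ?n (\<lambda>x. ?N ^\<^sub>m t * Zb (fst x) h * ?N ^\<^sub>m u)"
      by (rule pm.AW.mat_in_mult[OF _ pm.AW.mat_in_const mult_carrier_mat[OF eps_pow_carrier Zc] eps_pow_carrier])
    from pm.AW.uminus[OF mat_inD[OF this rs]] show ?thesis .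
  qed
  show "f \<in> pm.AW"
    unfolding f vertex_eq_def[abs_def]
    by (intro pm.AW.add pm.AW.sum pm.AW.const 1 2) auto
qed

abbreviation vn where "vn n \<equiv> v0(j := n)"

definition par :: "('v \<Rightarrow> complex poly) \<Rightarrow> complex poly \<Rightarrow> complex poly \<Rightarrow> 'v \<Rightarrow> complex poly" where
  "par lam l z k = (if k = j then l else lam k - shift z k)"

lemma \<beta>_coords:
  "mat_in (gs.AR n) (n * D) (w * D) (amat n)" "mat_in (gs.AR n) (w * D) (n * D) (bmat n)"
  "c \<in> CY \<Longrightarrow> (\<lambda>B. c (restrict B hoff)) \<in> gs.AR n"
proof -
  interpret A: fun_algebra "Rep n" "gs.AR n" by (rule gs.AR_algebra)
  have in1: "mat_in (gs.AR n) (n * D) (vk h * dk h) (\<lambda>B. B h)" "mat_in (gs.AR n) (vk h * dk h) (n * D) (\<lambda>B. B (rev_arrow h))"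
    if "h \<in> hin" for h
    using gs.rep_coord[of h n] gs.rep_coord[of "rev_arrow h" n] hinD[OF that] hin_src(1)[OF that] by simp_all
  show "mat_in (gs.AR n) (n * D) (w * D) (amat n)"
    unfolding mat_in_def
  proof (intro allI impI)
    fix r x assume r: "r < n * D" and x: "x < w * D"
    obtain h m i where h: "h \<in> hin" "m < ff h" "i < vk h * dk h" "x = \<iota> h m i" by (rule \<iota>_cases[OF x])
    have "mat_in (gs.AR n) (n * D) (vk h * dk h) (\<lambda>B. eps_mat n D ^\<^sub>m m * B h)"
      by (rule A.mat_in_mult[OF A.mat_in_const in1(1)[OF h(1)]], rule eps_pow_carrier, rule rep_in(1)[OF _ h(1)])
    from mat_inD[OF this r h(3)] show "(\<lambda>B. amat n B $$ (r, x)) \<in> gs.AR n"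
      using r x \<kappa>_\<iota>[OF h(1-3)] unfolding h(4) by (simp add: amat_def del: index_mult_mat(1))
  qed
  show "mat_in (gs.AR n) (w * D) (n * D) (bmat n)"
    unfolding mat_in_def
  proof (intro allI impI)
    fix r x assume r: "r < n * D" and x: "x < w * D"
    obtain h m i where h: "h \<in> hin" "m < ff h" "i < vk h * dk h" "x = \<iota> h m i" by (rule \<iota>_cases[OF x])
    let ?P = "\<lambda>B. B (rev_arrow h) * eps_mat n D ^\<^sub>m (ff h - 1 - m)"
    have "mat_in (gs.AR n) (vk h * dk h) (n * D) ?P"
      by (rule A.mat_in_mult[OF in1(2)[OF h(1)] A.mat_in_const], rule rep_in(3)[OF _ h(1)], assumption, rule eps_pow_carrier)
    from A.scale[OF mat_inD[OF this h(3) r], of "sgn_arrow h"]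
    show "(\<lambda>B. bmat n B $$ (x, r)) \<in> gs.AR n"
    proof (rule A.cong)
      fix B assume B: "B \<in> Rep n"
      show "bmat n B $$ (x, r) = sgn_arrow h * ?P B $$ (i, r)"
        using carrier_matD[OF rep_in(3)[OF B h(1)]] r x h(3) \<kappa>_\<iota>[OF h(1-3)] unfolding h(4) by (simp add: bmat_def del: index_mult_mat(1))
    qed
  qed
  show "(\<lambda>B. c (restrict B hoff)) \<in> gs.AR n" if cC: "c \<in> CY" for c
  proof -
    obtain h r s where h: "h \<in> hoff" and rs: "r < v0 (tgt Q h) * d (tgt Q h)" "s < v0 (src Q h) * d (src Q h)"
      and c: "c = (\<lambda>y. y h $$ (r, s))" using cC unfolding CY_def by blast
    have "h \<in> dbl Q" "src Q h \<noteq> j" "tgt Q h \<noteq> j" using h by (auto simp: hoff_def)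
    from mat_inD[OF gs.rep_coord[OF this(1), of n], of r s] rs this show ?thesis
      using h by (simp add: c)
  qed
qed

lemma \<beta>_pullback:
  assumes f: "f \<in> pm.A n"
  shows "(\<lambda>B. f (\<beta> n B)) \<in> gs.AR n"
  unfolding \<beta>_def
  by (rule pm.subst_E[OF gs.AR_algebra f \<beta>_coords]) (assumption | rule \<beta>_E[unfolded \<beta>_def])+

lemma asm_pullback:
  assumes f: "f \<in> gs.AR n"
  shows "(\<lambda>x. f (asm n x)) \<in> pm.A n"
proof -
  interpret A: fun_algebra "pm.E n" "pm.A n" by (rule pm.A_algebra)
  show ?thesis
  proof (rule A.poly_subst[OF f[unfolded gs.AR_def]])
    show "asm n x \<in> Rep n" if "x \<in> pm.E n" for x by (rule asm_rep[OF that])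
    have dims: "dim_row (fst x) = n * D" "dim_col (fst (snd x)) = n * D" if "x \<in> pm.E n" for x
      using pm.Ecar[OF that] by blast+
    fix c assume "c \<in> rep_coords Q d (vn n)"
    then obtain h r s where h: "h \<in> dbl Q" and rs: "r < vn n (tgt Q h) * d (tgt Q h)" "s < vn n (src Q h) * d (src Q h)"
      and c: "c = (\<lambda>B. B h $$ (r, s))" by (auto simp: rep_coords_def)
    consider "h \<in> hin" | "rev_arrow h \<in> hin" | "h \<in> hoff" using dbl_cases[OF h] by blast
    then show "(\<lambda>x. c (asm n x)) \<in> pm.A n"
    proof cases
      case 1
      then have rs': "r < n * D" "s < vk h * dk h" using rs hinD(2)[OF 1] hin_src(1)[OF 1] by auto
      show ?thesis
        by (rule A.cong[OF mat_inD[OF pm.coord_E(1) rs'(1) \<iota>_less[OF 1 hin_mult(4)[OF 1] rs'(2)]]])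
          (use rs' in \<open>simp add: c asm_in(1)[OF 1] Col_def dims\<close>)
    next
      case 2
      define g where "g = rev_arrow h"
      have g: "g \<in> hin" and hg: "h = rev_arrow g" using 2 by (simp_all add: g_def)
      then have rs': "r < vk g * dk g" "s < n * D" using rs hinD(2)[OF g] hin_src(1)[OF g] by auto
      have fl: "ff g - 1 < ff g" using hin_mult(4)[OF g] by simp
      show ?thesis
        by (rule A.cong[OF A.scale[OF mat_inD[OF pm.coord_E(2) \<iota>_less[OF g fl rs'(1)] rs'(2)], of "sgn_arrow g"]])
          (use rs' in \<open>simp add: c hg asm_in(2)[OF g] Row_def dims\<close>)
    next
      case 3
      then have rs': "r < v0 (tgt Q h) * d (tgt Q h)" "s < v0 (src Q h) * d (src Q h)" using rs by (auto simp: hoff_def)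
      have "(\<lambda>y. y h $$ (r, s)) \<in> CY" using rs' 3 unfolding CY_def by blast
      from pm.coord_E(3)[OF this, of n] show ?thesis
        using h hoff_not[OF 3] by (simp add: c asm_def)
    qed
  qed
qed

lemma equations_\<beta>:
  assumes B: "B \<in> Rep n"
  shows "r < n * D \<Longrightarrow> s < n * D \<Longrightarrow> (amat n B * bmat n B + scal_mat n D D l) $$ (r, s) =
      (moment_map Q d (vn n) j B + scal_mat (vn n j) D D (par lam l z j)) $$ (r, s)"
    "k \<in> verts Q \<Longrightarrow> k \<noteq> j \<Longrightarrow> r < v0 k * d k \<Longrightarrow> s < v0 k * d k \<Longrightarrow>
      vertex_eq lam k r s (pm.\<pi> z (\<beta> n B)) =
      (moment_map Q d (vn n) k B + scal_mat (vn n k) (d k) (d k) (par lam l z k)) $$ (r, s)"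
proof -
  show "(amat n B * bmat n B + scal_mat n D D l) $$ (r, s) =
      (moment_map Q d (vn n) j B + scal_mat (vn n j) D D (par lam l z j)) $$ (r, s)" if "r < n * D" "s < n * D"
    using moment_at_j[OF B that] that carrier_matD[OF amat_carrier] carrier_matD[OF bmat_carrier]
      carrier_matD[OF gs.moment_carrier[of n j B]]
    by (simp add: par_def carrier_matD[OF scal_carrier] del: index_mult_mat(1))
  show "k \<in> verts Q \<Longrightarrow> k \<noteq> j \<Longrightarrow> r < v0 k * d k \<Longrightarrow> s < v0 k * d k \<Longrightarrow>
      vertex_eq lam k r s (pm.\<pi> z (\<beta> n B)) =
      (moment_map Q d (vn n) k B + scal_mat (vn n k) (d k) (d k) (par lam l z k)) $$ (r, s)"
    using moment_off_j[OF B] by (simp add: par_def del: index_add_mat)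
qed

lemma \<beta>_ideal:
  assumes f: "f \<in> pm.I lam n l z"
  shows "(\<lambda>B. f (\<beta> n B)) \<in> gs.IR n (par lam l z)"
proof -
  interpret I: fun_ideal "Rep n" "gs.AR n" "gs.IR n (par lam l z)" by (rule gs.IR_ideal)
  have gen: "(\<lambda>B. (moment_map Q d (vn n) k B + scal_mat (vn n k) (d k) (d k) (par lam l z k)) $$ (r, s)) \<in> gs.IR n (par lam l z)"
    if "k \<in> verts Q" "r < vn n k * d k" "s < vn n k * d k" for k r s
    unfolding gs.IR_def by (rule I.gen_ideal_gen) (use that in \<open>unfold gs.gens_def, blast\<close>)
  show ?thesis
  proof (rule I.gen_ideal_subst[OF f[unfolded pm.I_def]])
    show "\<beta> n B \<in> pm.E n" if "B \<in> Rep n" for B by (rule \<beta>_E[OF that])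
    show "(\<lambda>B. a (\<beta> n B)) \<in> gs.AR n" if "a \<in> pm.A n" for a by (rule \<beta>_pullback[OF that])
  next
    fix g assume "g \<in> {\<lambda>x. (fst x * fst (snd x) + scal_mat n D D l) $$ (r, s) | r s. r < n * D \<and> s < n * D} \<union>
      {\<lambda>x. m (pm.\<pi> z x) | m. m \<in> vertex_eqs lam}"
    then consider (1) r s where "r < n * D" "s < n * D" "g = (\<lambda>x. (fst x * fst (snd x) + scal_mat n D D l) $$ (r, s))"
      | (2) k r s where "k \<in> verts Q" "k \<noteq> j" "r < v0 k * d k" "s < v0 k * d k" "g = (\<lambda>x. vertex_eq lam k r s (pm.\<pi> z x))"
      unfolding vertex_eqs_def by blast
    then show "(\<lambda>B. g (\<beta> n B)) \<in> gs.IR n (par lam l z)"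
    proof cases
      case 1
      show ?thesis
        by (rule I.I_cong[OF gen[of j r s]])
          (use 1 j equations_\<beta>(1)[where z = z and lam = lam] in \<open>simp_all add: \<beta>_def del: index_add_mat\<close>)
    next
      case 2
      show ?thesis
        by (rule I.I_cong[OF gen[of k r s]]) (use 2 equations_\<beta>(2)[where l = l] in \<open>simp_all del: index_add_mat\<close>)
    qed
  qed
qed

lemma asm_parts:
  assumes x: "x \<in> pm.E n"
  shows "amat n (asm n x) = fst x" "bmat n (asm n x) = fst (snd x)" "restrict (asm n x) hoff = snd (snd x)"
  using arg_cong[OF \<beta>_asm[OF x], of fst] arg_cong[OF \<beta>_asm[OF x], of "\<lambda>x. fst (snd x)"]
    arg_cong[OF \<beta>_asm[OF x], of "\<lambda>x. snd (snd x)"]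
  by (simp_all only: \<beta>_def fst_conv snd_conv)

lemma asm_ideal:
  assumes f: "f \<in> gs.IR n (par lam l z)"
  shows "(\<lambda>x. f (asm n x)) \<in> pm.I lam n l z"
proof -
  interpret I: fun_ideal "pm.E n" "pm.A n" "pm.I lam n l z" by (rule pm.I_ideal)
  show ?thesis
  proof (rule I.gen_ideal_subst[OF f[unfolded gs.IR_def]])
    show "asm n x \<in> Rep n" if "x \<in> pm.E n" for x by (rule asm_rep[OF that])
    show "(\<lambda>x. a (asm n x)) \<in> pm.A n" if "a \<in> gs.AR n" for a by (rule asm_pullback[OF that])
  next
    fix g assume "g \<in> gs.gens n (par lam l z)"
    then obtain k r s where k: "k \<in> verts Q" and rs: "r < vn n k * d k" "s < vn n k * d k"
      and g: "g = (\<lambda>B. (moment_map Q d (vn n) k B + scal_mat (vn n k) (d k) (d k) (par lam l z k)) $$ (r, s))"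
      unfolding gs.gens_def by blast
    show "(\<lambda>x. g (asm n x)) \<in> pm.I lam n l z"
    proof (cases "k = j")
      case True
      then have rs': "r < n * D" "s < n * D" using rs by auto
      have "(\<lambda>x. (fst x * fst (snd x) + scal_mat n D D l) $$ (r, s)) \<in> pm.I lam n l z"
        unfolding pm.I_def using rs' by (intro I.gen_ideal_gen) blast
      then show ?thesis
      proof (rule I.I_cong)
        fix x assume x: "x \<in> pm.E n"
        show "g (asm n x) = (fst x * fst (snd x) + scal_mat n D D l) $$ (r, s)"
          unfolding g True
          by (rule equations_\<beta>(1)[OF asm_rep[OF x] rs', of l lam z, unfolded asm_parts[OF x], symmetric])
      qed
    next
      case False
      then have rs': "r < v0 k * d k" "s < v0 k * d k" using rs by auto
      have "vertex_eq lam k r s \<in> vertex_eqs lam" unfolding vertex_eqs_def using k False rs' by blast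
      then have "(\<lambda>x. vertex_eq lam k r s (pm.\<pi> z x)) \<in> pm.I lam n l z"
        unfolding pm.I_def by (intro I.gen_ideal_gen) blast
      then show ?thesis
      proof (rule I.I_cong)
        fix x assume x: "x \<in> pm.E n"
        show "g (asm n x) = vertex_eq lam k r s (pm.\<pi> z x)"
          unfolding g
          by (rule equations_\<beta>(2)[OF asm_rep[OF x] k False rs', of lam z l, unfolded \<beta>_asm[OF x], symmetric])
      qed
    qed
  qed
qed

end

context vertex_setting
begin

text \<open>The action of the groups at the other vertices on the induced module.\<close>

definition rho :: "('v \<Rightarrow> complex mat) \<Rightarrow> complex mat" where
  "rho \<gamma> = mat (w * D) (w * D) (\<lambda>(x, y). case \<kappa> x of (h, m, i) \<Rightarrow> case \<kappa> y of (h', m', i') \<Rightarrow>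
     if h = h' \<and> m = m' then \<gamma> (src Q h) $$ (i, i') else 0)"

lemma rho_carrier: "rho \<gamma> \<in> carrier_mat (w * D) (w * D)"
  by (simp add: rho_def)

lemma rho_entry:
  assumes "h \<in> hin" "m < ff h" "i < vk h * dk h" "h' \<in> hin" "m' < ff h'" "i' < vk h' * dk h'"
  shows "rho \<gamma> $$ (\<iota> h m i, \<iota> h' m' i') = (if h = h' \<and> m = m' then \<gamma> (src Q h) $$ (i, i') else 0)"
  using \<iota>_less[OF assms(1-3)] \<iota>_less[OF assms(4-6)] \<kappa>_\<iota>[OF assms(1-3)] \<kappa>_\<iota>[OF assms(4-6)] by (simp add: rho_def)

lemma sum_block_delta:
  assumes h: "h \<in> hin" "m < ff h"
  shows "(\<Sum>h'\<in>hin. \<Sum>m'<ff h'. if h' = h \<and> m' = m then F h' m' else 0) = (F h m :: complex)"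
proof -
  have "(\<Sum>h'\<in>hin. \<Sum>m'<ff h'. if h' = h \<and> m' = m then F h' m' else 0) =
    (\<Sum>h'\<in>hin. if h' = h then (\<Sum>m'<ff h. if m' = m then F h m' else 0) else 0)"
    by (intro sum.cong refl) auto
  then show ?thesis using h finite_hin by (simp add: sum.delta)
qed

lemma Col_rho:
  assumes A: "A \<in> carrier_mat r (w * D)" and \<gamma>: "\<gamma> (src Q h) \<in> carrier_mat (vk h * dk h) (vk h * dk h)"
    and h: "h \<in> hin" "m < ff h"
  shows "Col (A * rho \<gamma>) h m = Col A h m * \<gamma> (src Q h)"
proof (rule eq_matI)
  fix x i assume "x < dim_row (Col A h m * \<gamma> (src Q h))" "i < dim_col (Col A h m * \<gamma> (src Q h))"
  then have xi: "x < r" "i < vk h * dk h" using A \<gamma> by (auto simp: Col_def)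
  have "Col (A * rho \<gamma>) h m $$ (x, i) = (\<Sum>y<w * D. A $$ (x, y) * rho \<gamma> $$ (y, \<iota> h m i))"
    using xi A times_mat_entry[OF A rho_carrier xi(1) \<iota>_less[OF h xi(2)]] by (simp add: Col_def del: index_mult_mat(1))
  also have "\<dots> = (\<Sum>h'\<in>hin. \<Sum>m'<ff h'. \<Sum>i'<vk h' * dk h'. A $$ (x, \<iota> h' m' i') * rho \<gamma> $$ (\<iota> h' m' i', \<iota> h m i))"
    by (rule sum_\<iota>)
  also have "\<dots> = (\<Sum>h'\<in>hin. \<Sum>m'<ff h'. if h' = h \<and> m' = m then
      (\<Sum>i'<vk h' * dk h'. A $$ (x, \<iota> h' m' i') * \<gamma> (src Q h') $$ (i', i)) else 0)"
    by (intro sum.cong refl) (auto simp: rho_entry h xi)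
  also have "\<dots> = (\<Sum>i'<vk h * dk h. A $$ (x, \<iota> h m i') * \<gamma> (src Q h) $$ (i', i))"
    by (rule sum_block_delta[OF h])
  also have "\<dots> = (Col A h m * \<gamma> (src Q h)) $$ (x, i)"
    unfolding times_mat_entry[OF Col_carrier[OF A] \<gamma> xi] using xi A by (simp add: Col_def)
  finally show "Col (A * rho \<gamma>) h m $$ (x, i) = (Col A h m * \<gamma> (src Q h)) $$ (x, i)" .
qed (use A \<gamma> in \<open>auto simp: Col_def\<close>)

lemma Row_rho:
  assumes A: "A \<in> carrier_mat (w * D) r" and \<gamma>: "\<gamma> (src Q h) \<in> carrier_mat (vk h * dk h) (vk h * dk h)"
    and h: "h \<in> hin" "m < ff h"
  shows "Row (rho \<gamma> * A) h m = \<gamma> (src Q h) * Row A h m"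
proof (rule eq_matI)
  fix i x assume "i < dim_row (\<gamma> (src Q h) * Row A h m)" "x < dim_col (\<gamma> (src Q h) * Row A h m)"
  then have xi: "x < r" "i < vk h * dk h" using A \<gamma> by (auto simp: Row_def)
  have "Row (rho \<gamma> * A) h m $$ (i, x) = (\<Sum>y<w * D. rho \<gamma> $$ (\<iota> h m i, y) * A $$ (y, x))"
    using xi A times_mat_entry[OF rho_carrier A \<iota>_less[OF h xi(2)] xi(1)] by (simp add: Row_def del: index_mult_mat(1))
  also have "\<dots> = (\<Sum>h'\<in>hin. \<Sum>m'<ff h'. \<Sum>i'<vk h' * dk h'. rho \<gamma> $$ (\<iota> h m i, \<iota> h' m' i') * A $$ (\<iota> h' m' i', x))"
    by (rule sum_\<iota>)
  also have "\<dots> = (\<Sum>h'\<in>hin. \<Sum>m'<ff h'. if h' = h \<and> m' = m then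
      (\<Sum>i'<vk h' * dk h'. \<gamma> (src Q h') $$ (i, i') * A $$ (\<iota> h' m' i', x)) else 0)"
    by (intro sum.cong refl) (auto simp: rho_entry h xi)
  also have "\<dots> = (\<Sum>i'<vk h * dk h. \<gamma> (src Q h) $$ (i, i') * A $$ (\<iota> h m i', x))"
    by (rule sum_block_delta[OF h])
  also have "\<dots> = (\<gamma> (src Q h) * Row A h m) $$ (i, x)"
    unfolding times_mat_entry[OF \<gamma> Row_carrier[OF A] xi(2,1)] using xi A by (simp add: Row_def)
  finally show "Row (rho \<gamma> * A) h m $$ (i, x) = (\<gamma> (src Q h) * Row A h m) $$ (i, x)" .
qed (use A \<gamma> in \<open>auto simp: Row_def\<close>)

definition good :: "('v \<Rightarrow> complex mat) \<Rightarrow> bool" where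
  "good \<gamma> \<longleftrightarrow> (\<forall>i\<in>verts Q. i \<noteq> j \<longrightarrow> lin (d i) (v0 i) (v0 i) (\<gamma> i))"

lemma good_src: "good \<gamma> \<Longrightarrow> h \<in> hin \<Longrightarrow> lin (dk h) (vk h) (vk h) (\<gamma> (src Q h))"
  using hin_src[of h] by (simp add: good_def)

lemma good_src_carrier: "good \<gamma> \<Longrightarrow> h \<in> hin \<Longrightarrow> \<gamma> (src Q h) \<in> carrier_mat (vk h * dk h) (vk h * dk h)"
  by (rule lin_carrier[OF good_src])

lemma Row_rho_one:
  assumes "good \<gamma>" "h \<in> hin" "m < ff h"
  shows "Row (rho \<gamma>) h m = \<gamma> (src Q h) * Row (1\<^sub>m (w * D)) h m"
  using Row_rho[where \<gamma> = \<gamma>, OF one_carrier_mat good_src_carrier[OF assms(1,2)] assms(2,3)] right_mult_one_mat[OF rho_carrier] by simp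

lemma rho_lin:
  assumes \<gamma>: "good \<gamma>"
  shows "lin D w w (rho \<gamma>)"
proof -
  have one: "(1\<^sub>m (w * D) :: complex mat) \<in> carrier_mat (w * D) (w * D)" by simp
  have "rho \<gamma> * eps_mat w D = eps_mat w D * rho \<gamma>"
  proof (rule Row_ext)
    fix h m assume h: "h \<in> hin" "m < ff h"
    let ?g = "\<gamma> (src Q h)" and ?R = "\<lambda>m. Row (1\<^sub>m (w * D)) h m"
    note gc = good_src_carrier[OF \<gamma> h(1)]
    have R: "?R m \<in> carrier_mat (vk h * dk h) (w * D)" for m by (rule Row_carrier[OF one])
    have l: "Row (rho \<gamma> * eps_mat w D) h m = ?g * Row (eps_mat w D) h m" by (rule Row_rho[where \<gamma> = \<gamma>, OF eps_carrier gc h])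
    have e: "Row (eps_mat w D) h m = (if m = 0 then N h ^\<^sub>m ee h * ?R (ff h - 1) else ?R (m - 1))"
      using Row_eps[OF one h] right_mult_one_mat[OF eps_carrier, of w D] by simp
    have r: "Row (eps_mat w D * rho \<gamma>) h m = (if m = 0 then N h ^\<^sub>m ee h * Row (rho \<gamma>) h (ff h - 1) else Row (rho \<gamma>) h (m - 1))"
      by (rule Row_eps[OF rho_carrier h])
    have rr: "Row (rho \<gamma>) h m' = ?g * ?R m'" if "m' < ff h" for m' by (rule Row_rho_one[OF \<gamma> h(1) that])
    show "Row (rho \<gamma> * eps_mat w D) h m = Row (eps_mat w D * rho \<gamma>) h m"
    proof (cases "m = 0")
      case True
      have "?g * (N h ^\<^sub>m ee h * ?R (ff h - 1)) = ?g * N h ^\<^sub>m ee h * ?R (ff h - 1)"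
        by (rule assoc_mult_mat[OF gc eps_pow_carrier R, symmetric])
      also have "?g * N h ^\<^sub>m ee h = N h ^\<^sub>m ee h * ?g" by (rule lin_eps_pow[OF good_src[OF \<gamma> h(1)]])
      also have "N h ^\<^sub>m ee h * ?g * ?R (ff h - 1) = N h ^\<^sub>m ee h * (?g * ?R (ff h - 1))"
        by (rule assoc_mult_mat[OF eps_pow_carrier gc R])
      finally show ?thesis unfolding l e r using True rr[of "ff h - 1"] h(2) by simp
    next
      case False
      then show ?thesis unfolding l e r using rr[of "m - 1"] h(2) by simp
    qed
  qed (auto simp: rho_def)
  then show ?thesis by (simp add: lin_def rho_carrier)
qed

lemma rho_inverse:
  assumes \<gamma>: "good \<gamma>" and \<delta>: "good \<delta>" and inv: "\<And>i. i \<in> verts Q \<Longrightarrow> i \<noteq> j \<Longrightarrow> \<gamma> i * \<delta> i = 1\<^sub>m (v0 i * d i)"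
  shows "rho \<gamma> * rho \<delta> = 1\<^sub>m (w * D)"
proof (rule Row_ext)
  fix h m assume h: "h \<in> hin" "m < ff h"
  note gc = good_src_carrier[OF \<gamma> h(1)] and dc = good_src_carrier[OF \<delta> h(1)]
  let ?R = "Row (1\<^sub>m (w * D)) h m"
  have R: "?R \<in> carrier_mat (vk h * dk h) (w * D)" by (rule Row_carrier) simp
  have "Row (rho \<gamma> * rho \<delta>) h m = \<gamma> (src Q h) * (\<delta> (src Q h) * ?R)"
    unfolding Row_rho[where \<gamma> = \<gamma>, OF rho_carrier gc h] Row_rho_one[OF \<delta> h] by (rule refl)
  also have "\<dots> = \<gamma> (src Q h) * \<delta> (src Q h) * ?R" by (rule assoc_mult_mat[OF gc dc R, symmetric])
  also have "\<dots> = ?R" unfolding inv[OF hin_src(2,1)[OF h(1)]] by (rule left_mult_one_mat[OF R])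
  finally show "Row (rho \<gamma> * rho \<delta>) h m = ?R" .
qed (auto simp: rho_def)

lemma rho_one:
  assumes "\<And>i. i \<in> verts Q \<Longrightarrow> i \<noteq> j \<Longrightarrow> \<gamma> i = 1\<^sub>m (v0 i * d i)"
  shows "rho \<gamma> = 1\<^sub>m (w * D)"
proof (rule Row_ext)
  have g: "good \<gamma>" using assms lin_one by (simp add: good_def)
  fix h m assume h: "h \<in> hin" "m < ff h"
  have R: "Row (1\<^sub>m (w * D)) h m \<in> carrier_mat (vk h * dk h) (w * D)" by (rule Row_carrier) simp
  show "Row (rho \<gamma>) h m = Row (1\<^sub>m (w * D)) h m"
    unfolding Row_rho_one[OF g h] assms[OF hin_src(2,1)[OF h(1)]] by (rule left_mult_one_mat[OF R])
qed (auto simp: rho_def)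

lemma gauge_good: "g \<in> carrier (gs.G n) \<Longrightarrow> good g"
  unfolding good_def using gs.gauge_lin[of g n] by fastforce

lemma amat_act:
  assumes g: "g \<in> carrier (gs.G n)" and B: "B \<in> Rep n"
  shows "amat n (gauge_act Q d (vn n) g B) = g j * amat n B * rho (inv\<^bsub>gs.G n\<^esub> g)"
proof -
  let ?k = "inv\<^bsub>gs.G n\<^esub> g"
  have gj: "lin D n n (g j)" using gs.gauge_lin[OF g j] by simp
  note gjc = lin_carrier[OF gj] and kg = gauge_good[OF gs.gauge_inv(1)[OF g]]
  have ga: "g j * amat n B \<in> carrier_mat (n * D) (w * D)" by (rule mult_carrier_mat[OF gjc amat_carrier])
  show ?thesis
  proof (rule Col_ext[OF amat_carrier mult_carrier_mat[OF ga rho_carrier]])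
    fix h m assume h: "h \<in> hin" "m < ff h"
    note b = rep_in(1)[OF B h(1)] and kc = good_src_carrier[OF kg h(1)]
    have act: "gauge_act Q d (vn n) g B h = g j * B h * ?k (src Q h)"
      using hinD[OF h(1)] by (simp add: gauge_act_def)
    have "Col (amat n (gauge_act Q d (vn n) g B)) h m = eps_mat n D ^\<^sub>m m * (g j * B h * ?k (src Q h))"
      unfolding Col_amat[OF gs.gauge_act_rep[OF g B] h] act by (rule refl)
    also have "\<dots> = eps_mat n D ^\<^sub>m m * (g j * B h) * ?k (src Q h)"
      by (rule assoc_mult_mat[OF eps_pow_carrier mult_carrier_mat[OF gjc b] kc, symmetric])
    also have "eps_mat n D ^\<^sub>m m * (g j * B h) = eps_mat n D ^\<^sub>m m * g j * B h"
      by (rule assoc_mult_mat[OF eps_pow_carrier gjc b, symmetric])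
    also have "eps_mat n D ^\<^sub>m m * g j = g j * eps_mat n D ^\<^sub>m m" by (rule lin_eps_pow[OF gj, symmetric])
    also have "g j * eps_mat n D ^\<^sub>m m * B h = g j * Col (amat n B) h m"
      unfolding Col_amat[OF B h] by (rule assoc_mult_mat[OF gjc eps_pow_carrier b])
    also have "g j * Col (amat n B) h m * ?k (src Q h) = Col (g j * amat n B * rho ?k) h m"
      unfolding Col_rho[where \<gamma> = ?k, OF ga kc h] Col_left_mult[OF gjc amat_carrier h] by (rule refl)
    finally show "Col (amat n (gauge_act Q d (vn n) g B)) h m = Col (g j * amat n B * rho ?k) h m" .
  qed
qed

lemma bmat_act:
  assumes g: "g \<in> carrier (gs.G n)" and B: "B \<in> Rep n"
  shows "bmat n (gauge_act Q d (vn n) g B) = rho g * bmat n B * (inv\<^bsub>gs.G n\<^esub> g) j"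
proof -
  let ?k = "inv\<^bsub>gs.G n\<^esub> g"
  have kj: "lin D n n (?k j)" using gs.gauge_lin[OF gs.gauge_inv(1)[OF g] j] by simp
  note kjc = lin_carrier[OF kj] and gg = gauge_good[OF g]
  have rb: "rho g * bmat n B \<in> carrier_mat (w * D) (n * D)" by (rule mult_carrier_mat[OF rho_carrier bmat_carrier])
  show ?thesis
  proof (rule Row_ext[OF bmat_carrier mult_carrier_mat[OF rb kjc]])
    fix h m assume h: "h \<in> hin" "m < ff h"
    note b = rep_in(3)[OF B h(1)] and gc = good_src_carrier[OF gg h(1)]
    let ?q = "ff h - 1 - m" and ?b = "B (rev_arrow h)"
    let ?E = "eps_mat n D ^\<^sub>m (ff h - 1 - m)"
    have bE: "?b * ?E \<in> carrier_mat (vk h * dk h) (n * D)" by (rule mult_carrier_mat[OF b eps_pow_carrier])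
    have act: "gauge_act Q d (vn n) g B (rev_arrow h) = g (src Q h) * ?b * ?k j"
      using hinD[OF h(1)] by (simp add: gauge_act_def)
    have "g (src Q h) * ?b * ?k j * ?E = g (src Q h) * ?b * (?k j * ?E)"
      by (rule assoc_mult_mat[OF mult_carrier_mat[OF gc b] kjc eps_pow_carrier])
    also have "?k j * ?E = ?E * ?k j" by (rule lin_eps_pow[OF kj])
    also have "g (src Q h) * ?b * (?E * ?k j) = g (src Q h) * ?b * ?E * ?k j"
      by (rule assoc_mult_mat[OF mult_carrier_mat[OF gc b] eps_pow_carrier kjc, symmetric])
    also have "g (src Q h) * ?b * ?E = g (src Q h) * (?b * ?E)"
      by (rule assoc_mult_mat[OF gc b eps_pow_carrier])
    finally have eq: "g (src Q h) * ?b * ?k j * ?E = g (src Q h) * (?b * ?E) * ?k j" .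
    have "Row (bmat n (gauge_act Q d (vn n) g B)) h m = sgn_arrow h \<cdot>\<^sub>m (g (src Q h) * (?b * ?E) * ?k j)"
      unfolding Row_bmat[OF gs.gauge_act_rep[OF g B] h] act eq by (rule refl)
    also have "\<dots> = g (src Q h) * (sgn_arrow h \<cdot>\<^sub>m (?b * ?E)) * ?k j"
      unfolding mult_smult_distrib[OF gc bE] mult_smult_assoc_mat[OF mult_carrier_mat[OF gc bE] kjc] by (rule refl)
    also have "\<dots> = Row (rho g * bmat n B * ?k j) h m"
      unfolding Row_right_mult[OF kjc rb h] Row_rho[where \<gamma> = g, OF bmat_carrier gc h] Row_bmat[OF B h] by (rule refl)
    finally show "Row (bmat n (gauge_act Q d (vn n) g B)) h m = Row (rho g * bmat n B * ?k j) h m" .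
  qed
qed

definition kap where
  "kap \<gamma> \<delta> x = (rho \<gamma> * fst x * rho \<delta>, \<lambda>h\<in>hoff. \<gamma> (tgt Q h) * snd x h * \<delta> (src Q h))"

lemma restrict_act: "restrict (gauge_act Q d (vn n) g B) hoff =
    (\<lambda>h\<in>hoff. g (tgt Q h) * restrict B hoff h * (inv\<^bsub>gs.G n\<^esub> g) (src Q h))"
  by (rule ext) (auto simp: gauge_act_def hoff_def restrict_def)

lemma \<pi>_act:
  assumes g: "g \<in> carrier (gs.G n)" and B: "B \<in> Rep n"
  shows "pm.\<pi> z (\<beta> n (gauge_act Q d (vn n) g B)) = kap g (inv\<^bsub>gs.G n\<^esub> g) (pm.\<pi> z (\<beta> n B))"
proof -
  let ?k = "inv\<^bsub>gs.G n\<^esub> g" and ?S = "scal_mat w D D z"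
  let ?a = "amat n B" and ?b = "bmat n B" and ?r = "rho g" and ?s = "rho (inv\<^bsub>gs.G n\<^esub> g)"
  note gg = gauge_good[OF g] and kg = gauge_good[OF gs.gauge_inv(1)[OF g]]
  have gj: "g j \<in> carrier_mat (n * D) (n * D)" and kj: "?k j \<in> carrier_mat (n * D) (n * D)"
    using lin_carrier[OF gs.gauge_lin[OF g j]] lin_carrier[OF gs.gauge_lin[OF gs.gauge_inv(1)[OF g] j]] by simp_all
  have kgj: "?k j * g j = 1\<^sub>m (n * D)" using gs.gauge_inv(3)[OF g j] by simp
  note a = amat_carrier[of n B] and b = bmat_carrier[of n B] and r = rho_carrier[of g] and s = rho_carrier[of ?k]
  have rb: "?r * ?b \<in> carrier_mat (w * D) (n * D)" and as: "?a * ?s \<in> carrier_mat (n * D) (w * D)"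
    and ba: "?b * ?a \<in> carrier_mat (w * D) (w * D)" using a b r s by simp_all
  have "?r * ?b * ?k j * (g j * ?a * ?s) = ?r * ?b * (?k j * (g j * (?a * ?s)))"
    using assoc_mult_mat[OF rb kj mult_carrier_mat[OF gj as]] assoc_mult_mat[OF gj a s] by simp
  also have "?k j * (g j * (?a * ?s)) = ?a * ?s"
    using assoc_mult_mat[OF kj gj as] kgj left_mult_one_mat[OF as] by simp
  also have "?r * ?b * (?a * ?s) = ?r * (?b * ?a) * ?s"
    using assoc_mult_mat[OF rb a s] assoc_mult_mat[OF r b a] by simp
  finally have 1: "?r * ?b * ?k j * (g j * ?a * ?s) = ?r * (?b * ?a) * ?s" .
  have "?r * ?S * ?s = ?S * (?r * ?s)"
    unfolding lin_scal[OF rho_lin[OF gg]] by (rule assoc_mult_mat[OF scal_carrier r s])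
  also have "?r * ?s = 1\<^sub>m (w * D)"
  proof (rule rho_inverse[OF gg kg])
    fix i assume "i \<in> verts Q" "i \<noteq> j"
    then show "g i * ?k i = 1\<^sub>m (v0 i * d i)" using gs.gauge_inv(2)[OF g, of i] by simp
  qed
  finally have 2: "?r * ?S * ?s = ?S" unfolding right_mult_one_mat[OF scal_carrier] .
  have "?r * (?b * ?a + ?S) * ?s = ?r * (?b * ?a) * ?s + ?r * ?S * ?s"
    using mult_add_distrib_mat[OF r ba scal_carrier]
      add_mult_distrib_mat[OF mult_carrier_mat[OF r ba] mult_carrier_mat[OF r scal_carrier] s] by simp
  then show ?thesis
    unfolding pm.\<pi>_def \<beta>_def kap_def fst_conv snd_conv amat_act[OF g B] bmat_act[OF g B] restrict_act 1 2 by simp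
qed

lemma kap_AW:
  assumes \<gamma>: "good \<gamma>" and \<delta>: "good \<delta>" and p: "p \<in> pm.AW"
  shows "(\<lambda>x. p (kap \<gamma> \<delta> x)) \<in> pm.AW"
  unfolding kap_def
proof (rule pm.subst_W[OF pm.AW.fun_algebra_axioms p])
  have X: "fst x \<in> carrier_mat (w * D) (w * D)" if "x \<in> pm.W" for x
    using that by (auto simp: pm.W_def lin_carrier)
  have "mat_in pm.AW (w * D) (w * D) (\<lambda>x. rho \<gamma> * fst x)"
    by (rule pm.AW.mat_in_mult[OF pm.AW.mat_in_const pm.coord_W(1) rho_carrier X])
  then show "mat_in pm.AW (w * D) (w * D) (\<lambda>x. rho \<gamma> * fst x * rho \<delta>)"
    by (rule pm.AW.mat_in_mult[OF _ pm.AW.mat_in_const mult_carrier_mat[OF rho_carrier X] rho_carrier])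
  have ends: "src Q h \<in> verts Q" "tgt Q h \<in> verts Q" "src Q h \<noteq> j" "tgt Q h \<noteq> j" if "h \<in> hoff" for h
    using that gs.ends_in_verts[of h] by (auto simp: hoff_def)
  have lins: "lin (d (tgt Q h)) (v0 (tgt Q h)) (v0 (tgt Q h)) (\<gamma> (tgt Q h))"
    "lin (d (src Q h)) (v0 (src Q h)) (v0 (src Q h)) (\<delta> (src Q h))" if "h \<in> hoff" for h
    using ends[OF that] \<gamma> \<delta> by (auto simp: good_def)
  show "(\<lambda>x. c (\<lambda>h\<in>hoff. \<gamma> (tgt Q h) * snd x h * \<delta> (src Q h))) \<in> pm.AW" if cC: "c \<in> CY" for c
  proof -
    obtain h r s where h: "h \<in> hoff" and rs: "r < v0 (tgt Q h) * d (tgt Q h)" "s < v0 (src Q h) * d (src Q h)"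
      and c: "c = (\<lambda>y. y h $$ (r, s))" using cC unfolding CY_def by blast
    let ?t = "v0 (tgt Q h) * d (tgt Q h)" and ?s = "v0 (src Q h) * d (src Q h)"
    have yc: "snd x h \<in> carrier_mat ?t ?s" if "x \<in> pm.W" for x
      using Y_carrier[OF _ h] that by (auto simp: pm.W_def)
    have y: "mat_in pm.AW ?t ?s (\<lambda>x. snd x h)"
      unfolding mat_in_def
    proof (intro allI impI)
      fix r s assume rs: "r < ?t" "s < ?s"
      have "(\<lambda>y. y h $$ (r, s)) \<in> CY" using rs h unfolding CY_def by blast
      from pm.coord_W(2)[OF this] show "(\<lambda>x. snd x h $$ (r, s)) \<in> pm.AW" .
    qed
    note gc = lin_carrier[OF lins(1)[OF h]] and dc = lin_carrier[OF lins(2)[OF h]]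
    have "mat_in pm.AW ?t ?s (\<lambda>x. \<gamma> (tgt Q h) * snd x h)"
      by (rule pm.AW.mat_in_mult[OF pm.AW.mat_in_const y gc yc])
    then have "mat_in pm.AW ?t ?s (\<lambda>x. \<gamma> (tgt Q h) * snd x h * \<delta> (src Q h))"
      by (rule pm.AW.mat_in_mult[OF _ pm.AW.mat_in_const mult_carrier_mat[OF gc yc] dc])
    from mat_inD[OF this rs] show ?thesis using h by (simp add: c del: index_mult_mat(1))
  qed
  fix x assume x: "x \<in> pm.W"
  have "(\<lambda>h\<in>hoff. \<gamma> (tgt Q h) * snd x h * \<delta> (src Q h)) \<in> Y"
  proof -
    have "gs.comm_h 0 h (\<gamma> (tgt Q h) * snd x h * \<delta> (src Q h))" if h: "h \<in> hoff" for h
    proof (rule gs.comm_h_mult)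
      have "snd x \<in> Y" using x by (auto simp: pm.W_def)
      then show "gs.comm_h 0 h (snd x h)" using h by (simp add: Y_def)
    qed (use lins[OF h] ends[OF h] in simp_all)
    then show ?thesis by (simp add: Y_def)
  qed
  then show "(rho \<gamma> * fst x * rho \<delta>, \<lambda>h\<in>hoff. \<gamma> (tgt Q h) * snd x h * \<delta> (src Q h)) \<in> pm.W"
    using x by (intro pm.WI lin_mult[of D w w _ w] rho_lin \<gamma> \<delta>) (auto simp: pm.W_def)
qed

lemma kap_cong:
  assumes "\<And>i. i \<in> verts Q \<Longrightarrow> i \<noteq> j \<Longrightarrow> \<gamma> i = \<gamma>' i" "\<And>i. i \<in> verts Q \<Longrightarrow> i \<noteq> j \<Longrightarrow> \<delta> i = \<delta>' i"
  shows "kap \<gamma> \<delta> = kap \<gamma>' \<delta>'"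
proof -
  have rho_cong: "rho \<gamma> = rho \<gamma>'" if "\<And>i. i \<in> verts Q \<Longrightarrow> i \<noteq> j \<Longrightarrow> \<gamma> i = \<gamma>' i" for \<gamma> \<gamma>'
  proof (rule eq_matI)
    fix x y assume "x < dim_row (rho \<gamma>')" "y < dim_col (rho \<gamma>')"
    then have xy: "x < w * D" "y < w * D" by (auto simp: rho_def)
    obtain h m i where h: "h \<in> hin" "m < ff h" "i < vk h * dk h" "x = \<iota> h m i" by (rule \<iota>_cases[OF xy(1)])
    obtain h' m' i' where h': "h' \<in> hin" "m' < ff h'" "i' < vk h' * dk h'" "y = \<iota> h' m' i'" by (rule \<iota>_cases[OF xy(2)])
    show "rho \<gamma> $$ (x, y) = rho \<gamma>' $$ (x, y)"
      unfolding h(4) h'(4) rho_entry[OF h(1-3) h'(1-3)] that[OF hin_src(2,1)[OF h(1)]] by (rule refl)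
  qed (auto simp: rho_def)
  have "(\<lambda>h\<in>hoff. \<gamma> (tgt Q h) * snd x h * \<delta> (src Q h)) = (\<lambda>h\<in>hoff. \<gamma>' (tgt Q h) * snd x h * \<delta>' (src Q h))"
    for x :: "complex mat \<times> ('e + 'e \<Rightarrow> complex mat)"
  proof (rule restrict_ext)
    fix h assume "h \<in> hoff"
    then have "h \<in> dbl Q" "src Q h \<noteq> j" "tgt Q h \<noteq> j" by (auto simp: hoff_def)
    then show "\<gamma> (tgt Q h) * snd x h * \<delta> (src Q h) = \<gamma>' (tgt Q h) * snd x h * \<delta>' (src Q h)"
      using assms gs.ends_in_verts[of h] by simp
  qed
  moreover have "rho \<gamma> = rho \<gamma>'" by (rule rho_cong) (rule assms(1))
  moreover have "rho \<delta> = rho \<delta>'" by (rule rho_cong) (rule assms(2))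
  ultimately show ?thesis unfolding kap_def by simp
qed

lemma single_gauge:
  assumes \<gamma>: "lin D n n \<gamma>" "det \<gamma> \<noteq> 0"
  defines "g \<equiv> (\<lambda>i\<in>verts Q. if i = j then \<gamma> else 1\<^sub>m (v0 i * d i))"
  shows "g \<in> carrier (gs.G n)" "(inv\<^bsub>gs.G n\<^esub> g) j = minv \<gamma>"
    "i \<in> verts Q \<Longrightarrow> i \<noteq> j \<Longrightarrow> (inv\<^bsub>gs.G n\<^esub> g) i = 1\<^sub>m (v0 i * d i)"
proof -
  note gc = lin_carrier[OF \<gamma>(1)]
  note mi = minv[OF gc \<gamma>(2)] and mc = minv_carrier[OF gc]
  show g: "g \<in> carrier (gs.G n)"
    unfolding gs.gauge_carrier
  proof (intro conjI ballI)
    show "g \<in> extensional (verts Q)" by (simp add: g_def)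
    fix i assume i: "i \<in> verts Q"
    have "lin (d i) (vn n i) (vn n i) (g i) \<and> (\<exists>N. lin (d i) (vn n i) (vn n i) N \<and> g i * N = 1\<^sub>m (vn n i * d i) \<and> N * g i = 1\<^sub>m (vn n i * d i))"
    proof (cases "i = j")
      case True
      then show ?thesis using i \<gamma> lin_minv[OF \<gamma>] mi by (auto simp: g_def)
    next
      case False
      then show ?thesis using i lin_one[of "d i" "v0 i"] by (auto simp: g_def intro!: exI[of _ "1\<^sub>m (v0 i * d i)"])
    qed
    then show "lin (d i) (vn n i) (vn n i) (g i)"
      "\<exists>N. lin (d i) (vn n i) (vn n i) N \<and> g i * N = 1\<^sub>m (vn n i * d i) \<and> N * g i = 1\<^sub>m (vn n i * d i)" by blast+
  qed
  let ?k = "inv\<^bsub>gs.G n\<^esub> g"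
  have kj: "?k j \<in> carrier_mat (n * D) (n * D)"
    using lin_carrier[OF gs.gauge_lin[OF gs.gauge_inv(1)[OF g] j]] by simp
  have "?k j * \<gamma> = 1\<^sub>m (n * D)" using gs.gauge_inv(3)[OF g j] j by (simp add: g_def)
  then have "?k j * \<gamma> * minv \<gamma> = minv \<gamma>" using left_mult_one_mat[OF mc] by simp
  moreover have "?k j * \<gamma> * minv \<gamma> = ?k j * (\<gamma> * minv \<gamma>)" by (rule assoc_mult_mat[OF kj gc mc])
  ultimately show "?k j = minv \<gamma>" unfolding mi right_mult_one_mat[OF kj] by simp
  show "?k i = 1\<^sub>m (v0 i * d i)" if i: "i \<in> verts Q" "i \<noteq> j"
  proof -
    have "?k i \<in> carrier_mat (v0 i * d i) (v0 i * d i)"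
      using lin_carrier[OF gs.gauge_lin[OF gs.gauge_inv(1)[OF g] i(1)]] i by simp
    from right_mult_one_mat[OF this] show ?thesis
      using gs.gauge_inv(3)[OF g i(1)] i by (simp add: g_def)
  qed
qed

lemma act_asm:
  assumes \<gamma>: "lin D n n \<gamma>" "det \<gamma> \<noteq> 0" and x: "x \<in> pm.E n"
  shows "gauge_act Q d (vn n) (\<lambda>i\<in>verts Q. if i = j then \<gamma> else 1\<^sub>m (v0 i * d i)) (asm n x) =
    asm n (\<gamma> * fst x, fst (snd x) * minv \<gamma>, snd (snd x))"
proof -
  let ?g = "\<lambda>i\<in>verts Q. if i = j then \<gamma> else 1\<^sub>m (v0 i * d i)" and ?k = "inv\<^bsub>gs.G n\<^esub> (\<lambda>i\<in>verts Q. if i = j then \<gamma> else 1\<^sub>m (v0 i * d i))"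
  note sg = single_gauge[OF \<gamma>] and B = asm_rep[OF x]
  note comps = asm_parts[OF x]
  have r1: "rho ?g = 1\<^sub>m (w * D)" by (rule rho_one) simp
  have r2: "rho ?k = 1\<^sub>m (w * D)" by (rule rho_one) (rule sg(3))
  have a: "\<gamma> * fst x \<in> carrier_mat (n * D) (w * D)" by (rule mult_carrier_mat[OF lin_carrier[OF \<gamma>(1)] pm.Ecar(1)[OF x]])
  have "amat n (gauge_act Q d (vn n) ?g (asm n x)) = \<gamma> * fst x"
    unfolding amat_act[OF sg(1) B] comps r2 using j right_mult_one_mat[OF a] by simp
  moreover have "bmat n (gauge_act Q d (vn n) ?g (asm n x)) = fst (snd x) * minv \<gamma>"
    unfolding bmat_act[OF sg(1) B] comps r1 sg(2) left_mult_one_mat[OF pm.Ecar(2)[OF x]] by (rule refl)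
  moreover have "restrict (gauge_act Q d (vn n) ?g (asm n x)) hoff = snd (snd x)"
    unfolding restrict_act comps
  proof (rule ext)
    fix h
    show "(\<lambda>h\<in>hoff. ?g (tgt Q h) * snd (snd x) h * ?k (src Q h)) h = snd (snd x) h"
    proof (cases "h \<in> hoff")
      case False
      have "snd (snd x) \<in> extensional hoff" using pm.EE(3)[OF x] by (simp add: Y_def)
      from extensional_arb[OF this False] show ?thesis using False by simp
    next
      case True
      then have h: "h \<in> dbl Q" "src Q h \<noteq> j" "tgt Q h \<noteq> j" by (auto simp: hoff_def)
      note y = Y_carrier[OF pm.EE(3)[OF x] True] and e = gs.ends_in_verts[OF h(1)]
      have "?g (tgt Q h) = 1\<^sub>m (v0 (tgt Q h) * d (tgt Q h))" using e h by simp
      moreover have "?k (src Q h) = 1\<^sub>m (v0 (src Q h) * d (src Q h))" by (rule sg(3)[OF e(1) h(2)])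
      ultimately show ?thesis using True left_mult_one_mat[OF y] right_mult_one_mat[OF y] by simp
    qed
  qed
  ultimately have "\<beta> n (gauge_act Q d (vn n) ?g (asm n x)) = (\<gamma> * fst x, fst (snd x) * minv \<gamma>, snd (snd x))"
    by (simp add: \<beta>_def)
  then show ?thesis using asm_\<beta>[OF gs.gauge_act_rep[OF sg(1) B]] by simp
qed

lemma Inv_generated:
  assumes l: "coeff l 0 \<noteq> 0" and f: "f \<in> gs.Inv n (par lam l z)"
  shows "\<exists>p\<in>pm.AW. (\<lambda>B. f B - p (pm.\<pi> z (\<beta> n B))) \<in> gs.IR n (par lam l z)"
proof -
  interpret E: fun_ideal "pm.E n" "pm.A n" "pm.I lam n l z" by (rule pm.I_ideal)
  interpret I: fun_ideal "Rep n" "gs.AR n" "gs.IR n (par lam l z)" by (rule gs.IR_ideal)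
  have fA: "f \<in> gs.AR n" using f by (simp add: gs.Inv_def)
  have "\<exists>p\<in>pm.AW. (\<lambda>x. f (asm n x) - p (pm.\<pi> z x)) \<in> pm.I lam n l z"
  proof (rule pm.invariants_generated[OF l asm_pullback[OF fA]])
    fix \<gamma> assume \<gamma>: "lin D n n \<gamma>" "det \<gamma> \<noteq> 0"
    let ?g = "\<lambda>i\<in>verts Q. if i = j then \<gamma> else 1\<^sub>m (v0 i * d i)"
    have "(\<lambda>B. f (gauge_act Q d (vn n) ?g B) - f B) \<in> gs.IR n (par lam l z)"
      using f single_gauge(1)[OF \<gamma>] unfolding gs.Inv_def by blast
    from asm_ideal[OF this]
    show "(\<lambda>x. f (asm n (\<gamma> * fst x, fst (snd x) * minv \<gamma>, snd (snd x))) - f (asm n x)) \<in> pm.I lam n l z"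
      by (rule E.I_cong) (simp only: act_asm[OF \<gamma>])
  qed
  then obtain p where p: "p \<in> pm.AW" "(\<lambda>x. f (asm n x) - p (pm.\<pi> z x)) \<in> pm.I lam n l z" by blast
  from \<beta>_ideal[OF p(2)] have "(\<lambda>B. f B - p (pm.\<pi> z (\<beta> n B))) \<in> gs.IR n (par lam l z)"
    by (rule I.I_cong) (simp only: asm_\<beta>)
  then show ?thesis using p(1) by blast
qed

lemma relation_transfer:
  assumes nm: "n + m = w" and l: "coeff l 0 \<noteq> 0" and p: "p \<in> pm.AW"
    and pI: "(\<lambda>B. p (pm.\<pi> z (\<beta> n B))) \<in> gs.IR n (par lam l z)"
  shows "(\<lambda>B. p (pm.\<pi> (z - l) (\<beta> m B))) \<in> gs.IR m (par lam (- l) (z - l))"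
proof -
  interpret E: fun_ideal "pm.E n" "pm.A n" "pm.I lam n l z" by (rule pm.I_ideal)
  have "(\<lambda>x. p (pm.\<pi> z x)) \<in> pm.I lam n l z"
    by (rule E.I_cong[OF asm_ideal[OF pI]]) (simp only: \<beta>_asm)
  from pm.relations_transfer[OF nm vertex_eqs_AW l p this] show ?thesis by (rule \<beta>_ideal)
qed

lemma Inv_transfer:
  assumes nm: "n + m = w" and l: "coeff l 0 \<noteq> 0" and f: "f \<in> gs.Inv n (par lam l z)"
    and p: "p \<in> pm.AW" and fp: "(\<lambda>B. f B - p (pm.\<pi> z (\<beta> n B))) \<in> gs.IR n (par lam l z)"
  shows "(\<lambda>B. p (pm.\<pi> (z - l) (\<beta> m B))) \<in> gs.Inv m (par lam (- l) (z - l))"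
  unfolding gs.Inv_def
proof (intro CollectI conjI ballI)
  interpret I: fun_ideal "Rep n" "gs.AR n" "gs.IR n (par lam l z)" by (rule gs.IR_ideal)
  interpret J: fun_ideal "Rep m" "gs.AR m" "gs.IR m (par lam (- l) (z - l))" by (rule gs.IR_ideal)
  show "(\<lambda>B. p (pm.\<pi> (z - l) (\<beta> m B))) \<in> gs.AR m" by (rule \<beta>_pullback[OF pm.\<pi>_pullback[OF p]])
  fix g assume g: "g \<in> carrier (gs.G m)"
  let ?k = "inv\<^bsub>gs.G m\<^esub> g"
  note gg = gauge_good[OF g] and kg = gauge_good[OF gs.gauge_inv(1)[OF g]]
  define g' where "g' = (\<lambda>i\<in>verts Q. if i = j then 1\<^sub>m (n * D) else g i)"
  have g': "g' \<in> carrier (gs.G n)"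
    unfolding gs.gauge_carrier
  proof (intro conjI ballI)
    show "g' \<in> extensional (verts Q)" by (simp add: g'_def)
    fix i assume i: "i \<in> verts Q"
    have "lin (d i) (vn n i) (vn n i) (g' i) \<and> (\<exists>N. lin (d i) (vn n i) (vn n i) N \<and> g' i * N = 1\<^sub>m (vn n i * d i) \<and> N * g' i = 1\<^sub>m (vn n i * d i))"
    proof (cases "i = j")
      case True
      then show ?thesis using i lin_one[of D n] by (auto simp: g'_def intro!: exI[of _ "1\<^sub>m (n * D)"])
    next
      case False
      have "lin (d i) (vn m i) (vn m i) (g i) \<and> (\<exists>N. lin (d i) (vn m i) (vn m i) N \<and> g i * N = 1\<^sub>m (vn m i * d i) \<and> N * g i = 1\<^sub>m (vn m i * d i))"
        using g i unfolding gs.gauge_carrier by blast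
      then show ?thesis using i False by (simp add: g'_def)
    qed
    then show "lin (d i) (vn n i) (vn n i) (g' i)"
      "\<exists>N. lin (d i) (vn n i) (vn n i) N \<and> g' i * N = 1\<^sub>m (vn n i * d i) \<and> N * g' i = 1\<^sub>m (vn n i * d i)" by blast+
  qed
  let ?k' = "inv\<^bsub>gs.G n\<^esub> g'"
  have kk: "?k' i = ?k i" if i: "i \<in> verts Q" "i \<noteq> j" for i
  proof -
    let ?n = "v0 i * d i"
    have c: "?k i \<in> carrier_mat ?n ?n" "?k' i \<in> carrier_mat ?n ?n" "g i \<in> carrier_mat ?n ?n"
      using lin_carrier[OF gs.gauge_lin[OF gs.gauge_inv(1)[OF g] i(1)]] lin_carrier[OF gs.gauge_lin[OF gs.gauge_inv(1)[OF g'] i(1)]]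
        lin_carrier[OF gs.gauge_lin[OF g i(1)]] i by simp_all
    have o: "?k' i * g i = 1\<^sub>m ?n" "g i * ?k i = 1\<^sub>m ?n"
      using gs.gauge_inv(3)[OF g' i(1)] gs.gauge_inv(2)[OF g i(1)] i by (simp_all add: g'_def)
    have "?k' i = ?k' i * (g i * ?k i)" unfolding o using right_mult_one_mat[OF c(2)] by simp
    also have "\<dots> = ?k' i * g i * ?k i" by (rule assoc_mult_mat[OF c(2,3,1), symmetric])
    also have "\<dots> = ?k i" unfolding o by (rule left_mult_one_mat[OF c(1)])
    finally show ?thesis .
  qed
  have kap_eq: "kap g' ?k' = kap g ?k" by (rule kap_cong) (use kk in \<open>simp_all add: g'_def\<close>)
  define q where "q = (\<lambda>x. p (kap g ?k x) - p x)"
  have q: "q \<in> pm.AW" unfolding q_def by (rule pm.AW.diff[OF kap_AW[OF gg kg p] p])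
  have "(\<lambda>B. f (gauge_act Q d (vn n) g' B) - p (pm.\<pi> z (\<beta> n (gauge_act Q d (vn n) g' B)))) \<in> gs.IR n (par lam l z)"
    by (rule gs.act_ideal[OF g' fp])
  from I.I_sym[OF this] have "(\<lambda>B. p (pm.\<pi> z (\<beta> n (gauge_act Q d (vn n) g' B))) - f B) \<in> gs.IR n (par lam l z)"
    by (rule I.I_trans) (use f g' in \<open>simp add: gs.Inv_def\<close>)
  from I.I_trans[OF this fp]
  have "(\<lambda>B. q (pm.\<pi> z (\<beta> n B))) \<in> gs.IR n (par lam l z)"
    by (rule I.I_cong) (simp only: q_def \<pi>_act[OF g'] kap_eq)
  from relation_transfer[OF nm l q this]
  show "(\<lambda>B. p (pm.\<pi> (z - l) (\<beta> m (gauge_act Q d (vn m) g B))) - p (pm.\<pi> (z - l) (\<beta> m B)))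
      \<in> gs.IR m (par lam (- l) (z - l))"
    by (rule J.I_cong) (simp only: q_def \<pi>_act[OF g])
qed

lemma one_in_IR:
  assumes "coeff l 0 \<noteq> 0" "w < n"
  shows "(\<lambda>_. 1) \<in> gs.IR n (par lam l z)"
  using \<beta>_ideal[OF pm.one_in_ideal[OF assms, of lam z]] by simp

end

section \<open>Isomorphic algebras have isomorphic spectra\<close>

locale ring_iso_setting =
  fixes A :: "'a ring" and B :: "'b ring" and f :: "'a \<Rightarrow> 'b" and g :: "'b \<Rightarrow> 'a"
  assumes A: "cring A" and B: "cring B"
    and hom: "f \<in> ring_hom A B" and hom': "g \<in> ring_hom B A"
    and gf: "x \<in> carrier A \<Longrightarrow> g (f x) = x" and fg: "y \<in> carrier B \<Longrightarrow> f (g y) = y"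
begin

sublocale A: cring A by (rule A)
sublocale B: cring B by (rule B)

lemma closed: "x \<in> carrier A \<Longrightarrow> f x \<in> carrier B"
  by (rule ring_hom_closed[OF hom])

lemma inj: "inj_on f (carrier A)"
  by (rule inj_on_inverseI) (rule gf)

lemma img: "f ` carrier A = carrier B"
proof
  show "carrier B \<subseteq> f ` carrier A"
    using fg ring_hom_closed[OF hom'] by (metis image_eqI subsetI)
qed (use closed in blast)

lemma f_mult: "x \<in> carrier A \<Longrightarrow> y \<in> carrier A \<Longrightarrow> f (x \<otimes>\<^bsub>A\<^esub> y) = f x \<otimes>\<^bsub>B\<^esub> f y"
  by (rule ring_hom_mult[OF hom])

lemma f_add: "x \<in> carrier A \<Longrightarrow> y \<in> carrier A \<Longrightarrow> f (x \<oplus>\<^bsub>A\<^esub> y) = f x \<oplus>\<^bsub>B\<^esub> f y"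
  by (rule ring_hom_add[OF hom])

lemma f_one: "f \<one>\<^bsub>A\<^esub> = \<one>\<^bsub>B\<^esub>"
  by (rule ring_hom_one[OF hom])

lemma f_zero: "f \<zero>\<^bsub>A\<^esub> = \<zero>\<^bsub>B\<^esub>"
  by (rule ring_hom_zero[OF hom A.ring_axioms B.ring_axioms])

lemma f_eq: "x \<in> carrier A \<Longrightarrow> y \<in> carrier A \<Longrightarrow> f x = f y \<longleftrightarrow> x = y"
  using inj by (auto simp: inj_on_def)

lemma f_mem: "p \<subseteq> carrier A \<Longrightarrow> x \<in> carrier A \<Longrightarrow> f x \<in> f ` p \<longleftrightarrow> x \<in> p"
  by (rule inj_on_image_mem_iff[OF inj]) auto

lemma prime_image:
  assumes p: "p \<in> prime_spectrum A"
  shows "f ` p \<in> prime_spectrum B"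
proof -
  have pr: "primeideal p A" using p by (simp add: prime_spectrum_def)
  interpret p: primeideal p A by (rule pr)
  have sub: "p \<subseteq> carrier A" by (rule p.a_subset)
  have "ideal (f ` p) B"
  proof (rule idealI)
    show "ring B" by (rule B.ring_axioms)
    show "subgroup (f ` p) (add_monoid B)"
    proof (rule B.add.subgroupI)
      show "f ` p \<subseteq> carrier B" using sub closed by blast
      show "f ` p \<noteq> {}" using p.zero_closed by blast
      show "\<ominus>\<^bsub>B\<^esub> x \<in> f ` p" if xp: "x \<in> f ` p" for x
      proof -
        obtain y where y: "y \<in> p" "x = f y" using xp by blast
        then have yc: "y \<in> carrier A" using sub by blast
        have "f (\<ominus>\<^bsub>A\<^esub> y) \<oplus>\<^bsub>B\<^esub> f y = \<zero>\<^bsub>B\<^esub>"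
          unfolding f_add[OF A.a_inv_closed[OF yc] yc, symmetric] A.l_neg[OF yc] by (rule f_zero)
        from B.minus_equality[OF this closed[OF yc] closed[OF A.a_inv_closed[OF yc]]]
        have e: "\<ominus>\<^bsub>B\<^esub> f y = f (\<ominus>\<^bsub>A\<^esub> y)" .
        show ?thesis unfolding y(2) e by (rule imageI[OF p.a_inv_closed[OF y(1)]])
      qed
      show "x \<oplus>\<^bsub>B\<^esub> y \<in> f ` p" if "x \<in> f ` p" "y \<in> f ` p" for x y
      proof -
        obtain a b where ab: "a \<in> p" "x = f a" "b \<in> p" "y = f b" using \<open>x \<in> f ` p\<close> \<open>y \<in> f ` p\<close> by blast
        show ?thesis
          unfolding ab(2,4) f_add[symmetric, OF subsetD[OF sub ab(1)] subsetD[OF sub ab(3)]]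
          by (rule imageI[OF p.a_closed[OF ab(1,3)]])
      qed
    qed
    show "x \<otimes>\<^bsub>B\<^esub> a \<in> f ` p" "a \<otimes>\<^bsub>B\<^esub> x \<in> f ` p" if a: "a \<in> f ` p" and x: "x \<in> carrier B" for a x
    proof -
      obtain b where b: "b \<in> p" "a = f b" using a by blast
      have bc: "b \<in> carrier A" using b(1) sub by blast
      obtain y where y: "y \<in> carrier A" "x = f y" using x img by blast
      show "x \<otimes>\<^bsub>B\<^esub> a \<in> f ` p" "a \<otimes>\<^bsub>B\<^esub> x \<in> f ` p"
        unfolding b(2) y(2) f_mult[OF y(1) bc, symmetric] f_mult[OF bc y(1), symmetric]
        by (rule imageI[OF p.I_l_closed[OF b(1) y(1)]], rule imageI[OF p.I_r_closed[OF b(1) y(1)]])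
    qed
  qed
  then have "primeideal (f ` p) B"
  proof (rule primeidealI[OF _ B])
    show "carrier B \<noteq> f ` p"
    proof
      assume "carrier B = f ` p"
      then have "carrier A \<subseteq> p" using closed f_mem[OF sub] by (auto simp del: image_iff)
      then show False using p.I_notcarr sub by blast
    qed
    show "a \<in> f ` p \<or> b \<in> f ` p" if ab: "a \<in> carrier B" "b \<in> carrier B" "a \<otimes>\<^bsub>B\<^esub> b \<in> f ` p" for a b
    proof -
      obtain x y where xy: "x \<in> carrier A" "a = f x" "y \<in> carrier A" "b = f y" using ab(1,2) img by blast
      have "f (x \<otimes>\<^bsub>A\<^esub> y) \<in> f ` p" unfolding f_mult[OF xy(1,3)] using ab(3) unfolding xy(2,4) .
      then have "x \<otimes>\<^bsub>A\<^esub> y \<in> p" unfolding f_mem[OF sub A.m_closed[OF xy(1,3)]] .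
      from p.I_prime[OF xy(1,3) this] show ?thesis unfolding xy(2,4) by blast
    qed
  qed
  then show ?thesis by (simp add: prime_spectrum_def)
qed

lemma prime_sub: "p \<in> prime_spectrum A \<Longrightarrow> p \<subseteq> carrier A"
proof -
  assume "p \<in> prime_spectrum A"
  then interpret primeideal p A by (simp add: prime_spectrum_def)
  show ?thesis by (rule a_subset)
qed

end

lemma topspace_zariski:
  assumes "cring A"
  shows "topspace (zariski A) = prime_spectrum A"
proof -
  have "\<exists>f\<in>carrier A. f \<notin> p" if "p \<in> prime_spectrum A" for p
  proof -
    from that interpret primeideal p A by (simp add: prime_spectrum_def)
    show ?thesis using I_notcarr a_subset by blast
  qed
  then show ?thesis unfolding zariski_def topology_generated_by_topspace by blast
qed

context ring_iso_setting
begin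

sublocale inv: ring_iso_setting B A g f
  by (rule ring_iso_setting.intro) (use A B hom hom' gf fg in auto)

lemma g_img_f: "p \<subseteq> carrier A \<Longrightarrow> g ` (f ` p) = p"
proof -
  assume sub: "p \<subseteq> carrier A"
  have "g ` (f ` p) = (\<lambda>x. x) ` p"
    unfolding image_image by (rule image_cong[OF refl]) (rule gf[OF subsetD[OF sub]])
  then show ?thesis by simp
qed

end

context ring_iso_setting
begin

lemma f_img_g: "p \<subseteq> carrier B \<Longrightarrow> f ` (g ` p) = p"
  by (rule inv.g_img_f)

lemma spec_bij: "q \<in> prime_spectrum B \<Longrightarrow> g ` q \<in> prime_spectrum A" "q \<in> prime_spectrum B \<Longrightarrow> f ` (g ` q) = q"
  "p \<in> prime_spectrum A \<Longrightarrow> g ` (f ` p) = p"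
  by (rule inv.prime_image, assumption, rule f_img_g, rule inv.prime_sub, assumption, rule g_img_f, rule prime_sub)

lemma spec_continuous: "continuous_map (zariski A) (zariski B) ((`) f)"
  unfolding zariski_def[of B]
proof (rule continuous_on_generated_topo)
  show "((`) f) ` topspace (zariski A) \<subseteq> \<Union> {{p \<in> prime_spectrum B. h \<notin> p} |h. h \<in> carrier B}"
    using prime_image topspace_zariski[OF B] unfolding topspace_zariski[OF A]
    by (auto simp: zariski_def topology_generated_by_topspace)
  fix U assume "U \<in> {{p \<in> prime_spectrum B. h \<notin> p} |h. h \<in> carrier B}"
  then obtain h where h: "h \<in> carrier B" and U: "U = {p \<in> prime_spectrum B. h \<notin> p}" by blast
  have "((`) f) -` U \<inter> topspace (zariski A) = {p \<in> prime_spectrum A. g h \<notin> p}"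
    unfolding topspace_zariski[OF A] U
    using f_mem[OF prime_sub inv.closed[OF h]] fg[OF h] prime_image by auto
  moreover have "openin (zariski A) {p \<in> prime_spectrum A. g h \<notin> p}"
    unfolding zariski_def using inv.closed[OF h] by (intro topology_generated_by_Basis) blast
  ultimately show "openin (zariski A) (((`) f) -` U \<inter> topspace (zariski A))" by simp
qed

end

lemma (in ring_iso_setting) spec_homeo: "homeomorphic_map (zariski A) (zariski B) ((`) f)"
proof -
  have "homeomorphic_maps (zariski A) (zariski B) ((`) f) ((`) g)"
    unfolding homeomorphic_maps_def topspace_zariski[OF A] topspace_zariski[OF B]
    by (intro conjI ballI spec_continuous inv.spec_continuous spec_bij(2,3))
  then show ?thesis by (auto simp: homeomorphic_map_maps)
qed

text \<open>A fraction is a set of pairs, and its image under the isomorphism is again a fraction.\<close>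

definition map_pairs :: "('a \<Rightarrow> 'b) \<Rightarrow> ('a \<times> 'a) set \<Rightarrow> ('b \<times> 'b) set" where
  "map_pairs f X = (\<lambda>(a, b). (f a, f b)) ` X"

lemma fraction_at_iff:
  "(b, k) \<in> fraction_at A p a h \<longleftrightarrow> b \<in> carrier A \<and> k \<in> carrier A - p \<and>
    (\<exists>u\<in>carrier A - p. u \<otimes>\<^bsub>A\<^esub> (k \<otimes>\<^bsub>A\<^esub> a) = u \<otimes>\<^bsub>A\<^esub> (h \<otimes>\<^bsub>A\<^esub> b))"
  by (simp add: fraction_at_def)

lemma (in ring_iso_setting) map_fraction:
  assumes p: "p \<in> prime_spectrum A" and a: "a \<in> carrier A" and h: "h \<in> carrier A"
  shows "map_pairs f (fraction_at A p a h) = fraction_at B (f ` p) (f a) (f h)"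
proof -
  note sub = prime_sub[OF p]
  have compl: "carrier B - f ` p = f ` (carrier A - p)"
    unfolding img[symmetric] by (rule inj_on_image_set_diff[OF inj _ sub, symmetric]) simp
  have key: "(f b, f k) \<in> fraction_at B (f ` p) (f a) (f h) \<longleftrightarrow> (b, k) \<in> fraction_at A p a h"
    if b: "b \<in> carrier A" and k: "k \<in> carrier A" for b k
  proof -
    have "f u \<otimes>\<^bsub>B\<^esub> (f k \<otimes>\<^bsub>B\<^esub> f a) = f u \<otimes>\<^bsub>B\<^esub> (f h \<otimes>\<^bsub>B\<^esub> f b) \<longleftrightarrow>
        u \<otimes>\<^bsub>A\<^esub> (k \<otimes>\<^bsub>A\<^esub> a) = u \<otimes>\<^bsub>A\<^esub> (h \<otimes>\<^bsub>A\<^esub> b)" if "u \<in> carrier A - p" for u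
    proof -
      have u: "u \<in> carrier A" using that by simp
      note ka = A.m_closed[OF k a] and hb = A.m_closed[OF h b]
      show ?thesis
        unfolding f_mult[OF k a, symmetric] f_mult[OF h b, symmetric] f_mult[OF u ka, symmetric] f_mult[OF u hb, symmetric]
        by (rule f_eq[OF A.m_closed[OF u ka] A.m_closed[OF u hb]])
    qed
    then have "(\<exists>u\<in>f ` (carrier A - p). u \<otimes>\<^bsub>B\<^esub> (f k \<otimes>\<^bsub>B\<^esub> f a) = u \<otimes>\<^bsub>B\<^esub> (f h \<otimes>\<^bsub>B\<^esub> f b)) \<longleftrightarrow>
        (\<exists>u\<in>carrier A - p. u \<otimes>\<^bsub>A\<^esub> (k \<otimes>\<^bsub>A\<^esub> a) = u \<otimes>\<^bsub>A\<^esub> (h \<otimes>\<^bsub>A\<^esub> b))"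
      unfolding bex_simps(7) by (rule bex_cong[OF refl])
    moreover have "f k \<in> f ` (carrier A - p) \<longleftrightarrow> k \<in> carrier A - p"
      by (rule inj_on_image_mem_iff[OF inj k]) simp
    ultimately show ?thesis
      unfolding fraction_at_iff compl using closed[OF b] b by simp
  qed
  show ?thesis
  proof (rule Set.equalityI; rule subsetI)
    fix z assume "z \<in> map_pairs f (fraction_at A p a h)"
    then obtain y where y: "y \<in> fraction_at A p a h" "z = (case y of (a, b) \<Rightarrow> (f a, f b))"
      unfolding map_pairs_def by blast
    obtain b k where bk: "y = (b, k)" by (cases y)
    have "b \<in> carrier A" "k \<in> carrier A" using y(1) unfolding bk fraction_at_iff by simp_all
    from key[OF this] show "z \<in> fraction_at B (f ` p) (f a) (f h)" using y unfolding bk by simp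
  next
    fix z assume z: "z \<in> fraction_at B (f ` p) (f a) (f h)"
    obtain b' k' where bk': "z = (b', k')" by (cases z)
    have "b' \<in> carrier B" "k' \<in> carrier B" using z unfolding bk' fraction_at_iff by simp_all
    then obtain b k where bk: "b \<in> carrier A" "b' = f b" "k \<in> carrier A" "k' = f k" unfolding img[symmetric] by blast
    have "(b, k) \<in> fraction_at A p a h" using z key[OF bk(1,3)] unfolding bk' bk(2,4) by simp
    then show "z \<in> map_pairs f (fraction_at A p a h)"
      unfolding map_pairs_def bk' bk(2,4) by (rule image_eqI[rotated]) simp
  qed
qed

lemma fraction_carrier:
  assumes "x \<in> carrier (local_ring_at A p)" "(a, h) \<in> x"
  shows "a \<in> carrier A" "h \<in> carrier A" "h \<notin> p"
  using assms by (auto simp: local_ring_at_def fraction_at_def)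

lemma section_value:
  assumes "s \<in> carrier (structure_sheaf A U)"
  shows "p \<in> U \<Longrightarrow> s p \<in> carrier (local_ring_at A p)" "s \<in> extensional U"
proof -
  have s: "s \<in> (\<Pi>\<^sub>E p\<in>U. carrier (local_ring_at A p))"
    using assms unfolding structure_sheaf_def by simp
  show "p \<in> U \<Longrightarrow> s p \<in> carrier (local_ring_at A p)" by (rule PiE_mem[OF s])
  show "s \<in> extensional U" using s by (simp add: PiE_def)
qed

context ring_iso_setting
begin

lemma map_local_carrier:
  assumes p: "p \<in> prime_spectrum A" and x: "x \<in> carrier (local_ring_at A p)"
  shows "map_pairs f x \<in> carrier (local_ring_at B (f ` p))"
proof -
  obtain a h where ah: "a \<in> carrier A" "h \<in> carrier A - p" "x = fraction_at A p a h"
    using x by (auto simp: local_ring_at_def)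
  have h: "h \<in> carrier A" using ah(2) by simp
  have "f h \<in> carrier B - f ` p" using f_mem[OF prime_sub[OF p] h] ah(2) closed[OF h] by simp
  then show ?thesis
    unfolding ah(3) map_fraction[OF p ah(1) h] local_ring_at_def partial_object.simps
    using closed[OF ah(1)] by blast
qed

lemma map_local_ops:
  assumes p: "p \<in> prime_spectrum A" and x: "x \<in> carrier (local_ring_at A p)" and y: "y \<in> carrier (local_ring_at A p)"
  shows "map_pairs f (x \<otimes>\<^bsub>local_ring_at A p\<^esub> y) = map_pairs f x \<otimes>\<^bsub>local_ring_at B (f ` p)\<^esub> map_pairs f y"
    "map_pairs f (x \<oplus>\<^bsub>local_ring_at A p\<^esub> y) = map_pairs f x \<oplus>\<^bsub>local_ring_at B (f ` p)\<^esub> map_pairs f y"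
proof -
  have union: "map_pairs f (\<Union>(a, h)\<in>x. \<Union>(b, k)\<in>y. F a h b k) = (\<Union>(a, h)\<in>map_pairs f x. \<Union>(b, k)\<in>map_pairs f y. F' a h b k)"
    if "\<And>a h b k. (a, h) \<in> x \<Longrightarrow> (b, k) \<in> y \<Longrightarrow> map_pairs f (F a h b k) = F' (f a) (f h) (f b) (f k)" for F F'
  proof -
    have "map_pairs f (\<Union>(a, h)\<in>x. \<Union>(b, k)\<in>y. F a h b k) = (\<Union>(a, h)\<in>x. \<Union>(b, k)\<in>y. map_pairs f (F a h b k))"
      unfolding map_pairs_def by (simp add: image_UN case_prod_beta)
    also have "\<dots> = (\<Union>(a, h)\<in>x. \<Union>(b, k)\<in>y. F' (f a) (f h) (f b) (f k))"
      using that by (intro SUP_cong refl) (auto intro!: SUP_cong)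
    also have "\<dots> = (\<Union>(a, h)\<in>map_pairs f x. \<Union>(b, k)\<in>map_pairs f y. F' a h b k)"
      unfolding map_pairs_def by (simp add: case_prod_beta)
    finally show ?thesis .
  qed
  show "map_pairs f (x \<otimes>\<^bsub>local_ring_at A p\<^esub> y) = map_pairs f x \<otimes>\<^bsub>local_ring_at B (f ` p)\<^esub> map_pairs f y"
    unfolding local_ring_at_def monoid.simps
    by (rule union) (use fraction_carrier[OF x] fraction_carrier[OF y] in \<open>simp add: map_fraction[OF p] f_mult\<close>)
  show "map_pairs f (x \<oplus>\<^bsub>local_ring_at A p\<^esub> y) = map_pairs f x \<oplus>\<^bsub>local_ring_at B (f ` p)\<^esub> map_pairs f y"
    unfolding local_ring_at_def ring.simps
    by (rule union) (use fraction_carrier[OF x] fraction_carrier[OF y] in \<open>simp add: map_fraction[OF p] f_mult f_add\<close>)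
qed

lemma map_pairs_cancel:
  assumes "x \<subseteq> carrier A \<times> carrier A"
  shows "map_pairs g (map_pairs f x) = x"
proof -
  have "map_pairs g (map_pairs f x) = (\<lambda>z. z) ` x"
    unfolding map_pairs_def image_image by (rule image_cong[OF refl]) (use assms gf in auto)
  then show ?thesis by simp
qed

lemma local_sub: "x \<in> carrier (local_ring_at A p) \<Longrightarrow> x \<subseteq> carrier A \<times> carrier A"
  using fraction_carrier[of x A p] by auto

text \<open>The comorphism of sections over \<open>U\<close>, where \<open>U\<close> is a set of primes of \<open>A\<close>.\<close>

definition push :: "'a set set \<Rightarrow> ('a set \<Rightarrow> ('a \<times> 'a) set) \<Rightarrow> 'b set \<Rightarrow> ('b \<times> 'b) set" where
  "push U s = (\<lambda>q\<in>(`) f ` U. map_pairs f (s (g ` q)))"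

lemma push_section:
  assumes U: "openin (zariski A) U" and s: "s \<in> carrier (structure_sheaf A U)"
  shows "push U s \<in> carrier (structure_sheaf B ((`) f ` U))"
proof -
  have Usub: "U \<subseteq> prime_spectrum A" using openin_subset[OF U] unfolding topspace_zariski[OF A] .
  have sp: "s p \<in> carrier (local_ring_at A p)" if "p \<in> U" for p
    by (rule section_value(1)[OF s that])
  have val: "push U s (f ` p) = map_pairs f (s p)" if "p \<in> U" for p
  proof -
    have "g ` (f ` p) = p" by (rule spec_bij(3)[OF subsetD[OF Usub that]])
    then show ?thesis unfolding push_def restrict_apply'[OF imageI[OF that]] by simp
  qed
  have vals: "push U s \<in> (\<Pi>\<^sub>E q\<in>(`) f ` U. carrier (local_ring_at B q))"
  proof (rule PiE_I)
    fix q assume "q \<in> (`) f ` U"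
    then obtain p where p: "p \<in> U" "q = f ` p" by blast
    have pp: "p \<in> prime_spectrum A" using p(1) Usub by blast
    show "push U s q \<in> carrier (local_ring_at B q)"
      unfolding p(2) val[OF p(1)] by (rule map_local_carrier[OF pp sp[OF p(1)]])
  qed (simp add: push_def)
  have fractions: "\<exists>W a h. openin (zariski B) W \<and> q \<in> W \<and> W \<subseteq> (`) f ` U \<and> a \<in> carrier B \<and> h \<in> carrier B \<and>
      (\<forall>q\<in>W. h \<notin> q \<and> push U s q = fraction_at B q a h)" if q: "q \<in> (`) f ` U" for q
  proof -
    obtain p where p: "p \<in> U" "q = f ` p" using q by blast
    obtain W a h where W: "openin (zariski A) W" "p \<in> W" "W \<subseteq> U" "a \<in> carrier A" "h \<in> carrier A"
      and loc: "\<forall>q\<in>W. h \<notin> q \<and> s q = fraction_at A q a h"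
    proof -
      have "\<forall>p\<in>U. \<exists>W a f. openin (zariski A) W \<and> p \<in> W \<and> W \<subseteq> U \<and> a \<in> carrier A \<and> f \<in> carrier A \<and>
          (\<forall>q\<in>W. f \<notin> q \<and> s q = fraction_at A q a f)"
        using s unfolding structure_sheaf_def by simp
      from bspec[OF this p(1)] show thesis by (elim exE conjE) (rule that)
    qed
    have fW: "openin (zariski B) ((`) f ` W)"
      using homeomorphic_imp_open_map[OF spec_homeo] W(1) unfolding open_map_def by simp
    have fl: "f h \<notin> q' \<and> push U s q' = fraction_at B q' (f a) (f h)" if q': "q' \<in> (`) f ` W" for q'
    proof -
      obtain p' where p': "p' \<in> W" "q' = f ` p'" using q' by blast
      have pU: "p' \<in> U" using p' W by blast
      then have pp: "p' \<in> prime_spectrum A" using Usub by blast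
      have lp: "h \<notin> p'" "s p' = fraction_at A p' a h" using loc p'(1) by blast+
      show ?thesis
        unfolding p'(2) val[OF pU] lp(2) map_fraction[OF pp W(4,5)]
        using f_mem[OF prime_sub[OF pp] W(5)] lp(1) by simp
    qed
    show ?thesis
    proof (intro exI conjI ballI)
      show "openin (zariski B) ((`) f ` W)" by (rule fW)
      show "q \<in> (`) f ` W" unfolding p(2) by (rule imageI[OF W(2)])
      show "(`) f ` W \<subseteq> (`) f ` U" by (rule image_mono[OF W(3)])
      show "f a \<in> carrier B" "f h \<in> carrier B" by (rule closed[OF W(4)], rule closed[OF W(5)])
      show "f h \<notin> q'" "push U s q' = fraction_at B q' (f a) (f h)" if "q' \<in> (`) f ` W" for q' using fl[OF that] by simp_all
    qed
  qed
  show ?thesis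
    unfolding structure_sheaf_def partial_object.simps
    by (intro CollectI conjI ballI vals) (rule fractions)
qed

end

context ring_iso_setting
begin

lemma push_cancel:
  assumes U: "openin (zariski A) U" and s: "s \<in> carrier (structure_sheaf A U)"
  shows "inv.push ((`) f ` U) (push U s) = s"
proof (rule ext)
  fix p
  have Usub: "U \<subseteq> prime_spectrum A" using openin_subset[OF U] unfolding topspace_zariski[OF A] .
  have img2: "(`) g ` (`) f ` U = U"
  proof -
    have "(`) g ` (`) f ` U = (\<lambda>p. p) ` U"
      unfolding image_image[of "(`) g"] by (rule image_cong[OF refl]) (rule spec_bij(3)[OF subsetD[OF Usub]])
    then show ?thesis by simp
  qed
  show "inv.push ((`) f ` U) (push U s) p = s p"
  proof (cases "p \<in> U")
    case True
    have pp: "p \<in> prime_spectrum A" using True Usub by blast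
    have "s p \<in> carrier (local_ring_at A p)" by (rule section_value(1)[OF s True])
    then have "map_pairs g (map_pairs f (s p)) = s p" by (intro map_pairs_cancel local_sub)
    then show ?thesis
      using True spec_bij(3)[OF pp] unfolding inv.push_def push_def img2 by simp
  next
    case False
    have "s \<in> extensional U" by (rule section_value(2)[OF s])
    from extensional_arb[OF this False] show ?thesis using False unfolding inv.push_def img2 by simp
  qed
qed

end

context ring_iso_setting
begin

lemma push_iso:
  assumes U: "openin (zariski A) U"
  shows "push U \<in> ring_iso (structure_sheaf A U) (structure_sheaf B ((`) f ` U))"
proof -
  have Usub: "U \<subseteq> prime_spectrum A" using openin_subset[OF U] unfolding topspace_zariski[OF A] .
  have fU: "openin (zariski B) ((`) f ` U)"
    using homeomorphic_imp_open_map[OF spec_homeo] U unfolding open_map_def by simp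
  have pp: "p \<in> prime_spectrum A" if "p \<in> U" for p using Usub that by blast
  have gf_img: "g ` (f ` p) = p" if "p \<in> U" for p by (rule spec_bij(3)[OF pp[OF that]])
  have sp: "s p \<in> carrier (local_ring_at A p)" if "s \<in> carrier (structure_sheaf A U)" "p \<in> U" for s p
    by (rule section_value(1)[OF that])
  have eq_on: "F = F'" if "F \<in> extensional ((`) f ` U)" "F' \<in> extensional ((`) f ` U)"
    "\<And>p. p \<in> U \<Longrightarrow> F (f ` p) = F' (f ` p)" for F F' :: "'b set \<Rightarrow> ('b \<times> 'b) set"
    by (rule extensionalityI[OF that(1,2)]) (use that(3) in auto)
  have val: "push U s (f ` p) = map_pairs f (s p)" if "p \<in> U" for p s
    unfolding push_def restrict_apply'[OF imageI[OF that]] gf_img[OF that] by (rule refl)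
  have ext: "push U s \<in> extensional ((`) f ` U)" for s by (simp add: push_def)
  have hom: "push U \<in> ring_hom (structure_sheaf A U) (structure_sheaf B ((`) f ` U))"
  proof (rule ring_hom_memI)
    show "push U s \<in> carrier (structure_sheaf B ((`) f ` U))" if "s \<in> carrier (structure_sheaf A U)" for s
      by (rule push_section[OF U that])
    fix s t assume st: "s \<in> carrier (structure_sheaf A U)" "t \<in> carrier (structure_sheaf A U)"
    show "push U (s \<otimes>\<^bsub>structure_sheaf A U\<^esub> t) = push U s \<otimes>\<^bsub>structure_sheaf B ((`) f ` U)\<^esub> push U t"
      by (rule eq_on[OF ext]) (simp_all add: structure_sheaf_def val map_local_ops(1)[OF pp sp[OF st(1)] sp[OF st(2)]])
    show "push U (s \<oplus>\<^bsub>structure_sheaf A U\<^esub> t) = push U s \<oplus>\<^bsub>structure_sheaf B ((`) f ` U)\<^esub> push U t"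
      by (rule eq_on[OF ext]) (simp_all add: structure_sheaf_def val map_local_ops(2)[OF pp sp[OF st(1)] sp[OF st(2)]])
  next
    show "push U \<one>\<^bsub>structure_sheaf A U\<^esub> = \<one>\<^bsub>structure_sheaf B ((`) f ` U)\<^esub>"
      by (rule eq_on[OF ext]) (simp_all add: structure_sheaf_def val local_ring_at_def map_fraction[OF pp] f_one)
  qed
  have img2: "(`) g ` (`) f ` U = U"
  proof -
    have "(`) g ` (`) f ` U = (\<lambda>p. p) ` U"
      unfolding image_image[of "(`) g"] by (rule image_cong[OF refl]) (rule gf_img)
    then show ?thesis by simp
  qed
  have "bij_betw (push U) (carrier (structure_sheaf A U)) (carrier (structure_sheaf B ((`) f ` U)))"
  proof (rule bij_betw_byWitness[where f' = "inv.push ((`) f ` U)"])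
    show "\<forall>s\<in>carrier (structure_sheaf A U). inv.push ((`) f ` U) (push U s) = s"
      using push_cancel[OF U] by blast
    show "push U ` carrier (structure_sheaf A U) \<subseteq> carrier (structure_sheaf B ((`) f ` U))"
      using push_section[OF U] by blast
    show "inv.push ((`) f ` U) ` carrier (structure_sheaf B ((`) f ` U)) \<subseteq> carrier (structure_sheaf A U)"
      using inv.push_section[OF fU] unfolding img2 by blast
    show "\<forall>t\<in>carrier (structure_sheaf B ((`) f ` U)). push U (inv.push ((`) f ` U) t) = t"
    proof
      fix t assume t: "t \<in> carrier (structure_sheaf B ((`) f ` U))"
      have te: "t \<in> extensional ((`) f ` U)" by (rule section_value(2)[OF t])
      show "push U (inv.push ((`) f ` U) t) = t"
      proof (rule eq_on[OF ext te])
        fix p assume p: "p \<in> U"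
        have tp: "t (f ` p) \<in> carrier (local_ring_at B (f ` p))" by (rule section_value(1)[OF t imageI[OF p]])
        have "map_pairs f (map_pairs g (t (f ` p))) = (\<lambda>z. z) ` t (f ` p)"
          unfolding map_pairs_def image_image by (rule image_cong[OF refl]) (use inv.local_sub[OF tp] fg in auto)
        then show "push U (inv.push ((`) f ` U) t) (f ` p) = t (f ` p)"
          unfolding val[OF p] using p unfolding inv.push_def img2 by simp
      qed
    qed
  qed
  then show ?thesis using hom by (simp add: ring_iso_def)
qed

end

theorem spec_iso:
  fixes A :: "'a ring" and B :: "'b ring"
  assumes A: "cring A" and B: "cring B" and f: "f \<in> ring_iso A B"
    and const: "\<And>z. \<eta> z \<in> carrier A" "\<And>z. f (\<eta> z) = \<eta>' z"
  shows "\<exists>\<phi> \<psi>. scheme_iso (Spec A \<eta>) (Spec B \<eta>') \<phi> \<psi>"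
proof -
  define g where "g = inv_into (carrier A) f"
  have bij: "bij_betw f (carrier A) (carrier B)" using f by (simp add: ring_iso_def)
  interpret ring_iso_setting A B f g
  proof (rule ring_iso_setting.intro)
    show "g \<in> ring_hom B A"
      using ring_iso_set_sym[OF cring.axioms(1)[OF A] f] by (simp add: g_def ring_iso_def)
    show "f \<in> ring_hom A B" using f by (simp add: ring_iso_def)
    show "g (f x) = x" if "x \<in> carrier A" for x
      unfolding g_def using bij that by (simp add: bij_betw_def)
    show "f (g y) = y" if "y \<in> carrier B" for y
      unfolding g_def using bij that by (simp add: bij_betw_inv_into_right)
  qed (rule A, rule B)
  define pre where "pre U = {p \<in> prime_spectrum A. f ` p \<in> U}" for U
  have pre_img: "pre U = (`) g ` U" if "openin (zariski B) U" for U
  proof -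
    have sub: "U \<subseteq> prime_spectrum B" using openin_subset[OF that] topspace_zariski[OF B] by simp
    show ?thesis
    proof (intro equalityI subsetI)
      fix p assume "p \<in> pre U"
      then show "p \<in> (`) g ` U" using spec_bij(3)[of p] by (auto simp: pre_def intro!: image_eqI[of _ _ "f ` p"])
    next
      fix p assume "p \<in> (`) g ` U"
      then obtain q where q: "q \<in> U" "p = g ` q" by auto
      then have qq: "q \<in> prime_spectrum B" using sub by blast
      show "p \<in> pre U" using q spec_bij(1,2)[OF qq] by (simp add: pre_def)
    qed
  qed
  have push_val: "inv.push U t p = map_pairs g (t (f ` p))" if "openin (zariski B) U" "p \<in> pre U" for U t p
    unfolding inv.push_def pre_img[OF that(1), symmetric] using that(2) by simp
  have pre_eq: "{x \<in> topspace (space_of (Spec A \<eta>)). f ` x \<in> U} = pre U" for U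
    unfolding pre_def Spec_def ringed_space_C.simps topspace_zariski[OF A] by (rule refl)
  have "scheme_iso (Spec A \<eta>) (Spec B \<eta>') ((`) f) inv.push"
    unfolding scheme_iso_def Let_def pre_eq
  proof (intro conjI allI impI ballI)
    show "homeomorphic_map (space_of (Spec A \<eta>)) (space_of (Spec B \<eta>')) ((`) f)"
      using spec_homeo by (simp add: Spec_def)
  next
    fix U assume "openin (space_of (Spec B \<eta>')) U"
    then have U: "openin (zariski B) U" by (simp add: Spec_def)
    then have sub: "U \<subseteq> prime_spectrum B" using openin_subset topspace_zariski[OF B] by fastforce
    show "inv.push U \<in> ring_iso (sections (Spec B \<eta>') U) (sections (Spec A \<eta>) (pre U))"
      using inv.push_iso[OF U] unfolding pre_img[OF U] by (simp add: Spec_def)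
    fix z
    show "inv.push U (const_sec (Spec B \<eta>') U z) = const_sec (Spec A \<eta>) (pre U) z"
    proof (rule ext)
      fix p
      show "inv.push U (const_sec (Spec B \<eta>') U z) p = const_sec (Spec A \<eta>) (pre U) z p"
      proof (cases "p \<in> pre U")
        case False
        then show ?thesis unfolding inv.push_def pre_img[OF U, symmetric] by (simp add: Spec_def)
      next
        case True
        then have p: "p \<in> prime_spectrum A" "f ` p \<in> U" by (auto simp: pre_def)
        have fp: "f ` p \<in> prime_spectrum B" using p sub by blast
        have g\<eta>: "g (\<eta>' z) = \<eta> z" unfolding const(2)[symmetric] by (rule gf[OF const(1)])
        have e: "map_pairs g (fraction_at B (f ` p) (\<eta>' z) \<one>\<^bsub>B\<^esub>) = fraction_at A p (\<eta> z) \<one>\<^bsub>A\<^esub>"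
          using inv.map_fraction[OF fp closed[OF const(1)[of z]] B.one_closed]
          unfolding spec_bij(3)[OF p(1)] inv.f_one const(2) g\<eta> .
        have c: "const_sec (Spec B \<eta>') U z (f ` p) = fraction_at B (f ` p) (\<eta>' z) \<one>\<^bsub>B\<^esub>"
          "const_sec (Spec A \<eta>) (pre U) z p = fraction_at A p (\<eta> z) \<one>\<^bsub>A\<^esub>"
          using p(2) True by (simp_all add: Spec_def)
        show ?thesis unfolding push_val[OF U True] c by (rule e)
      qed
    qed
  next
    fix U V s assume "openin (space_of (Spec B \<eta>')) U" "openin (space_of (Spec B \<eta>')) V" and VU: "V \<subseteq> U"
    then have U: "openin (zariski B) U" and V: "openin (zariski B) V" by (simp_all add: Spec_def)
    show "inv.push V (restr (Spec B \<eta>') U V s) = restr (Spec A \<eta>) (pre U) (pre V) (inv.push U s)"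
    proof (rule ext)
      fix p
      show "inv.push V (restr (Spec B \<eta>') U V s) p = restr (Spec A \<eta>) (pre U) (pre V) (inv.push U s) p"
      proof (cases "p \<in> pre V")
        case False
        then show ?thesis unfolding inv.push_def pre_img[OF V, symmetric] by (simp add: Spec_def)
      next
        case True
        then have p: "p \<in> prime_spectrum A" "f ` p \<in> V" "p \<in> pre U" using VU by (auto simp: pre_def)
        have r: "restr (Spec B \<eta>') U V s (f ` p) = s (f ` p)"
          "restr (Spec A \<eta>) (pre U) (pre V) (inv.push U s) p = inv.push U s p"
          using p(2) True by (simp_all add: Spec_def)
        show ?thesis unfolding push_val[OF V True] r push_val[OF U p(3)] by (rule refl)
      qed
    qed
  qed
  then show ?thesis by blast
qed

section \<open>Rings of invariants as quotients of algebras of functions\<close>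

lemma poly_funs_uminus: "f \<in> poly_funs X C \<Longrightarrow> (\<lambda>x\<in>X. - f x) \<in> poly_funs X C"
  using poly_funs.mult[OF poly_funs.const[of "-1" X C]] by (auto cong: restrict_cong)

lemma poly_funs_ext: "f \<in> poly_funs X C \<Longrightarrow> f \<in> extensional X"
  by (cases rule: poly_funs.cases) auto

lemma poly_fun_ring_simps [simp]:
  "carrier (poly_fun_ring X C) = poly_funs X C"
  "f \<otimes>\<^bsub>poly_fun_ring X C\<^esub> g = (\<lambda>x\<in>X. f x * g x)"
  "f \<oplus>\<^bsub>poly_fun_ring X C\<^esub> g = (\<lambda>x\<in>X. f x + g x)"
  "\<one>\<^bsub>poly_fun_ring X C\<^esub> = (\<lambda>x\<in>X. 1)" "\<zero>\<^bsub>poly_fun_ring X C\<^esub> = (\<lambda>x\<in>X. 0)"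
  by (simp_all add: poly_fun_ring_def)

lemma poly_fun_ring_cring: "cring (poly_fun_ring X C)"
proof (rule cringI)
  show "abelian_group (poly_fun_ring X C)"
  proof (rule abelian_groupI)
    fix x assume x: "x \<in> carrier (poly_fun_ring X C)"
    then show "\<zero>\<^bsub>poly_fun_ring X C\<^esub> \<oplus>\<^bsub>poly_fun_ring X C\<^esub> x = x"
      by (intro extensionalityI[where A = X]) (auto dest: poly_funs_ext)
    show "\<exists>y\<in>carrier (poly_fun_ring X C). y \<oplus>\<^bsub>poly_fun_ring X C\<^esub> x = \<zero>\<^bsub>poly_fun_ring X C\<^esub>"
      using poly_funs_uminus[of x X C] x by (intro bexI[of _ "\<lambda>a\<in>X. - x a"]) (auto cong: restrict_cong)
  qed (auto intro: poly_funs.add poly_funs.const simp: add_ac cong: restrict_cong)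
  show "Group.comm_monoid (poly_fun_ring X C)"
  proof (rule comm_monoidI)
    fix x assume x: "x \<in> carrier (poly_fun_ring X C)"
    then show "\<one>\<^bsub>poly_fun_ring X C\<^esub> \<otimes>\<^bsub>poly_fun_ring X C\<^esub> x = x"
      by (intro extensionalityI[where A = X]) (auto dest: poly_funs_ext)
  qed (auto intro: poly_funs.mult poly_funs.const simp: mult_ac cong: restrict_cong)
qed (auto simp: algebra_simps cong: restrict_cong)

context gauge_setting
begin

abbreviation "X \<equiv> rep_space Q d v"
abbreviation "R \<equiv> rep_ring Q d v"

lemma R_cring: "cring R"
  unfolding rep_ring_def by (rule poly_fun_ring_cring)

lemma R_simps:
  "carrier R = poly_funs X (rep_coords Q d v)" "f \<otimes>\<^bsub>R\<^esub> g = (\<lambda>B\<in>X. f B * g B)" "f \<oplus>\<^bsub>R\<^esub> g = (\<lambda>B\<in>X. f B + g B)"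
  "\<one>\<^bsub>R\<^esub> = (\<lambda>B\<in>X. 1)" "\<zero>\<^bsub>R\<^esub> = (\<lambda>B\<in>X. 0)"
  by (simp_all add: rep_ring_def)

lemma restrict_R: "f \<in> AR \<Longrightarrow> restrict f X \<in> carrier R"
  by (simp add: AR_def polyf_def R_simps)

lemma R_AR: "f \<in> carrier R \<Longrightarrow> f \<in> AR \<and> restrict f X = f"
proof -
  assume "f \<in> carrier R"
  then have f: "f \<in> poly_funs X (rep_coords Q d v)" by (simp add: R_simps)
  then have "restrict f X = f" by (intro extensional_restrict poly_funs_ext)
  then show ?thesis using f by (simp add: AR_def polyf_def)
qed

lemma gens_AR: "f \<in> gens lam \<Longrightarrow> f \<in> AR"
proof -
  interpret A: fun_algebra X AR by (rule AR_algebra)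
  assume "f \<in> gens lam"
  then obtain i r s where i: "i \<in> verts Q" and rs: "r < v i * d i" "s < v i * d i"
    and f: "f = (\<lambda>B. (moment_map Q d v i B + scal_mat (v i) (d i) (d i) (lam i)) $$ (r, s))"
    unfolding gens_def by blast
  let ?n = "v i * d i" and ?N = "eps_mat (v i) (d i)"
  have summand: "(\<lambda>B. sgn_arrow h * (?N ^\<^sub>m k * B h * B (rev_arrow h) * ?N ^\<^sub>m l) $$ (r, s)) \<in> AR"
    if h: "h \<in> dbl Q" "tgt Q h = i" for h k l
  proof -
    let ?m = "v (src Q h) * d (src Q h)"
    have c: "B h \<in> carrier_mat ?n ?m" "B (rev_arrow h) \<in> carrier_mat ?m ?n" if "B \<in> X" for B
      using rep_carrier[OF that, of h] rep_carrier[OF that, of "rev_arrow h"] h by simp_all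
    have m: "mat_in AR ?n ?m (\<lambda>B. B h)" "mat_in AR ?m ?n (\<lambda>B. B (rev_arrow h))"
      using rep_coord[of h] rep_coord[of "rev_arrow h"] h by simp_all
    have 1: "mat_in AR ?n ?m (\<lambda>B. ?N ^\<^sub>m k * B h)"
      by (rule A.mat_in_mult[OF A.mat_in_const m(1)], rule eps_pow_carrier, rule c(1))
    have c1: "?N ^\<^sub>m k * B h \<in> carrier_mat ?n ?m" if "B \<in> X" for B
      by (rule mult_carrier_mat[OF eps_pow_carrier c(1)[OF that]])
    have 2: "mat_in AR ?n ?n (\<lambda>B. ?N ^\<^sub>m k * B h * B (rev_arrow h))"
      by (rule A.mat_in_mult[OF 1 m(2)], rule c1, assumption, rule c(2))
    have c2: "?N ^\<^sub>m k * B h * B (rev_arrow h) \<in> carrier_mat ?n ?n" if "B \<in> X" for B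
      by (rule mult_carrier_mat[OF c1[OF that] c(2)[OF that]])
    have "mat_in AR ?n ?n (\<lambda>B. ?N ^\<^sub>m k * B h * B (rev_arrow h) * ?N ^\<^sub>m l)"
      by (rule A.mat_in_mult[OF 2 A.mat_in_const], rule c2, assumption, rule eps_pow_carrier)
    from A.scale[OF mat_inD[OF this rs]] show ?thesis .
  qed
  have "(\<lambda>B. (\<Sum>h\<in>{h \<in> dbl Q. tgt Q h = i}. \<Sum>k<f_h Q d h.
      sgn_arrow h * (?N ^\<^sub>m k * B h * B (rev_arrow h) * ?N ^\<^sub>m (f_h Q d h - k - 1)) $$ (r, s)) +
      scal_mat (v i) (d i) (d i) (lam i) $$ (r, s)) \<in> AR"
    by (intro A.add A.sum A.const summand) auto
  then show "f \<in> AR"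
    by (rule A.cong) (use rs in \<open>simp add: f moment_map_def carrier_matD[OF scal_carrier] del: index_mult_mat(1)\<close>)
qed

lemma IR_AR: "f \<in> IR lam \<Longrightarrow> f \<in> AR"
proof -
  interpret A: fun_algebra X AR by (rule AR_algebra)
  show "f \<in> IR lam \<Longrightarrow> f \<in> AR"
    unfolding IR_def
  proof (induction rule: gen_ideal.induct)
    case (zero f)
    show ?case by (rule A.cong[OF A.const[of 0]]) (simp add: zero)
  next
    case (step i a s)
    show ?case by (rule A.add[OF step.IH A.mult[OF step.hyps(2) gens_AR[OF step.hyps(3)]]])
  qed
qed

lemma fibre_ideal_eq: "fibre_ideal Q d lam v = (\<lambda>f. restrict f X) ` IR lam"
proof -
  interpret R: cring R by (rule R_cring)
  interpret A: fun_algebra X AR by (rule AR_algebra)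
  interpret I: fun_ideal X AR "IR lam" by (rule IR_ideal)
  let ?J = "(\<lambda>f. restrict f X) ` IR lam"
  have gens: "{\<lambda>B \<in> X. (moment_map Q d v i B + scal_mat (v i) (d i) (d i) (lam i)) $$ (r, s) | i r s.
          i \<in> verts Q \<and> r < v i * d i \<and> s < v i * d i} = (\<lambda>f. restrict f X) ` gens lam"
    unfolding gens_def by blast
  have sub: "(\<lambda>f. restrict f X) ` gens lam \<subseteq> carrier R" using restrict_R[OF gens_AR] by blast
  have "ideal ?J R"
  proof (rule idealI)
    show "ring R" by (rule R.ring_axioms)
    show "subgroup ?J (add_monoid R)"
    proof (rule R.add.subgroupI)
      show "?J \<subseteq> carrier R" using restrict_R[OF IR_AR] by blast
      show "?J \<noteq> {}" using I.I_zero by blast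
      show "\<ominus>\<^bsub>R\<^esub> x \<in> ?J" if x: "x \<in> ?J" for x
      proof -
        obtain f where f: "f \<in> IR lam" "x = restrict f X" using x by blast
        have "\<ominus>\<^bsub>R\<^esub> x = restrict (\<lambda>B. - f B) X"
          unfolding f(2)
        proof (rule R.minus_equality)
          show "(\<lambda>B\<in>X. - f B) \<oplus>\<^bsub>R\<^esub> restrict f X = \<zero>\<^bsub>R\<^esub>" by (auto simp: R_simps cong: restrict_cong)
          show "restrict f X \<in> carrier R" by (rule restrict_R[OF IR_AR[OF f(1)]])
          show "(\<lambda>B\<in>X. - f B) \<in> carrier R" by (rule restrict_R[OF IR_AR[OF I.I_uminus[OF f(1)]]])
        qed
        then show ?thesis using I.I_uminus[OF f(1)] by blast
      qed
      show "x \<oplus>\<^bsub>R\<^esub> y \<in> ?J" if "x \<in> ?J" "y \<in> ?J" for x y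
      proof -
        obtain f g where f: "f \<in> IR lam" "x = restrict f X" and g: "g \<in> IR lam" "y = restrict g X"
          using \<open>x \<in> ?J\<close> \<open>y \<in> ?J\<close> by blast
        have "x \<oplus>\<^bsub>R\<^esub> y = restrict (\<lambda>B. f B + g B) X" by (auto simp: R_simps f g cong: restrict_cong)
        then show ?thesis using I.I_add[OF f(1) g(1)] by blast
      qed
    qed
    fix a x assume a: "a \<in> ?J" and x: "x \<in> carrier R"
    obtain f where f: "f \<in> IR lam" "a = restrict f X" using a by blast
    have eq: "x \<otimes>\<^bsub>R\<^esub> a = restrict (\<lambda>B. x B * f B) X" "a \<otimes>\<^bsub>R\<^esub> x = restrict (\<lambda>B. x B * f B) X"
      by (auto simp: R_simps f cong: restrict_cong)
    have "(\<lambda>B. x B * f B) \<in> IR lam" by (rule I.I_mult[OF conjunct1[OF R_AR[OF x]] f(1)])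
    then show "x \<otimes>\<^bsub>R\<^esub> a \<in> ?J" "a \<otimes>\<^bsub>R\<^esub> x \<in> ?J" unfolding eq by blast+
  qed
  moreover have "(\<lambda>f. restrict f X) ` gens lam \<subseteq> ?J"
    using A.gen_ideal_gen[of _ "gens lam"] unfolding IR_def by blast
  ultimately have le: "fibre_ideal Q d lam v \<subseteq> ?J"
    unfolding fibre_ideal_def gens by (rule R.genideal_minimal)
  interpret F: ideal "fibre_ideal Q d lam v" R
    unfolding fibre_ideal_def gens by (rule R.genideal_ideal[OF sub])
  have "restrict f X \<in> fibre_ideal Q d lam v" if "f \<in> IR lam" for f
    using that unfolding IR_def
  proof (induction rule: gen_ideal.induct)
    case (zero f)
    then have "restrict f X = \<zero>\<^bsub>R\<^esub>" by (auto simp: R_simps cong: restrict_cong)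
    then show ?case using F.zero_closed by simp
  next
    case (step i a s)
    have "restrict s X \<in> fibre_ideal Q d lam v"
      unfolding fibre_ideal_def gens using R.genideal_self[OF sub] step.hyps(3) by blast
    note sum = F.a_closed[OF step.IH F.I_l_closed[OF this restrict_R[OF step.hyps(2)]]]
    have "restrict i X \<oplus>\<^bsub>R\<^esub> (restrict a X \<otimes>\<^bsub>R\<^esub> restrict s X) = restrict (\<lambda>B. i B + a B * s B) X"
      by (auto simp: R_simps cong: restrict_cong)
    from sum[unfolded this] show ?case .
  qed
  then show ?thesis using le by blast
qed

text \<open>The class of a function in the coordinate ring of the fibre of the moment map.\<close>

definition cl where
  "cl lam f = {restrict h X | h. (\<lambda>B. h B - f B) \<in> IR lam}"

lemma coset_cl: "fibre_ideal Q d lam v +>\<^bsub>R\<^esub> restrict f X = cl lam f"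
proof -
  interpret I: fun_ideal X AR "IR lam" by (rule IR_ideal)
  have "fibre_ideal Q d lam v +>\<^bsub>R\<^esub> restrict f X = {(\<lambda>B\<in>X. i B + f B) | i. i \<in> IR lam}"
  proof -
    have "restrict i X \<oplus>\<^bsub>R\<^esub> restrict f X = (\<lambda>B\<in>X. i B + f B)" for i
      by (auto simp: R_simps cong: restrict_cong)
    then show ?thesis unfolding a_r_coset_def' fibre_ideal_eq by (simp add: Setcompr_eq_image UNION_singleton_eq_range image_image)
  qed
  also have "\<dots> = cl lam f"
  proof (intro equalityI subsetI)
    fix x assume "x \<in> {(\<lambda>B\<in>X. i B + f B) | i. i \<in> IR lam}"
    then obtain i where "i \<in> IR lam" "x = (\<lambda>B\<in>X. i B + f B)" by blast
    then show "x \<in> cl lam f" unfolding cl_def by (intro CollectI exI[of _ "\<lambda>B. i B + f B"]) simp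
  next
    fix x assume "x \<in> cl lam f"
    then obtain h where h: "(\<lambda>B. h B - f B) \<in> IR lam" "x = restrict h X" unfolding cl_def by blast
    then show "x \<in> {(\<lambda>B\<in>X. i B + f B) | i. i \<in> IR lam}" by (intro CollectI exI[of _ "\<lambda>B. h B - f B"]) simp
  qed
  finally show ?thesis .
qed

lemma cl_eq: "cl lam f = cl lam f' \<longleftrightarrow> (\<lambda>B. f B - f' B) \<in> IR lam"
proof -
  interpret I: fun_ideal X AR "IR lam" by (rule IR_ideal)
  show ?thesis
  proof
    assume eq: "cl lam f = cl lam f'"
    have "restrict f X \<in> cl lam f" unfolding cl_def using I.I_zero by (intro CollectI exI[of _ f]) simp
    then have "restrict f X \<in> cl lam f'" unfolding eq .
    then obtain h where h: "(\<lambda>B. h B - f' B) \<in> IR lam" "restrict f X = restrict h X" unfolding cl_def by blast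
    show "(\<lambda>B. f B - f' B) \<in> IR lam"
      proof (rule I.I_cong[OF h(1)])
      fix B assume "B \<in> X"
      then show "f B - f' B = h B - f' B" using fun_cong[OF h(2), of B] by simp
    qed
  next
    assume *: "(\<lambda>B. f B - f' B) \<in> IR lam"
    have "(\<lambda>B. h B - f B) \<in> IR lam \<longleftrightarrow> (\<lambda>B. h B - f' B) \<in> IR lam" for h
      using I.I_trans[OF _ *, of h] I.I_trans[OF _ I.I_sym[OF *], of h] by blast
    then show "cl lam f = cl lam f'" unfolding cl_def by simp
  qed
qed

lemma fibre_ideal: "ideal (fibre_ideal Q d lam v) R"
proof -
  interpret R: cring R by (rule R_cring)
  show ?thesis unfolding fibre_ideal_def
    by (rule R.genideal_ideal) (use restrict_R[OF gens_AR] in \<open>unfold gens_def, blast\<close>)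
qed

lemma fibre_ring:
  "carrier (fibre_ring Q d lam v) = cl lam ` AR"
  "f \<in> AR \<Longrightarrow> g \<in> AR \<Longrightarrow> cl lam f \<otimes>\<^bsub>fibre_ring Q d lam v\<^esub> cl lam g = cl lam (\<lambda>B. f B * g B)"
  "f \<in> AR \<Longrightarrow> g \<in> AR \<Longrightarrow> cl lam f \<oplus>\<^bsub>fibre_ring Q d lam v\<^esub> cl lam g = cl lam (\<lambda>B. f B + g B)"
  "\<one>\<^bsub>fibre_ring Q d lam v\<^esub> = cl lam (\<lambda>_. 1)" "\<zero>\<^bsub>fibre_ring Q d lam v\<^esub> = cl lam (\<lambda>_. 0)"
proof -
  interpret R: cring R by (rule R_cring)
  interpret F: ideal "fibre_ideal Q d lam v" R by (rule fibre_ideal)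
  have "carrier (fibre_ring Q d lam v) = (\<lambda>x. fibre_ideal Q d lam v +>\<^bsub>R\<^esub> x) ` carrier R"
    unfolding fibre_ring_def FactRing_def A_RCOSETS_def' by auto
  also have "carrier R = (\<lambda>f. restrict f X) ` AR" 
  proof (intro equalityI subsetI)
    fix x assume x: "x \<in> carrier R"
    show "x \<in> (\<lambda>f. restrict f X) ` AR"
      by (rule image_eqI[where x = x]) (use R_AR[OF x] in simp_all)
  qed (use restrict_R in blast)
  finally show "carrier (fibre_ring Q d lam v) = cl lam ` AR" unfolding image_image coset_cl .
  show "cl lam f \<otimes>\<^bsub>fibre_ring Q d lam v\<^esub> cl lam g = cl lam (\<lambda>B. f B * g B)" if "f \<in> AR" "g \<in> AR"
  proof -
    have "restrict f X \<otimes>\<^bsub>R\<^esub> restrict g X = restrict (\<lambda>B. f B * g B) X" by (auto simp: R_simps cong: restrict_cong)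
    then show ?thesis
      using F.rcoset_mult_add[OF restrict_R[OF that(1)] restrict_R[OF that(2)]]
      unfolding coset_cl fibre_ring_def FactRing_def by (simp add: coset_cl)
  qed
  show "cl lam f \<oplus>\<^bsub>fibre_ring Q d lam v\<^esub> cl lam g = cl lam (\<lambda>B. f B + g B)" if "f \<in> AR" "g \<in> AR"
  proof -
    have "restrict f X \<oplus>\<^bsub>R\<^esub> restrict g X = restrict (\<lambda>B. f B + g B) X" by (auto simp: R_simps cong: restrict_cong)
    then show ?thesis
      using F.a_rcos_sum[OF restrict_R[OF that(1)] restrict_R[OF that(2)]]
      unfolding coset_cl fibre_ring_def FactRing_def by (simp add: coset_cl)
  qed
  show "\<one>\<^bsub>fibre_ring Q d lam v\<^esub> = cl lam (\<lambda>_. 1)"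
    unfolding fibre_ring_def FactRing_def by (simp add: R_simps coset_cl)
  show "\<zero>\<^bsub>fibre_ring Q d lam v\<^esub> = cl lam (\<lambda>_. 0)"
    unfolding fibre_ring_def FactRing_def cl_def by (auto simp: fibre_ideal_eq)
qed

lemma gauge_act_fun_cl:
  assumes g: "g \<in> carrier G"
  shows "gauge_act_fun Q d v g ` cl lam f = cl lam (\<lambda>B. f (gauge_act Q d v (inv\<^bsub>G\<^esub> g) B))"
proof (intro equalityI subsetI)
  note k = gauge_inv(1)[OF g]
  fix x assume "x \<in> gauge_act_fun Q d v g ` cl lam f"
  then obtain h where h: "(\<lambda>B. h B - f B) \<in> IR lam" and x: "x = gauge_act_fun Q d v g (restrict h X)"
    unfolding cl_def by blast
  have "x = restrict (\<lambda>B. h (gauge_act Q d v (inv\<^bsub>G\<^esub> g) B)) X"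
    unfolding x gauge_act_fun_def by (rule restrict_ext) (simp add: gauge_act_rep[OF k])
  then show "x \<in> cl lam (\<lambda>B. f (gauge_act Q d v (inv\<^bsub>G\<^esub> g) B))"
    using act_ideal[OF k h] unfolding cl_def by blast
next
  interpret I: fun_ideal X AR "IR lam" by (rule IR_ideal)
  note k = gauge_inv(1)[OF g]
  have gg: "inv\<^bsub>G\<^esub> (inv\<^bsub>G\<^esub> g) = g" by (rule group.inv_inv[OF gauge_group g])
  fix x assume "x \<in> cl lam (\<lambda>B. f (gauge_act Q d v (inv\<^bsub>G\<^esub> g) B))"
  then obtain h where h: "(\<lambda>B. h B - f (gauge_act Q d v (inv\<^bsub>G\<^esub> g) B)) \<in> IR lam" and x: "x = restrict h X"
    unfolding cl_def by blast
  let ?h = "\<lambda>B. h (gauge_act Q d v g B)"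
  have "(\<lambda>B. ?h B - f B) \<in> IR lam"
    by (rule I.I_cong[OF act_ideal[OF g h]]) (simp only: gauge_act_inv[OF k, unfolded gg])
  then have "restrict ?h X \<in> cl lam f" unfolding cl_def by blast
  moreover have "x = gauge_act_fun Q d v g (restrict ?h X)"
    unfolding x gauge_act_fun_def
  proof (rule restrict_ext)
    fix B assume B: "B \<in> X"
    show "h B = restrict ?h X (gauge_act Q d v (inv\<^bsub>G\<^esub> g) B)"
      using gauge_act_rep[OF k B] gauge_act_inv[OF g B] by simp
  qed
  ultimately show "x \<in> gauge_act_fun Q d v g ` cl lam f" by blast
qed

lemma invariant_carrier: "carrier (invariant_ring Q d lam v) = cl lam ` Inv lam"
proof -
  have inv: "(\<forall>g\<in>carrier G. gauge_act_fun Q d v g ` cl lam f = cl lam f) \<longleftrightarrow>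
      (\<forall>g\<in>carrier G. (\<lambda>B. f (gauge_act Q d v g B) - f B) \<in> IR lam)" for f
  proof -
    have "(\<forall>g\<in>carrier G. gauge_act_fun Q d v g ` cl lam f = cl lam f) \<longleftrightarrow>
      (\<forall>g\<in>carrier G. (\<lambda>B. f (gauge_act Q d v (inv\<^bsub>G\<^esub> g) B) - f B) \<in> IR lam)"
      by (rule ball_cong[OF refl]) (simp only: gauge_act_fun_cl cl_eq)
    also have "\<dots> \<longleftrightarrow> (\<forall>g\<in>carrier G. (\<lambda>B. f (gauge_act Q d v g B) - f B) \<in> IR lam)"
    proof (intro iffI ballI)
      fix g assume *: "\<forall>g\<in>carrier G. (\<lambda>B. f (gauge_act Q d v (inv\<^bsub>G\<^esub> g) B) - f B) \<in> IR lam" and g: "g \<in> carrier G"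
      from bspec[OF *(1) gauge_inv(1)[OF g]]
      show "(\<lambda>B. f (gauge_act Q d v g B) - f B) \<in> IR lam" unfolding group.inv_inv[OF gauge_group g] .
    next
      fix g assume *: "\<forall>g\<in>carrier G. (\<lambda>B. f (gauge_act Q d v g B) - f B) \<in> IR lam" and g: "g \<in> carrier G"
      from bspec[OF *(1) gauge_inv(1)[OF g]]
      show "(\<lambda>B. f (gauge_act Q d v (inv\<^bsub>G\<^esub> g) B) - f B) \<in> IR lam" .
    qed
    finally show ?thesis .
  qed
  have "carrier (invariant_ring Q d lam v) = {x \<in> cl lam ` AR. \<forall>g\<in>carrier G. gauge_act_fun Q d v g ` x = x}"
    unfolding invariant_ring_def by (simp add: fibre_ring(1))
  also have "\<dots> = cl lam ` Inv lam" unfolding Inv_def using inv by blast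
  finally show ?thesis .
qed

lemma Inv_closed:
  "(\<lambda>_. z) \<in> Inv lam"
  "f \<in> Inv lam \<Longrightarrow> g \<in> Inv lam \<Longrightarrow> (\<lambda>B. f B + g B) \<in> Inv lam"
  "f \<in> Inv lam \<Longrightarrow> g \<in> Inv lam \<Longrightarrow> (\<lambda>B. f B * g B) \<in> Inv lam"
proof -
  interpret A: fun_algebra X AR by (rule AR_algebra)
  interpret I: fun_ideal X AR "IR lam" by (rule IR_ideal)
  show "(\<lambda>_. z) \<in> Inv lam" using A.const I.I_zero by (simp add: Inv_def)
  show "(\<lambda>B. f B + g B) \<in> Inv lam" if "f \<in> Inv lam" "g \<in> Inv lam"
    unfolding Inv_def
  proof (intro CollectI conjI ballI)
    show "(\<lambda>B. f B + g B) \<in> AR" using that by (intro A.add) (simp_all add: Inv_def)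
    fix k assume k: "k \<in> carrier G"
    have "(\<lambda>B. f (gauge_act Q d v k B) - f B + (g (gauge_act Q d v k B) - g B)) \<in> IR lam"
      using that k by (intro I.I_add) (simp_all add: Inv_def)
    then show "(\<lambda>B. f (gauge_act Q d v k B) + g (gauge_act Q d v k B) - (f B + g B)) \<in> IR lam"
      by (rule I.I_cong) simp
  qed
  show "(\<lambda>B. f B * g B) \<in> Inv lam" if "f \<in> Inv lam" "g \<in> Inv lam"
    unfolding Inv_def
  proof (intro CollectI conjI ballI)
    show "(\<lambda>B. f B * g B) \<in> AR" using that by (intro A.mult) (simp_all add: Inv_def)
    fix k assume k: "k \<in> carrier G"
    show "(\<lambda>B. f (gauge_act Q d v k B) * g (gauge_act Q d v k B) - f B * g B) \<in> IR lam"
      using that k by (intro I.mult_cong act_coords[OF k]) (simp_all add: Inv_def)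
  qed
qed

lemma Inv_AR: "f \<in> Inv lam \<Longrightarrow> f \<in> AR"
  by (simp add: Inv_def)

lemma invariant_ring:
  "f \<in> Inv lam \<Longrightarrow> g \<in> Inv lam \<Longrightarrow> cl lam f \<otimes>\<^bsub>invariant_ring Q d lam v\<^esub> cl lam g = cl lam (\<lambda>B. f B * g B)"
  "f \<in> Inv lam \<Longrightarrow> g \<in> Inv lam \<Longrightarrow> cl lam f \<oplus>\<^bsub>invariant_ring Q d lam v\<^esub> cl lam g = cl lam (\<lambda>B. f B + g B)"
  "\<one>\<^bsub>invariant_ring Q d lam v\<^esub> = cl lam (\<lambda>_. 1)" "\<zero>\<^bsub>invariant_ring Q d lam v\<^esub> = cl lam (\<lambda>_. 0)"
  using fibre_ring(2,3)[of f g lam] fibre_ring(4,5)[of lam] Inv_AR[of f lam] Inv_AR[of g lam]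
  by (simp_all add: invariant_ring_def)

lemma invariant_cring: "cring (invariant_ring Q d lam v)"
proof -
  let ?A = "invariant_ring Q d lam v"
  have mem: "cl lam f \<in> carrier ?A" if "f \<in> Inv lam" for f
    unfolding invariant_carrier using that by blast
  have rep: "\<exists>f\<in>Inv lam. x = cl lam f" if "x \<in> carrier ?A" for x
    using that unfolding invariant_carrier by blast
  note ops = invariant_ring Inv_closed
  show ?thesis
  proof (rule cringI)
    show "abelian_group ?A"
    proof (rule abelian_groupI)
      show "\<zero>\<^bsub>?A\<^esub> \<in> carrier ?A" unfolding invariant_ring(4) by (rule mem[OF Inv_closed(1)])
      fix x assume x: "x \<in> carrier ?A"
      obtain f where f: "f \<in> Inv lam" "x = cl lam f" using rep[OF x] by blast
      show "\<zero>\<^bsub>?A\<^esub> \<oplus>\<^bsub>?A\<^esub> x = x" by (simp add: f ops)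
      have m: "(\<lambda>B. - 1 * f B) \<in> Inv lam" by (rule Inv_closed(3)[OF Inv_closed(1) f(1)])
      show "\<exists>y\<in>carrier ?A. y \<oplus>\<^bsub>?A\<^esub> x = \<zero>\<^bsub>?A\<^esub>"
        by (rule bexI[OF _ mem[OF m]]) (simp only: f ops(2)[OF m f(1)] ops(4), simp)
      fix y assume y: "y \<in> carrier ?A"
      obtain g where g: "g \<in> Inv lam" "y = cl lam g" using rep[OF y] by blast
      show "x \<oplus>\<^bsub>?A\<^esub> y \<in> carrier ?A" by (simp add: f g ops mem)
      show "x \<oplus>\<^bsub>?A\<^esub> y = y \<oplus>\<^bsub>?A\<^esub> x" by (simp add: f g ops add.commute)
      fix z assume z: "z \<in> carrier ?A"
      obtain h where h: "h \<in> Inv lam" "z = cl lam h" using rep[OF z] by blast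
      show "x \<oplus>\<^bsub>?A\<^esub> y \<oplus>\<^bsub>?A\<^esub> z = x \<oplus>\<^bsub>?A\<^esub> (y \<oplus>\<^bsub>?A\<^esub> z)" by (simp add: f g h ops add.assoc)
    qed
    show "Group.comm_monoid ?A"
    proof (rule comm_monoidI)
      show "\<one>\<^bsub>?A\<^esub> \<in> carrier ?A" unfolding invariant_ring(3) by (rule mem[OF Inv_closed(1)])
      fix x assume x: "x \<in> carrier ?A"
      obtain f where f: "f \<in> Inv lam" "x = cl lam f" using rep[OF x] by blast
      show "\<one>\<^bsub>?A\<^esub> \<otimes>\<^bsub>?A\<^esub> x = x" by (simp add: f ops)
      fix y assume y: "y \<in> carrier ?A"
      obtain g where g: "g \<in> Inv lam" "y = cl lam g" using rep[OF y] by blast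
      show "x \<otimes>\<^bsub>?A\<^esub> y \<in> carrier ?A" by (simp add: f g ops mem)
      show "x \<otimes>\<^bsub>?A\<^esub> y = y \<otimes>\<^bsub>?A\<^esub> x" by (simp add: f g ops mult.commute)
      fix z assume z: "z \<in> carrier ?A"
      obtain h where h: "h \<in> Inv lam" "z = cl lam h" using rep[OF z] by blast
      show "x \<otimes>\<^bsub>?A\<^esub> y \<otimes>\<^bsub>?A\<^esub> z = x \<otimes>\<^bsub>?A\<^esub> (y \<otimes>\<^bsub>?A\<^esub> z)" by (simp add: f g h ops mult.assoc)
    qed
    fix x y z assume xyz: "x \<in> carrier ?A" "y \<in> carrier ?A" "z \<in> carrier ?A"
    obtain f where f: "f \<in> Inv lam" "x = cl lam f" using rep[OF xyz(1)] by blast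
    obtain g where g: "g \<in> Inv lam" "y = cl lam g" using rep[OF xyz(2)] by blast
    obtain h where h: "h \<in> Inv lam" "z = cl lam h" using rep[OF xyz(3)] by blast
    show "(x \<oplus>\<^bsub>?A\<^esub> y) \<otimes>\<^bsub>?A\<^esub> z = x \<otimes>\<^bsub>?A\<^esub> z \<oplus>\<^bsub>?A\<^esub> y \<otimes>\<^bsub>?A\<^esub> z" by (simp add: f g h ops distrib_right)
  qed
qed

end

text \<open>Two rings covered by the same set, with the same fibres, are isomorphic.\<close>

lemma ring_iso_common_cover:
  assumes \<phi>: "\<phi> ` K = carrier A" and \<psi>: "\<psi> ` K = carrier B"
    and eq: "\<And>p q. p \<in> K \<Longrightarrow> q \<in> K \<Longrightarrow> \<phi> p = \<phi> q \<longleftrightarrow> \<psi> p = \<psi> q"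
    and mult: "\<And>p q. p \<in> K \<Longrightarrow> q \<in> K \<Longrightarrow> \<exists>r\<in>K. \<phi> r = \<phi> p \<otimes>\<^bsub>A\<^esub> \<phi> q \<and> \<psi> r = \<psi> p \<otimes>\<^bsub>B\<^esub> \<psi> q"
    and add: "\<And>p q. p \<in> K \<Longrightarrow> q \<in> K \<Longrightarrow> \<exists>r\<in>K. \<phi> r = \<phi> p \<oplus>\<^bsub>A\<^esub> \<phi> q \<and> \<psi> r = \<psi> p \<oplus>\<^bsub>B\<^esub> \<psi> q"
    and one: "\<exists>r\<in>K. \<phi> r = \<one>\<^bsub>A\<^esub> \<and> \<psi> r = \<one>\<^bsub>B\<^esub>"
  shows "\<exists>F\<in>ring_iso A B. \<forall>p\<in>K. F (\<phi> p) = \<psi> p"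
proof -
  define F where "F x = \<psi> (SOME p. p \<in> K \<and> \<phi> p = x)" for x
  have F: "F (\<phi> p) = \<psi> p" if "p \<in> K" for p
  proof -
    have "(SOME q. q \<in> K \<and> \<phi> q = \<phi> p) \<in> K \<and> \<phi> (SOME q. q \<in> K \<and> \<phi> q = \<phi> p) = \<phi> p"
      by (rule someI[of _ p]) (simp add: that)
    then show ?thesis unfolding F_def using eq that by blast
  qed
  have "F \<in> ring_hom A B"
  proof (rule ring_hom_memI)
    show "F x \<in> carrier B" if x: "x \<in> carrier A" for x
    proof -
      obtain p where p: "p \<in> K" "x = \<phi> p" using x \<phi> by blast
      show ?thesis unfolding p(2) F[OF p(1)] using p(1) \<psi> by blast
    qed
    show "F (x \<otimes>\<^bsub>A\<^esub> y) = F x \<otimes>\<^bsub>B\<^esub> F y" "F (x \<oplus>\<^bsub>A\<^esub> y) = F x \<oplus>\<^bsub>B\<^esub> F y"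
      if xy: "x \<in> carrier A" "y \<in> carrier A" for x y
    proof -
      obtain p q where p: "p \<in> K" "x = \<phi> p" and q: "q \<in> K" "y = \<phi> q" using xy \<phi> by blast
      obtain r where r: "r \<in> K" "\<phi> r = \<phi> p \<otimes>\<^bsub>A\<^esub> \<phi> q" "\<psi> r = \<psi> p \<otimes>\<^bsub>B\<^esub> \<psi> q"
        using mult[OF p(1) q(1)] by blast
      show "F (x \<otimes>\<^bsub>A\<^esub> y) = F x \<otimes>\<^bsub>B\<^esub> F y"
        unfolding p(2) q(2) r(2)[symmetric] F[OF r(1)] F[OF p(1)] F[OF q(1)] by (rule r(3))
      obtain s where s: "s \<in> K" "\<phi> s = \<phi> p \<oplus>\<^bsub>A\<^esub> \<phi> q" "\<psi> s = \<psi> p \<oplus>\<^bsub>B\<^esub> \<psi> q"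
        using add[OF p(1) q(1)] by blast
      show "F (x \<oplus>\<^bsub>A\<^esub> y) = F x \<oplus>\<^bsub>B\<^esub> F y"
        unfolding p(2) q(2) s(2)[symmetric] F[OF s(1)] F[OF p(1)] F[OF q(1)] by (rule s(3))
    qed
    obtain r where r: "r \<in> K" "\<phi> r = \<one>\<^bsub>A\<^esub>" "\<psi> r = \<one>\<^bsub>B\<^esub>" using one by blast
    show "F \<one>\<^bsub>A\<^esub> = \<one>\<^bsub>B\<^esub>" unfolding r(2)[symmetric] F[OF r(1)] by (rule r(3))
  qed
  moreover have "bij_betw F (carrier A) (carrier B)"
  proof (rule bij_betw_imageI)
    show "inj_on F (carrier A)"
    proof (rule inj_onI)
      fix x y assume "x \<in> carrier A" "y \<in> carrier A" and xy: "F x = F y"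
      then obtain p q where p: "p \<in> K" "x = \<phi> p" and q: "q \<in> K" "y = \<phi> q" using \<phi> by blast
      show "x = y" using xy eq[OF p(1) q(1)] unfolding p(2) q(2) F[OF p(1)] F[OF q(1)] by blast
    qed
    show "F ` carrier A = carrier B"
      unfolding \<phi>[symmetric] \<psi>[symmetric] image_image by (rule image_cong[OF refl]) (rule F)
  qed
  ultimately show ?thesis using F by (intro bexI[of _ F]) (auto simp: ring_iso_def)
qed

section \<open>The reflection isomorphism\<close>

context vertex_setting
begin

lemma invariant_iso:
  assumes nm: "n + m = w" and l: "coeff l 0 \<noteq> 0"
  shows "\<exists>F\<in>ring_iso (invariant_ring Q d (par lam l z) (vn n)) (invariant_ring Q d (par lam (- l) (z - l)) (vn m)).
    \<forall>c. F (gs.cl n (par lam l z) (\<lambda>_. c)) = gs.cl m (par lam (- l) (z - l)) (\<lambda>_. c)"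
proof -
  let ?P = "par lam l z" and ?P' = "par lam (- l) (z - l)"
  let ?a = "\<lambda>p B. p (pm.\<pi> z (\<beta> n B))" and ?b = "\<lambda>p B. p (pm.\<pi> (z - l) (\<beta> m B))"
  interpret I: fun_ideal "Rep n" "gs.AR n" "gs.IR n ?P" by (rule gs.IR_ideal)
  interpret J: fun_ideal "Rep m" "gs.AR m" "gs.IR m ?P'" by (rule gs.IR_ideal)
  define K where "K = {p \<in> pm.AW. ?a p \<in> gs.Inv n ?P}"
  have mn: "m + n = w" and l': "coeff (- l) 0 \<noteq> 0" using nm l by simp_all
  have return: "- (- l) = l" "z - l - - l = z" by simp_all
  have KA: "p \<in> pm.AW" "?a p \<in> gs.Inv n ?P" if "p \<in> K" for p using that by (simp_all add: K_def)
  have KB: "?b p \<in> gs.Inv m ?P'" if "p \<in> K" for p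
    by (rule Inv_transfer[OF nm l KA(2)[OF that] KA(1)[OF that]]) (simp add: I.I_zero)
  have KI: "p \<in> K" if p: "p \<in> pm.AW" and b: "?b p \<in> gs.Inv m ?P'" for p
  proof -
    have "(\<lambda>B. ?b p B - ?b p B) \<in> gs.IR m ?P'" by (simp add: J.I_zero)
    from Inv_transfer[OF mn l' b p this] show ?thesis unfolding return K_def using p by blast
  qed
  have "\<exists>F\<in>ring_iso (invariant_ring Q d ?P (vn n)) (invariant_ring Q d ?P' (vn m)).
    \<forall>p\<in>K. F (gs.cl n ?P (?a p)) = gs.cl m ?P' (?b p)"
  proof (rule ring_iso_common_cover)
    show "(\<lambda>p. gs.cl n ?P (?a p)) ` K = carrier (invariant_ring Q d ?P (vn n))"
      unfolding gs.invariant_carrier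
    proof (intro equalityI subsetI)
      fix x assume "x \<in> (\<lambda>p. gs.cl n ?P (?a p)) ` K"
      then show "x \<in> gs.cl n ?P ` gs.Inv n ?P" using KA(2) by blast
    next
      fix x assume "x \<in> gs.cl n ?P ` gs.Inv n ?P"
      then obtain f where f: "f \<in> gs.Inv n ?P" "x = gs.cl n ?P f" by blast
      obtain p where p: "p \<in> pm.AW" "(\<lambda>B. f B - ?a p B) \<in> gs.IR n ?P" using Inv_generated[OF l f(1)] by blast
      have "p \<in> K" by (rule KI[OF p(1) Inv_transfer[OF nm l f(1) p]])
      moreover have "x = gs.cl n ?P (?a p)" unfolding f(2) gs.cl_eq by (rule p(2))
      ultimately show "x \<in> (\<lambda>p. gs.cl n ?P (?a p)) ` K" by blast
    qed
    show "(\<lambda>p. gs.cl m ?P' (?b p)) ` K = carrier (invariant_ring Q d ?P' (vn m))"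
      unfolding gs.invariant_carrier
    proof (intro equalityI subsetI)
      fix x assume "x \<in> (\<lambda>p. gs.cl m ?P' (?b p)) ` K"
      then show "x \<in> gs.cl m ?P' ` gs.Inv m ?P'" using KB by blast
    next
      fix x assume "x \<in> gs.cl m ?P' ` gs.Inv m ?P'"
      then obtain f where f: "f \<in> gs.Inv m ?P'" "x = gs.cl m ?P' f" by blast
      obtain p where p: "p \<in> pm.AW" "(\<lambda>B. f B - ?b p B) \<in> gs.IR m ?P'" using Inv_generated[OF l' f(1)] by blast
      have "p \<in> K" unfolding K_def using Inv_transfer[OF mn l' f(1) p] p(1) unfolding return by blast
      moreover have "x = gs.cl m ?P' (?b p)" unfolding f(2) gs.cl_eq by (rule p(2))
      ultimately show "x \<in> (\<lambda>p. gs.cl m ?P' (?b p)) ` K" by blast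
    qed
  next
    fix p q assume p: "p \<in> K" and q: "q \<in> K"
    have pq: "(\<lambda>x. p x - q x) \<in> pm.AW" by (rule pm.AW.diff[OF KA(1)[OF p] KA(1)[OF q]])
    show "gs.cl n ?P (?a p) = gs.cl n ?P (?a q) \<longleftrightarrow> gs.cl m ?P' (?b p) = gs.cl m ?P' (?b q)"
      unfolding gs.cl_eq
    proof
      assume "(\<lambda>B. ?a p B - ?a q B) \<in> gs.IR n ?P"
      from relation_transfer[OF nm l pq this] show "(\<lambda>B. ?b p B - ?b q B) \<in> gs.IR m ?P'" .
    next
      assume "(\<lambda>B. ?b p B - ?b q B) \<in> gs.IR m ?P'"
      from relation_transfer[OF mn l' pq this] show "(\<lambda>B. ?a p B - ?a q B) \<in> gs.IR n ?P" unfolding return .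
    qed
    show "\<exists>r\<in>K. gs.cl n ?P (?a r) = gs.cl n ?P (?a p) \<otimes>\<^bsub>invariant_ring Q d ?P (vn n)\<^esub> gs.cl n ?P (?a q) \<and>
        gs.cl m ?P' (?b r) = gs.cl m ?P' (?b p) \<otimes>\<^bsub>invariant_ring Q d ?P' (vn m)\<^esub> gs.cl m ?P' (?b q)"
      unfolding gs.invariant_ring(1)[OF KA(2)[OF p] KA(2)[OF q]] gs.invariant_ring(1)[OF KB[OF p] KB[OF q]]
      using gs.Inv_closed(3)[OF KA(2)[OF p] KA(2)[OF q]] pm.AW.mult[OF KA(1)[OF p] KA(1)[OF q]]
      by (intro bexI[of _ "\<lambda>x. p x * q x"] conjI refl) (simp add: K_def)
    show "\<exists>r\<in>K. gs.cl n ?P (?a r) = gs.cl n ?P (?a p) \<oplus>\<^bsub>invariant_ring Q d ?P (vn n)\<^esub> gs.cl n ?P (?a q) \<and>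
        gs.cl m ?P' (?b r) = gs.cl m ?P' (?b p) \<oplus>\<^bsub>invariant_ring Q d ?P' (vn m)\<^esub> gs.cl m ?P' (?b q)"
      unfolding gs.invariant_ring(2)[OF KA(2)[OF p] KA(2)[OF q]] gs.invariant_ring(2)[OF KB[OF p] KB[OF q]]
      using gs.Inv_closed(2)[OF KA(2)[OF p] KA(2)[OF q]] pm.AW.add[OF KA(1)[OF p] KA(1)[OF q]]
      by (intro bexI[of _ "\<lambda>x. p x + q x"] conjI refl) (simp add: K_def)
  next
    show "\<exists>r\<in>K. gs.cl n ?P (?a r) = \<one>\<^bsub>invariant_ring Q d ?P (vn n)\<^esub> \<and>
        gs.cl m ?P' (?b r) = \<one>\<^bsub>invariant_ring Q d ?P' (vn m)\<^esub>"
      unfolding gs.invariant_ring(3) using gs.Inv_closed(1) pm.AW.const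
      by (intro bexI[of _ "\<lambda>_. 1"] conjI refl) (simp add: K_def)
  qed
  then obtain F where F: "F \<in> ring_iso (invariant_ring Q d ?P (vn n)) (invariant_ring Q d ?P' (vn m))"
    "\<And>p. p \<in> K \<Longrightarrow> F (gs.cl n ?P (?a p)) = gs.cl m ?P' (?b p)" by blast
  have "(\<lambda>_. c) \<in> K" for c unfolding K_def using gs.Inv_closed(1) pm.AW.const by simp
  from F(2)[OF this] show ?thesis using F(1) by blast
qed

lemma par_initial: "par lam (lam j) 0 = lam"
  by (rule ext) (simp add: par_def shift_zero)

lemma par_reflected: "par lam (- lam j) (0 - lam j) = reflect_param Q d j lam"
proof (rule ext)
  fix k show "par lam (- lam j) (0 - lam j) k = reflect_param Q d j lam k"
    by (cases "k = j") (simp add: par_def reflect_param_def, simp add: par_def reflect_param_eq)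
qed

lemma reflect_dim_eq:
  assumes "\<And>i. i \<in> verts Q \<Longrightarrow> v i = int (v0 i)"
  shows "reflect_dim Q d j v = v(j := int w - v j)"
proof -
  let ?F = "\<lambda>k. v0 k * (d k div gcd D (d k))"
  have ee: "ee h = d (src Q h) div gcd D (d (src Q h))" if "h \<in> hin" for h
    using hinD[OF that] by (simp add: f_h_def mult_h_def)
  have "w = (\<Sum>h\<in>hin. ?F (src Q h))" unfolding w_eq by (intro sum.cong refl) (simp add: ee)
  also have "\<dots> = (\<Sum>k\<in>verts Q. \<Sum>h\<in>{h \<in> hin. src Q h = k}. ?F (src Q h))"
    using hin_src(2) by (intro sum.group[symmetric] finite_hin gs.finite_verts) auto
  also have "\<dots> = (\<Sum>k\<in>verts Q. adj Q j k * ?F k)"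
    by (intro sum.cong refl) (simp add: adj_eq)
  finally have w: "w = (\<Sum>k\<in>verts Q. adj Q j k * ?F k)" .
  have "(\<Sum>k\<in>verts Q. cartan Q d j k * v k) =
    (\<Sum>k\<in>verts Q. (if k = j then 2 * v j else 0) - int (adj Q j k * ?F k))"
    by (intro sum.cong refl) (simp add: cartan_def assms j algebra_simps)
  also have "\<dots> = 2 * v j - int w"
    unfolding sum_subtractf w using j gs.finite_verts by (simp add: sum.delta)
  finally show ?thesis by (simp add: reflect_dim_def)
qed

end

text \<open>A ring in which all elements coincide has no prime ideals.\<close>

lemma Spec_trivial:
  fixes A :: "'a ring" and \<eta> :: "complex \<Rightarrow> 'a"
  assumes A: "cring A" and triv: "carrier A = {\<zero>\<^bsub>A\<^esub>}"
  shows "\<exists>\<phi> \<psi>. scheme_iso (Spec A \<eta>) (empty_scheme :: ('a set, 'a set \<Rightarrow> ('a \<times> 'a) set) ringed_space_C) \<phi> \<psi>"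
proof -
  have "prime_spectrum A = {}"
  proof (rule ccontr)
    assume "prime_spectrum A \<noteq> {}"
    then obtain p where "primeideal p A" by (auto simp: prime_spectrum_def)
    then interpret primeideal p A .
    have "\<zero>\<^bsub>A\<^esub> \<in> p" by (rule additive_subgroup.zero_closed) unfold_locales
    then show False using I_notcarr a_subset unfolding triv by blast
  qed
  then have "topspace (zariski A) = {}" unfolding topspace_zariski[OF A] .
  then have Z: "zariski A = discrete_topology {}" by (simp only: null_topspace_iff_trivial)
  have "scheme_iso (Spec A \<eta>) (empty_scheme :: ('a set, 'a set \<Rightarrow> ('a \<times> 'a) set) ringed_space_C) id (\<lambda>U s p. undefined)"
    unfolding scheme_iso_def Let_def
  proof (intro conjI allI impI ballI)
    show "homeomorphic_map (space_of (Spec A \<eta>)) (space_of (empty_scheme :: ('a set, 'a set \<Rightarrow> ('a \<times> 'a) set) ringed_space_C)) id"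
      by (simp add: Spec_def empty_scheme_def Z)
  next
    fix U :: "'a set set"
    have pre: "{x \<in> topspace (space_of (Spec A \<eta>)). id x \<in> U} = {}" by (simp add: Spec_def Z)
    have car: "carrier (structure_sheaf A {}) = {\<lambda>p. undefined}" by (auto simp: structure_sheaf_def)
    show "(\<lambda>s p. undefined) \<in> ring_iso (sections (empty_scheme :: ('a set, 'a set \<Rightarrow> ('a \<times> 'a) set) ringed_space_C) U)
        (sections (Spec A \<eta>) {x \<in> topspace (space_of (Spec A \<eta>)). id x \<in> U})"
      unfolding pre ring_iso_def
    proof (intro CollectI conjI)
      show "(\<lambda>s p. undefined) \<in> ring_hom (sections (empty_scheme :: ('a set, 'a set \<Rightarrow> ('a \<times> 'a) set) ringed_space_C) U) (sections (Spec A \<eta>) {})"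
        by (rule ring_hom_memI) (simp_all add: Spec_def empty_scheme_def car, simp_all add: structure_sheaf_def restrict_def)
      show "bij_betw (\<lambda>s p. undefined) (carrier (sections (empty_scheme :: ('a set, 'a set \<Rightarrow> ('a \<times> 'a) set) ringed_space_C) U)) (carrier (sections (Spec A \<eta>) {}))"
        by (simp add: Spec_def empty_scheme_def car bij_betw_def)
    qed
    show "(\<lambda>p. undefined) = const_sec (Spec A \<eta>) {x \<in> topspace (space_of (Spec A \<eta>)). id x \<in> U} z" for z
      unfolding pre by (simp add: Spec_def restrict_def)
    show "(\<lambda>p. undefined) = restr (Spec A \<eta>) {x \<in> topspace (space_of (Spec A \<eta>)). id x \<in> U}
        {x \<in> topspace (space_of (Spec A \<eta>)). id x \<in> V} (\<lambda>p. undefined)" for V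
      by (simp add: Spec_def Z)
  qed
  then show ?thesis by blast
qed

theorem theorem1p1:
  fixes Q :: "('v, 'e) pre_digraph"
    and d :: "'v \<Rightarrow> nat"
    and lam :: "'v \<Rightarrow> complex poly"
    and v :: "'v \<Rightarrow> int"
    and j :: 'v
  assumes "fin_digraph Q"
    and "loopfree_digraph Q"
    and "\<And>i. i \<in> verts Q \<Longrightarrow> 0 < d i"
    and "j \<in> verts Q"
    and "\<And>i. i \<in> verts Q \<Longrightarrow> lam i \<in> carrier (trunc_ring (d i))"
    and "\<And>i. i \<in> verts Q \<Longrightarrow> 0 \<le> v i"
    and "lam j \<in> Units (trunc_ring (d j))"
  shows "\<exists>\<phi> \<psi>. scheme_iso (quiver_scheme Q d lam v)
                 (quiver_scheme Q d (reflect_param Q d j lam) (reflect_dim Q d j v)) \<phi> \<psi>"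
proof -
  define v0 where "v0 = nat \<circ> v"
  interpret vertex_setting Q d j v0
    by (rule vertex_setting.intro) (use assms in simp_all)
  define n where "n = v0 j"
  have vn: "vn n = v0" by (simp add: n_def)
  have vf: "(\<lambda>i. nat (v i)) = v0" by (simp add: v0_def comp_def)
  have v: "v i = int (v0 i)" if "i \<in> verts Q" for i using assms(6)[OF that] by (simp add: v0_def)
  have l: "coeff (lam j) 0 \<noteq> 0"
  proof
    assume 0: "coeff (lam j) 0 = 0"
    obtain q where "lam j \<otimes>\<^bsub>trunc_ring D\<^esub> q = \<one>\<^bsub>trunc_ring D\<^esub>"
      using assms(7) unfolding Units_def by blast
    then have q: "(lam j * q) mod monom 1 D = 1" by (simp add: trunc_ring_def)
    have "(lam j * q) div monom 1 D * monom 1 D + 1 = lam j * q"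
      by (rule div_mult_mod_eq[of "lam j * q" "monom 1 D", unfolded q])
    from arg_cong[OF this, of "\<lambda>p. poly p 0"]
    have "poly ((lam j * q) div monom 1 D) 0 * 0 ^ D + 1 = poly (lam j) 0 * poly q 0"
      by (simp only: poly_add poly_mult poly_monom poly_1 mult_1)
    then show False using 0 D_pos by (simp only: poly_0_coeff_0 zero_power mult_zero_right mult_zero_left) simp
  qed
  have coset: "fibre_ideal Q d lam v0 +>\<^bsub>rep_ring Q d v0\<^esub> restrict f (rep_space Q d v0) = gs.cl n lam f" for f
    using gs.coset_cl[where n = n and lam = lam and f = f] unfolding vn .
  have nonneg: "\<forall>i\<in>verts Q. 0 \<le> v i" using assms(6) by blast
  have source: "quiver_scheme Q d lam v =
      Spec (invariant_ring Q d lam v0) (\<lambda>z. gs.cl n lam (\<lambda>_. z))"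
    unfolding quiver_scheme_def Let_def vf if_P[OF nonneg]
    by (rule arg_cong[where f = "Spec _"], rule ext, rule coset)
  have dim: "reflect_dim Q d j v = v(j := int w - v j)" by (rule reflect_dim_eq[OF v])
  have cr: "cring (invariant_ring Q d lam v0)" using gs.invariant_cring[where n = n and lam = lam] unfolding vn .
  have car: "carrier (invariant_ring Q d lam v0) = gs.cl n lam ` gs.Inv n lam"
    using gs.invariant_carrier[where n = n and lam = lam] unfolding vn .
  show ?thesis
  proof (cases "n \<le> w")
    case True
    define m where "m = w - n"
    have nm: "n + m = w" using True by (simp add: m_def)
    have pos: "\<forall>i\<in>verts Q. 0 \<le> reflect_dim Q d j v i"
      using assms(6) True v[OF assms(4)] by (simp add: dim n_def)
    have v': "(\<lambda>i. nat (reflect_dim Q d j v i)) = vn m"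
    proof (rule ext)
      fix i
      have e: "int w - v j = int m" unfolding v[OF assms(4)] using True by (simp add: m_def n_def)
      show "nat (reflect_dim Q d j v i) = vn m i"
      proof (cases "i = j")
        case True
        have "reflect_dim Q d j v i = int m" unfolding dim True fun_upd_same by (rule e)
        then show ?thesis using True by simp
      next
        case False
        have "reflect_dim Q d j v i = v i" unfolding dim by (rule fun_upd_other[OF False])
        then show ?thesis using fun_cong[OF vf, of i] False by simp
      qed
    qed
    have target: "quiver_scheme Q d (reflect_param Q d j lam) (reflect_dim Q d j v) =
        Spec (invariant_ring Q d (reflect_param Q d j lam) (vn m)) (\<lambda>z. gs.cl m (reflect_param Q d j lam) (\<lambda>_. z))"
      unfolding quiver_scheme_def Let_def v' if_P[OF pos]
      by (rule arg_cong[where f = "Spec _"], rule ext, rule gs.coset_cl)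
    have "\<exists>F\<in>ring_iso (invariant_ring Q d lam v0) (invariant_ring Q d (reflect_param Q d j lam) (vn m)).
        \<forall>c. F (gs.cl n lam (\<lambda>_. c)) = gs.cl m (reflect_param Q d j lam) (\<lambda>_. c)"
      using invariant_iso[OF nm l, of lam 0] unfolding par_initial par_reflected vn .
    then obtain F where F: "F \<in> ring_iso (invariant_ring Q d lam v0) (invariant_ring Q d (reflect_param Q d j lam) (vn m))"
      "\<forall>c. F (gs.cl n lam (\<lambda>_. c)) = gs.cl m (reflect_param Q d j lam) (\<lambda>_. c)" by (rule bexE)
    show ?thesis
      unfolding source target
    proof (rule spec_iso[OF cr gs.invariant_cring F(1)])
      show "gs.cl n lam (\<lambda>_. z) \<in> carrier (invariant_ring Q d lam v0)" for z
        unfolding car by (rule imageI[OF gs.Inv_closed(1)])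
      show "F (gs.cl n lam (\<lambda>_. z)) = gs.cl m (reflect_param Q d j lam) (\<lambda>_. z)" for z by (rule spec[OF F(2)])
    qed
  next
    case False
    then have neg: "\<not> (\<forall>i\<in>verts Q. 0 \<le> reflect_dim Q d j v i)"
      using v[OF assms(4)] assms(4) by (auto simp: dim n_def intro!: bexI[of _ j])
    have target: "quiver_scheme Q d (reflect_param Q d j lam) (reflect_dim Q d j v) = empty_scheme"
      unfolding quiver_scheme_def by (rule if_not_P[OF neg])
    interpret C: cring "invariant_ring Q d lam v0" by (rule cr)
    have "(\<lambda>_. 1) \<in> gs.IR n lam"
      using one_in_IR[OF l, of n lam 0] False unfolding par_initial by simp
    interpret I: fun_ideal "Rep n" "gs.AR n" "gs.IR n lam" by (rule gs.IR_ideal)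
    have all: "f \<in> gs.IR n lam" if "f \<in> gs.AR n" for f
      using I.I_mult[OF that \<open>(\<lambda>_. 1) \<in> gs.IR n lam\<close>] by simp
    have "x = y" if xy: "x \<in> carrier (invariant_ring Q d lam v0)" "y \<in> carrier (invariant_ring Q d lam v0)" for x y
    proof -
      obtain f g where f: "f \<in> gs.Inv n lam" "x = gs.cl n lam f" and g: "g \<in> gs.Inv n lam" "y = gs.cl n lam g"
        using xy unfolding car by blast
      show ?thesis
        unfolding f(2) g(2) gs.cl_eq by (rule all[OF I.diff[OF gs.Inv_AR[OF f(1)] gs.Inv_AR[OF g(1)]]])
    qed
    then have "carrier (invariant_ring Q d lam v0) = {\<zero>\<^bsub>invariant_ring Q d lam v0\<^esub>}" using C.zero_closed by blast
    from Spec_trivial[OF cr this] show ?thesis unfolding source target .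
  qed
qed

end
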